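(* Let $X\in\mathbb R^p$ and $Y\in\mathbb R^q$ be mean-zero random vectors and $n\ge4$. Assume that $\mathbb E[\|X\|^{4+4\tau}]+\mathbb E[\|Y\|^{4+4\tau}]<\infty$ for some constant $0<\tau\le1/2$ and that $$\frac{B_X^{-2\tau}L_{x,\tau}}{\mathbb E[(X_1^TX_2)^2]}\le\frac1{18}\quad\text{and}\quad\frac{B_Y^{-2\tau}L_{y,\tau}}{\mathbb E[(Y_1^TY_2)^2]}\le\frac1{18}.$$ Then under the independence of $X$ and $Y$, $$\sup_{x\in\mathbb R}|\mathbb P(T_n\le x)-\Phi(x)|\le C\Big\{(E_xE_y)^{\frac{1+\tau}2}+\frac{n^{-\tau}L_{x,\tau}L_{y,\tau}}{\big(\mathbb E[(X_1^TX_2)^2]\,\mathbb E[(Y_1^TY_2)^2]\big)^{1+\tau}}\Big\}^{\frac1{3+2\tau}},$$ where $C$ is some positive constant (not depending on $n,p,q$ or the distributions of $X,Y$; it may depend on $\tau$) and $\Phi$ is the standard normal distribution function.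
   Context: $\|\cdot\|$ is the Euclidean norm and $(X_1,Y_1),(X_2,Y_2),\dots$ are i.i.d. copies of $(X,Y)$. $\mathbb E[X]=0$, $\mathbb E[Y]=0$, $\Sigma_x=\mathbb E[XX^T]$, $\Sigma_y=\mathbb E[YY^T]$. $B_X=\mathbb E\|X_1-X_2\|^2=2\,\mathbb E\|X\|^2$, $B_Y=2\,\mathbb E\|Y\|^2$; $L_{x,\tau}=\mathbb E\big(\big|\|X\|^2-\mathbb E\|X\|^2\big|^{2+2\tau}\big)+\mathbb E\big(|X_1^TX_2|^{2+2\tau}\big)$, and $L_{y,\tau}$ is defined in the same way with $Y$; $$E_x=\frac{\mathbb E[(X_1^T\Sigma_xX_2)^2]+B_X^{-2\tau}L_{x,\tau}^{(2+\tau)/(1+\tau)}}{(\mathbb E[(X_1^TX_2)^2])^2},\qquad E_y=\frac{\mathbb E[(Y_1^T\Sigma_yY_2)^2]+B_Y^{-2\tau}L_{y,\tau}^{(2+\tau)/(1+\tau)}}{(\mathbb E[(Y_1^TY_2)^2])^2}.$$ Denominators are assumed positive so that the ratios are well defined. Sample quantities ($n\ge4$), computed from $(X_1,Y_1),\dots,(X_n,Y_n)$: with $a_{k,l}=\|X_k-X_l\|$, $b_{k,l}=\|Y_k-Y_l\|$, put $A^*_{k,l}=a_{k,l}-\frac1{n-2}\sum_{i=1}^n a_{i,l}-\frac1{n-2}\sum_{j=1}^n a_{k,j}+\frac{1}{(n-1)(n-2)}\sum_{i,j=1}^n a_{i,j}$, and $B^*_{k,l}$ in the same way from $b_{k,l}$.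 Set $\mathcal V_n^*(X,Y)=\frac1{n(n-3)}\sum_{1\le k\ne l\le n}A^*_{k,l}B^*_{k,l}$, $\mathcal V_n^*(X)=\mathcal V_n^*(X,X)$, $\mathcal V_n^*(Y)=\mathcal V_n^*(Y,Y)$. $\mathcal R_n^*(X,Y)=\mathcal V_n^*(X,Y)/\sqrt{\mathcal V_n^*(X)\mathcal V_n^*(Y)}$ if $\mathcal V_n^*(X)\mathcal V_n^*(Y)>0$ and $0$ otherwise. $T_n=\sqrt{n(n-1)/2}\;\mathcal R_n^*(X,Y)$. *)

theory Defs
  imports "HOL-Probability.Probability"
begin

text \<open>
  The constant of the theorem must not depend on the dimensions \<open>p\<close>, \<open>q\<close> or on the
  distributions, so dimensions are natural numbers rather than types, and \<open>\<real>\<^sup>d\<close> is the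
  product measurable space over the index set \<open>{..<d}\<close>.  All functions below only look at
  the coordinates \<open>i < d\<close>.

  For the same reason random vectors are given by their laws, which keeps the type of the
  sample space from being fixed before the constant is chosen: \<open>P\<close> is the law of \<open>(X, Y)\<close>
  on \<open>\<real>\<^sup>p \<times> \<real>\<^sup>q\<close>, \<open>X\<close> and \<open>Y\<close> are the two projections, and the i.i.d.
  copies \<open>(X\<^sub>k, Y\<^sub>k)\<close> are the coordinates of the infinite product of \<open>P\<close>.
\<close>

abbreviation vec_space :: "nat \<Rightarrow> (nat \<Rightarrow> real) measure" where
  "vec_space d \<equiv> PiM {..<d} (\<lambda>_. borel)"

definition vec_norm :: "nat \<Rightarrow> (nat \<Rightarrow> real) \<Rightarrow> real" where
  "vec_norm d x = L2_set x {..<d}"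

definition vec_dist :: "nat \<Rightarrow> (nat \<Rightarrow> real) \<Rightarrow> (nat \<Rightarrow> real) \<Rightarrow> real" where
  "vec_dist d x y = vec_norm d (\<lambda>i. x i - y i)"

definition vec_inner :: "nat \<Rightarrow> (nat \<Rightarrow> real) \<Rightarrow> (nat \<Rightarrow> real) \<Rightarrow> real" where
  "vec_inner d x y = (\<Sum>i<d. x i * y i)"


text \<open>
  Population quantities of a random vector in \<open>\<real>\<^sup>d\<close> with law \<open>\<mu>\<close>.  An expectation
  involving two independent copies is an integral over \<open>\<mu> \<Otimes>\<^sub>M \<mu>\<close>.
\<close>

definition mean_zero :: "nat \<Rightarrow> (nat \<Rightarrow> real) measure \<Rightarrow> bool" where
  "mean_zero d \<mu> \<longleftrightarrow> (\<forall>i<d. integrable \<mu> (\<lambda>x. x i) \<and> (\<integral>x. x i \<partial>\<mu>) = 0)"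

definition cov_entry :: "(nat \<Rightarrow> real) measure \<Rightarrow> nat \<Rightarrow> nat \<Rightarrow> real" where
  "cov_entry \<mu> i j = (\<integral>x. x i * x j \<partial>\<mu>)"

definition mean_sq_dist :: "nat \<Rightarrow> (nat \<Rightarrow> real) measure \<Rightarrow> real" where
  "mean_sq_dist d \<mu> = (\<integral>(x, x'). (vec_dist d x x')\<^sup>2 \<partial>(\<mu> \<Otimes>\<^sub>M \<mu>))"

definition inner_moment2 :: "nat \<Rightarrow> (nat \<Rightarrow> real) measure \<Rightarrow> real" where
  "inner_moment2 d \<mu> = (\<integral>(x, x'). (vec_inner d x x')\<^sup>2 \<partial>(\<mu> \<Otimes>\<^sub>M \<mu>))"

definition cov_form_moment2 :: "nat \<Rightarrow> (nat \<Rightarrow> real) measure \<Rightarrow> real" where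
  "cov_form_moment2 d \<mu> =
     (\<integral>(x, x'). (\<Sum>i<d. \<Sum>j<d. x i * cov_entry \<mu> i j * x' j)\<^sup>2 \<partial>(\<mu> \<Otimes>\<^sub>M \<mu>))"

definition L_moment :: "nat \<Rightarrow> (nat \<Rightarrow> real) measure \<Rightarrow> real \<Rightarrow> real" where
  "L_moment d \<mu> \<tau> =
     (\<integral>x. \<bar>(vec_norm d x)\<^sup>2 - (\<integral>x'. (vec_norm d x')\<^sup>2 \<partial>\<mu>)\<bar> powr (2 + 2 * \<tau>) \<partial>\<mu>)
     + (\<integral>(x, x'). \<bar>vec_inner d x x'\<bar> powr (2 + 2 * \<tau>) \<partial>(\<mu> \<Otimes>\<^sub>M \<mu>))"

definition E_ratio :: "nat \<Rightarrow> (nat \<Rightarrow> real) measure \<Rightarrow> real \<Rightarrow> real" where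
  "E_ratio d \<mu> \<tau> =
     (cov_form_moment2 d \<mu>
        + mean_sq_dist d \<mu> powr (- 2 * \<tau>) * L_moment d \<mu> \<tau> powr ((2 + \<tau>) / (1 + \<tau>)))
     / (inner_moment2 d \<mu>)\<^sup>2"


text \<open>
  Sample quantities.  Observations are indexed by \<open>1, \<dots>, n\<close>, and \<open>a\<close>, \<open>b\<close> are the arrays
  of pairwise distances.
\<close>

definition u_center :: "nat \<Rightarrow> (nat \<Rightarrow> nat \<Rightarrow> real) \<Rightarrow> nat \<Rightarrow> nat \<Rightarrow> real" where
  "u_center n a k l =
     a k l - (\<Sum>i=1..n. a i l) / (real n - 2) - (\<Sum>j=1..n. a k j) / (real n - 2)
     + (\<Sum>i=1..n. \<Sum>j=1..n. a i j) / ((real n - 1) * (real n - 2))"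

definition dist_cov :: "nat \<Rightarrow> (nat \<Rightarrow> nat \<Rightarrow> real) \<Rightarrow> (nat \<Rightarrow> nat \<Rightarrow> real) \<Rightarrow> real" where
  "dist_cov n a b =
     (\<Sum>k=1..n. \<Sum>l\<in>{1..n} - {k}. u_center n a k l * u_center n b k l)
     / (real n * (real n - 3))"

definition dist_cor :: "nat \<Rightarrow> (nat \<Rightarrow> nat \<Rightarrow> real) \<Rightarrow> (nat \<Rightarrow> nat \<Rightarrow> real) \<Rightarrow> real" where
  "dist_cor n a b =
     (if dist_cov n a a * dist_cov n b b > 0
      then dist_cov n a b / sqrt (dist_cov n a a * dist_cov n b b) else 0)"

definition T_stat ::
    "nat \<Rightarrow> nat \<Rightarrow> nat \<Rightarrow> (nat \<Rightarrow> (nat \<Rightarrow> real) \<times> (nat \<Rightarrow> real)) \<Rightarrow> real" where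
  "T_stat p q n \<omega> =
     sqrt (real n * (real n - 1) / 2)
     * dist_cor n (\<lambda>k l. vec_dist p (fst (\<omega> k)) (fst (\<omega> l)))
                  (\<lambda>k l. vec_dist q (snd (\<omega> k)) (snd (\<omega> l)))"

end

theory Submission
  imports Defs
begin

text \<open>
  Write \<open>d\<^sub>X\<close>, \<open>d\<^sub>Y\<close> for the doubly centered distances.  U-centering does not see the difference
  between \<open>\<parallel>X\<^sub>k - X\<^sub>l\<parallel>\<close> and \<open>d\<^sub>X (X\<^sub>k, X\<^sub>l)\<close>, and up to negligible terms the sample distance covariance
  is the sum over \<open>k < l\<close> of \<open>h (Z\<^sub>k, Z\<^sub>l) = d\<^sub>X (X\<^sub>k, X\<^sub>l) d\<^sub>Y (Y\<^sub>k, Y\<^sub>l)\<close>.  By independence \<open>h\<close> is a degenerate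
  kernel, so this sum is a martingale.  Its conditional variance is a quadratic form in
  \<open>G (z, z') = E h (Z, z) h (Z, z')\<close>, whose diagonal and off-diagonal parts are controlled by the
  \<open>(2 + 2\<tau>)\<close>-th moment of \<open>h\<close> and by \<open>E G\<^sup>2\<close>.

  With \<open>p = 2 + 2\<tau> \<le> 3\<close>, Lindeberg's exchange against a Gaussian of variance at least \<open>e\<^sup>2\<close>, applied to
  the martingale frozen once its conditional variance exceeds \<open>1 + e\<^sup>2\<close>, costs \<open>e powr - p\<close> times
  the sum of the \<open>p\<close>-th moments, and the smoothing costs \<open>O(e)\<close>; balancing gives the exponent
  \<open>1 / (3 + 2\<tau>)\<close>.  The other terms of numerator and denominator are of smaller order, by Chebyshev's
  and von Bahr and Esseen's inequalities.

  Finally \<open>\<parallel>x - x'\<parallel>\<^sup>2 = B (1 + W)\<close>, and since \<open>\<surd>(1 + W) - 1 - W / 2 = - (\<surd>(1 + W) - 1)\<^sup>2 / 2\<close>, the kernel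
  \<open>d\<^sub>X\<close> is \<open>- x \<bullet> x' / \<surd>B\<close> plus an error of \<open>L\<^sup>2\<close>-size \<open>(8 B powr (- 1 - 2\<tau>) L)\<^bsup>1/2\<^esup>\<close>; the hypothesis with
  \<open>1/18\<close> is what makes this error smaller than the leading term.
\<close>

section \<open>Power inequalities and moments\<close>

text \<open>Freezing gives the exchange deterministic bounds: the Gaussian reserve of variance never
  falls below e^2 on any path, and on the event of good conditional variance it is at most 4 e^2,
  small enough to be removed again. The shortage of moments shapes the rest. Only p-th moments of
  the kernel are available, so its squares have only p/2 moments, with 1 < p/2 \<le> 3/2; sums of
  squares therefore need von Bahr--Esseen, and the second moment of the off-diagonal part is lowered
  to a power p/4 by Jensen so that all parts cost the same e powr - p. The centered distance is used
  in two forms. Its p-th moment comes from |dist - b| \<le> b |W|, where b^2 = B; the lower bound on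
  its variance and the bound on G come from the linear form plus an error that is controlled in L^2
  only. The remainders of numerator and denominator cost 1 / (n e^2), a term absent from the claim.
  It is absorbed because Jensen bounds the moment ratios below by 1, so that n powr - \<tau> is at
  most a constant times the bracket, while \<tau> \<le> 1/2 gives 1/n \<le> n powr (- 2
  \<tau>).\<close>

lemma powr_tangent_concave:
  fixes x c \<theta> :: real
  assumes "0 \<le> x" "0 < c" "0 < \<theta>" "\<theta> \<le> 1"
  shows "x powr \<theta> \<le> c powr \<theta> + \<theta> * c powr (\<theta> - 1) * (x - c)"
proof (cases "x = 0")
  case True
  have "c powr \<theta> + \<theta> * c powr (\<theta> - 1) * (x - c) = (1 - \<theta>) * c powr \<theta>"
    using True assms powr_mult_base[of c "\<theta> - 1"] by (simp add: algebra_simps)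
  with assms True show ?thesis by simp
next
  case False
  \<comment> \<open>Weighted Young with weight \<theta> on x; multiplied by
    \<open>c powr (\<theta> - 1)\<close> it is already the tangent inequality, without
    derivatives.\<close>
  have "x powr \<theta> * c powr (1 - \<theta>) \<le> \<theta> * x + (1 - \<theta>) * c"
    using assms False by (intro Youngs_inequality_0) auto
  hence "x powr \<theta> * c powr (1 - \<theta>) * c powr (\<theta> - 1) \<le> (\<theta> * x + (1 - \<theta>) * c) * c powr (\<theta> - 1)"
    by (intro mult_right_mono) auto
  moreover have "c powr (1 - \<theta>) * c powr (\<theta> - 1) = 1"
    using assms by (simp flip: powr_add)
  moreover have "c * c powr (\<theta> - 1) = c powr \<theta>"
    using assms powr_mult_base[of c "\<theta> - 1"] by simp
  ultimately show ?thesis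
    by (simp add: algebra_simps)
qed

text \<open>The concave tangent inequality for the exponent 1/p at the point
  \<open>c powr p\<close>, solved for \<open>x powr p\<close>.\<close>

lemma powr_tangent_convex:
  fixes x c p :: real
  assumes "0 \<le> x" "0 < c" "1 \<le> p"
  shows "c powr p + p * c powr (p - 1) * (x - c) \<le> x powr p"
proof -
  have "(x powr p) powr (1/p) \<le> (c powr p) powr (1/p) + 1/p * (c powr p) powr (1/p - 1) * (x powr p - c powr p)"
    using assms by (intro powr_tangent_concave) auto
  moreover have "(c powr p) powr (1/p - 1) = c powr (1 - p)"
    using assms by (simp add: powr_powr algebra_simps)
  ultimately have "x \<le> c + 1/p * c powr (1 - p) * (x powr p - c powr p)"
    using assms by (simp add: powr_powr)
  hence "p * c powr (p - 1) * x \<le> p * c powr (p - 1) * (c + 1/p * c powr (1 - p) * (x powr p - c powr p))"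
    using assms by (intro mult_left_mono) auto
  also have "\<dots> = p * c powr (p - 1) * c + (c powr (p - 1) * c powr (1 - p)) * (x powr p - c powr p)"
    using assms by (simp add: field_simps)
  also have "c powr (p - 1) * c powr (1 - p) = 1"
    using assms by (simp flip: powr_add)
  finally show ?thesis by (simp add: algebra_simps)
qed

text \<open>The convex tangents at the mean c of the absolute values are summed: the linear terms
  cancel and N c^p remains. The tangent needs c > 0, hence the case split.\<close>

lemma sum_abs_powr_le:
  fixes x :: "'i \<Rightarrow> real"
  assumes "finite I" "1 \<le> p"
  shows "\<bar>\<Sum>i\<in>I. x i\<bar> powr p \<le> real (card I) powr (p - 1) * (\<Sum>i\<in>I. \<bar>x i\<bar> powr p)"
proof (cases "(\<Sum>i\<in>I. \<bar>x i\<bar>) = 0")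
  case True
  hence "(\<Sum>i\<in>I. x i) = 0"
    using sum_abs[of x I] by simp
  thus ?thesis by (simp add: sum_nonneg)
next
  case False
  define N where "N = real (card I)"
  define c where "c = (\<Sum>i\<in>I. \<bar>x i\<bar>) / N"
  have "I \<noteq> {}" using False by auto
  hence N: "N > 0" using assms by (simp add: N_def card_gt_0_iff)
  have s: "(\<Sum>i\<in>I. \<bar>x i\<bar>) > 0" using False by (simp add: sum_nonneg order.strict_iff_order)
  hence c: "c > 0" using N by (simp add: c_def)
  have "(\<Sum>i\<in>I. c powr p + p * c powr (p - 1) * (\<bar>x i\<bar> - c)) \<le> (\<Sum>i\<in>I. \<bar>x i\<bar> powr p)"
    using assms c by (intro sum_mono powr_tangent_convex) auto
  also have "(\<Sum>i\<in>I. c powr p + p * c powr (p - 1) * (\<bar>x i\<bar> - c))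
     = N * c powr p + p * c powr (p - 1) * ((\<Sum>i\<in>I. \<bar>x i\<bar>) - N * c)"
    by (simp add: sum.distrib sum_distrib_left[symmetric] sum_subtractf N_def)
  also have "\<dots> = N * c powr p" using N by (simp add: c_def)
  finally have "N powr (p - 1) * (N * c powr p) \<le> N powr (p - 1) * (\<Sum>i\<in>I. \<bar>x i\<bar> powr p)"
    by (intro mult_left_mono) auto
  moreover have "N powr (p - 1) * N = N powr p"
    using N powr_mult_base[of N "p - 1"] by (simp add: mult.commute)
  moreover have "N powr p * c powr p = (\<Sum>i\<in>I. \<bar>x i\<bar>) powr p"
    using N s by (simp add: c_def powr_divide)
  moreover have "\<bar>\<Sum>i\<in>I. x i\<bar> powr p \<le> (\<Sum>i\<in>I. \<bar>x i\<bar>) powr p"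
    using assms by (intro powr_mono2) (auto)
  ultimately show ?thesis by (simp add: N_def mult.assoc[symmetric])
qed

lemma abs_add_powr_le:
  fixes a b :: real
  assumes "1 \<le> p"
  shows "\<bar>a + b\<bar> powr p \<le> 2 powr (p - 1) * (\<bar>a\<bar> powr p + \<bar>b\<bar> powr p)"
  using sum_abs_powr_le[of "{0::nat, 1}" p "\<lambda>i. if i = 0 then a else b"] assms by simp

text \<open>By homogeneity: the shares a / s and b / s lie in [0, 1], where t \<le> t powr r, and
  they add up to 1.\<close>

lemma powr_add_subadditive:
  fixes a b r :: real
  assumes "0 \<le> a" "0 \<le> b" "0 < r" "r \<le> 1"
  shows "(a + b) powr r \<le> a powr r + b powr r"
proof (cases "a + b = 0")
  case False
  define s where "s = a + b"
  have s: "s > 0" using False assms by (simp add: s_def)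
  have le: "x / s * s powr r \<le> x powr r" if "0 \<le> x" "x \<le> s" for x
  proof -
    have "x / s \<le> (x / s) powr r"
      using powr_mono'[of r 1 "x / s"] that s assms by auto
    hence "x / s * s powr r \<le> (x / s) powr r * s powr r" by (intro mult_right_mono) auto
    thus ?thesis using s that by (simp add: powr_divide)
  qed
  have "s powr r = a / s * s powr r + b / s * s powr r"
    using s by (simp add: s_def add_divide_distrib[symmetric] distrib_right[symmetric])
  also have "\<dots> \<le> a powr r + b powr r"
    using assms by (intro add_mono le) (auto simp: s_def)
  finally show ?thesis by (simp add: s_def)
qed (use assms in auto)

section \<open>Signed powers, the derivatives of absolute powers, and expansions of the
  latter\<close>

definition spow :: "real \<Rightarrow> real \<Rightarrow> real" where
  "spow r y = sgn y * \<bar>y\<bar> powr r"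

lemma spow_measurable [measurable]: "spow r \<in> borel_measurable borel"
  unfolding spow_def by measurable

lemma abs_spow: "\<bar>spow r y\<bar> = \<bar>y\<bar> powr r"
  by (simp add: spow_def abs_mult sgn_if)

text \<open>Arguments of equal sign reduce to subadditivity. For opposite signs |y - x| is the sum
  of the two absolute values, and each of the two powers is bounded by its power; hence the
  2.\<close>

lemma spow_holder:
  assumes "0 < r" "r \<le> 1"
  shows "\<bar>spow r y - spow r x\<bar> \<le> 2 * \<bar>y - x\<bar> powr r"
proof -
  have diff: "\<bar>u powr r - v powr r\<bar> \<le> \<bar>u - v\<bar> powr r" if "0 \<le> u" "0 \<le> v" for u v :: real
  proof -
    have "w powr r - z powr r \<le> (w - z) powr r \<and> z powr r \<le> w powr r" if "0 \<le> z" "z \<le> w" for w z :: real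
      using powr_add_subadditive[of z "w - z" r] powr_mono2[of r z w] that assms by simp
    from this[of u v] this[of v u] that show ?thesis
      by (cases "u \<le> v") (simp_all add: abs_if)
  qed
  have opp: "u powr r + v powr r \<le> 2 * (u + v) powr r" if "0 \<le> u" "0 \<le> v" for u v :: real
    using powr_mono2[of r u "u + v"] powr_mono2[of r v "u + v"] that assms by auto
  consider "0 \<le> x" "0 \<le> y" | "x \<le> 0" "y \<le> 0" | "x \<le> 0" "0 \<le> y" | "0 \<le> x" "y \<le> 0" by linarith
  thus ?thesis
  proof cases
    case 1
    have "spow r y - spow r x = y powr r - x powr r" using 1 by (auto simp: spow_def sgn_if)
    with diff[OF 1(2,1)] show ?thesis using powr_ge_zero[of "\<bar>y - x\<bar>" r] by linarith
  next
    case 2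
    have "spow r y - spow r x = (-x) powr r - (-y) powr r" using 2 by (auto simp: spow_def sgn_if)
    moreover have "\<bar>- x - - y\<bar> = \<bar>y - x\<bar>" by simp
    ultimately show ?thesis using diff[of "-x" "-y"] 2 powr_ge_zero[of "\<bar>y - x\<bar>" r] by simp
  next
    case 3
    have "spow r y - spow r x = y powr r + (-x) powr r" using 3 by (auto simp: spow_def sgn_if)
    moreover have "\<bar>y - x\<bar> = y + - x" using 3 by simp
    ultimately show ?thesis using opp[of y "-x"] 3 by simp
  next
    case 4
    have "spow r y - spow r x = - (x powr r + (-y) powr r)" using 4 by (auto simp: spow_def sgn_if)
    moreover have e: "\<bar>y - x\<bar> = x + - y" using 4 by simp
    moreover have "0 \<le> x powr r + (- y) powr r" by simp
    ultimately show ?thesis unfolding e using opp[of x "-y"] 4 by linarith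
  qed
qed

text \<open>Absolute and signed powers are given by different smooth formulas on the two sides of 0;
  this supplies the derivative at the junction.\<close>

lemma DERIV_zero_of_abs_powr_le:
  fixes f :: "real \<Rightarrow> real"
  assumes "1 < p" "\<And>y. \<bar>f y\<bar> \<le> \<bar>y\<bar> powr p"
  shows "(f has_real_derivative 0) (at 0)"
proof -
  have f0: "f 0 = 0" using assms(2)[of 0] assms(1) by simp
  have "((\<lambda>h. \<bar>h\<bar> powr (p - 1)) \<longlongrightarrow> \<bar>0\<bar> powr (p - 1)) (at (0::real))"
    using assms by (intro tendsto_powr2 tendsto_intros) auto
  hence "((\<lambda>h::real. \<bar>h\<bar> powr (p - 1)) \<longlongrightarrow> 0) (at 0)" by simp
  moreover have "\<forall>\<^sub>F h in at 0. norm ((f (0 + h) - f 0) / h) \<le> \<bar>h\<bar> powr (p - 1)"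
  proof (rule eventually_at_filter[THEN iffD2], rule eventuallyI, safe)
    fix h :: real assume h: "h \<noteq> 0"
    have "\<bar>h\<bar> powr p = \<bar>h\<bar> powr (p - 1) * \<bar>h\<bar>"
      using h powr_mult_base[of "\<bar>h\<bar>" "p - 1"] by (simp add: mult.commute)
    with assms(2)[of h] h show "norm ((f (0 + h) - f 0) / h) \<le> \<bar>h\<bar> powr (p - 1)"
      by (simp add: f0 field_simps)
  qed
  ultimately have "((\<lambda>h. (f (0 + h) - f 0) / h) \<longlongrightarrow> 0) (at 0)"
    by (rule Lim_null_comparison[rotated])
  thus ?thesis by (simp add: DERIV_def)
qed

lemma DERIV_abs_powr:
  assumes "1 < p"
  shows "((\<lambda>y. \<bar>y\<bar> powr p) has_real_derivative p * spow (p - 1) y) (at y)"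
proof -
  consider "y > 0" | "y < 0" | "y = 0" by linarith
  thus ?thesis
  proof cases
    case 1
    have "((\<lambda>y. y powr p) has_real_derivative p * spow (p - 1) y) (at y)"
      using 1 by (auto intro!: derivative_eq_intros simp: spow_def powr_diff)
    thus ?thesis
      by (rule has_field_derivative_transform_within_open[of _ _ _ "{0<..}"]) (use 1 in auto)
  next
    case 2
    have "((\<lambda>y. (-y) powr p) has_real_derivative p * spow (p - 1) y) (at y)"
      using 2 by (auto intro!: derivative_eq_intros simp: spow_def powr_diff field_simps)
    thus ?thesis
      by (rule has_field_derivative_transform_within_open[of _ _ _ "{..<0}"]) (use 2 in auto)
  next
    case 3
    thus ?thesis using DERIV_zero_of_abs_powr_le[OF assms, of "\<lambda>y. \<bar>y\<bar> powr p"]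
      by (simp add: spow_def)
  qed
qed

lemma DERIV_spow:
  assumes "1 < r"
  shows "(spow r has_real_derivative r * \<bar>y\<bar> powr (r - 1)) (at y)"
proof -
  consider "y > 0" | "y < 0" | "y = 0" by linarith
  thus ?thesis
  proof cases
    case 1
    have "((\<lambda>y. y powr r) has_real_derivative r * \<bar>y\<bar> powr (r - 1)) (at y)"
      using 1 by (auto intro!: derivative_eq_intros simp: spow_def powr_diff)
    thus ?thesis
      by (rule has_field_derivative_transform_within_open[of _ _ _ "{0<..}"]) (use 1 in \<open>auto simp: spow_def\<close>)
  next
    case 2
    have "((\<lambda>y. - ((-y) powr r)) has_real_derivative r * \<bar>y\<bar> powr (r - 1)) (at y)"
      using 2 by (auto intro!: derivative_eq_intros simp: spow_def powr_diff field_simps)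
    thus ?thesis
      by (rule has_field_derivative_transform_within_open[of _ _ _ "{..<0}"]) (use 2 in \<open>auto simp: spow_def\<close>)
  next
    case 3
    thus ?thesis using DERIV_zero_of_abs_powr_le[OF assms, of "spow r"] assms
      by (simp add: abs_spow)
  qed
qed

lemma abs_powr_add_mvt:
  fixes a b :: real
  assumes "1 < p"
  obtains c where "\<bar>c - a\<bar> \<le> \<bar>b\<bar>" "\<bar>a + b\<bar> powr p = \<bar>a\<bar> powr p + p * b * spow (p - 1) c"
proof (cases "b = 0")
  case True
  with that[of a] show ?thesis by auto
next
  case False
  hence "a < a + b \<or> a + b < a" by auto
  thus ?thesis
  proof
    assume lt: "a < a + b"
    from MVT2[OF lt DERIV_abs_powr[OF assms]]
    obtain z where "a < z" "z < a + b"
      "\<bar>a + b\<bar> powr p - \<bar>a\<bar> powr p = (a + b - a) * (p * spow (p - 1) z)" by auto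
    thus ?thesis by (intro that[of z]) (auto simp: algebra_simps)
  next
    assume lt: "a + b < a"
    from MVT2[OF lt DERIV_abs_powr[OF assms]]
    obtain z where "a + b < z" "z < a"
      "\<bar>a\<bar> powr p - \<bar>a + b\<bar> powr p = (a - (a + b)) * (p * spow (p - 1) z)" by auto
    thus ?thesis by (intro that[of z]) (auto simp: algebra_simps)
  qed
qed

text \<open>The mean value theorem leaves a remainder b (f c - f a) with f the signed power, which
  is Hoelder continuous of order p - 1. The term linear in b is kept exact, because integrating out
  a fresh coordinate will annihilate it.\<close>

lemma abs_powr_add_le_low:
  fixes a b :: real
  assumes "1 < p" "p \<le> 2"
  shows "\<bar>a + b\<bar> powr p \<le> \<bar>a\<bar> powr p + p * (spow (p - 1) a * b) + 4 * \<bar>b\<bar> powr p"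
proof -
  obtain c where c: "\<bar>c - a\<bar> \<le> \<bar>b\<bar>" "\<bar>a + b\<bar> powr p = \<bar>a\<bar> powr p + p * b * spow (p - 1) c"
    using abs_powr_add_mvt[OF assms(1)] by blast
  have "p * b * spow (p - 1) c = p * (spow (p - 1) a * b) + p * (b * (spow (p - 1) c - spow (p - 1) a))"
    by (simp add: algebra_simps)
  also have "b * (spow (p - 1) c - spow (p - 1) a) \<le> \<bar>b\<bar> * \<bar>spow (p - 1) c - spow (p - 1) a\<bar>"
    by (metis abs_ge_self abs_mult)
  also have "\<dots> \<le> \<bar>b\<bar> * (2 * \<bar>c - a\<bar> powr (p - 1))"
    using assms by (intro mult_left_mono spow_holder) auto
  also have "\<dots> \<le> \<bar>b\<bar> * (2 * \<bar>b\<bar> powr (p - 1))"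
    using assms c by (intro mult_left_mono powr_mono2) auto
  also have "\<dots> = 2 * \<bar>b\<bar> powr p"
    using powr_mult_base[of "\<bar>b\<bar>" "p - 1"] by simp
  also have "p * (2 * \<bar>b\<bar> powr p) \<le> 4 * \<bar>b\<bar> powr p"
    using assms mult_right_mono[of p 2 "\<bar>b\<bar> powr p"] by simp
  finally show ?thesis using c assms by simp
qed

text \<open>Here the derivative is itself differentiable, with derivative of order |z|^(q - 2). As q
  - 2 \<le> 1, subadditivity splits this into a part in |a| and a part in |b|, which give the two
  remainder terms; 6 is the largest value of 2 q.\<close>

lemma abs_powr_add_le_high:
  fixes a b :: real
  assumes "2 < q" "q \<le> 3"
  shows "\<bar>a + b\<bar> powr q \<le> \<bar>a\<bar> powr q + q * (spow (q - 1) a * b) + 6 * (\<bar>a\<bar> powr (q - 2) * b\<^sup>2 + \<bar>b\<bar> powr q)"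
proof -
  have q1: "1 < q" using assms by simp
  obtain c where c: "\<bar>c - a\<bar> \<le> \<bar>b\<bar>" "\<bar>a + b\<bar> powr q = \<bar>a\<bar> powr q + q * b * spow (q - 1) c"
    using abs_powr_add_mvt[OF q1] by blast
  have "\<bar>spow (q - 1) c - spow (q - 1) a\<bar> \<le> 2 * (\<bar>a\<bar> powr (q - 2) + \<bar>b\<bar> powr (q - 2)) * \<bar>c - a\<bar>"
  proof -
    have bd: "(q - 1) * \<bar>z\<bar> powr (q - 1 - 1) \<le> 2 * (\<bar>a\<bar> powr (q - 2) + \<bar>b\<bar> powr (q - 2))"
      if "\<bar>z - a\<bar> \<le> \<bar>b\<bar>" for z
    proof -
      have "\<bar>z\<bar> powr (q - 2) \<le> (\<bar>a\<bar> + \<bar>b\<bar>) powr (q - 2)"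
        using that assms by (intro powr_mono2) auto
      also have "\<dots> \<le> \<bar>a\<bar> powr (q - 2) + \<bar>b\<bar> powr (q - 2)"
        using assms by (intro powr_add_subadditive) auto
      finally show ?thesis using assms by (intro mult_mono) auto
    qed
    have "norm (spow (q - 1) c - spow (q - 1) a) \<le> 2 * (\<bar>a\<bar> powr (q - 2) + \<bar>b\<bar> powr (q - 2)) * norm (c - a)"
    proof (rule field_differentiable_bound[of "{a - \<bar>b\<bar>..a + \<bar>b\<bar>}" _ "\<lambda>z. (q - 1) * \<bar>z\<bar> powr (q - 1 - 1)"])
      show "(spow (q - 1) has_field_derivative (q - 1) * \<bar>z\<bar> powr (q - 1 - 1)) (at z within {a - \<bar>b\<bar>..a + \<bar>b\<bar>})" for z
        using DERIV_spow[of "q - 1" z] assms by (auto intro: has_field_derivative_at_within)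
      show "norm ((q - 1) * \<bar>z\<bar> powr (q - 1 - 1)) \<le> 2 * (\<bar>a\<bar> powr (q - 2) + \<bar>b\<bar> powr (q - 2))"
        if "z \<in> {a - \<bar>b\<bar>..a + \<bar>b\<bar>}" for z
      proof -
        have "\<bar>z - a\<bar> \<le> \<bar>b\<bar>" using that by auto
        from bd[OF this] show ?thesis using assms by (simp add: abs_mult)
      qed
    qed (use c in auto)
    thus ?thesis by simp
  qed
  also have "\<dots> \<le> 2 * (\<bar>a\<bar> powr (q - 2) + \<bar>b\<bar> powr (q - 2)) * \<bar>b\<bar>"
    using c by (intro mult_left_mono) auto
  finally have H: "\<bar>spow (q - 1) c - spow (q - 1) a\<bar> \<le> 2 * (\<bar>a\<bar> powr (q - 2) + \<bar>b\<bar> powr (q - 2)) * \<bar>b\<bar>" .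
  have "q * b * spow (q - 1) c = q * (spow (q - 1) a * b) + q * (b * (spow (q - 1) c - spow (q - 1) a))"
    by (simp add: algebra_simps)
  also have "b * (spow (q - 1) c - spow (q - 1) a) \<le> \<bar>b\<bar> * \<bar>spow (q - 1) c - spow (q - 1) a\<bar>"
    by (metis abs_ge_self abs_mult)
  also have "\<dots> \<le> \<bar>b\<bar> * (2 * (\<bar>a\<bar> powr (q - 2) + \<bar>b\<bar> powr (q - 2)) * \<bar>b\<bar>)"
    using H by (intro mult_left_mono) auto
  also have "\<dots> = 2 * (\<bar>a\<bar> powr (q - 2) * b\<^sup>2 + (\<bar>b\<bar> * (\<bar>b\<bar> * \<bar>b\<bar> powr (q - 2))))"
    by (simp add: algebra_simps power2_eq_square)
  also have "\<bar>b\<bar> * (\<bar>b\<bar> * \<bar>b\<bar> powr (q - 2)) = \<bar>b\<bar> powr q"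
    using powr_mult_base[of "\<bar>b\<bar>" "q - 2"] powr_mult_base[of "\<bar>b\<bar>" "q - 1"] by simp
  also have "q * (2 * (\<bar>a\<bar> powr (q - 2) * b\<^sup>2 + \<bar>b\<bar> powr q)) \<le> 6 * (\<bar>a\<bar> powr (q - 2) * b\<^sup>2 + \<bar>b\<bar> powr q)"
    using assms mult_right_mono[of "2 * q" 6 "\<bar>a\<bar> powr (q - 2) * b\<^sup>2 + \<bar>b\<bar> powr q"] by (simp add: algebra_simps)
  finally show ?thesis using c assms by simp
qed

section \<open>Jensen's inequality and comparison of moments\<close>

lemma (in prob_space) integral_powr_le_powr_integral:
  fixes X :: "'a \<Rightarrow> real"
  assumes X: "integrable M X" "\<And>x. x \<in> space M \<Longrightarrow> 0 \<le> X x" and \<theta>: "0 < \<theta>" "\<theta> \<le> 1"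
  shows "integrable M (\<lambda>x. X x powr \<theta>)" "(\<integral>x. X x powr \<theta> \<partial>M) \<le> (\<integral>x. X x \<partial>M) powr \<theta>"
proof -
  have [measurable]: "X \<in> borel_measurable M" using X by simp
  show int: "integrable M (\<lambda>x. X x powr \<theta>)"
  proof (rule Bochner_Integration.integrable_bound[of M "\<lambda>x. 1 + X x"])
    show "AE x in M. norm (X x powr \<theta>) \<le> norm (1 + X x)"
    proof (rule AE_I2)
      fix x assume x: "x \<in> space M"
      have "X x powr \<theta> \<le> 1 powr \<theta> + \<theta> * 1 powr (\<theta> - 1) * (X x - 1)"
        using X x \<theta> by (intro powr_tangent_concave) auto
      also have "\<dots> \<le> 1 + X x" using \<theta> X(2)[OF x] mult_left_le_one_le[of "X x" \<theta>]
        by (simp add: algebra_simps)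
      finally show "norm (X x powr \<theta>) \<le> norm (1 + X x)" using X(2)[OF x] by simp
    qed
  qed (use X in auto)
  show "(\<integral>x. X x powr \<theta> \<partial>M) \<le> (\<integral>x. X x \<partial>M) powr \<theta>"
  proof (cases "(\<integral>x. X x \<partial>M) = 0")
    case True
    hence "AE x in M. X x = 0"
      using X by (subst (asm) integral_nonneg_eq_0_iff_AE) auto
    hence "(\<integral>x. X x powr \<theta> \<partial>M) = (\<integral>x. 0 \<partial>M)" by (intro integral_cong_AE) auto
    thus ?thesis by simp
  next
    case False
    \<comment> \<open>The tangent at the mean c is integrated; its linear term has integral zero.
      The degenerate case c = 0 was split off because the tangent requires c > 0.\<close>
    define c where "c = (\<integral>x. X x \<partial>M)"
    have c: "c > 0" using False X integral_nonneg_AE[of X M] by (auto simp: c_def order.strict_iff_order)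
    have "(\<integral>x. X x powr \<theta> \<partial>M) \<le> (\<integral>x. c powr \<theta> + \<theta> * c powr (\<theta> - 1) * (X x - c) \<partial>M)"
      using X c \<theta> int by (intro integral_mono powr_tangent_concave) auto
    also have "\<dots> = c powr \<theta> + \<theta> * c powr (\<theta> - 1) * ((\<integral>x. X x \<partial>M) - c)"
      using X by (simp add: prob_space)
    finally show ?thesis by (simp add: c_def)
  qed
qed

lemma (in prob_space) moment_mono:
  fixes f :: "'a \<Rightarrow> real"
  assumes f [measurable]: "f \<in> borel_measurable M" and int: "integrable M (\<lambda>x. \<bar>f x\<bar> powr b)"
    and "0 < a" "a \<le> b"
  shows "integrable M (\<lambda>x. \<bar>f x\<bar> powr a)"
    "(\<integral>x. \<bar>f x\<bar> powr a \<partial>M) \<le> (\<integral>x. \<bar>f x\<bar> powr b \<partial>M) powr (a / b)"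
proof -
  have eq: "(\<bar>f x\<bar> powr b) powr (a / b) = \<bar>f x\<bar> powr a" for x
    using assms by (simp add: powr_powr)
  show "integrable M (\<lambda>x. \<bar>f x\<bar> powr a)"
    "(\<integral>x. \<bar>f x\<bar> powr a \<partial>M) \<le> (\<integral>x. \<bar>f x\<bar> powr b \<partial>M) powr (a / b)"
    using integral_powr_le_powr_integral[OF int, of "a / b"] assms by (simp_all add: eq)
qed

lemma (in prob_space) abs_integral_powr_le:
  fixes f :: "'a \<Rightarrow> real"
  assumes f [measurable]: "f \<in> borel_measurable M" and int: "integrable M (\<lambda>x. \<bar>f x\<bar> powr p)" and p: "1 \<le> p"
  shows "integrable M f" "\<bar>\<integral>x. f x \<partial>M\<bar> powr p \<le> (\<integral>x. \<bar>f x\<bar> powr p \<partial>M)"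
proof -
  have m: "integrable M (\<lambda>x. \<bar>f x\<bar>)" "(\<integral>x. \<bar>f x\<bar> \<partial>M) \<le> (\<integral>x. \<bar>f x\<bar> powr p \<partial>M) powr (1 / p)"
    using moment_mono[OF f int, of 1] p by simp_all
  thus "integrable M f" by (subst (asm) integrable_abs_iff) auto
  have "\<bar>\<integral>x. f x \<partial>M\<bar> powr p \<le> ((\<integral>x. \<bar>f x\<bar> powr p \<partial>M) powr (1 / p)) powr p"
    using order.trans[OF integral_abs_bound m(2)] p by (intro powr_mono2) auto
  also have "\<dots> = (\<integral>x. \<bar>f x\<bar> powr p \<partial>M)"
    using p by (simp add: powr_powr)
  finally show "\<bar>\<integral>x. f x \<partial>M\<bar> powr p \<le> (\<integral>x. \<bar>f x\<bar> powr p \<partial>M)" .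
qed

lemma (in prob_space) integrable_square_of_powr:
  fixes f :: "'a \<Rightarrow> real"
  assumes f [measurable]: "f \<in> borel_measurable M" and int: "integrable M (\<lambda>x. \<bar>f x\<bar> powr p)" and p: "2 \<le> p"
  shows "integrable M (\<lambda>x. (f x)\<^sup>2)" "(\<integral>x. (f x)\<^sup>2 \<partial>M) powr (p / 2) \<le> (\<integral>x. \<bar>f x\<bar> powr p \<partial>M)"
proof -
  have eq: "\<bar>f x\<bar> powr 2 = (f x)\<^sup>2" for x by simp
  have m: "integrable M (\<lambda>x. (f x)\<^sup>2)" "(\<integral>x. (f x)\<^sup>2 \<partial>M) \<le> (\<integral>x. \<bar>f x\<bar> powr p \<partial>M) powr (2 / p)"
    using moment_mono[OF f int, of 2] p by (simp_all only: eq)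
  thus "integrable M (\<lambda>x. (f x)\<^sup>2)" by simp
  have "(\<integral>x. (f x)\<^sup>2 \<partial>M) powr (p / 2) \<le> ((\<integral>x. \<bar>f x\<bar> powr p \<partial>M) powr (2 / p)) powr (p / 2)"
    using m p by (intro powr_mono2) auto
  also have "\<dots> = (\<integral>x. \<bar>f x\<bar> powr p \<partial>M)"
    using p by (simp add: powr_powr)
  finally show "(\<integral>x. (f x)\<^sup>2 \<partial>M) powr (p / 2) \<le> (\<integral>x. \<bar>f x\<bar> powr p \<partial>M)" .
qed

section \<open>The normal distribution\<close>

abbreviation Phi :: "real \<Rightarrow> real" where
  "Phi \<equiv> cdf std_normal_distribution"

interpretation NN: real_distribution std_normal_distribution
  by (rule real_dist_normal_dist)

lemma Phi_diff_eq_integral: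
  assumes "a \<le> b"
  shows "Phi b - Phi a = integral {a..b} std_normal_density"
proof (cases "a = b")
  case False
  have "Phi b - Phi a = measure std_normal_distribution {a<..b}"
    using False assms by (intro NN.cdf_diff_eq) auto
  also have "\<dots> = (\<integral>x. indicator {a<..b} x \<partial>std_normal_distribution)"
    by simp
  also have "\<dots> = (LINT x:{a<..b}|lborel. std_normal_density x)"
    by (subst integral_density) (auto simp: set_lebesgue_integral_def mult.commute)
  also have "\<dots> = integral {a<..b} std_normal_density"
  proof (rule set_borel_integral_eq_integral)
    show "set_integrable lborel {a<..b} std_normal_density"
      unfolding set_integrable_def by (rule integrable_mult_indicator) auto
  qed
  also have "\<dots> = integral {a..b} std_normal_density"
    by (rule integral_spike_set; rule negligible_subset[of "{a}"]) auto
  finally show ?thesis .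
qed simp

lemma continuous_on_std_normal_density: "continuous_on A std_normal_density"
  unfolding normal_density_def by (intro continuous_intros) auto

lemma DERIV_Phi: "(Phi has_real_derivative std_normal_density x) (at x)"
proof -
  have "((\<lambda>t. integral {x - 1..t} std_normal_density) has_real_derivative std_normal_density x) (at x within {x - 1..x + 1})"
    by (intro integral_has_real_derivative continuous_on_std_normal_density) auto
  hence "((\<lambda>t. integral {x - 1..t} std_normal_density) has_real_derivative std_normal_density x) (at x)"
    by (subst (asm) at_within_Icc_at) auto
  hence "((\<lambda>t. Phi (x - 1) + integral {x - 1..t} std_normal_density) has_real_derivative std_normal_density x) (at x)"
    by (auto intro!: derivative_eq_intros)
  thus ?thesis
    by (rule has_field_derivative_transform_within_open[of _ _ _ "{x - 1<..<x + 1}"])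
       (auto simp: Phi_diff_eq_integral[symmetric])
qed

lemma DERIV_std_normal_density:
  "(std_normal_density has_real_derivative - (x * std_normal_density x)) (at x)"
  unfolding normal_density_def by (auto intro!: derivative_eq_intros simp: field_simps)

lemma DERIV_deriv_std_normal_density:
  "((\<lambda>x. - (x * std_normal_density x)) has_real_derivative (x\<^sup>2 - 1) * std_normal_density x) (at x)"
  by (auto intro!: derivative_eq_intros DERIV_std_normal_density simp: power2_eq_square algebra_simps)

text \<open>From sqrt (2 pi) \<ge> 2 and exp t \<ge> 1 + t. The rational majorant bounds the density
  and its first two derivatives by elementary algebra.\<close>

lemma std_normal_density_le: "std_normal_density x \<le> (1/2) / (1 + x\<^sup>2 / 2)"
proof -
  have "2 = sqrt 4" by simp
  also have "\<dots> \<le> sqrt (2 * pi)" using pi_gt3 by (intro real_sqrt_le_mono) auto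
  finally have 1: "1 / sqrt (2 * pi) \<le> 1/2" by (simp add: field_simps)
  have "1 + x\<^sup>2 / 2 \<le> exp (x\<^sup>2 / 2)" by (rule exp_ge_add_one_self)
  hence "1 / exp (x\<^sup>2 / 2) \<le> 1 / (1 + x\<^sup>2 / 2)"
    by (intro divide_left_mono mult_pos_pos) (auto intro: add_pos_nonneg)
  hence 2: "exp (- x\<^sup>2 / 2) \<le> 1 / (1 + x\<^sup>2 / 2)" by (simp add: exp_minus field_simps)
  have "std_normal_density x = 1 / sqrt (2 * pi) * exp (- x\<^sup>2 / 2)"
    by (simp add: std_normal_density_def)
  also have "\<dots> \<le> (1/2) * (1 / (1 + x\<^sup>2 / 2))"
    using 1 2 by (intro mult_mono) auto
  finally show ?thesis by simp
qed

lemma std_normal_density_le_half: "std_normal_density x \<le> 1/2"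
proof -
  have "(1/2) / (1 + x\<^sup>2 / 2) \<le> (1/2) / 1"
    by (intro divide_left_mono mult_pos_pos add_pos_nonneg) auto
  with std_normal_density_le[of x] show ?thesis by linarith
qed

lemma abs_mult_std_normal_density_le: "\<bar>x * std_normal_density x\<bar> \<le> 1/2"
proof -
  have pos: "0 < 1 + x\<^sup>2 / 2" by (intro add_pos_nonneg) auto
  have "0 \<le> (\<bar>x\<bar> - 1)\<^sup>2" by simp
  hence "\<bar>x\<bar> \<le> 1 + x\<^sup>2 / 2" by (simp add: power2_diff)
  hence "\<bar>x\<bar> * ((1/2) / (1 + x\<^sup>2 / 2)) \<le> 1/2" using pos by (simp add: field_simps)
  moreover have "\<bar>x\<bar> * std_normal_density x \<le> \<bar>x\<bar> * ((1/2) / (1 + x\<^sup>2 / 2))"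
    by (intro mult_left_mono std_normal_density_le) auto
  moreover have "\<bar>x * std_normal_density x\<bar> = \<bar>x\<bar> * std_normal_density x" by (simp add: abs_mult)
  ultimately show ?thesis by linarith
qed

lemma abs_deriv2_std_normal_density_le: "\<bar>(x\<^sup>2 - 1) * std_normal_density x\<bar> \<le> 1"
proof -
  have pos: "0 < 1 + x\<^sup>2 / 2" by (intro add_pos_nonneg) auto
  have "\<bar>x\<^sup>2 - 1\<bar> \<le> 2 * (1 + x\<^sup>2 / 2)" using zero_le_power2[of x] by (simp add: abs_if)
  hence "\<bar>x\<^sup>2 - 1\<bar> * ((1/2) / (1 + x\<^sup>2 / 2)) \<le> 1" using pos by (simp add: field_simps)
  moreover have "\<bar>x\<^sup>2 - 1\<bar> * std_normal_density x \<le> \<bar>x\<^sup>2 - 1\<bar> * ((1/2) / (1 + x\<^sup>2 / 2))"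
    by (intro mult_left_mono std_normal_density_le) auto
  moreover have "\<bar>(x\<^sup>2 - 1) * std_normal_density x\<bar> = \<bar>x\<^sup>2 - 1\<bar> * std_normal_density x" by (simp add: abs_mult)
  ultimately show ?thesis by linarith
qed

lemma Phi_lipschitz: "\<bar>Phi y - Phi x\<bar> \<le> \<bar>y - x\<bar> / 2"
proof -
  have "norm (Phi y - Phi x) \<le> 1/2 * norm (y - x)"
  proof (rule field_differentiable_bound[of UNIV _ std_normal_density])
    show "norm (std_normal_density z) \<le> 1/2" for z
      using std_normal_density_le_half[of z] by simp
  qed (auto intro: DERIV_Phi)
  thus ?thesis by simp
qed

text \<open>The remainder is (g t - g y) h^2 / 2 with g the second derivative, whose oscillation is
  at most 1 and whose Lipschitz constant is 1. So it is below min(1, |h|) h^2, and this is below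
  |h|^p for every p between 2 and 3.\<close>

lemma Phi_taylor:
  assumes "2 \<le> p" "p \<le> 3"
  shows "\<bar>Phi (y + h) - (Phi y + h * std_normal_density y - h\<^sup>2 / 2 * (y * std_normal_density y))\<bar> \<le> \<bar>h\<bar> powr p"
proof (cases "h = 0")
  case False
  let ?g = "\<lambda>x. - (x * std_normal_density x)"
  define D where "D = (\<lambda>m::nat. if m = 0 then Phi else if m = 1 then std_normal_density else ?g)"
  have "\<exists>t. (if y + h < y then y + h < t \<and> t < y else y < t \<and> t < y + h) \<and>
     Phi (y + h) = (\<Sum>m<2. D m y / fact m * (y + h - y) ^ m) + D 2 t / fact 2 * (y + h - y) ^ 2"
    by (rule Taylor[of 2 D Phi "min y (y + h)" "max y (y + h)" y "y + h"])
       (use False in \<open>auto simp: D_def intro: DERIV_Phi DERIV_std_normal_density\<close>)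
  then obtain t where "if y + h < y then y + h < t \<and> t < y else y < t \<and> t < y + h" and
    t: "Phi (y + h) = (\<Sum>m<2. D m y / fact m * (y + h - y) ^ m) + D 2 t / fact 2 * (y + h - y) ^ 2"
    by blast
  hence t: "\<bar>t - y\<bar> \<le> \<bar>h\<bar>"
    "Phi (y + h) = (\<Sum>m<2. D m y / fact m * (y + h - y) ^ m) + D 2 t / fact 2 * (y + h - y) ^ 2"
    by (auto split: if_splits)
  have "Phi (y + h) = Phi y + h * std_normal_density y + ?g t / 2 * h\<^sup>2"
    unfolding t(2) by (simp add: D_def numeral_2_eq_2)
  hence "Phi (y + h) - (Phi y + h * std_normal_density y - h\<^sup>2 / 2 * (y * std_normal_density y)) = (?g t - ?g y) * (h\<^sup>2 / 2)"
    by (simp add: algebra_simps)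
  also have "\<bar>\<dots>\<bar> = \<bar>?g t - ?g y\<bar> * (h\<^sup>2 / 2)" by (simp add: abs_mult)
  also have "\<bar>?g t - ?g y\<bar> \<le> min 1 \<bar>h\<bar>"
  proof -
    have "\<bar>?g t - ?g y\<bar> \<le> 1"
      using abs_mult_std_normal_density_le[of t] abs_mult_std_normal_density_le[of y] by (simp add: abs_if split: if_splits)
    moreover have "norm (?g t - ?g y) \<le> 1 * norm (t - y)"
      by (rule field_differentiable_bound[of UNIV _ "\<lambda>x. (x\<^sup>2 - 1) * std_normal_density x"])
         (use abs_deriv2_std_normal_density_le in \<open>auto intro: DERIV_deriv_std_normal_density\<close>)
    ultimately show ?thesis using t(1) by simp
  qed
  hence "\<bar>?g t - ?g y\<bar> * (h\<^sup>2 / 2) \<le> min 1 \<bar>h\<bar> * h\<^sup>2"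
    by (intro mult_mono) auto
  also have "\<dots> \<le> \<bar>h\<bar> powr p"
  proof (cases "\<bar>h\<bar> \<le> 1")
    case True
    have "\<bar>h\<bar> powr 3 \<le> \<bar>h\<bar> powr p" using True False assms by (intro powr_mono') auto
    moreover have "\<bar>h\<bar> powr 3 = \<bar>h\<bar> * h\<^sup>2"
    proof -
      have "\<bar>h\<bar> powr 3 = \<bar>h\<bar> ^ 3" using False by simp
      also have "\<dots> = \<bar>h\<bar> * h\<^sup>2" by (simp add: power3_eq_cube power2_eq_square)
      finally show ?thesis .
    qed
    ultimately show ?thesis using True by simp
  next
    case False
    have "\<bar>h\<bar> powr 2 \<le> \<bar>h\<bar> powr p" using False assms by (intro powr_mono) auto
    thus ?thesis using False by simp
  qed
  finally show ?thesis .
qed simp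

text \<open>Both sides are the probability that sqrt s Z + sqrt v Z' \<le> b for independent
  standard normals: integrating over Z first gives the left side, adding the variances the right
  one. The exchange thereby reads a Gaussian increment as additional variance.\<close>

lemma Phi_conv:
  assumes s: "0 < s" and v: "0 \<le> v"
  shows "(\<integral>y. Phi ((b - sqrt v * y) / sqrt s) \<partial>std_normal_distribution) = Phi (b / sqrt (s + v))"
proof (cases "v = 0")
  case True
  thus ?thesis using NN.prob_space by simp
next
  case False
  let ?N = "std_normal_distribution"
  let ?Q = "?N \<Otimes>\<^sub>M ?N"
  have v: "v > 0" using v False by simp
  interpret Q: pair_prob_space ?N ?N ..
  have d1: "distr ?Q ?N fst = ?N" by (rule NN.distr_pair_fst)
  have d2: "distr ?Q ?N snd = ?N"
  proof (rule measure_eqI)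
    fix A assume A: "A \<in> sets (distr ?Q ?N snd)"
    have "emeasure (distr ?Q ?N snd) A = emeasure ?Q (space ?N \<times> A)"
      using A sets.sets_into_space[of A ?N] by (subst emeasure_distr) (auto intro!: arg_cong2[where f=emeasure] simp: space_pair_measure)
    thus "emeasure (distr ?Q ?N snd) A = emeasure ?N A"
      using A NN.emeasure_space_1 by (simp add: NN.emeasure_pair_measure_Times del: space_density space_lborel)
  qed simp
  have ind: "Q.indep_var borel fst borel snd"
    unfolding Q.indep_var_distribution_eq
  proof (intro conjI)
    have "distr ?Q borel fst = ?N" "distr ?Q borel snd = ?N"
      using d1 d2 distr_cong[of ?Q ?Q borel ?N fst fst] distr_cong[of ?Q ?Q borel ?N snd snd] by simp_all
    moreover have "distr ?Q (borel \<Otimes>\<^sub>M borel) (\<lambda>x. (fst x, snd x)) = distr ?Q ?Q (\<lambda>x. x)"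
      by (rule distr_cong) (auto intro!: sets_pair_measure_cong)
    ultimately show "distr ?Q borel fst \<Otimes>\<^sub>M distr ?Q borel snd = distr ?Q (borel \<Otimes>\<^sub>M borel) (\<lambda>x. (fst x, snd x))"
      by (simp add: distr_id2)
  qed measurable
  have n1: "distributed ?Q lborel fst std_normal_density" "distributed ?Q lborel snd std_normal_density"
    using d1 d2 distr_cong[of ?Q ?Q lborel ?N fst fst] distr_cong[of ?Q ?Q lborel ?N snd snd]
    by (auto simp: distributed_def)
  have X: "distributed ?Q lborel (\<lambda>w. sqrt s * fst w) (normal_density 0 (sqrt s))"
    using Q.normal_density_affine[OF n1(1), of "sqrt s" 0] s by simp
  have Y: "distributed ?Q lborel (\<lambda>w. sqrt v * snd w) (normal_density 0 (sqrt v))"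
    using Q.normal_density_affine[OF n1(2), of "sqrt v" 0] v by simp
  have "Q.indep_var borel ((\<lambda>x. sqrt s * x) \<circ> fst) borel ((\<lambda>x. sqrt v * x) \<circ> snd)"
    by (intro Q.indep_var_compose[OF ind]) auto
  hence ind': "Q.indep_var borel (\<lambda>w. sqrt s * fst w) borel (\<lambda>w. sqrt v * snd w)"
    by (simp add: comp_def)
  have "distributed ?Q lborel (\<lambda>w. sqrt s * fst w + sqrt v * snd w) (normal_density 0 (sqrt (s + v)))"
    using Q.add_indep_normal[OF ind' _ _ X Y] s v by simp
  hence Z: "distributed ?Q lborel (\<lambda>w. (sqrt s * fst w + sqrt v * snd w) / sqrt (s + v)) std_normal_density"
    using Q.normal_standard_normal_convert[of "sqrt (s + v)" "\<lambda>w. sqrt s * fst w + sqrt v * snd w" 0] s v by simp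
  have sv: "sqrt (s + v) > 0" using s v by simp
  have "Phi (b / sqrt (s + v)) = measure (distr ?Q lborel (\<lambda>w. (sqrt s * fst w + sqrt v * snd w) / sqrt (s + v))) {..b / sqrt (s + v)}"
    using distributed_distr_eq_density[OF Z] by (simp add: cdf_def)
  also have "\<dots> = measure ?Q {w \<in> space ?Q. sqrt s * fst w + sqrt v * snd w \<le> b}"
    using sv by (subst measure_distr) (auto simp: divide_le_cancel intro!: arg_cong[where f = "measure ?Q"])
  also have "\<dots> = (\<integral>w. indicator {w \<in> space ?Q. sqrt s * fst w + sqrt v * snd w \<le> b} w \<partial>?Q)"
  proof -
    have "{w \<in> space ?Q. sqrt s * fst w + sqrt v * snd w \<le> b} \<inter> space ?Q = {w \<in> space ?Q. sqrt s * fst w + sqrt v * snd w \<le> b}"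
      by auto
    thus ?thesis by simp
  qed
  also have "\<dots> = (\<integral>y. (\<integral>x. indicator {w \<in> space ?Q. sqrt s * fst w + sqrt v * snd w \<le> b} (x, y) \<partial>?N) \<partial>?N)"
  proof (rule Q.integral_snd[of "\<lambda>x y. indicator {w \<in> space ?Q. sqrt s * fst w + sqrt v * snd w \<le> b} (x, y) :: real", symmetric, unfolded case_prod_eta])
    show "integrable ?Q (\<lambda>z. indicator {w \<in> space ?Q. sqrt s * fst w + sqrt v * snd w \<le> b} z :: real)"
      by (rule Q.integrable_const_bound[where B = 1]) auto
  qed
  also have "\<dots> = (\<integral>y. Phi ((b - sqrt v * y) / sqrt s) \<partial>?N)"
  proof (rule Bochner_Integration.integral_cong[OF refl])
    fix y
    have "(\<integral>x. indicator {w \<in> space ?Q. sqrt s * fst w + sqrt v * snd w \<le> b} (x, y) \<partial>?N)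
       = (\<integral>x. indicator {..(b - sqrt v * y) / sqrt s} x \<partial>?N)"
      by (rule Bochner_Integration.integral_cong)
         (use s in \<open>auto simp: indicator_def space_pair_measure field_simps\<close>)
    also have "\<dots> = Phi ((b - sqrt v * y) / sqrt s)" by (simp add: cdf_def)
    finally show "(\<integral>x. indicator {w \<in> space ?Q. sqrt s * fst w + sqrt v * snd w \<le> b} (x, y) \<partial>?N) = Phi ((b - sqrt v * y) / sqrt s)" .
  qed
  finally show ?thesis ..
qed

section \<open>Gaussian smoothing: expansion, exchange of increments, and removal of the
  smoothing\<close>

lemma Phi_measurable [measurable]: "Phi \<in> borel_measurable borel"
  by (intro borel_measurable_continuous_onI) (auto simp: continuous_on_eq_continuous_at intro: DERIV_isCont DERIV_Phi)

lemma Phi_bounds: "0 \<le> Phi x" "Phi x \<le> 1"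
  by (auto simp: NN.cdf_nonneg NN.cdf_bounded_prob)

text \<open>Mean zero kills the linear term, so the integrated expansion sees the law of \<eta> only
  through its second moment. Two laws of equal variance then differ by p-th moments alone.\<close>

lemma (in prob_space) Phi_taylor_integral:
  assumes \<eta> [measurable]: "\<eta> \<in> borel_measurable M" and int: "integrable M (\<lambda>x. \<bar>\<eta> x\<bar> powr p)"
    and p: "2 \<le> p" "p \<le> 3" and mean: "(\<integral>x. \<eta> x \<partial>M) = 0" and s: "0 < s"
  shows "\<bar>(\<integral>x. Phi ((b - \<eta> x) / sqrt s) \<partial>M)
      - (Phi (b / sqrt s) - (\<integral>x. (\<eta> x)\<^sup>2 \<partial>M) / s / 2 * (b / sqrt s * std_normal_density (b / sqrt s)))\<bar>
    \<le> (\<integral>x. \<bar>\<eta> x\<bar> powr p \<partial>M) / sqrt s powr p"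
proof -
  define y where "y = b / sqrt s"
  have i1: "integrable M \<eta>" using abs_integral_powr_le[OF \<eta> int] p by simp
  have i2: "integrable M (\<lambda>x. (\<eta> x)\<^sup>2)" using integrable_square_of_powr[OF \<eta> int] p by simp
  have i3: "integrable M (\<lambda>x. Phi ((b - \<eta> x) / sqrt s))"
    by (rule integrable_const_bound[where B = 1]) (auto simp: Phi_bounds)
  define T where "T x = Phi y - \<eta> x * (std_normal_density y / sqrt s) - (\<eta> x)\<^sup>2 * (y * std_normal_density y / s / 2)" for x
  have T_eq: "T x = Phi y + (- \<eta> x / sqrt s) * std_normal_density y - (- \<eta> x / sqrt s)\<^sup>2 / 2 * (y * std_normal_density y)" for x
    using s by (simp add: T_def power_divide)
  have i4: "integrable M T" unfolding T_def using i1 i2 by simp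
  have T: "(\<integral>x. T x \<partial>M) = Phi y - (\<integral>x. (\<eta> x)\<^sup>2 \<partial>M) / s / 2 * (y * std_normal_density y)"
    unfolding T_def using i1 i2 mean by (simp add: prob_space)
  have "\<bar>(\<integral>x. Phi ((b - \<eta> x) / sqrt s) \<partial>M) - (\<integral>x. T x \<partial>M)\<bar> = \<bar>\<integral>x. Phi ((b - \<eta> x) / sqrt s) - T x \<partial>M\<bar>"
    using i3 i4 by simp
  also have "\<dots> \<le> (\<integral>x. \<bar>\<eta> x\<bar> powr p / sqrt s powr p \<partial>M)"
  proof (rule order.trans[OF integral_abs_bound], rule integral_mono)
    show "integrable M (\<lambda>x. \<bar>Phi ((b - \<eta> x) / sqrt s) - T x\<bar>)" using i3 i4 by (intro integrable_abs Bochner_Integration.integrable_diff)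
    show "integrable M (\<lambda>x. \<bar>\<eta> x\<bar> powr p / sqrt s powr p)" using int by simp
    fix x
    have "(b - \<eta> x) / sqrt s = y + - \<eta> x / sqrt s" by (simp add: y_def diff_divide_distrib)
    moreover have "\<bar>- \<eta> x / sqrt s\<bar> powr p = \<bar>\<eta> x\<bar> powr p / sqrt s powr p"
      using s by (simp add: powr_divide)
    ultimately show "\<bar>Phi ((b - \<eta> x) / sqrt s) - T x\<bar> \<le> \<bar>\<eta> x\<bar> powr p / sqrt s powr p"
      using Phi_taylor[OF p, of y "- \<eta> x / sqrt s"] by (simp add: T_eq)
  qed
  finally show ?thesis by (simp add: T y_def)
qed

lemma std_normal_abs_moment_le:
  assumes "0 < p" "p \<le> 4"
  shows "integrable std_normal_distribution (\<lambda>x. \<bar>x\<bar> powr p)"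
    "(\<integral>x. \<bar>x\<bar> powr p \<partial>std_normal_distribution) \<le> 3"
proof -
  have eq: "\<bar>x\<bar> powr 4 = x ^ 4" for x :: real by simp
  have i4: "integrable std_normal_distribution (\<lambda>x. \<bar>x\<bar> powr 4)"
    using integrable_std_normal_distribution_moment[of 4] by (simp add: eq)
  have e4: "(\<integral>x. \<bar>x\<bar> powr 4 \<partial>std_normal_distribution) = 3"
    using std_normal_distribution_even_moments(1)[of 2] by (simp add: fact_numeral)
  show "integrable std_normal_distribution (\<lambda>x. \<bar>x\<bar> powr p)"
    using NN.moment_mono[OF _ i4, of p] assms by simp
  have "(\<integral>x. \<bar>x\<bar> powr p \<partial>std_normal_distribution) \<le> 3 powr (p / 4)"
    using NN.moment_mono[OF _ i4, of p] assms e4 by simp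
  also have "\<dots> \<le> 3 powr 1" using assms by (intro powr_mono) auto
  finally show "(\<integral>x. \<bar>x\<bar> powr p \<partial>std_normal_distribution) \<le> 3" by simp
qed

text \<open>Lindeberg's exchange: one increment is replaced by a Gaussian one of the same variance.\<close>

lemma (in prob_space) Phi_exchange:
  assumes \<eta> [measurable]: "\<eta> \<in> borel_measurable M" and int: "integrable M (\<lambda>x. \<bar>\<eta> x\<bar> powr p)"
    and p: "2 \<le> p" "p \<le> 3" and mean: "(\<integral>x. \<eta> x \<partial>M) = 0" and e: "0 < e" "e\<^sup>2 \<le> s"
  shows "\<bar>(\<integral>x. Phi ((b - \<eta> x) / sqrt s) \<partial>M) - Phi (b / sqrt (s + (\<integral>x. (\<eta> x)\<^sup>2 \<partial>M)))\<bar>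
    \<le> 4 * e powr (-p) * (\<integral>x. \<bar>\<eta> x\<bar> powr p \<partial>M)"
proof -
  define v where "v = (\<integral>x. (\<eta> x)\<^sup>2 \<partial>M)"
  define R where "R = (\<integral>x. \<bar>\<eta> x\<bar> powr p \<partial>M)"
  have v: "0 \<le> v" by (simp add: v_def)
  have R: "0 \<le> R" by (simp add: R_def)
  have s: "0 < s" using e by (smt (verit) zero_less_power)
  have es: "e \<le> sqrt s" using e by (simp add: real_le_rsqrt)
  define c where "c = Phi (b / sqrt s) - v / s / 2 * (b / sqrt s * std_normal_density (b / sqrt s))"
  have 1: "\<bar>(\<integral>x. Phi ((b - \<eta> x) / sqrt s) \<partial>M) - c\<bar> \<le> R / sqrt s powr p"
    using Phi_taylor_integral[OF \<eta> int p mean s, of b] by (simp add: v_def R_def c_def)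
  let ?N = "std_normal_distribution"
  have pw: "\<bar>sqrt v * x\<bar> powr p = sqrt v powr p * \<bar>x\<bar> powr p" for x
    using v by (simp add: abs_mult powr_mult)
  have N2: "(\<integral>x. (sqrt v * x)\<^sup>2 \<partial>?N) = v"
    using std_normal_distribution_even_moments(1)[of 1] v by (simp add: power_mult_distrib)
  have N1: "(\<integral>x. sqrt v * x \<partial>?N) = 0"
    using integral_std_normal_distribution_moment_odd[of 1] by simp
  \<comment> \<open>The Gaussian substitute has p-th moment at most 3 v^(p/2), and v^(p/2) \<le> R
    by Jensen; with the R of the original increment this makes the factor 4.\<close>
  have Np: "(\<integral>x. \<bar>sqrt v * x\<bar> powr p \<partial>?N) \<le> 3 * R"
  proof -
    have "sqrt v powr p = v powr (p / 2)" using v by (simp add: powr_half_sqrt[symmetric] powr_powr)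
    also have "\<dots> \<le> R" using integrable_square_of_powr[OF \<eta> int] p by (simp add: v_def R_def)
    finally have "sqrt v powr p \<le> R" .
    moreover have "(\<integral>x. \<bar>x\<bar> powr p \<partial>?N) \<le> 3" using std_normal_abs_moment_le[of p] p by simp
    ultimately have "sqrt v powr p * (\<integral>x. \<bar>x\<bar> powr p \<partial>?N) \<le> R * 3"
      using R by (intro mult_mono) auto
    thus ?thesis by (simp add: pw)
  qed
  have "\<bar>(\<integral>x. Phi ((b - sqrt v * x) / sqrt s) \<partial>?N) - c\<bar> \<le> (\<integral>x. \<bar>sqrt v * x\<bar> powr p \<partial>?N) / sqrt s powr p"
    using NN.Phi_taylor_integral[of "\<lambda>x. sqrt v * x" p s b] p s N1 N2 std_normal_abs_moment_le[of p]
    by (simp add: pw c_def)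
  also have "\<dots> \<le> (3 * R) / sqrt s powr p" using Np by (intro divide_right_mono) auto
  finally have "\<bar>Phi (b / sqrt (s + v)) - c\<bar> \<le> (3 * R) / sqrt s powr p"
    using Phi_conv[OF s v] by simp
  note 2 = this
  have "\<bar>(\<integral>x. Phi ((b - \<eta> x) / sqrt s) \<partial>M) - Phi (b / sqrt (s + v))\<bar> \<le> 4 * R / sqrt s powr p"
  proof -
    have "4 * R / sqrt s powr p = R / sqrt s powr p + (3 * R) / sqrt s powr p"
      by (simp add: add_divide_distrib[symmetric])
    with 1 2 show ?thesis by linarith
  qed
  also have "\<dots> \<le> 4 * R / e powr p"
    using e es p R s by (intro divide_left_mono powr_mono2 mult_pos_pos) auto
  also have "\<dots> = 4 * e powr (-p) * R" by (simp add: powr_minus field_simps)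
  finally show ?thesis by (simp add: v_def R_def)
qed

text \<open>The mean value point z satisfies |z - x| \<le> (1 + |x|) / 2, hence 1 + |x| \<le> 2 (1 +
  |z|), and 1 + |z| times the density at z is at most 1. So rescaling a variance, or dividing by a
  random normalizer, costs nothing that grows with x.\<close>

lemma Phi_relative_perturbation:
  assumes "\<bar>y - x\<bar> \<le> \<delta> * (1 + \<bar>x\<bar>)" "\<delta> \<le> 1/2"
  shows "\<bar>Phi y - Phi x\<bar> \<le> 2 * \<delta>"
proof (cases "x = y")
  case True
  from assms(1) True have "0 \<le> \<delta> * (1 + \<bar>x\<bar>)" by simp
  hence "0 \<le> \<delta>" using zero_le_mult_iff[of \<delta> "1 + \<bar>x\<bar>"] abs_ge_zero[of x] by linarith
  with True show ?thesis by simp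
next
  case False
  have "\<exists>z. \<bar>z - x\<bar> \<le> \<bar>y - x\<bar> \<and> \<bar>Phi y - Phi x\<bar> = \<bar>y - x\<bar> * std_normal_density z"
  proof (cases "x < y")
    case True
    from MVT2[OF True DERIV_Phi] obtain z where "x < z" "z < y" "Phi y - Phi x = (y - x) * std_normal_density z"
      by blast
    thus ?thesis by (intro exI[of _ z]) (auto simp: abs_mult)
  next
    case F: False
    with False have "y < x" by simp
    from MVT2[OF this DERIV_Phi] obtain z where "y < z" "z < x" "Phi x - Phi y = (x - y) * std_normal_density z"
      by blast
    thus ?thesis by (intro exI[of _ z]) (auto simp: abs_mult abs_minus_commute[of "Phi y"])
  qed
  then obtain z where z: "\<bar>z - x\<bar> \<le> \<bar>y - x\<bar>" "\<bar>Phi y - Phi x\<bar> = \<bar>y - x\<bar> * std_normal_density z" by blast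
  have "0 \<le> \<delta> * (1 + \<bar>x\<bar>)" using assms(1) by (rule order.trans[rotated]) simp
  hence \<delta>: "0 \<le> \<delta>" using zero_le_mult_iff[of \<delta> "1 + \<bar>x\<bar>"] abs_ge_zero[of x] by linarith
  have "\<delta> * (1 + \<bar>x\<bar>) \<le> 1/2 * (1 + \<bar>x\<bar>)" using assms by (intro mult_right_mono) auto
  with z(1) assms(1) have "\<bar>z - x\<bar> \<le> 1/2 * (1 + \<bar>x\<bar>)" by linarith
  moreover have "\<bar>x\<bar> \<le> \<bar>z\<bar> + \<bar>z - x\<bar>" using abs_triangle_ineq[of z "x - z"] by (simp add: abs_minus_commute)
  ultimately have x: "1 + \<bar>x\<bar> \<le> 2 + 2 * \<bar>z\<bar>" by argo
  have "\<bar>y - x\<bar> * std_normal_density z \<le> \<delta> * (2 + 2 * \<bar>z\<bar>) * std_normal_density z"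
    using assms(1) x \<delta> by (intro mult_right_mono order.trans[OF assms(1)] mult_left_mono) auto
  also have "\<dots> = \<delta> * (2 * std_normal_density z + 2 * \<bar>z * std_normal_density z\<bar>)"
    by (simp add: algebra_simps abs_mult)
  also have "\<dots> \<le> \<delta> * 2"
    using std_normal_density_le_half[of z] abs_mult_std_normal_density_le[of z] \<delta> by (intro mult_left_mono) auto
  finally show ?thesis using z(2) by simp
qed

lemma integrable_indicator_std_normal [simp]:
  "A \<in> sets borel \<Longrightarrow> integrable std_normal_distribution (indicator A :: real \<Rightarrow> real)"
  by (rule NN.integrable_const_bound[where B = 1]) auto

text \<open>Chebyshev with the second moment. The crude value suffices: twice the tail probability
  has only to stay below 1.\<close>

lemma std_normal_tail_3:
  "measure std_normal_distribution {3<..} \<le> 1/9" "measure std_normal_distribution {..<-3} \<le> 1/9"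
proof -
  have int: "integrable std_normal_distribution (\<lambda>x. x\<^sup>2 / 9)"
    using integrable_std_normal_distribution_moment[of 2] by simp
  have "(\<integral>x. x\<^sup>2 / 9 \<partial>std_normal_distribution) = 1/9"
    using std_normal_distribution_even_moments(1)[of 1] by simp
  hence key: "measure std_normal_distribution A \<le> 1/9"
    if A: "A \<in> sets borel" "\<And>x. x \<in> A \<Longrightarrow> 3 \<le> \<bar>x\<bar>" for A
  proof -
    have "measure std_normal_distribution A = (\<integral>x. indicator A x \<partial>std_normal_distribution)" by simp
    also have "\<dots> \<le> (\<integral>x. x\<^sup>2 / 9 \<partial>std_normal_distribution)"
    proof (rule integral_mono[OF _ int])
      show "integrable std_normal_distribution (indicator A :: real \<Rightarrow> real)" using A(1) by simp
      fix x :: real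
      have "9 \<le> x\<^sup>2" if "x \<in> A"
        using A(2)[OF that] abs_le_square_iff[of 3 x] by simp
      thus "indicator A x \<le> x\<^sup>2 / 9" by (auto simp: indicator_def)
    qed
    also have "\<dots> = 1/9" by fact
    finally show ?thesis .
  qed
  show "measure std_normal_distribution {3<..} \<le> 1/9" "measure std_normal_distribution {..<-3} \<le> 1/9"
    by (rule key; simp)+
qed

lemma Phi_eq_integral_indicator:
  assumes "0 < \<sigma>"
  shows "Phi (t / \<sigma>) = (\<integral>y. indicator {y. \<sigma> * y \<le> t} y \<partial>std_normal_distribution)"
proof -
  have "{y. \<sigma> * y \<le> t} = {..t / \<sigma>}" using assms by (auto simp: field_simps)
  thus ?thesis by (simp add: cdf_def)
qed

text \<open>
  Bolthausen's device: a Gaussian perturbation of conditional scale at most \<open>2 e\<close> is removed at the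
  cost of \<open>O(e)\<close>, because the distance \<open>\<Delta>\<close> of the unperturbed law to the normal law
  re-enters only with the factor \<open>2/9\<close>.
\<close>

lemma (in prob_space) unsmoothing:
  fixes X X' s :: "'a \<Rightarrow> real"
  assumes [measurable]: "X \<in> borel_measurable M" "X' \<in> borel_measurable M" "s \<in> borel_measurable M" "G \<in> sets M"
    and e: "0 < e"
    and spos: "\<And>\<omega>. \<omega> \<in> space M \<Longrightarrow> 0 < s \<omega>"
    and G: "\<And>\<omega>. \<omega> \<in> G \<Longrightarrow> X' \<omega> = X \<omega>" "\<And>\<omega>. \<omega> \<in> G \<Longrightarrow> s \<omega> \<le> (2 * e)\<^sup>2"
    and H: "\<And>a. \<bar>(\<integral>\<omega>. Phi ((a - X' \<omega>) / sqrt (s \<omega>)) \<partial>M) - Phi a\<bar> \<le> D"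
  shows "\<bar>prob {\<omega> \<in> space M. X \<omega> \<le> a} - Phi a\<bar> \<le> 2 * (D + 4 * e + prob (space M - G))"
proof -
  let ?N = std_normal_distribution
  interpret pair: pair_prob_space M ?N ..
  define F where "F a = prob {\<omega> \<in> space M. X \<omega> \<le> a}" for a
  define \<Delta> where "\<Delta> = (SUP a. \<bar>F a - Phi a\<bar>)"
  define B where "B = prob (space M - G)"
  have "\<bar>F a - Phi a\<bar> \<le> 1" for a using Phi_bounds[of a] prob_le_1[of "{\<omega> \<in> space M. X \<omega> \<le> a}"] measure_nonneg[of M "{\<omega> \<in> space M. X \<omega> \<le> a}"]
    unfolding F_def by linarith
  hence bdd: "bdd_above (range (\<lambda>a. \<bar>F a - Phi a\<bar>))" by (intro bdd_aboveI[of _ 1]) auto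
  have \<Delta>: "\<bar>F a - Phi a\<bar> \<le> \<Delta>" for a unfolding \<Delta>_def by (rule cSUP_upper[OF _ bdd]) simp
  have \<Delta>0: "0 \<le> \<Delta>" using \<Delta>[of 0] by linarith
  have F_mono: "F a \<le> F b" if "a \<le> b" for a b
    unfolding F_def using that by (intro finite_measure_mono) auto
  \<comment> \<open>F is within \<Delta> of Phi at both points, and Phi has Lipschitz constant 1/2;
    this replaces regularity of F.\<close>
  have F_shift: "\<bar>F b - F a\<bar> \<le> 2 * \<Delta> + \<bar>b - a\<bar> / 2" for a b
    using \<Delta>[of a] \<Delta>[of b] Phi_lipschitz[of b a] by linarith
  have iG: "integrable M (indicator (space M - G) :: 'a \<Rightarrow> real)"
    by (rule integrable_const_bound[where B = 1]) auto
  have iB: "(\<integral>\<omega>. indicator (space M - G) \<omega> \<partial>M) = B"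
  proof -
    have "(space M - G) \<inter> space M = space M - G" by auto
    thus ?thesis by (simp add: B_def)
  qed
  have absN: "integrable ?N (\<lambda>y. \<bar>y\<bar>)" "(\<integral>y. \<bar>y\<bar> \<partial>?N) \<le> 1"
  proof -
    show i: "integrable ?N (\<lambda>y. \<bar>y\<bar>)" using integrable_std_normal_distribution_moment[of 1] by simp
    have "(\<integral>y. \<bar>y\<bar> \<partial>?N) \<le> (\<integral>y. (1 + y\<^sup>2) / 2 \<partial>?N)"
    proof (rule integral_mono[OF i])
      show "integrable ?N (\<lambda>y. (1 + y\<^sup>2) / 2)" using integrable_std_normal_distribution_moment[of 2] by simp
      fix y :: real
      have "0 \<le> (\<bar>y\<bar> - 1)\<^sup>2" by simp
      thus "\<bar>y\<bar> \<le> (1 + y\<^sup>2) / 2" by (simp add: power2_diff)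
    qed
    also have "\<dots> = 1" using std_normal_distribution_even_moments[of 1] NN.prob_space by simp
    finally show "(\<integral>y. \<bar>y\<bar> \<partial>?N) \<le> 1" .
  qed
  have tail_int: "(\<integral>y. 2 * \<Delta> * indicator A y + e * \<bar>y\<bar> \<partial>?N) \<le> 2/9 * \<Delta> + e"
    if "A \<in> sets borel" "measure ?N A \<le> 1/9" for A
  proof -
    have "(\<integral>y. 2 * \<Delta> * indicator A y + e * \<bar>y\<bar> \<partial>?N) = 2 * \<Delta> * measure ?N A + e * (\<integral>y. \<bar>y\<bar> \<partial>?N)"
      using absN that by (subst Bochner_Integration.integral_add) auto
    also have "\<dots> \<le> 2 * \<Delta> * (1/9) + e * 1"
      using absN that \<Delta>0 e by (intro add_mono mult_left_mono) auto
    finally show ?thesis by simp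
  qed
  have iPhi: "integrable M (\<lambda>\<omega>. Phi ((a - X' \<omega>) / sqrt (s \<omega>)))" for a
    by (rule integrable_const_bound[where B = 1]) (auto simp: Phi_bounds)
  define f where "f g \<omega> y = (indicator {\<omega> \<in> space M. X \<omega> \<le> g y} \<omega> :: real)" for g :: "real \<Rightarrow> real" and \<omega> y
  have f_meas: "(\<lambda>(\<omega>, y). f g \<omega> y) \<in> borel_measurable (M \<Otimes>\<^sub>M ?N)" if [measurable]: "g \<in> borel_measurable borel" for g
    unfolding f_def by measurable
  have f_int: "integrable (M \<Otimes>\<^sub>M ?N) (\<lambda>(\<omega>, y). f g \<omega> y)" if "g \<in> borel_measurable borel" for g
    using f_meas[OF that] by (intro pair.P.integrable_const_bound[where B = 1]) (auto simp: f_def)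
  have f_fub: "(\<integral>\<omega>. (\<integral>y. f g \<omega> y \<partial>?N) \<partial>M) = (\<integral>y. F (g y) \<partial>?N)" if "g \<in> borel_measurable borel" for g
    using pair.Fubini_integral[OF f_int[OF that]] by (simp add: f_def F_def)
  have f_i1: "integrable M (\<lambda>\<omega>. \<integral>y. f g \<omega> y \<partial>?N)" if "g \<in> borel_measurable borel" for g
    using pair.integrable_fst'[OF f_int[OF that]] by simp
  have f_i2: "integrable ?N (\<lambda>y. F (g y))" if "g \<in> borel_measurable borel" for g
    using pair.integrable_snd[OF f_int[OF that]] by (simp add: f_def F_def)
  have i_f: "integrable ?N (f g \<omega>)" if [measurable]: "g \<in> borel_measurable borel" and "\<omega> \<in> space M" for g \<omega>
  proof -
    have "f g \<omega> = indicator {y. X \<omega> \<le> g y}" using that by (auto simp: f_def indicator_def)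
    moreover have "{y. X \<omega> \<le> g y} \<in> sets borel" by measurable
    ultimately show ?thesis by (simp only: integrable_indicator_std_normal)
  qed
  have f_01: "0 \<le> (\<integral>y. f g \<omega> y \<partial>?N)" "(\<integral>y. f g \<omega> y \<partial>?N) \<le> 1" if [measurable]: "g \<in> borel_measurable borel" for g \<omega>
  proof -
    show "0 \<le> (\<integral>y. f g \<omega> y \<partial>?N)" by (simp add: f_def)
    have "(\<integral>y. f g \<omega> y \<partial>?N) \<le> (\<integral>y. 1 \<partial>?N)"
    proof (cases "\<omega> \<in> space M")
      case True
      show ?thesis by (rule integral_mono[OF i_f[OF that True]]) (auto simp: f_def indicator_def)
    qed (simp add: f_def)
    thus "(\<integral>y. f g \<omega> y \<partial>?N) \<le> 1" using NN.prob_space by simp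
  qed
  have i_ind: "integrable ?N (indicator {y. \<sigma> * y \<le> t} :: real \<Rightarrow> real)" for \<sigma> t
  proof -
    have "{y. \<sigma> * y \<le> t} \<in> sets borel" by measurable
    thus ?thesis by (simp only: integrable_indicator_std_normal)
  qed
  have sq: "0 < sqrt (s \<omega>)" "sqrt (s \<omega>) \<le> 2 * e" if "\<omega> \<in> G" for \<omega>
  proof -
    have "\<omega> \<in> space M" using that sets.sets_into_space[of G M] by auto
    thus "0 < sqrt (s \<omega>)" using spos by simp
    show "sqrt (s \<omega>) \<le> 2 * e" using G(2)[OF that] e real_le_lsqrt[of "2 * e" "s \<omega>"] by simp
  qed
  have up: "F a - Phi a \<le> D + 4 * e + B + 2/9 * \<Delta>" for a
  proof -
    \<comment> \<open>The true scale sqrt (s \<omega>) is random. Replacing it by 2 e for y > 0 and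
      by 0 for y < 0 gives a shift common to all \<omega>, so Fubini turns the smoothed probability
      into an integral of F. The offset 6 e = 2 e * 3 keeps g y above a until y = 3.\<close>
    define g where "g y = a + 6 * e - 2 * e * max y 0" for y
    have g [measurable]: "g \<in> borel_measurable borel" unfolding g_def by measurable
    have "(\<integral>y. F (g y) \<partial>?N) - B = (\<integral>\<omega>. (\<integral>y. f g \<omega> y \<partial>?N) - indicator (space M - G) \<omega> \<partial>M)"
      using f_i1[OF g] f_fub[OF g] iB iG by (subst Bochner_Integration.integral_diff) auto
    also have "\<dots> \<le> (\<integral>\<omega>. Phi ((a + 6 * e - X' \<omega>) / sqrt (s \<omega>)) \<partial>M)"
    proof (rule integral_mono[OF _ iPhi])
      show "integrable M (\<lambda>\<omega>. (\<integral>y. f g \<omega> y \<partial>?N) - indicator (space M - G) \<omega>)" using f_i1[OF g] iG by auto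
      fix \<omega> assume w: "\<omega> \<in> space M"
      show "(\<integral>y. f g \<omega> y \<partial>?N) - indicator (space M - G) \<omega> \<le> Phi ((a + 6 * e - X' \<omega>) / sqrt (s \<omega>))"
      proof (cases "\<omega> \<in> G")
        case False
        thus ?thesis using f_01[OF g, of \<omega>] Phi_bounds w by (smt (verit) DiffI indicator_simps(1))
      next
        case True
        have "(\<integral>y. f g \<omega> y \<partial>?N) \<le> (\<integral>y. indicator {y. sqrt (s \<omega>) * y \<le> a + 6 * e - X' \<omega>} y \<partial>?N)"
        proof (rule integral_mono[OF i_f[OF g w] i_ind])
          fix y
          have "sqrt (s \<omega>) * y \<le> 2 * e * max y 0"
            using sq[OF True] e by (cases "y \<le> 0") (auto simp: max_def mult_nonneg_nonpos mult_right_mono)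
          thus "f g \<omega> y \<le> indicator {y. sqrt (s \<omega>) * y \<le> a + 6 * e - X' \<omega>} y"
            using G(1)[OF True] by (auto simp: f_def g_def indicator_def)
        qed
        also have "\<dots> = Phi ((a + 6 * e - X' \<omega>) / sqrt (s \<omega>))"
          using Phi_eq_integral_indicator sq[OF True] by simp
        finally show ?thesis using True by simp
      qed
    qed
    also have "\<dots> \<le> Phi (a + 6 * e) + D" using H[of "a + 6 * e"] by linarith
    also have "\<dots> \<le> Phi a + 3 * e + D" using Phi_lipschitz[of "a + 6 * e" a] e by (simp add: abs_if split: if_splits)
    finally have 1: "(\<integral>y. F (g y) \<partial>?N) - B \<le> Phi a + 3 * e + D" .
    have "F a - (2/9 * \<Delta> + e) \<le> F a - (\<integral>y. 2 * \<Delta> * indicator {3<..} y + e * \<bar>y\<bar> \<partial>?N)"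
      using tail_int[of "{3<..}"] std_normal_tail_3 by simp
    also have "\<dots> = (\<integral>y. F a - (2 * \<Delta> * indicator {3<..} y + e * \<bar>y\<bar>) \<partial>?N)"
      using absN NN.prob_space by (subst Bochner_Integration.integral_diff) auto
    also have "\<dots> \<le> (\<integral>y. F (g y) \<partial>?N)"
    proof (rule integral_mono[OF _ f_i2[OF g]])
      show "integrable ?N (\<lambda>y. F a - (2 * \<Delta> * indicator {3<..} y + e * \<bar>y\<bar>))" using absN by auto
      fix y
      \<comment> \<open>Up to y = 3 monotonicity of F is enough; \<open>F_shift\<close> is paid only
        beyond, on mass at most 1/9, which is how \<Delta> comes back with the factor 2/9.\<close>
      show "F a - (2 * \<Delta> * indicator {3<..} y + e * \<bar>y\<bar>) \<le> F (g y)"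
      proof (cases "y > 3")
        case False
        have "F a \<le> F (g y)" using False e by (intro F_mono) (auto simp: g_def max_def)
        moreover have "0 \<le> e * \<bar>y\<bar>" using e by simp
        ultimately show ?thesis using False by (simp add: indicator_def)
      next
        case True
        have "g y - a = - (2 * e * (y - 3))" using True by (simp add: g_def algebra_simps)
        hence "\<bar>g y - a\<bar> = 2 * e * (y - 3)" using True e by (simp add: abs_mult)
        hence "\<bar>g y - a\<bar> / 2 \<le> e * \<bar>y\<bar>" using True e by (simp add: algebra_simps)
        hence "F a - (2 * \<Delta> + e * \<bar>y\<bar>) \<le> F (g y)" using F_shift[of "g y" a] by linarith
        thus ?thesis using True by (simp add: indicator_def)
      qed
    qed
    finally show ?thesis using 1 by linarith
  qed
  have low: "Phi a - F a \<le> D + 4 * e + B + 2/9 * \<Delta>" for a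
  proof -
    \<comment> \<open>Mirror image: now the worst case of the unknown scale lies at negative
      y.\<close>
    define g where "g y = a - 6 * e + 2 * e * max (-y) 0" for y
    have g [measurable]: "g \<in> borel_measurable borel" unfolding g_def by measurable
    have "Phi a - 3 * e - D \<le> Phi (a - 6 * e) - D" using Phi_lipschitz[of "a - 6 * e" a] e by (simp add: abs_if split: if_splits)
    also have "\<dots> \<le> (\<integral>\<omega>. Phi ((a - 6 * e - X' \<omega>) / sqrt (s \<omega>)) \<partial>M)" using H[of "a - 6 * e"] by linarith
    also have "\<dots> \<le> (\<integral>\<omega>. (\<integral>y. f g \<omega> y \<partial>?N) + indicator (space M - G) \<omega> \<partial>M)"
    proof (rule integral_mono[OF iPhi])
      show "integrable M (\<lambda>\<omega>. (\<integral>y. f g \<omega> y \<partial>?N) + indicator (space M - G) \<omega>)" using f_i1[OF g] iG by auto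
      fix \<omega> assume w: "\<omega> \<in> space M"
      show "Phi ((a - 6 * e - X' \<omega>) / sqrt (s \<omega>)) \<le> (\<integral>y. f g \<omega> y \<partial>?N) + indicator (space M - G) \<omega>"
      proof (cases "\<omega> \<in> G")
        case False
        thus ?thesis using f_01[OF g, of \<omega>] Phi_bounds w by (smt (verit) DiffI indicator_simps(1))
      next
        case True
        have "Phi ((a - 6 * e - X' \<omega>) / sqrt (s \<omega>)) = (\<integral>y. indicator {y. sqrt (s \<omega>) * y \<le> a - 6 * e - X' \<omega>} y \<partial>?N)"
          using Phi_eq_integral_indicator sq[OF True] by simp
        also have "\<dots> \<le> (\<integral>y. f g \<omega> y \<partial>?N)"
        proof (rule integral_mono[OF i_ind i_f[OF g w]])
          fix y
          have "sqrt (s \<omega>) * (-y) \<le> 2 * e * max (-y) 0"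
            using sq[OF True] e by (cases "y \<ge> 0") (auto simp: max_def mult_nonneg_nonpos mult_right_mono intro: mult_right_mono_neg)
          thus "indicator {y. sqrt (s \<omega>) * y \<le> a - 6 * e - X' \<omega>} y \<le> f g \<omega> y"
            using G(1)[OF True] w by (auto simp: f_def g_def indicator_def)
        qed
        finally show ?thesis using True by simp
      qed
    qed
    also have "\<dots> = (\<integral>y. F (g y) \<partial>?N) + B"
      using f_i1[OF g] f_fub[OF g] iB iG by (subst Bochner_Integration.integral_add) auto
    finally have 1: "Phi a - 3 * e - D \<le> (\<integral>y. F (g y) \<partial>?N) + B" .
    have "(\<integral>y. F (g y) \<partial>?N) \<le> (\<integral>y. F a + (2 * \<Delta> * indicator {..<-3} y + e * \<bar>y\<bar>) \<partial>?N)"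
    proof (rule integral_mono[OF f_i2[OF g]])
      show "integrable ?N (\<lambda>y. F a + (2 * \<Delta> * indicator {..<-3} y + e * \<bar>y\<bar>))" using absN by auto
      fix y
      show "F (g y) \<le> F a + (2 * \<Delta> * indicator {..<-3} y + e * \<bar>y\<bar>)"
      proof (cases "y < -3")
        case False
        have "F (g y) \<le> F a" using False e by (intro F_mono) (auto simp: g_def max_def)
        moreover have "0 \<le> e * \<bar>y\<bar>" using e by simp
        ultimately show ?thesis using False by (simp add: indicator_def)
      next
        case True
        have "g y - a = 2 * e * (- y - 3)" using True by (simp add: g_def algebra_simps)
        hence "\<bar>g y - a\<bar> = 2 * e * (- y - 3)" using True e by (simp add: abs_mult)
        hence "\<bar>g y - a\<bar> / 2 \<le> e * \<bar>y\<bar>" using True e by (simp add: algebra_simps)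
        hence "F (g y) \<le> F a + (2 * \<Delta> + e * \<bar>y\<bar>)" using F_shift[of "g y" a] by linarith
        thus ?thesis using True by (simp add: indicator_def)
      qed
    qed
    also have "\<dots> = F a + (\<integral>y. 2 * \<Delta> * indicator {..<-3} y + e * \<bar>y\<bar> \<partial>?N)"
      using absN NN.prob_space by (subst Bochner_Integration.integral_add) auto
    also have "\<dots> \<le> F a + (2/9 * \<Delta> + e)"
      using tail_int[of "{..<-3}"] std_normal_tail_3 by simp
    finally show ?thesis using 1 by linarith
  qed
  \<comment> \<open>The supremum over a gives an inequality for \<Delta> itself; 7/9 of it remains
    on the left, and 9/7 \<le> 2.\<close>
  have "\<Delta> \<le> D + 4 * e + B + 2/9 * \<Delta>"
    unfolding \<Delta>_def[symmetric]
    by (subst \<Delta>_def, rule cSUP_least) (use up low in \<open>auto simp: abs_le_iff\<close>)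
  moreover have "0 \<le> D" using H[of 0] by linarith
  moreover have "0 \<le> B" by (simp add: B_def)
  ultimately have "\<Delta> \<le> 2 * (D + 4 * e + B)" using e by argo
  with \<Delta>[of a] show ?thesis by (simp add: F_def B_def)
qed

section \<open>Resampling one coordinate of an i.i.d. sequence\<close>

abbreviation iid_seq :: "'a measure \<Rightarrow> (nat \<Rightarrow> 'a) measure" where
  "iid_seq P \<equiv> PiM UNIV (\<lambda>_. P)"

lemma abs_mult_le_sum_squares: "\<bar>a * b\<bar> \<le> a\<^sup>2 + b\<^sup>2" for a b :: real
proof -
  have "2 * \<bar>a * b\<bar> \<le> a\<^sup>2 + b\<^sup>2"
    using sum_squares_bound[of "\<bar>a\<bar>" "\<bar>b\<bar>"] by (simp add: abs_mult mult.assoc)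
  thus ?thesis using abs_ge_zero[of "a * b"] by linarith
qed

context prob_space
begin

lemma prob_space_iid_seq: "prob_space (iid_seq M)"
  by (intro prob_space_PiM prob_space_axioms)

lemma measurable_iid_seq_upd [measurable (raw)]:
  assumes [measurable]: "f \<in> measurable N (iid_seq M)" "g \<in> measurable N M"
  shows "(\<lambda>x. (f x)(k := g x)) \<in> measurable N (iid_seq M)"
  by (rule measurable_fun_upd[where J = UNIV]) auto

lemma space_iid_seq_comp: "w \<in> space (iid_seq M) \<Longrightarrow> w k \<in> space M"
  by (auto simp: space_PiM PiE_iff)

lemma distr_iid_seq_upd:
  "distr (M \<Otimes>\<^sub>M iid_seq M) (iid_seq M) (\<lambda>(z, w). w(k := z)) = iid_seq M"
  using distr_pair_PiM_eq_PiM[of UNIV "\<lambda>_. M" k] prob_space_axioms by simp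

text \<open>Integrating out one fresh coordinate plays the part of conditional expectations.\<close>

lemma integral_resample:
  fixes f :: "(nat \<Rightarrow> 'a) \<Rightarrow> real"
  assumes int: "integrable (iid_seq M) f"
  shows "integrable (iid_seq M) (\<lambda>w. \<integral>z. f (w(k := z)) \<partial>M)"
    "(\<integral>w. f w \<partial>iid_seq M) = (\<integral>w. (\<integral>z. f (w(k := z)) \<partial>M) \<partial>iid_seq M)"
proof -
  interpret S: prob_space "iid_seq M" by (rule prob_space_iid_seq)
  interpret Q: pair_prob_space M "iid_seq M" ..
  have [measurable]: "f \<in> borel_measurable (iid_seq M)" using int by simp
  have i: "integrable (M \<Otimes>\<^sub>M iid_seq M) (\<lambda>(z, w). f (w(k := z)))"
  proof -
    have "integrable (distr (M \<Otimes>\<^sub>M iid_seq M) (iid_seq M) (\<lambda>(z, w). w(k := z))) f"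
      using int by (simp only: distr_iid_seq_upd)
    thus ?thesis by (subst (asm) integrable_distr_eq) (auto simp: split_def)
  qed
  show "integrable (iid_seq M) (\<lambda>w. \<integral>z. f (w(k := z)) \<partial>M)"
    using Q.integrable_snd[OF i] .
  have "(\<integral>w. f w \<partial>iid_seq M) = (\<integral>w. f w \<partial>distr (M \<Otimes>\<^sub>M iid_seq M) (iid_seq M) (\<lambda>(z, w). w(k := z)))"
    by (simp only: distr_iid_seq_upd)
  also have "\<dots> = (\<integral>(z, w). f (w(k := z)) \<partial>(M \<Otimes>\<^sub>M iid_seq M))"
    by (subst integral_distr) (auto simp: split_def)
  also have "\<dots> = (\<integral>w. (\<integral>z. f (w(k := z)) \<partial>M) \<partial>iid_seq M)"
    using Q.integral_snd[OF i] by simp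
  finally show "(\<integral>w. f w \<partial>iid_seq M) = (\<integral>w. (\<integral>z. f (w(k := z)) \<partial>M) \<partial>iid_seq M)" .
qed

lemma nn_integral_resample:
  assumes [measurable]: "f \<in> borel_measurable (iid_seq M)"
  shows "(\<integral>\<^sup>+w. f w \<partial>iid_seq M) = (\<integral>\<^sup>+w. (\<integral>\<^sup>+z. f (w(k := z)) \<partial>M) \<partial>iid_seq M)"
proof -
  interpret S: prob_space "iid_seq M" by (rule prob_space_iid_seq)
  interpret Q: pair_prob_space M "iid_seq M" ..
  have "(\<integral>\<^sup>+w. f w \<partial>iid_seq M) = (\<integral>\<^sup>+w. f w \<partial>distr (M \<Otimes>\<^sub>M iid_seq M) (iid_seq M) (\<lambda>(z, w). w(k := z)))"
    by (simp only: distr_iid_seq_upd)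
  also have "\<dots> = (\<integral>\<^sup>+(z, w). f (w(k := z)) \<partial>(M \<Otimes>\<^sub>M iid_seq M))"
    by (subst nn_integral_distr) (auto simp: split_def)
  also have "\<dots> = (\<integral>\<^sup>+w. (\<integral>\<^sup>+z. f (w(k := z)) \<partial>M) \<partial>iid_seq M)"
    by (subst Q.nn_integral_snd[symmetric]) (auto simp: split_def)
  finally show ?thesis .
qed

lemma distr_iid_seq_comp: "distr (iid_seq M) M (\<lambda>w. w k) = M"
  by (rule distr_PiM_component) (auto intro: prob_space_axioms)

lemma distr_iid_seq_comp2:
  assumes "k \<noteq> l"
  shows "distr (iid_seq M) (M \<Otimes>\<^sub>M M) (\<lambda>w. (w k, w l)) = M \<Otimes>\<^sub>M M"
proof (rule pair_measure_eqI[symmetric])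
  fix A B assume [measurable]: "A \<in> sets M" "B \<in> sets M"
  interpret prod: product_prob_space "\<lambda>_. M" "UNIV :: nat set" ..
  have "emeasure (distr (iid_seq M) (M \<Otimes>\<^sub>M M) (\<lambda>w. (w k, w l))) (A \<times> B)
      = emeasure (iid_seq M) {w \<in> space (iid_seq M). \<forall>i\<in>{k, l}. w i \<in> (if i = k then A else B)}"
    using assms by (subst emeasure_distr) (auto intro!: arg_cong2[where f = emeasure])
  also have "\<dots> = (\<Prod>i\<in>{k, l}. emeasure M (if i = k then A else B))"
    by (rule prod.emeasure_PiM_Collect) auto
  finally show "emeasure M A * emeasure M B = emeasure (distr (iid_seq M) (M \<Otimes>\<^sub>M M) (\<lambda>w. (w k, w l))) (A \<times> B)"
    using assms by simp
qed (auto intro: sigma_finite_measure_axioms)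

lemma integrable_iid_seq_comp_iff:
  fixes f :: "'a \<Rightarrow> real"
  assumes [measurable]: "f \<in> borel_measurable M"
  shows "integrable (iid_seq M) (\<lambda>w. f (w k)) \<longleftrightarrow> integrable M f"
  by (subst (2) distr_iid_seq_comp[of k, symmetric], subst integrable_distr_eq) auto

lemma integral_iid_seq_comp:
  fixes f :: "'a \<Rightarrow> real"
  assumes [measurable]: "f \<in> borel_measurable M"
  shows "(\<integral>w. f (w k) \<partial>iid_seq M) = (\<integral>x. f x \<partial>M)"
  by (subst (2) distr_iid_seq_comp[of k, symmetric], subst integral_distr) auto

lemma integrable_iid_seq_comp2_iff:
  fixes f :: "'a \<times> 'a \<Rightarrow> real"
  assumes [measurable]: "f \<in> borel_measurable (M \<Otimes>\<^sub>M M)" and "k \<noteq> l"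
  shows "integrable (iid_seq M) (\<lambda>w. f (w k, w l)) \<longleftrightarrow> integrable (M \<Otimes>\<^sub>M M) f"
proof -
  have "integrable (M \<Otimes>\<^sub>M M) f \<longleftrightarrow> integrable (distr (iid_seq M) (M \<Otimes>\<^sub>M M) (\<lambda>w. (w k, w l))) f"
    by (simp only: distr_iid_seq_comp2[OF assms(2)])
  thus ?thesis by (simp add: integrable_distr_eq)
qed

lemma integral_iid_seq_comp2:
  fixes f :: "'a \<times> 'a \<Rightarrow> real"
  assumes [measurable]: "f \<in> borel_measurable (M \<Otimes>\<^sub>M M)" and "k \<noteq> l"
  shows "(\<integral>w. f (w k, w l) \<partial>iid_seq M) = (\<integral>x. f x \<partial>(M \<Otimes>\<^sub>M M))"
proof -
  have "(\<integral>x. f x \<partial>(M \<Otimes>\<^sub>M M)) = (\<integral>x. f x \<partial>distr (iid_seq M) (M \<Otimes>\<^sub>M M) (\<lambda>w. (w k, w l)))"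
    by (simp only: distr_iid_seq_comp2[OF assms(2)])
  thus ?thesis by (simp add: integral_distr)
qed

text \<open>Coordinate k is integrated first: g does not see it and factors out, while f averages to
  zero. This is the orthogonality of martingale increments.\<close>

lemma integral_iid_seq_orthogonal:
  fixes f g :: "(nat \<Rightarrow> 'a) \<Rightarrow> real"
  assumes int: "integrable (iid_seq M) (\<lambda>w. f w * g w)"
    and g: "\<And>w z. g (w(k := z)) = g w"
    and f: "\<And>w. w \<in> space (iid_seq M) \<Longrightarrow> (\<integral>z. f (w(k := z)) \<partial>M) = 0"
  shows "(\<integral>w. f w * g w \<partial>iid_seq M) = 0"
proof -
  have "(\<integral>w. f w * g w \<partial>iid_seq M) = (\<integral>w. (\<integral>z. f (w(k := z)) \<partial>M) * g w \<partial>iid_seq M)"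
    by (subst integral_resample(2)[OF int, of k]) (simp add: g)
  also have "\<dots> = (\<integral>w. 0 \<partial>iid_seq M)"
    by (intro Bochner_Integration.integral_cong) (auto simp: f)
  finally show ?thesis by simp
qed

section \<open>Moment bounds for sums of martingale differences and of i.i.d. terms\<close>

lemma von_bahr_esseen:
  fixes \<xi> :: "nat \<Rightarrow> (nat \<Rightarrow> 'a) \<Rightarrow> real"
  assumes meas: "\<And>l. l \<in> {1..n} \<Longrightarrow> \<xi> l \<in> borel_measurable (iid_seq M)"
    and int: "\<And>l. l \<in> {1..n} \<Longrightarrow> integrable (iid_seq M) (\<lambda>w. \<bar>\<xi> l w\<bar> powr p)"
    and adapted: "\<And>k l w z. l < k \<Longrightarrow> \<xi> l (w(k := z)) = \<xi> l w"
    and mean: "\<And>l w. l \<in> {1..n} \<Longrightarrow> w \<in> space (iid_seq M) \<Longrightarrow> (\<integral>z. \<xi> l (w(l := z)) \<partial>M) = 0"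
    and p: "1 < p" "p \<le> 2"
  shows "integrable (iid_seq M) (\<lambda>w. \<bar>\<Sum>l=1..n. \<xi> l w\<bar> powr p) \<and>
    (\<integral>w. \<bar>\<Sum>l=1..n. \<xi> l w\<bar> powr p \<partial>iid_seq M) \<le> 4 * (\<Sum>l=1..n. \<integral>w. \<bar>\<xi> l w\<bar> powr p \<partial>iid_seq M)"
  using meas int mean
proof (induction n)
  case 0
  show ?case by simp
next
  case (Suc n)
  interpret S: prob_space "iid_seq M" by (rule prob_space_iid_seq)
  define A where "A w = (\<Sum>l=1..n. \<xi> l w)" for w
  have [measurable]: "\<xi> l \<in> borel_measurable (iid_seq M)" if "l \<in> {1..n}" for l using Suc.prems(1) that by simp
  have [measurable]: "\<xi> (Suc n) \<in> borel_measurable (iid_seq M)" using Suc.prems(1) by simp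
  have A_meas [measurable]: "A \<in> borel_measurable (iid_seq M)" unfolding A_def by measurable
  have IH: "integrable (iid_seq M) (\<lambda>w. \<bar>A w\<bar> powr p)"
    "(\<integral>w. \<bar>A w\<bar> powr p \<partial>iid_seq M) \<le> 4 * (\<Sum>l=1..n. \<integral>w. \<bar>\<xi> l w\<bar> powr p \<partial>iid_seq M)"
    using Suc.IH Suc.prems by (auto simp: A_def)
  have intS: "integrable (iid_seq M) (\<lambda>w. \<bar>\<xi> (Suc n) w\<bar> powr p)" using Suc.prems(2) by simp
  have A_adapted: "A (w(Suc n := z)) = A w" for w z
    unfolding A_def by (intro sum.cong) (auto intro: adapted)
  have eqS: "(\<Sum>l=1..Suc n. \<xi> l w) = A w + \<xi> (Suc n) w" for w by (simp add: A_def)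
  \<comment> \<open>Needed for integrability of the linear term: the larger of the two absolute
    values dominates the product.\<close>
  have prod_bd: "\<bar>\<xi> (Suc n) w * spow (p - 1) (A w)\<bar> \<le> \<bar>\<xi> (Suc n) w\<bar> powr p + \<bar>A w\<bar> powr p" for w
  proof (cases "\<bar>\<xi> (Suc n) w\<bar> \<le> \<bar>A w\<bar>")
    case True
    have "\<bar>\<xi> (Suc n) w * spow (p - 1) (A w)\<bar> = \<bar>\<xi> (Suc n) w\<bar> * \<bar>A w\<bar> powr (p - 1)" by (simp add: abs_mult abs_spow)
    also have "\<dots> \<le> \<bar>A w\<bar> * \<bar>A w\<bar> powr (p - 1)" using True by (intro mult_right_mono) auto
    also have "\<dots> = \<bar>A w\<bar> powr p" using powr_mult_base[of "\<bar>A w\<bar>" "p - 1"] by simp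
    finally show ?thesis by (simp add: add_increasing)
  next
    case False
    have "\<bar>\<xi> (Suc n) w * spow (p - 1) (A w)\<bar> = \<bar>\<xi> (Suc n) w\<bar> * \<bar>A w\<bar> powr (p - 1)" by (simp add: abs_mult abs_spow)
    also have "\<dots> \<le> \<bar>\<xi> (Suc n) w\<bar> * \<bar>\<xi> (Suc n) w\<bar> powr (p - 1)" using False p by (intro mult_left_mono powr_mono2) auto
    also have "\<dots> = \<bar>\<xi> (Suc n) w\<bar> powr p" using powr_mult_base[of "\<bar>\<xi> (Suc n) w\<bar>" "p - 1"] by simp
    finally show ?thesis by (simp add: add_increasing2)
  qed
  have i_prod: "integrable (iid_seq M) (\<lambda>w. \<xi> (Suc n) w * spow (p - 1) (A w))"
  proof (rule Bochner_Integration.integrable_bound)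
    show "integrable (iid_seq M) (\<lambda>w. \<bar>\<xi> (Suc n) w\<bar> powr p + \<bar>A w\<bar> powr p)" using intS IH by simp
  qed (use prod_bd in auto)
  \<comment> \<open>A does not depend on coordinate Suc n, so the linear term of
    \<open>abs_powr_add_le_low\<close> vanishes and every increment adds only 4 times its own p-th
    moment.\<close>
  have zero: "(\<integral>w. \<xi> (Suc n) w * spow (p - 1) (A w) \<partial>iid_seq M) = 0"
    by (rule integral_iid_seq_orthogonal[OF i_prod, of "Suc n"]) (auto simp: A_adapted Suc.prems(3))
  let ?R = "\<lambda>w. \<bar>A w\<bar> powr p + p * (\<xi> (Suc n) w * spow (p - 1) (A w)) + 4 * \<bar>\<xi> (Suc n) w\<bar> powr p"
  have iR: "integrable (iid_seq M) ?R" using IH i_prod intS by auto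
  have bd: "\<bar>A w + \<xi> (Suc n) w\<bar> powr p \<le> ?R w" for w
    using abs_powr_add_le_low[OF p, of "A w" "\<xi> (Suc n) w"] by (simp add: mult.commute)
  have iL: "integrable (iid_seq M) (\<lambda>w. \<bar>A w + \<xi> (Suc n) w\<bar> powr p)"
  proof (rule Bochner_Integration.integrable_bound[OF iR])
    show "AE w in iid_seq M. norm (\<bar>A w + \<xi> (Suc n) w\<bar> powr p) \<le> norm (?R w)"
      by (rule AE_I2, unfold real_norm_def abs_of_nonneg[OF powr_ge_zero], rule order.trans[OF bd abs_ge_self])
  qed simp
  have "(\<integral>w. \<bar>A w + \<xi> (Suc n) w\<bar> powr p \<partial>iid_seq M) \<le> (\<integral>w. ?R w \<partial>iid_seq M)"
    using iL iR bd by (intro integral_mono) auto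
  also have "\<dots> = (\<integral>w. \<bar>A w\<bar> powr p \<partial>iid_seq M) + 4 * (\<integral>w. \<bar>\<xi> (Suc n) w\<bar> powr p \<partial>iid_seq M)"
    using IH i_prod intS zero by simp
  finally show ?case
    using IH(2) iL by (simp only: eqS) (simp add: algebra_simps)
qed

lemma iid_sum_second_moment:
  fixes \<phi> :: "'a \<Rightarrow> real"
  assumes [measurable]: "\<phi> \<in> borel_measurable M" and int2: "integrable M (\<lambda>x. (\<phi> x)\<^sup>2)"
    and mean: "(\<integral>x. \<phi> x \<partial>M) = 0"
  shows "integrable (iid_seq M) (\<lambda>w. (\<Sum>k=1..n. \<phi> (w k))\<^sup>2) \<and>
    (\<integral>w. (\<Sum>k=1..n. \<phi> (w k))\<^sup>2 \<partial>iid_seq M) = real n * (\<integral>x. (\<phi> x)\<^sup>2 \<partial>M)"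
proof (induction n)
  case (Suc n)
  interpret S: prob_space "iid_seq M" by (rule prob_space_iid_seq)
  define A where "A w = (\<Sum>l=1..n. \<phi> (w l))" for w
  have A_meas [measurable]: "A \<in> borel_measurable (iid_seq M)" unfolding A_def by measurable
  have IH: "integrable (iid_seq M) (\<lambda>w. (A w)\<^sup>2)" "(\<integral>w. (A w)\<^sup>2 \<partial>iid_seq M) = real n * (\<integral>x. (\<phi> x)\<^sup>2 \<partial>M)"
    using Suc.IH by (auto simp: A_def)
  have i2: "integrable (iid_seq M) (\<lambda>w. (\<phi> (w (Suc n)))\<^sup>2)"
    using integrable_iid_seq_comp_iff[of "\<lambda>x. (\<phi> x)\<^sup>2"] int2 by simp
  have e2: "(\<integral>w. (\<phi> (w (Suc n)))\<^sup>2 \<partial>iid_seq M) = (\<integral>x. (\<phi> x)\<^sup>2 \<partial>M)"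
    using integral_iid_seq_comp[of "\<lambda>x. (\<phi> x)\<^sup>2"] by simp
  have ip: "integrable (iid_seq M) (\<lambda>w. \<phi> (w (Suc n)) * A w)"
  proof (rule Bochner_Integration.integrable_bound)
    show "integrable (iid_seq M) (\<lambda>w. (\<phi> (w (Suc n)))\<^sup>2 + (A w)\<^sup>2)" using i2 IH by simp
    show "AE w in iid_seq M. norm (\<phi> (w (Suc n)) * A w) \<le> norm ((\<phi> (w (Suc n)))\<^sup>2 + (A w)\<^sup>2)"
      using abs_mult_le_sum_squares by (intro AE_I2) simp
  qed simp
  have zero: "(\<integral>w. \<phi> (w (Suc n)) * A w \<partial>iid_seq M) = 0"
    by (rule integral_iid_seq_orthogonal[OF ip, of "Suc n"]) (auto simp: A_def mean)
  have eq: "(\<Sum>k=1..Suc n. \<phi> (w k))\<^sup>2 = (A w)\<^sup>2 + 2 * (\<phi> (w (Suc n)) * A w) + (\<phi> (w (Suc n)))\<^sup>2" for w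
    by (simp add: A_def power2_sum algebra_simps)
  show ?case unfolding eq using IH i2 e2 ip zero by (auto simp: distrib_right)
qed simp

text \<open>A Rosenthal-type bound by adding one summand X to the partial sum A at a time. The
  linear term vanishes, and the quadratic one, |A|^(q-2) X^2, is of order n^(q/2 - 1); 12 is 6 times
  the two remainder terms.\<close>

lemma iid_sum_high_moment:
  fixes \<phi> :: "'a \<Rightarrow> real"
  assumes \<phi> [measurable]: "\<phi> \<in> borel_measurable M" and int: "integrable M (\<lambda>x. \<bar>\<phi> x\<bar> powr q)"
    and mean: "(\<integral>x. \<phi> x \<partial>M) = 0" and q: "2 < q" "q \<le> 3"
  shows "integrable (iid_seq M) (\<lambda>w. \<bar>\<Sum>k=1..n. \<phi> (w k)\<bar> powr q)"
    "(\<integral>w. \<bar>\<Sum>k=1..n. \<phi> (w k)\<bar> powr q \<partial>iid_seq M) \<le> 12 * real n powr (q / 2) * (\<integral>x. \<bar>\<phi> x\<bar> powr q \<partial>M)"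
proof -
  interpret S: prob_space "iid_seq M" by (rule prob_space_iid_seq)
  define m2 where "m2 = (\<integral>x. (\<phi> x)\<^sup>2 \<partial>M)"
  define mq where "mq = (\<integral>x. \<bar>\<phi> x\<bar> powr q \<partial>M)"
  have m2: "integrable M (\<lambda>x. (\<phi> x)\<^sup>2)" "m2 powr (q / 2) \<le> mq"
    using integrable_square_of_powr[OF \<phi> int] q by (auto simp: m2_def mq_def)
  have m20: "0 \<le> m2" by (simp add: m2_def)
  have mq0: "0 \<le> mq" by (simp add: mq_def)
  \<comment> \<open>The induction runs over m \<le> n with n fixed in the increment, so that every
    step adds the same amount; n increments of order n^(q/2 - 1) make n^(q/2).\<close>
  have "integrable (iid_seq M) (\<lambda>w. \<bar>\<Sum>k=1..m. \<phi> (w k)\<bar> powr q) \<and>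
    (\<integral>w. \<bar>\<Sum>k=1..m. \<phi> (w k)\<bar> powr q \<partial>iid_seq M) \<le> real m * (12 * real n powr (q / 2 - 1) * mq)" if "m \<le> n" for m
    using that
  proof (induction m)
    case (Suc m)
    define A where "A w = (\<Sum>l=1..m. \<phi> (w l))" for w
    have A_meas [measurable]: "A \<in> borel_measurable (iid_seq M)" unfolding A_def by measurable
    have IH: "integrable (iid_seq M) (\<lambda>w. \<bar>A w\<bar> powr q)"
      "(\<integral>w. \<bar>A w\<bar> powr q \<partial>iid_seq M) \<le> real m * (12 * real n powr (q / 2 - 1) * mq)"
      using Suc by (auto simp: A_def)
    define X where "X w = \<phi> (w (Suc m))" for w :: "nat \<Rightarrow> 'a"
    have [measurable]: "X \<in> borel_measurable (iid_seq M)" unfolding X_def by measurable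
    have iX: "integrable (iid_seq M) (\<lambda>w. \<bar>X w\<bar> powr q)" "integrable (iid_seq M) (\<lambda>w. (X w)\<^sup>2)"
      using integrable_iid_seq_comp_iff[of "\<lambda>x. \<bar>\<phi> x\<bar> powr q"] integrable_iid_seq_comp_iff[of "\<lambda>x. (\<phi> x)\<^sup>2"] int m2
      by (auto simp: X_def)
    have eX: "(\<integral>w. \<bar>X w\<bar> powr q \<partial>iid_seq M) = mq"
      using integral_iid_seq_comp[of "\<lambda>x. \<bar>\<phi> x\<bar> powr q"] by (simp add: X_def mq_def)
    have young: "\<bar>a\<bar> * \<bar>b\<bar> powr (q - 1) \<le> \<bar>a\<bar> powr q + \<bar>b\<bar> powr q" and
      young2: "\<bar>b\<bar> powr (q - 2) * a\<^sup>2 \<le> \<bar>a\<bar> powr q + \<bar>b\<bar> powr q" for a b :: real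
    proof -
      define c where "c = max \<bar>a\<bar> \<bar>b\<bar>"
      have c: "0 \<le> c" "\<bar>a\<bar> \<le> c" "\<bar>b\<bar> \<le> c" by (auto simp: c_def)
      have cq: "c powr q \<le> \<bar>a\<bar> powr q + \<bar>b\<bar> powr q" by (auto simp: c_def max_def)
      have "\<bar>a\<bar> * \<bar>b\<bar> powr (q - 1) \<le> c * c powr (q - 1)"
        using c q by (intro mult_mono powr_mono2) auto
      also have "\<dots> = c powr q" using powr_mult_base[of c "q - 1"] c by simp
      finally show "\<bar>a\<bar> * \<bar>b\<bar> powr (q - 1) \<le> \<bar>a\<bar> powr q + \<bar>b\<bar> powr q" using cq by simp
      have "a\<^sup>2 \<le> c\<^sup>2" using c by (simp add: abs_le_square_iff[symmetric])
      hence "\<bar>b\<bar> powr (q - 2) * a\<^sup>2 \<le> c powr (q - 2) * c\<^sup>2"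
        using c q by (intro mult_mono powr_mono2) auto
      also have "\<dots> = c powr q"
        using powr_mult_base[of c "q - 2"] powr_mult_base[of c "q - 1"] c by (simp add: power2_eq_square algebra_simps)
      finally show "\<bar>b\<bar> powr (q - 2) * a\<^sup>2 \<le> \<bar>a\<bar> powr q + \<bar>b\<bar> powr q" using cq by simp
    qed
    have ip: "integrable (iid_seq M) (\<lambda>w. X w * spow (q - 1) (A w))"
    proof (rule Bochner_Integration.integrable_bound)
      show "integrable (iid_seq M) (\<lambda>w. \<bar>X w\<bar> powr q + \<bar>A w\<bar> powr q)" using iX IH by simp
    qed (use young in \<open>auto simp: abs_mult abs_spow\<close>)
    have ip2: "integrable (iid_seq M) (\<lambda>w. \<bar>A w\<bar> powr (q - 2) * (X w)\<^sup>2)"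
    proof (rule Bochner_Integration.integrable_bound)
      show "integrable (iid_seq M) (\<lambda>w. \<bar>X w\<bar> powr q + \<bar>A w\<bar> powr q)" using iX IH by simp
    qed (use young2 in \<open>auto simp: abs_mult\<close>)
    have zero: "(\<integral>w. X w * spow (q - 1) (A w) \<partial>iid_seq M) = 0"
      by (rule integral_iid_seq_orthogonal[OF ip, of "Suc m"]) (auto simp: A_def X_def mean)
    have A2: "integrable (iid_seq M) (\<lambda>w. (A w)\<^sup>2)" "(\<integral>w. (A w)\<^sup>2 \<partial>iid_seq M) = real m * m2"
      using iid_sum_second_moment[OF \<phi> m2(1) mean, of m] by (auto simp: A_def m2_def)
    have pw2: "\<bar>A w\<bar> powr (q - 2) = ((A w)\<^sup>2) powr ((q - 2) / 2)" for w
    proof -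
      have "((A w)\<^sup>2) powr ((q - 2) / 2) = (\<bar>A w\<bar> powr 2) powr ((q - 2) / 2)" by simp
      also have "\<dots> = \<bar>A w\<bar> powr (2 * ((q - 2) / 2))" by (rule powr_powr)
      also have "2 * ((q - 2) / 2) = q - 2" by simp
      finally show ?thesis ..
    qed
    have Ap: "(\<integral>w. \<bar>A w\<bar> powr (q - 2) \<partial>iid_seq M) \<le> (real m * m2) powr ((q - 2) / 2)"
      unfolding pw2 using S.integral_powr_le_powr_integral(2)[OF A2(1), of "(q - 2) / 2"] q A2(2) by auto
    \<comment> \<open>X involves the fresh coordinate alone, so the expectation factorizes; Jensen
      then bounds the moment of order q - 2 of A through its second moment m m2.\<close>
    have "(\<integral>w. \<bar>A w\<bar> powr (q - 2) * (X w)\<^sup>2 \<partial>iid_seq M)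
        = (\<integral>w. (\<integral>z. \<bar>A (w(Suc m := z))\<bar> powr (q - 2) * (X (w(Suc m := z)))\<^sup>2 \<partial>M) \<partial>iid_seq M)"
      by (rule integral_resample(2)[OF ip2])
    also have "\<dots> = (\<integral>w. \<bar>A w\<bar> powr (q - 2) \<partial>iid_seq M) * m2"
      by (simp add: A_def X_def m2_def)
    also have "\<dots> \<le> (real m * m2) powr ((q - 2) / 2) * m2"
      using Ap m20 by (intro mult_right_mono) auto
    also have "\<dots> = real m powr (q / 2 - 1) * (m2 * m2 powr (q / 2 - 1))"
      using m20 by (simp add: powr_mult diff_divide_distrib)
    also have "m2 * m2 powr (q / 2 - 1) = m2 powr (q / 2)"
      using powr_mult_base[of m2 "q / 2 - 1"] m20 by simp
    also have "real m powr (q / 2 - 1) * m2 powr (q / 2) \<le> real n powr (q / 2 - 1) * mq"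
      using Suc.prems q m2 by (intro mult_mono powr_mono2) auto
    finally have E2: "(\<integral>w. \<bar>A w\<bar> powr (q - 2) * (X w)\<^sup>2 \<partial>iid_seq M) \<le> real n powr (q / 2 - 1) * mq" .
    have n1: "1 \<le> real n powr (q / 2 - 1)" using Suc.prems q by (intro ge_one_powr_ge_zero) auto
    let ?R = "\<lambda>w. \<bar>A w\<bar> powr q + q * (X w * spow (q - 1) (A w)) + 6 * (\<bar>A w\<bar> powr (q - 2) * (X w)\<^sup>2 + \<bar>X w\<bar> powr q)"
    have iR: "integrable (iid_seq M) ?R" using IH ip ip2 iX by auto
    have bd: "\<bar>A w + X w\<bar> powr q \<le> ?R w" for w
      using abs_powr_add_le_high[OF q, of "A w" "X w"] by (simp add: mult.commute)
    have iL: "integrable (iid_seq M) (\<lambda>w. \<bar>A w + X w\<bar> powr q)"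
    proof (rule Bochner_Integration.integrable_bound[OF iR])
    show "AE w in iid_seq M. norm (\<bar>A w + X w\<bar> powr q) \<le> norm (?R w)"
      by (rule AE_I2, unfold real_norm_def abs_of_nonneg[OF powr_ge_zero], rule order.trans[OF bd abs_ge_self])
  qed simp
    have "(\<integral>w. \<bar>A w + X w\<bar> powr q \<partial>iid_seq M) \<le> (\<integral>w. ?R w \<partial>iid_seq M)"
      using iL iR bd by (intro integral_mono) auto
    also have "\<dots> = (\<integral>w. \<bar>A w\<bar> powr q \<partial>iid_seq M) + 6 * ((\<integral>w. \<bar>A w\<bar> powr (q - 2) * (X w)\<^sup>2 \<partial>iid_seq M) + mq)"
      using IH ip ip2 iX zero eX by simp
    also have "\<dots> \<le> real m * (12 * real n powr (q / 2 - 1) * mq) + 6 * (real n powr (q / 2 - 1) * mq + real n powr (q / 2 - 1) * mq)"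
      using IH(2) E2 mult_right_mono[OF n1 mq0] by (intro add_mono mult_left_mono) auto
    also have "\<dots> = real (Suc m) * (12 * real n powr (q / 2 - 1) * mq)" by (simp add: algebra_simps)
    finally show ?case using iL by (simp add: A_def X_def)
  qed simp
  note main = this[OF order.refl]
  have "real n * (12 * real n powr (q / 2 - 1) * mq) = 12 * (real n * real n powr (q / 2 - 1)) * mq" by simp
  also have "real n * real n powr (q / 2 - 1) = real n powr (q / 2)"
    using powr_mult_base[of "real n" "q / 2 - 1"] by simp
  finally have eq: "real n * (12 * real n powr (q / 2 - 1) * mq) = 12 * real n powr (q / 2) * mq" .
  show "integrable (iid_seq M) (\<lambda>w. \<bar>\<Sum>k=1..n. \<phi> (w k)\<bar> powr q)"
    by (rule conjunct1[OF main])
  show "(\<integral>w. \<bar>\<Sum>k=1..n. \<phi> (w k)\<bar> powr q \<partial>iid_seq M) \<le> 12 * real n powr (q / 2) * (\<integral>x. \<bar>\<phi> x\<bar> powr q \<partial>M)"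
    unfolding mq_def[symmetric] by (rule ord_le_eq_trans[OF conjunct2[OF main] eq])
qed

end

section \<open>A Berry--Esseen bound for martingales\<close>

lemma (in prob_space) markov_powr:
  fixes X :: "'a \<Rightarrow> real"
  assumes [measurable]: "X \<in> borel_measurable M" and int: "integrable M (\<lambda>x. \<bar>X x\<bar> powr r)" and "0 < t" "0 < r"
  shows "prob {x \<in> space M. t \<le> \<bar>X x\<bar>} \<le> (\<integral>x. \<bar>X x\<bar> powr r \<partial>M) / t powr r"
proof -
  have "prob {x \<in> space M. t \<le> \<bar>X x\<bar>} \<le> prob {x \<in> space M. t powr r \<le> \<bar>X x\<bar> powr r}"
    using assms by (intro finite_measure_mono) (auto intro: powr_mono2)
  also have "\<dots> \<le> (\<integral>x. \<bar>X x\<bar> powr r \<partial>M) / t powr r"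
    using assms by (intro integral_Markov_inequality_measure[OF int, of "{}"]) auto
  finally show ?thesis .
qed

lemma (in prob_space) martingale_Berry_Esseen:
  fixes \<xi> :: "nat \<Rightarrow> (nat \<Rightarrow> 'a) \<Rightarrow> real" and v :: "nat \<Rightarrow> (nat \<Rightarrow> 'a) \<Rightarrow> real"
  assumes meas: "\<And>l. \<xi> l \<in> borel_measurable (iid_seq M)"
    and adapted: "\<And>k l w z. l < k \<Longrightarrow> \<xi> l (w(k := z)) = \<xi> l w"
    and int: "\<And>l. integrable (iid_seq M) (\<lambda>w. \<bar>\<xi> l w\<bar> powr p)"
    and cint: "\<And>l w. w \<in> space (iid_seq M) \<Longrightarrow> integrable M (\<lambda>z. \<bar>\<xi> l (w(l := z))\<bar> powr p)"
    and mean: "\<And>l w. w \<in> space (iid_seq M) \<Longrightarrow> (\<integral>z. \<xi> l (w(l := z)) \<partial>M) = 0"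
    and v: "\<And>l w. v l w = (\<integral>z. (\<xi> l (w(l := z)))\<^sup>2 \<partial>M)"
    and p: "2 \<le> p" "p \<le> 3" and e: "0 < e" "e \<le> 1/2"
  shows "\<bar>measure (iid_seq M) {w \<in> space (iid_seq M). (\<Sum>l=1..n. \<xi> l w) \<le> a} - Phi a\<bar>
    \<le> 2 * (4 * e powr (-p) * (\<Sum>l=1..n. \<integral>w. \<bar>\<xi> l w\<bar> powr p \<partial>iid_seq M) + 8 * e
         + measure (iid_seq M) {w \<in> space (iid_seq M). e\<^sup>2 < \<bar>(\<Sum>l=1..n. v l w) - 1\<bar>})"
proof -
  let ?S = "iid_seq M"
  interpret S: prob_space ?S by (rule prob_space_iid_seq)
  note [measurable] = meas
  have v_meas [measurable]: "v l \<in> borel_measurable ?S" for l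
    unfolding v by measurable
  have v0: "0 \<le> v l w" for l w by (simp add: v)
  \<comment> \<open>The case l = k is included because \<open>v l\<close> integrates coordinate l
    out: the conditional variance is known one step before the increment.\<close>
  have v_adapted: "v l (w(k := z)) = v l w" if "l \<le> k" for l k w z
  proof (cases "l = k")
    case False
    hence "l < k" using that by simp
    hence "\<xi> l (w(k := z, l := z')) = \<xi> l (w(l := z'))" for z'
      using adapted[of l k "w(l := z')" z] by (simp add: fun_upd_twist)
    thus ?thesis by (simp add: v)
  qed (simp add: v)
  define V where "V k w = (\<Sum>l=1..k. v l w)" for k w
  \<comment> \<open>Freezing looks at the variance including that of the coming increment. This
    value is predictable, so frozen increments keep conditional mean zero, and the accumulated
    frozen variance never passes 1 + e^2.\<close>
  define J where "J k w = (if V k w \<le> 1 + e\<^sup>2 then 1 else 0 :: real)" for k w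
  define X' where "X' k w = (\<Sum>l=1..k. J l w * \<xi> l w)" for k w
  define V' where "V' k w = (\<Sum>l=1..k. J l w * v l w)" for k w
  have V_meas [measurable]: "V k \<in> borel_measurable ?S" for k unfolding V_def by measurable
  have J_meas [measurable]: "J k \<in> borel_measurable ?S" for k unfolding J_def by measurable
  have X'_meas [measurable]: "X' k \<in> borel_measurable ?S" for k unfolding X'_def by measurable
  have V'_meas [measurable]: "V' k \<in> borel_measurable ?S" for k unfolding V'_def by measurable
  have V_adapted: "V l (w(k := z)) = V l w" if "l \<le> k" for l k w z
    unfolding V_def using that by (intro sum.cong) (auto intro: v_adapted)
  have J_adapted: "J l (w(k := z)) = J l w" if "l \<le> k" for l k w z
    unfolding J_def using V_adapted[OF that] by simp
  have V'_adapted: "V' l (w(k := z)) = V' l w" if "l \<le> k" for l k w z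
    unfolding V'_def using that by (intro sum.cong) (auto simp: v_adapted J_adapted)
  have X'_adapted: "X' l (w(k := z)) = X' l w" if "l < k" for l k w z
    unfolding X'_def using that by (intro sum.cong) (auto simp: adapted J_adapted)
  have V_mono: "V l w \<le> V k w" if "l \<le> k" for l k w
    unfolding V_def using that v0 by (intro sum_mono2) auto
  have full: "J l w = 1" if "V k w \<le> 1 + e\<^sup>2" "l \<le> k" for k l w
    using that V_mono[of l k w] by (simp add: J_def)
  have V'_le: "V' k w \<le> 1 + e\<^sup>2" for k w
  proof (induction k)
    case 0
    show ?case by (simp add: V'_def)
  next
    case (Suc k)
    show ?case
    proof (cases "V (Suc k) w \<le> 1 + e\<^sup>2")
      case True
      have "V' (Suc k) w = V (Suc k) w"
        unfolding V'_def V_def by (rule sum.cong) (use full[OF True] in auto)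
      with True show ?thesis by simp
    next
      case False
      hence "V' (Suc k) w = V' k w" by (simp add: V'_def J_def)
      with Suc show ?thesis by simp
    qed
  qed
  \<comment> \<open>Total variance of martingale and reserve: one e^2 above the bound for V', so
    that at least e^2 is left for smoothing at every step.\<close>
  define T where "T = 1 + 2 * e\<^sup>2"
  have Ts: "e\<^sup>2 \<le> T - V' k w" for k w using V'_le[of k w] by (simp add: T_def)
  have e2: "0 < e\<^sup>2" using e by simp
  define u where "u a k w = Phi ((a - X' k w) / sqrt (T - V' k w))" for a k w
  have u_meas [measurable]: "u a k \<in> borel_measurable ?S" for a k unfolding u_def by measurable
  have u_int: "integrable ?S (u a k)" for a k
    by (rule S.integrable_const_bound[where B = 1]) (auto simp: Phi_bounds u_def)
  define L where "L l = (\<integral>w. \<bar>\<xi> l w\<bar> powr p \<partial>?S)" for l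
  have step: "\<bar>(\<integral>w. u a (Suc k) w \<partial>?S) - (\<integral>w. u a k w \<partial>?S)\<bar> \<le> 4 * e powr (-p) * L (Suc k)" for a k
  proof -
    let ?l = "Suc k"
    have pt: "\<bar>(\<integral>z. u a ?l (w(?l := z)) \<partial>M) - u a k w\<bar> \<le> 4 * e powr (-p) * (\<integral>z. \<bar>\<xi> ?l (w(?l := z))\<bar> powr p \<partial>M)"
      if w: "w \<in> space ?S" for w
    proof -
      define \<eta> where "\<eta> z = J ?l w * \<xi> ?l (w(?l := z))" for z
      have [measurable]: "(\<lambda>z. \<xi> ?l (w(?l := z))) \<in> borel_measurable M"
        by (rule measurable_compose[OF _ meas]) (use w in measurable)
      have \<eta>_meas: "\<eta> \<in> borel_measurable M" unfolding \<eta>_def by measurable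
      have J01: "J ?l w = 0 \<or> J ?l w = 1" by (simp add: J_def)
      have \<eta>p: "\<bar>\<eta> z\<bar> powr p = J ?l w * \<bar>\<xi> ?l (w(?l := z))\<bar> powr p" for z
        using J01 by (auto simp: \<eta>_def)
      have \<eta>_int: "integrable M (\<lambda>z. \<bar>\<eta> z\<bar> powr p)" unfolding \<eta>p using cint[OF w, of ?l] by simp
      have \<eta>_mean: "(\<integral>z. \<eta> z \<partial>M) = 0" unfolding \<eta>_def using mean[OF w, of ?l] by simp
      have \<eta>2: "(\<integral>z. (\<eta> z)\<^sup>2 \<partial>M) = J ?l w * v ?l w"
        unfolding \<eta>_def v using J01 by (auto simp: power_mult_distrib)
      have 1: "u a ?l (w(?l := z)) = Phi ((a - X' k w - \<eta> z) / sqrt (T - V' ?l w))" for z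
      proof -
        have "X' ?l (w(?l := z)) = X' k w + \<eta> z"
          using X'_adapted[of k ?l w z] J_adapted[of ?l ?l w z] by (simp add: X'_def \<eta>_def)
        thus ?thesis using V'_adapted[of ?l ?l w z] by (simp add: u_def diff_diff_eq)
      qed
      \<comment> \<open>The reserve before the step is the reserve after it plus the conditional
        variance of the step, which is the form required by the exchange.\<close>
      have 2: "u a k w = Phi ((a - X' k w) / sqrt (T - V' ?l w + (\<integral>z. (\<eta> z)\<^sup>2 \<partial>M)))"
        unfolding u_def \<eta>2 by (simp add: V'_def)
      have "\<bar>(\<integral>z. u a ?l (w(?l := z)) \<partial>M) - u a k w\<bar> \<le> 4 * e powr (-p) * (\<integral>z. \<bar>\<eta> z\<bar> powr p \<partial>M)"
        unfolding 1 2 by (rule Phi_exchange[OF \<eta>_meas \<eta>_int p \<eta>_mean e(1) Ts])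
      also have "\<dots> \<le> 4 * e powr (-p) * (\<integral>z. \<bar>\<xi> ?l (w(?l := z))\<bar> powr p \<partial>M)"
        unfolding \<eta>p using J01 by (intro mult_left_mono) auto
      finally show ?thesis .
    qed
    have i1: "integrable ?S (\<lambda>w. \<integral>z. u a ?l (w(?l := z)) \<partial>M)" by (rule integral_resample(1)[OF u_int])
    have i2: "integrable ?S (\<lambda>w. \<integral>z. \<bar>\<xi> ?l (w(?l := z))\<bar> powr p \<partial>M)" by (rule integral_resample(1)[OF int])
    have "(\<integral>w. u a ?l w \<partial>?S) - (\<integral>w. u a k w \<partial>?S) = (\<integral>w. (\<integral>z. u a ?l (w(?l := z)) \<partial>M) - u a k w \<partial>?S)"
      using i1 u_int[of a k] integral_resample(2)[OF u_int[of a ?l], of ?l] by simp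
    also have "\<bar>\<dots>\<bar> \<le> (\<integral>w. \<bar>(\<integral>z. u a ?l (w(?l := z)) \<partial>M) - u a k w\<bar> \<partial>?S)"
      by (rule integral_abs_bound)
    also have "\<dots> \<le> (\<integral>w. 4 * e powr (-p) * (\<integral>z. \<bar>\<xi> ?l (w(?l := z))\<bar> powr p \<partial>M) \<partial>?S)"
      using i1 i2 u_int[of a k] pt by (intro integral_mono) auto
    also have "\<dots> = 4 * e powr (-p) * L ?l"
      using integral_resample(2)[OF int[of ?l], of ?l] by (simp add: L_def)
    finally show ?thesis .
  qed
  have tele: "\<bar>(\<integral>w. u a k w \<partial>?S) - (\<integral>w. u a 0 w \<partial>?S)\<bar> \<le> 4 * e powr (-p) * (\<Sum>l=1..k. L l)" for a k
  proof (induction k)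
    case (Suc k)
    have "\<bar>(\<integral>w. u a (Suc k) w \<partial>?S) - (\<integral>w. u a 0 w \<partial>?S)\<bar> \<le> 4 * e powr (-p) * (\<Sum>l=1..k. L l) + 4 * e powr (-p) * L (Suc k)"
      using Suc step[of a k] by linarith
    thus ?case by (simp add: algebra_simps)
  qed simp
  \<comment> \<open>At time 0 the law is Gaussian of variance T instead of 1; rescaling by sqrt T is
    a relative perturbation of size e^2.\<close>
  have init: "\<bar>(\<integral>w. u a 0 w \<partial>?S) - Phi a\<bar> \<le> 4 * e" for a
  proof -
    have T1: "1 \<le> T" by (simp add: T_def)
    have "T \<le> (1 + e\<^sup>2)\<^sup>2" using e2 by (simp add: T_def power2_sum)
    hence sT: "1 \<le> sqrt T" "sqrt T \<le> 1 + e\<^sup>2" using T1 by (auto intro: real_le_lsqrt)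
    have "\<bar>a / sqrt T - a\<bar> = \<bar>a\<bar> * (1 - 1 / sqrt T)"
    proof -
      have "a / sqrt T - a = - (a * (1 - 1 / sqrt T))" using sT by (simp add: field_simps)
      moreover have "0 \<le> 1 - 1 / sqrt T" using sT by simp
      ultimately show ?thesis by (simp add: abs_mult)
    qed
    also have "1 - 1 / sqrt T \<le> e\<^sup>2"
    proof -
      have "1 - 1 / sqrt T = (sqrt T - 1) / sqrt T" using sT by (simp add: field_simps)
      also have "\<dots> \<le> (sqrt T - 1) / 1" using sT by (intro divide_left_mono) auto
      finally show ?thesis using sT by simp
    qed
    hence "\<bar>a\<bar> * (1 - 1 / sqrt T) \<le> \<bar>a\<bar> * e\<^sup>2" by (rule mult_left_mono) simp
    also have "\<bar>a\<bar> * e\<^sup>2 \<le> e\<^sup>2 * (1 + \<bar>a\<bar>)" using e2 by (simp add: algebra_simps)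
    finally have "\<bar>a / sqrt T - a\<bar> \<le> e\<^sup>2 * (1 + \<bar>a\<bar>)" .
    moreover have ee: "e\<^sup>2 \<le> e" using e by (simp add: power2_eq_square mult_left_le)
    ultimately have "\<bar>Phi (a / sqrt T) - Phi a\<bar> \<le> 2 * e\<^sup>2" using e by (intro Phi_relative_perturbation) auto
    moreover have "(\<integral>w. u a 0 w \<partial>?S) = Phi (a / sqrt T)" by (simp add: u_def X'_def V'_def S.prob_space)
    ultimately show ?thesis using ee by linarith
  qed
  define D where "D = 4 * e powr (-p) * (\<Sum>l=1..n. L l) + 4 * e"
  have HD: "\<bar>(\<integral>w. Phi ((a - X' n w) / sqrt (T - V' n w)) \<partial>?S) - Phi a\<bar> \<le> D" for a
    using tele[of a n] init[of a] unfolding u_def D_def by linarith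
  \<comment> \<open>On G nothing is frozen, since V \<le> 1 + e^2, and the reserve left is T - V
    \<le> 3 e^2.\<close>
  define G where "G = {w \<in> space ?S. \<bar>V n w - 1\<bar> \<le> e\<^sup>2}"
  have "\<bar>S.prob {w \<in> space ?S. (\<Sum>l=1..n. \<xi> l w) \<le> a} - Phi a\<bar> \<le> 2 * (D + 4 * e + S.prob (space ?S - G))"
  proof (rule S.unsmoothing[where X' = "X' n" and s = "\<lambda>w. T - V' n w"])
    show "(\<lambda>w. \<Sum>l=1..n. \<xi> l w) \<in> borel_measurable ?S" by measurable
    show "G \<in> sets ?S" unfolding G_def by measurable
    show "0 < T - V' n w" for w using Ts[of n w] e2 by linarith
    fix w assume w: "w \<in> G"
    hence Vw: "V n w \<le> 1 + e\<^sup>2" "1 - e\<^sup>2 \<le> V n w" by (auto simp: G_def)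
    show "X' n w = (\<Sum>l=1..n. \<xi> l w)"
      unfolding X'_def by (rule sum.cong) (use full[OF Vw(1)] in auto)
    have "V' n w = V n w"
      unfolding V'_def V_def by (rule sum.cong) (use full[OF Vw(1)] in auto)
    thus "T - V' n w \<le> (2 * e)\<^sup>2" using Vw e2 by (simp add: T_def power_mult_distrib)
  qed (use e HD in auto)
  also have "space ?S - G = {w \<in> space ?S. e\<^sup>2 < \<bar>(\<Sum>l=1..n. v l w) - 1\<bar>}"
    by (auto simp: G_def V_def)
  finally show ?thesis by (simp add: D_def L_def algebra_simps)
qed

section \<open>Degenerate kernels\<close>

lemma integral_mult_square_le:
  fixes f g :: "'a \<Rightarrow> real"
  assumes [measurable]: "f \<in> borel_measurable M" "g \<in> borel_measurable M"
    and f2: "integrable M (\<lambda>x. (f x)\<^sup>2)" and g2: "integrable M (\<lambda>x. (g x)\<^sup>2)"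
  shows "integrable M (\<lambda>x. f x * g x)" "(\<integral>x. f x * g x \<partial>M)\<^sup>2 \<le> (\<integral>x. (f x)\<^sup>2 \<partial>M) * (\<integral>x. (g x)\<^sup>2 \<partial>M)"
proof -
  show fg: "integrable M (\<lambda>x. f x * g x)"
  proof (rule Bochner_Integration.integrable_bound)
    show "integrable M (\<lambda>x. (f x)\<^sup>2 + (g x)\<^sup>2)" using f2 g2 by simp
    show "AE x in M. norm (f x * g x) \<le> norm ((f x)\<^sup>2 + (g x)\<^sup>2)"
      using abs_mult_le_sum_squares by (intro AE_I2) simp
  qed simp
  define b where "b = (\<integral>x. (g x)\<^sup>2 \<partial>M)"
  define a where "a = (\<integral>x. f x * g x \<partial>M)"
  show "(\<integral>x. f x * g x \<partial>M)\<^sup>2 \<le> (\<integral>x. (f x)\<^sup>2 \<partial>M) * (\<integral>x. (g x)\<^sup>2 \<partial>M)"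
  proof (cases "b = 0")
    case True
    hence "AE x in M. (g x)\<^sup>2 = 0" using g2 unfolding b_def by (subst (asm) integral_nonneg_eq_0_iff_AE) auto
    hence "AE x in M. f x * g x = 0" by auto
    hence "(\<integral>x. f x * g x \<partial>M) = (\<integral>x. 0 \<partial>M)" by (intro integral_cong_AE) auto
    thus ?thesis by simp
  next
    case False
    hence b: "b > 0" by (simp add: b_def order.strict_iff_order)
    have "0 \<le> (\<integral>x. (f x - a / b * g x)\<^sup>2 \<partial>M)" by simp
    also have "(\<lambda>x. (f x - a / b * g x)\<^sup>2) = (\<lambda>x. (f x)\<^sup>2 - (2 * a / b) * (f x * g x) + (a / b)\<^sup>2 * (g x)\<^sup>2)"
      by (simp add: power2_diff power_mult_distrib power_divide algebra_simps)
    also have "(\<integral>x. (f x)\<^sup>2 - (2 * a / b) * (f x * g x) + (a / b)\<^sup>2 * (g x)\<^sup>2 \<partial>M)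
        = (\<integral>x. (f x)\<^sup>2 \<partial>M) - (2 * a / b) * a + (a / b)\<^sup>2 * b"
      using f2 g2 fg by (simp add: a_def b_def)
    also have "\<dots> = (\<integral>x. (f x)\<^sup>2 \<partial>M) - a\<^sup>2 / b"
      using b by (simp add: power2_eq_square field_simps)
    finally have "a\<^sup>2 / b \<le> (\<integral>x. (f x)\<^sup>2 \<partial>M)" by simp
    thus ?thesis using b by (simp add: a_def b_def pos_divide_le_eq)
  qed
qed

lemma (in pair_sigma_finite) integrable_pair_product:
  fixes f :: "'a \<Rightarrow> real" and g :: "'b \<Rightarrow> real"
  assumes f: "integrable M1 f" and g: "integrable M2 g"
  shows "integrable (M1 \<Otimes>\<^sub>M M2) (\<lambda>(x, y). f x * g y)"
proof (rule Fubini_integrable)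
  have [measurable]: "f \<in> borel_measurable M1" "g \<in> borel_measurable M2" using f g by simp_all
  show "(\<lambda>(x, y). f x * g y) \<in> borel_measurable (M1 \<Otimes>\<^sub>M M2)" by measurable
  show "integrable M1 (\<lambda>x. \<integral>y. norm (case (x, y) of (x, y) \<Rightarrow> f x * g y) \<partial>M2)"
    using f by (simp add: abs_mult)
  show "AE x in M1. integrable M2 (\<lambda>y. case (x, y) of (x, y) \<Rightarrow> f x * g y)"
    using g by simp
qed

context prob_space
begin

text \<open>If the two index pairs differ, some index occurs in one of them only; integrating that
  coordinate first gives zero by degeneracy, after symmetry has moved it to the second
  argument.\<close>

lemma degenerate_orthogonal:
  fixes h :: "'a \<Rightarrow> 'a \<Rightarrow> real"
  assumes meas: "(\<lambda>(x, y). h x y) \<in> borel_measurable (M \<Otimes>\<^sub>M M)"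
    and sym: "\<And>x y. h x y = h y x"
    and mean: "\<And>x. x \<in> space M \<Longrightarrow> (\<integral>y. h x y \<partial>M) = 0"
    and int2: "integrable (M \<Otimes>\<^sub>M M) (\<lambda>(x, y). (h x y)\<^sup>2)"
    and ij: "i \<noteq> j" "k \<noteq> l"
  shows "integrable (iid_seq M) (\<lambda>w. h (w i) (w j) * h (w k) (w l))"
    "(\<integral>w. h (w i) (w j) * h (w k) (w l) \<partial>iid_seq M) = (if {i, j} = {k, l} then \<integral>(x, y). (h x y)\<^sup>2 \<partial>(M \<Otimes>\<^sub>M M) else 0)"
proof -
  note [measurable] = meas
  have h_meas [measurable]: "(\<lambda>w. h (w i) (w j)) \<in> borel_measurable (iid_seq M)" for i j
    by measurable
  have i2: "integrable (iid_seq M) (\<lambda>w. (h (w i) (w j))\<^sup>2)" if "i \<noteq> j" for i j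
    using integrable_iid_seq_comp2_iff[of "\<lambda>(x, y). (h x y)\<^sup>2" i j] that int2 by simp
  show int: "integrable (iid_seq M) (\<lambda>w. h (w i) (w j) * h (w k) (w l))"
    by (rule integral_mult_square_le) (use i2 ij in auto)
  have zero: "(\<integral>w. h (w i) (w j) * h (w k) (w l) \<partial>iid_seq M) = 0"
    if j: "j \<noteq> k" "j \<noteq> l" "i \<noteq> j" and int: "integrable (iid_seq M) (\<lambda>w. h (w i) (w j) * h (w k) (w l))" for i j k l
    by (rule integral_iid_seq_orthogonal[OF int, of j]) (use j mean space_iid_seq_comp in auto)
  show "(\<integral>w. h (w i) (w j) * h (w k) (w l) \<partial>iid_seq M) = (if {i, j} = {k, l} then \<integral>(x, y). (h x y)\<^sup>2 \<partial>(M \<Otimes>\<^sub>M M) else 0)"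
  proof (cases "{i, j} = {k, l}")
    case True
    hence "h (w k) (w l) = h (w i) (w j)" for w :: "nat \<Rightarrow> 'a" using sym by (auto simp: doubleton_eq_iff)
    hence "(\<integral>w. h (w i) (w j) * h (w k) (w l) \<partial>iid_seq M) = (\<integral>w. (h (w i) (w j))\<^sup>2 \<partial>iid_seq M)"
      by (simp add: power2_eq_square)
    thus ?thesis
      using integral_iid_seq_comp2[of "\<lambda>(x, y). (h x y)\<^sup>2" i j] ij True by simp
  next
    case False
    with ij consider "j \<noteq> k" "j \<noteq> l" | "i \<noteq> k" "i \<noteq> l" by auto
    thus ?thesis
    proof cases
      case 1
      thus ?thesis using zero[of j k l i] int ij False by auto
    next
      case 2
      have eqf: "(\<lambda>w. h (w i) (w j) * h (w k) (w l)) = (\<lambda>w. h (w j) (w i) * h (w k) (w l))"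
        by (rule ext, subst sym) (rule refl)
      show ?thesis
        using zero[of i k l j] int ij(1) False 2 unfolding eqf by simp
    qed
  qed
qed

text \<open>Ordering each pair as i < j makes different pairs different as sets, so only the
  diagonal of the squared sum survives.\<close>

lemma degenerate_sum_second_moment:
  fixes h :: "'a \<Rightarrow> 'a \<Rightarrow> real" and c :: "nat \<times> nat \<Rightarrow> real"
  assumes meas: "(\<lambda>(x, y). h x y) \<in> borel_measurable (M \<Otimes>\<^sub>M M)"
    and sym: "\<And>x y. h x y = h y x"
    and mean: "\<And>x. x \<in> space M \<Longrightarrow> (\<integral>y. h x y \<partial>M) = 0"
    and int2: "integrable (M \<Otimes>\<^sub>M M) (\<lambda>(x, y). (h x y)\<^sup>2)"
    and A: "finite A" "\<And>i j. (i, j) \<in> A \<Longrightarrow> i < j"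
  shows "integrable (iid_seq M) (\<lambda>w. (\<Sum>(i, j)\<in>A. c (i, j) * h (w i) (w j))\<^sup>2)"
    "(\<integral>w. (\<Sum>(i, j)\<in>A. c (i, j) * h (w i) (w j))\<^sup>2 \<partial>iid_seq M) = (\<Sum>a\<in>A. (c a)\<^sup>2) * (\<integral>(x, y). (h x y)\<^sup>2 \<partial>(M \<Otimes>\<^sub>M M))"
proof -
  define \<kappa> where "\<kappa> = (\<integral>(x, y). (h x y)\<^sup>2 \<partial>(M \<Otimes>\<^sub>M M))"
  define H where "H a w = h (w (fst a)) (w (snd a))" for a :: "nat \<times> nat" and w :: "nat \<Rightarrow> 'a"
  have eq: "(\<Sum>(i, j)\<in>A. c (i, j) * h (w i) (w j))\<^sup>2 = (\<Sum>a\<in>A. \<Sum>b\<in>A. (c a * c b) * (H a w * H b w))" for w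
    by (simp add: H_def power2_eq_square sum_product split_def algebra_simps)
  have H: "integrable (iid_seq M) (\<lambda>w. H a w * H b w)" "(\<integral>w. H a w * H b w \<partial>iid_seq M) = (if a = b then \<kappa> else 0)"
    if "a \<in> A" "b \<in> A" for a b
  proof -
    have lt: "fst a < snd a" "fst b < snd b" using A(2)[of "fst a" "snd a"] A(2)[of "fst b" "snd b"] that by auto
    have "{fst a, snd a} = {fst b, snd b} \<longleftrightarrow> a = b" using lt by (auto simp: doubleton_eq_iff prod_eq_iff)
    thus "integrable (iid_seq M) (\<lambda>w. H a w * H b w)" "(\<integral>w. H a w * H b w \<partial>iid_seq M) = (if a = b then \<kappa> else 0)"
      using degenerate_orthogonal[OF meas sym mean int2, of "fst a" "snd a" "fst b" "snd b"] lt
      by (auto simp: H_def \<kappa>_def)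
  qed
  show "integrable (iid_seq M) (\<lambda>w. (\<Sum>(i, j)\<in>A. c (i, j) * h (w i) (w j))\<^sup>2)"
    unfolding eq using H by (intro Bochner_Integration.integrable_sum integrable_mult_right) auto
  have "(\<integral>w. (\<Sum>(i, j)\<in>A. c (i, j) * h (w i) (w j))\<^sup>2 \<partial>iid_seq M)
      = (\<Sum>a\<in>A. \<Sum>b\<in>A. (c a * c b) * (if a = b then \<kappa> else 0))"
    unfolding eq
    by (subst Bochner_Integration.integral_sum, intro Bochner_Integration.integrable_sum integrable_mult_right H, assumption, assumption,
        intro sum.cong refl, subst Bochner_Integration.integral_sum, intro integrable_mult_right H, assumption, assumption)
       (auto intro!: sum.cong simp: H(2))
  also have "\<dots> = (\<Sum>a\<in>A. (c a)\<^sup>2) * \<kappa>"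
    using A(1) by (simp add: if_distrib sum_distrib_right power2_eq_square cong: if_cong)
  finally show "(\<integral>w. (\<Sum>(i, j)\<in>A. c (i, j) * h (w i) (w j))\<^sup>2 \<partial>iid_seq M) = (\<Sum>a\<in>A. (c a)\<^sup>2) * (\<integral>(x, y). (h x y)\<^sup>2 \<partial>(M \<Otimes>\<^sub>M M))"
    by (simp add: \<kappa>_def)
qed

end

lemma sum_triangle_swap:
  fixes f :: "nat \<Rightarrow> real"
  shows "(\<Sum>l=1..n. \<Sum>k=1..<l. f k) = (\<Sum>k=1..n. real (n - k) * f k)"
proof (induction n)
  case (Suc n)
  have "(\<Sum>k=1..Suc n. real (Suc n - k) * f k) = (\<Sum>k=1..n. real (Suc n - k) * f k)" by simp
  also have "\<dots> = (\<Sum>k=1..n. real (n - k) * f k + f k)"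
    by (intro sum.cong) (auto simp: Suc_diff_le algebra_simps)
  also have "\<dots> = (\<Sum>k=1..n. real (n - k) * f k) + (\<Sum>k=1..<Suc n. f k)"
    by (simp add: sum.distrib atLeastLessThanSuc_atLeastAtMost del: sum.op_ivl_Suc)
  finally show ?case using Suc by simp
qed simp

lemma sum_square_split:
  fixes g :: "nat \<Rightarrow> nat \<Rightarrow> real"
  assumes "\<And>i j. g i j = g j i"
  shows "(\<Sum>i=1..<l. \<Sum>j=1..<l. g i j) = (\<Sum>k=1..<l. g k k) + 2 * (\<Sum>k=1..<l. \<Sum>j=1..<k. g j k)"
proof (induction l)
  case (Suc l)
  show ?case
  proof (cases "l = 0")
    case False
    hence eq: "{1..<Suc l} = insert l {1..<l}" by auto
    have "(\<Sum>i=1..<Suc l. \<Sum>j=1..<Suc l. g i j) = (\<Sum>i=1..<l. \<Sum>j=1..<l. g i j) + (\<Sum>i=1..<l. g i l) + (\<Sum>j=1..<l. g l j) + g l l"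
      unfolding eq by (simp add: sum.distrib)
    also have "(\<Sum>j=1..<l. g l j) = (\<Sum>j=1..<l. g j l)" using assms by simp
    finally show ?thesis using Suc unfolding eq by simp
  qed simp
qed simp

text \<open>Degeneracy and conditional integrability are demanded at every point x, not at almost
  every one, because the exchange argument fixes a sample path and needs the conditional statements
  along each of them.\<close>

locale degenerate_kernel = prob_space M for M :: "'a measure" +
  fixes h :: "'a \<Rightarrow> 'a \<Rightarrow> real" and p :: real
  assumes h_meas: "(\<lambda>(x, y). h x y) \<in> borel_measurable (M \<Otimes>\<^sub>M M)"
    and h_sym: "h x y = h y x"
    and h_int1: "x \<in> space M \<Longrightarrow> integrable M (\<lambda>y. \<bar>h x y\<bar> powr p)"
    and h_mean: "x \<in> space M \<Longrightarrow> (\<integral>y. h x y \<partial>M) = 0"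
    and h_int2: "integrable (M \<Otimes>\<^sub>M M) (\<lambda>(x, y). \<bar>h x y\<bar> powr p)"
    and p: "2 < p" "p \<le> 3"
begin

text \<open>
  For the doubly centered distance \<open>d\<close> these are, in the notation of the paper, \<open>V\<^sup>2 (X)\<close>,
  \<open>E \<bar>d (X\<^sub>1, X\<^sub>2)\<bar> powr p\<close> and \<open>E (d (X\<^sub>1, X\<^sub>2) d (X\<^sub>1, X\<^sub>3) d (X\<^sub>2, X\<^sub>4) d (X\<^sub>3, X\<^sub>4))\<close>.
\<close>

definition sig2 :: real where "sig2 = (\<integral>(x, y). (h x y)\<^sup>2 \<partial>(M \<Otimes>\<^sub>M M))"
definition rho :: real where "rho = (\<integral>(x, y). \<bar>h x y\<bar> powr p \<partial>(M \<Otimes>\<^sub>M M))"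
definition G :: "'a \<Rightarrow> 'a \<Rightarrow> real" where "G x y = (\<integral>w. h w x * h w y \<partial>M)"
definition gam :: real where "gam = (\<integral>(x, y). (G x y)\<^sup>2 \<partial>(M \<Otimes>\<^sub>M M))"

sublocale MM: pair_prob_space M M ..
sublocale S: prob_space "iid_seq M" by (rule prob_space_iid_seq)

lemmas h_meas' [measurable] = h_meas

lemma h_meas_fst [measurable]: "x \<in> space M \<Longrightarrow> h x \<in> borel_measurable M"
  using measurable_Pair2[OF h_meas, of x] by simp

lemma h_meas_iid [measurable]: "(\<lambda>w. h (w i) (w j)) \<in> borel_measurable (iid_seq M)"
  by measurable

lemma h_sq: "x \<in> space M \<Longrightarrow> integrable M (\<lambda>y. (h x y)\<^sup>2)"
  using integrable_square_of_powr(1)[OF h_meas_fst h_int1] p by simp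

lemma h_sq_snd: "x \<in> space M \<Longrightarrow> integrable M (\<lambda>y. (h y x)\<^sup>2)"
  using h_sq by (subst h_sym)

lemma h_sq2: "integrable (M \<Otimes>\<^sub>M M) (\<lambda>(x, y). (h x y)\<^sup>2)"
  using MM.P.integrable_square_of_powr(1)[of "\<lambda>(x, y). h x y" p] h_int2 p by (simp add: split_def)

lemma sig2_powr_le: "sig2 powr (p / 2) \<le> rho"
  using MM.P.integrable_square_of_powr(2)[of "\<lambda>(x, y). h x y" p] h_int2 p by (simp add: split_def sig2_def rho_def)

lemma sig2_nonneg: "0 \<le> sig2" unfolding sig2_def by (rule integral_nonneg_AE) auto
lemma rho_nonneg: "0 \<le> rho" unfolding rho_def by (rule integral_nonneg_AE) auto

lemma G_meas [measurable]: "(\<lambda>(x, y). G x y) \<in> borel_measurable (M \<Otimes>\<^sub>M M)"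
  unfolding G_def by measurable

lemma G_diag_meas [measurable]: "(\<lambda>x. G x x) \<in> borel_measurable M"
  unfolding G_def by measurable

lemma G_sym: "G x y = G y x" by (simp add: G_def mult.commute)

lemma G_diag: "G x x = (\<integral>w. (h x w)\<^sup>2 \<partial>M)"
  unfolding G_def by (subst (1 2) h_sym) (simp add: power2_eq_square)

lemma G_diag_nonneg: "0 \<le> G x x" by (simp add: G_diag)

lemma G_sq_le: "x \<in> space M \<Longrightarrow> y \<in> space M \<Longrightarrow> (G x y)\<^sup>2 \<le> G x x * G y y"
  using integral_mult_square_le(2)[of "h x" M "h y"] h_sq unfolding G_diag
  by (simp add: G_def h_sym[of _ x] h_sym[of _ y])

text \<open>Fubini moves the integral over z onto h. Thus G is again degenerate, and off-diagonal
  sums of G fall under the orthogonality lemmas.\<close>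

lemma G_mean: assumes x: "x \<in> space M" shows "(\<integral>z. G x z \<partial>M) = 0"
proof -
  have [measurable]: "(\<lambda>w. h w x) \<in> borel_measurable M" using h_meas_fst[OF x] by (subst h_sym)
  have int: "integrable (M \<Otimes>\<^sub>M M) (\<lambda>(w, z). h w x * h w z)"
  proof (rule Bochner_Integration.integrable_bound)
    have "integrable (M \<Otimes>\<^sub>M M) (\<lambda>(w, z). (h w x)\<^sup>2 * 1)"
      by (rule MM.integrable_pair_product[OF h_sq_snd[OF x]]) simp
    thus "integrable (M \<Otimes>\<^sub>M M) (\<lambda>q. (h (fst q) x)\<^sup>2 + (h (fst q) (snd q))\<^sup>2)"
      using h_sq2 by (simp add: split_def)
    show "AE q in M \<Otimes>\<^sub>M M. norm (case q of (w, z) \<Rightarrow> h w x * h w z) \<le> norm ((h (fst q) x)\<^sup>2 + (h (fst q) (snd q))\<^sup>2)"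
      using abs_mult_le_sum_squares by (intro AE_I2) (auto simp: split_def)
  qed measurable
  have "(\<integral>z. G x z \<partial>M) = (\<integral>z. (\<integral>w. h w x * h w z \<partial>M) \<partial>M)" by (simp add: G_def)
  also have "\<dots> = (\<integral>w. (\<integral>z. h w x * h w z \<partial>M) \<partial>M)" using MM.Fubini_integral[OF int] by simp
  also have "\<dots> = (\<integral>w. 0 \<partial>M)" by (intro Bochner_Integration.integral_cong) (auto simp: h_mean)
  finally show ?thesis by simp
qed

text \<open>For fixed x this is Jensen from the second to the p-th moment of \<open>h x\<close>;
  integrating over x turns the bound into rho. It is the reason why squares have p/2 moments
  only.\<close>

lemma G_diag_powr:
  "integrable M (\<lambda>x. \<bar>G x x\<bar> powr (p / 2))" "(\<integral>x. \<bar>G x x\<bar> powr (p / 2) \<partial>M) \<le> rho"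
proof -
  have bd: "\<bar>G x x\<bar> powr (p / 2) \<le> (\<integral>y. \<bar>h x y\<bar> powr p \<partial>M)" if "x \<in> space M" for x
    using integrable_square_of_powr(2)[OF h_meas_fst[OF that] h_int1[OF that]] p G_diag_nonneg[of x] by (simp add: G_diag)
  have i: "integrable M (\<lambda>x. \<integral>y. \<bar>h x y\<bar> powr p \<partial>M)" using MM.integrable_fst[OF h_int2] .
  show ii: "integrable M (\<lambda>x. \<bar>G x x\<bar> powr (p / 2))"
    by (rule Bochner_Integration.integrable_bound[OF i]) (use bd in auto)
  have "(\<integral>x. \<bar>G x x\<bar> powr (p / 2) \<partial>M) \<le> (\<integral>x. (\<integral>y. \<bar>h x y\<bar> powr p \<partial>M) \<partial>M)"
    using ii i bd by (intro integral_mono) auto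
  also have "\<dots> = rho" using MM.integral_fst[OF h_int2] by (simp add: rho_def)
  finally show "(\<integral>x. \<bar>G x x\<bar> powr (p / 2) \<partial>M) \<le> rho" .
qed

lemma G_diag_int: "integrable M (\<lambda>x. G x x)" "(\<integral>x. G x x \<partial>M) = sig2"
  using MM.integrable_fst[OF h_sq2] MM.integral_fst[OF h_sq2] by (simp_all add: G_diag sig2_def)

lemma G_sq2: "integrable (M \<Otimes>\<^sub>M M) (\<lambda>(x, y). (G x y)\<^sup>2)"
  by (rule Bochner_Integration.integrable_bound[OF MM.integrable_pair_product[OF G_diag_int(1) G_diag_int(1)]])
     (use G_sq_le in \<open>auto simp: space_pair_measure G_diag_nonneg intro!: AE_I2\<close>)

lemma gam_nonneg: "0 \<le> gam" unfolding gam_def by (rule integral_nonneg_AE) auto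

end

lemma (in prob_space) centered_powr_moment:
  fixes X :: "'a \<Rightarrow> real"
  assumes [measurable]: "X \<in> borel_measurable M" "Y \<in> borel_measurable M"
    and X: "integrable M (\<lambda>x. \<bar>X x\<bar> powr r)" "(\<integral>x. \<bar>X x\<bar> powr r \<partial>M) \<le> c"
    and Y: "integrable M (\<lambda>x. \<bar>Y x\<bar> powr r)" "(\<integral>x. \<bar>Y x\<bar> powr r \<partial>M) \<le> c"
    and r: "1 \<le> r"
  shows "integrable M (\<lambda>x. \<bar>X x - Y x\<bar> powr r)" "(\<integral>x. \<bar>X x - Y x\<bar> powr r \<partial>M) \<le> 2 powr r * c"
proof -
  have bd: "\<bar>X x - Y x\<bar> powr r \<le> 2 powr (r - 1) * (\<bar>X x\<bar> powr r + \<bar>Y x\<bar> powr r)" for x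
    using abs_add_powr_le[OF r, of "X x" "- Y x"] by simp
  have i: "integrable M (\<lambda>x. 2 powr (r - 1) * (\<bar>X x\<bar> powr r + \<bar>Y x\<bar> powr r))" using X Y by simp
  show ii: "integrable M (\<lambda>x. \<bar>X x - Y x\<bar> powr r)"
    by (rule Bochner_Integration.integrable_bound[OF i]) (use bd in auto)
  have "(\<integral>x. \<bar>X x - Y x\<bar> powr r \<partial>M) \<le> (\<integral>x. 2 powr (r - 1) * (\<bar>X x\<bar> powr r + \<bar>Y x\<bar> powr r) \<partial>M)"
    using i ii bd by (intro integral_mono) auto
  also have "\<dots> = 2 powr (r - 1) * ((\<integral>x. \<bar>X x\<bar> powr r \<partial>M) + (\<integral>x. \<bar>Y x\<bar> powr r \<partial>M))" using X Y by simp
  also have "\<dots> \<le> 2 powr (r - 1) * (c + c)" using X Y by (intro mult_left_mono add_mono) auto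
  also have "\<dots> = (2 * 2 powr (r - 1)) * c" by simp
  also have "2 * 2 powr (r - 1) = (2::real) powr r" using powr_mult_base[of 2 "r - 1"] by simp
  finally show "(\<integral>x. \<bar>X x - Y x\<bar> powr r \<partial>M) \<le> 2 powr r * c" .
qed

definition lt_pairs :: "nat \<Rightarrow> (nat \<times> nat) set" where
  "lt_pairs n = {(j, k). 1 \<le> j \<and> j < k \<and> k \<le> n}"

lemma lt_pairs_eq: "lt_pairs n = prod.swap ` (SIGMA k:{1..n}. {1..<k})"
  by (force simp: lt_pairs_def image_iff)

lemma finite_lt_pairs [simp]: "finite (lt_pairs n)"
  by (simp add: lt_pairs_eq)

lemma sum_lt_pairs: "(\<Sum>(j, k)\<in>lt_pairs n. f j k) = (\<Sum>k=1..n. \<Sum>j=1..<k. f j k)"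
proof -
  have "(\<Sum>(j, k)\<in>lt_pairs n. f j k) = (\<Sum>(k, j)\<in>(SIGMA k:{1..n}. {1..<k}). f j k)"
    unfolding lt_pairs_eq by (subst sum.reindex) (auto simp: split_def)
  also have "\<dots> = (\<Sum>k=1..n. \<Sum>j=1..<k. f j k)" by (subst sum.Sigma) auto
  finally show ?thesis .
qed

lemma sum_real_diff: "(\<Sum>k=1..n. real (n - k)) = real n * (real n - 1) / 2"
proof -
  have "(\<Sum>k=1..n. real (n - k)) = (\<Sum>l=1..n. \<Sum>k=1..<l. 1)"
    using sum_triangle_swap[of "\<lambda>_. 1" n] by simp
  also have "\<dots> = real n * (real n - 1) / 2"
    by (induction n) (auto simp: field_simps of_nat_diff)
  finally show ?thesis .
qed

lemma card_lt_pairs: "real (card (lt_pairs n)) = real n * (real n - 1) / 2"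
proof -
  have "real (card (lt_pairs n)) = (\<Sum>(j, k)\<in>lt_pairs n. 1)" by simp
  also have "\<dots> = (\<Sum>k=1..n. \<Sum>j=1..<k. 1)" by (rule sum_lt_pairs)
  also have "\<dots> = (\<Sum>k=1..n. real (n - k))" using sum_triangle_swap[of "\<lambda>_. 1" n] by simp
  finally show ?thesis unfolding sum_real_diff .
qed

section \<open>Conditional variance and normal approximation for the sum of a degenerate
  kernel\<close>

context degenerate_kernel
begin

text \<open>Since p/2 \<le> 3/2, the power is at most the square root of x^3, which leaves 2^3 \<le>
  3^2, 8^3 \<le> 23^2 and 4^3 \<le> 8^2.\<close>

lemma powr_r_bounds: "(2::real) powr (p / 2) \<le> 3" "(8::real) powr (p / 2) \<le> 23" "(4::real) powr (p / 2) \<le> 8"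
proof -
  have le: "x powr (p / 2) \<le> y" if "1 \<le> x" "0 \<le> y" "x ^ 3 \<le> y ^ 2" for x y :: real
  proof -
    have "x powr (p / 2) \<le> x powr (3 / 2)" using p that by (intro powr_mono) auto
    also have "\<dots> = (x powr 3) powr (1 / 2)" by (simp add: powr_powr)
    also have "\<dots> = sqrt (x ^ 3)" using that by (simp add: powr_half_sqrt)
    also have "\<dots> \<le> y" using that by (intro real_le_lsqrt) auto
    finally show ?thesis .
  qed
  show "(2::real) powr (p / 2) \<le> 3" "(8::real) powr (p / 2) \<le> 23" "(4::real) powr (p / 2) \<le> 8"
    by (intro le; simp)+
qed

text \<open>Standard deviation of the sum of h over all pairs k < l, different pairs being
  uncorrelated.\<close>

definition normalizer :: "nat \<Rightarrow> real" where
  "normalizer n = sqrt (real n * (real n - 1) / 2 * sig2)"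

lemma normalizer_facts:
  assumes n: "2 \<le> n" and sig: "0 < sig2"
  shows "0 < normalizer n" "(normalizer n)\<^sup>2 = real n * (real n - 1) / 2 * sig2"
    "(real n)\<^sup>2 * sig2 \<le> 4 * (normalizer n)\<^sup>2"
    "0 \<le> X \<Longrightarrow> X / normalizer n powr p \<le> 8 * (X / (real n powr p * sig2 powr (p / 2)))"
proof -
  have n1: "2 \<le> real n" using n by simp
  have pos: "0 < real n * (real n - 1) / 2 * sig2" using n1 sig by simp
  show s0: "0 < normalizer n" using pos by (simp add: normalizer_def)
  show s2: "(normalizer n)\<^sup>2 = real n * (real n - 1) / 2 * sig2" using pos by (simp add: normalizer_def)
  have "real n * real n \<le> 2 * (real n * (real n - 1))" using n1 by (simp add: algebra_simps)
  hence "real n * real n * sig2 \<le> 2 * (real n * (real n - 1)) * sig2" using sig by (intro mult_right_mono) auto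
  thus s4: "(real n)\<^sup>2 * sig2 \<le> 4 * (normalizer n)\<^sup>2" unfolding s2 by (simp add: power2_eq_square algebra_simps)
  have pw: "(y\<^sup>2) powr (p / 2) = y powr p" if "0 < y" for y :: real
  proof -
    have "y\<^sup>2 = y powr 2" using that by simp
    thus ?thesis by (simp only: powr_powr) simp
  qed
  have "real n powr p * sig2 powr (p / 2) = ((real n)\<^sup>2 * sig2) powr (p / 2)"
    using sig n1 by (simp add: powr_mult pw)
  also have "\<dots> \<le> (4 * (normalizer n)\<^sup>2) powr (p / 2)"
    using s4 sig p by (intro powr_mono2) auto
  also have "\<dots> = 4 powr (p / 2) * normalizer n powr p" using s0 by (simp add: powr_mult pw)
  also have "\<dots> \<le> 8 * normalizer n powr p"
    by (rule mult_right_mono[OF powr_r_bounds(3)]) simp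
  finally have le: "real n powr p * sig2 powr (p / 2) \<le> 8 * normalizer n powr p" .
  show "X / normalizer n powr p \<le> 8 * (X / (real n powr p * sig2 powr (p / 2)))" if "0 \<le> X"
  proof -
    have "X / normalizer n powr p = 8 * (X / (8 * normalizer n powr p))" by simp
    also have "\<dots> \<le> 8 * (X / (real n powr p * sig2 powr (p / 2)))"
      using le that s0 sig n1 by (intro mult_left_mono divide_left_mono mult_pos_pos) auto
    finally show ?thesis .
  qed
qed

text \<open>All moment sums below are of order n n^(p/2) rho, and the p-th power of the normalizer
  is of order n^p sig2^(p/2); the quotient is the rate n^(1 - p/2).\<close>

lemma normalizer_scale:
  assumes n: "2 \<le> n" and sig: "0 < sig2" and c: "0 \<le> c"
  shows "c * (real n * real n powr (p / 2) * rho) / normalizer n powr p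
    \<le> 8 * c * (real n powr (1 - p / 2) * (rho / sig2 powr (p / 2)))"
proof -
  define N where "N = real n"
  have N2: "2 \<le> N" using n by (simp add: N_def)
  have "c * (N * N powr (p / 2) * rho) / normalizer n powr p \<le> 8 * (c * (N * N powr (p / 2) * rho) / (N powr p * sig2 powr (p / 2)))"
    using normalizer_facts(4)[OF n sig, of "c * (N * N powr (p / 2) * rho)"] c rho_nonneg N2 by (simp add: N_def)
  also have "\<dots> = 8 * c * ((N * N powr (p / 2) / N powr p) * (rho / sig2 powr (p / 2)))" by simp
  also have "N * N powr (p / 2) / N powr p = N powr (1 - p / 2)"
  proof -
    have "N * N powr (p / 2) = N powr (1 + p / 2)" using powr_mult_base[of N "p / 2"] N2 by simp
    moreover have "1 + p / 2 - p = 1 - p / 2" by (simp add: field_simps)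
    ultimately show ?thesis using N2 by (simp flip: powr_diff)
  qed
  finally show ?thesis by (simp only: N_def)
qed

lemma G_centered_powr:
  "integrable M (\<lambda>x. \<bar>G x x - sig2\<bar> powr (p / 2))" "(\<integral>x. \<bar>G x x - sig2\<bar> powr (p / 2) \<partial>M) \<le> 2 powr (p / 2) * rho"
  using centered_powr_moment[of "\<lambda>x. G x x" "\<lambda>_. sig2" "p / 2" rho] G_diag_powr sig2_powr_le sig2_nonneg p
  by (auto simp: prob_space)

text \<open>Independent centered summands with p/2 moments, hence von Bahr--Esseen and not a
  variance. The weight n - k counts the rows l > k in which the diagonal term of k occurs.\<close>

lemma diag_sum_moment:
  "integrable (iid_seq M) (\<lambda>w. \<bar>\<Sum>k=1..n. real (n - k) * (G (w k) (w k) - sig2)\<bar> powr (p / 2))"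
  "(\<integral>w. \<bar>\<Sum>k=1..n. real (n - k) * (G (w k) (w k) - sig2)\<bar> powr (p / 2) \<partial>iid_seq M)
     \<le> 4 * (real n * real n powr (p / 2) * (2 powr (p / 2) * rho))"
proof -
  let ?\<xi> = "\<lambda>k w. real (n - k) * (G (w k) (w k) - sig2)"
  have pw: "\<bar>?\<xi> k w\<bar> powr (p / 2) = real (n - k) powr (p / 2) * \<bar>G (w k) (w k) - sig2\<bar> powr (p / 2)" for k w
    by (simp add: abs_mult powr_mult)
  have int: "integrable (iid_seq M) (\<lambda>w. \<bar>?\<xi> k w\<bar> powr (p / 2))" for k
    unfolding pw using integrable_iid_seq_comp_iff[of "\<lambda>x. \<bar>G x x - sig2\<bar> powr (p / 2)" k] G_centered_powr by simp
  have vbe: "integrable (iid_seq M) (\<lambda>w. \<bar>\<Sum>k=1..n. ?\<xi> k w\<bar> powr (p / 2)) \<and>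
    (\<integral>w. \<bar>\<Sum>k=1..n. ?\<xi> k w\<bar> powr (p / 2) \<partial>iid_seq M) \<le> 4 * (\<Sum>k=1..n. \<integral>w. \<bar>?\<xi> k w\<bar> powr (p / 2) \<partial>iid_seq M)"
  proof (rule von_bahr_esseen)
    show "integrable (iid_seq M) (\<lambda>w. \<bar>?\<xi> k w\<bar> powr (p / 2))" for k by (rule int)
  qed (use p G_diag_int prob_space in auto)
  thus "integrable (iid_seq M) (\<lambda>w. \<bar>\<Sum>k=1..n. ?\<xi> k w\<bar> powr (p / 2))" by blast
  have "(\<integral>w. \<bar>?\<xi> k w\<bar> powr (p / 2) \<partial>iid_seq M) \<le> real n powr (p / 2) * (2 powr (p / 2) * rho)" for k
  proof -
    have "(\<integral>w. \<bar>?\<xi> k w\<bar> powr (p / 2) \<partial>iid_seq M) = real (n - k) powr (p / 2) * (\<integral>x. \<bar>G x x - sig2\<bar> powr (p / 2) \<partial>M)"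
      unfolding pw using integral_iid_seq_comp[of "\<lambda>x. \<bar>G x x - sig2\<bar> powr (p / 2)" k] by simp
    also have "\<dots> \<le> real n powr (p / 2) * (2 powr (p / 2) * rho)"
      using G_centered_powr p by (intro mult_mono powr_mono2) auto
    finally show ?thesis .
  qed
  hence "(\<Sum>k=1..n. \<integral>w. \<bar>?\<xi> k w\<bar> powr (p / 2) \<partial>iid_seq M) \<le> real n * (real n powr (p / 2) * (2 powr (p / 2) * rho))"
    by (rule order.trans[OF sum_bounded_above]) simp
  with vbe show "(\<integral>w. \<bar>\<Sum>k=1..n. ?\<xi> k w\<bar> powr (p / 2) \<partial>iid_seq M) \<le> 4 * (real n * real n powr (p / 2) * (2 powr (p / 2) * rho))"
    by (simp add: mult.assoc)
qed

text \<open>For a fixed last observation z the row is an i.i.d. sum of the centered terms h (., z).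
  The interchange of z with the sequence uses nonnegative integrals, since integrability of the row
  is only obtained from this bound.\<close>

lemma row_sum_high_moment:
  "integrable (iid_seq M) (\<lambda>w. \<bar>\<Sum>k=1..<l. h (w k) (w l)\<bar> powr p)"
  "(\<integral>w. \<bar>\<Sum>k=1..<l. h (w k) (w l)\<bar> powr p \<partial>iid_seq M) \<le> 12 * real l powr (p / 2) * rho"
proof -
  define C where "C = 12 * real l powr (p / 2)"
  have C: "0 \<le> C" by (simp add: C_def)
  interpret SM: pair_prob_space "iid_seq M" M ..
  have inner: "(\<integral>\<^sup>+w. ennreal (\<bar>\<Sum>k=1..<l. h (w k) z\<bar> powr p) \<partial>iid_seq M) \<le> ennreal (C * (\<integral>x. \<bar>h z x\<bar> powr p \<partial>M))"
    if z: "z \<in> space M" for z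
  proof -
    have m: "(\<lambda>x. h x z) \<in> borel_measurable M" using h_meas_fst[OF z] by (subst h_sym)
    have i: "integrable M (\<lambda>x. \<bar>h x z\<bar> powr p)" using h_int1[OF z] by (subst h_sym)
    have mean: "(\<integral>x. h x z \<partial>M) = 0" using h_mean[OF z] by (subst h_sym)
    have eq: "{1..<l} = {1..l - 1}" by auto
    have hm: "integrable (iid_seq M) (\<lambda>w. \<bar>\<Sum>k=1..<l. h (w k) z\<bar> powr p)"
      "(\<integral>w. \<bar>\<Sum>k=1..<l. h (w k) z\<bar> powr p \<partial>iid_seq M) \<le> 12 * real (l - 1) powr (p / 2) * (\<integral>x. \<bar>h x z\<bar> powr p \<partial>M)"
      unfolding eq using iid_sum_high_moment[OF m i mean p, of "l - 1"] by auto
    have "(\<integral>\<^sup>+w. ennreal (\<bar>\<Sum>k=1..<l. h (w k) z\<bar> powr p) \<partial>iid_seq M)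
        = ennreal (\<integral>w. \<bar>\<Sum>k=1..<l. h (w k) z\<bar> powr p \<partial>iid_seq M)"
      using hm by (intro nn_integral_eq_integral) auto
    also have "\<dots> \<le> ennreal (C * (\<integral>x. \<bar>h x z\<bar> powr p \<partial>M))"
      using p unfolding C_def by (intro ennreal_leI order.trans[OF hm(2)] mult_right_mono mult_left_mono powr_mono2) auto
    finally show ?thesis by (subst h_sym)
  qed
  have "(\<integral>\<^sup>+w. ennreal (\<bar>\<Sum>k=1..<l. h (w k) (w l)\<bar> powr p) \<partial>iid_seq M)
      = (\<integral>\<^sup>+w. (\<integral>\<^sup>+z. ennreal (\<bar>\<Sum>k=1..<l. h (w k) z\<bar> powr p) \<partial>M) \<partial>iid_seq M)"
    by (subst nn_integral_resample[of _ l]) auto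
  also have "\<dots> = (\<integral>\<^sup>+z. (\<integral>\<^sup>+w. ennreal (\<bar>\<Sum>k=1..<l. h (w k) z\<bar> powr p) \<partial>iid_seq M) \<partial>M)"
    by (rule SM.Fubini'[symmetric]) measurable
  also have "\<dots> \<le> (\<integral>\<^sup>+z. ennreal (C * (\<integral>x. \<bar>h z x\<bar> powr p \<partial>M)) \<partial>M)"
    by (intro nn_integral_mono inner)
  also have "\<dots> = ennreal (C * rho)"
    using MM.integrable_fst[OF h_int2] MM.integral_fst[OF h_int2] C
    by (subst nn_integral_eq_integral) (auto simp: rho_def intro!: AE_I2 mult_nonneg_nonneg)
  finally have bd: "(\<integral>\<^sup>+w. ennreal (\<bar>\<Sum>k=1..<l. h (w k) (w l)\<bar> powr p) \<partial>iid_seq M) \<le> ennreal (C * rho)" .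
  show int: "integrable (iid_seq M) (\<lambda>w. \<bar>\<Sum>k=1..<l. h (w k) (w l)\<bar> powr p)"
    by (rule integrableI_bounded) (use bd in \<open>auto intro: order.strict_trans1\<close>)
  have "ennreal (\<integral>w. \<bar>\<Sum>k=1..<l. h (w k) (w l)\<bar> powr p \<partial>iid_seq M) \<le> ennreal (C * rho)"
    using bd by (subst (asm) nn_integral_eq_integral[OF int]) auto
  thus "(\<integral>w. \<bar>\<Sum>k=1..<l. h (w k) (w l)\<bar> powr p \<partial>iid_seq M) \<le> 12 * real l powr (p / 2) * rho"
    using C rho_nonneg by (simp add: ennreal_le_iff C_def)
qed

lemma kernel_Berry_Esseen:
  assumes n: "2 \<le> n" and sig: "0 < sig2" and e: "0 < e" "e \<le> 1/2"
  shows "\<bar>measure (iid_seq M) {w \<in> space (iid_seq M). (\<Sum>l=1..n. \<Sum>k=1..<l. h (w k) (w l)) / normalizer n \<le> a} - Phi a\<bar>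
    \<le> 2000 * (e + e powr (-p) * (real n powr (1 - p / 2) * (rho / sig2 powr (p / 2)) + (gam / sig2\<^sup>2) powr (p / 4)))"
proof -
  let ?S = "iid_seq M"
  define s where "s = normalizer n"
  define N where "N = real n"
  define R where "R = rho / sig2 powr (p / 2)"
  define \<Gamma> where "\<Gamma> = (gam / sig2\<^sup>2) powr (p / 4)"
  define E where "E = e powr (-p)"
  note nf = normalizer_facts[OF n sig, folded s_def]
  have s0: "0 < s" by (rule nf)
  have R0: "0 \<le> R" using rho_nonneg by (simp add: R_def)
  have N2: "2 \<le> N" using n by (simp add: N_def)
  have E0: "0 \<le> E" by (simp add: E_def)
  note scale = normalizer_scale[OF n sig, folded s_def N_def R_def]
  define \<xi> where "\<xi> l w = (\<Sum>k=1..<l. h (w k) (w l)) / s" for l and w :: "nat \<Rightarrow> 'a"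
  define v where "v l w = (\<integral>z. (\<xi> l (w(l := z)))\<^sup>2 \<partial>M)" for l w
  have \<xi>_upd: "\<xi> l (w(l := z)) = (\<Sum>k=1..<l. h (w k) z) / s" for l w z
    unfolding \<xi>_def by (intro arg_cong2[where f = "(/)"] sum.cong) auto
  have \<xi>_meas [measurable]: "\<xi> l \<in> borel_measurable ?S" for l unfolding \<xi>_def by measurable
  have \<xi>_powr: "\<bar>\<xi> l w\<bar> powr p = \<bar>\<Sum>k=1..<l. h (w k) (w l)\<bar> powr p / s powr p" for l w
    using s0 by (simp add: \<xi>_def powr_divide)
  have \<xi>_int: "integrable ?S (\<lambda>w. \<bar>\<xi> l w\<bar> powr p)" for l
    unfolding \<xi>_powr using row_sum_high_moment(1)[of l] by simp
  have L: "(\<Sum>l=1..n. \<integral>w. \<bar>\<xi> l w\<bar> powr p \<partial>?S) \<le> 96 * (N powr (1 - p / 2) * R)"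
  proof -
    have "(\<Sum>l=1..n. \<integral>w. \<bar>\<xi> l w\<bar> powr p \<partial>?S) \<le> (\<Sum>l=1..n. 12 * N powr (p / 2) * rho / s powr p)"
    proof (rule sum_mono)
      fix l assume l: "l \<in> {1..n}"
      have "(\<integral>w. \<bar>\<Sum>k=1..<l. h (w k) (w l)\<bar> powr p \<partial>?S) \<le> 12 * real l powr (p / 2) * rho"
        by (rule row_sum_high_moment)
      also have "\<dots> \<le> 12 * N powr (p / 2) * rho"
        using l p rho_nonneg by (intro mult_right_mono mult_left_mono powr_mono2) (auto simp: N_def)
      finally show "(\<integral>w. \<bar>\<xi> l w\<bar> powr p \<partial>?S) \<le> 12 * N powr (p / 2) * rho / s powr p"
        unfolding \<xi>_powr by (simp add: divide_right_mono)
    qed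
    also have "\<dots> = 12 * (N * N powr (p / 2) * rho) / s powr p" by (simp add: N_def)
    also have "\<dots> \<le> 8 * 12 * (N powr (1 - p / 2) * R)" by (rule scale) simp
    finally show ?thesis by simp
  qed
  have v_eq: "v l w = (\<Sum>i=1..<l. \<Sum>j=1..<l. G (w i) (w j)) / s\<^sup>2" if w: "w \<in> space ?S" for l w
  proof -
    have ws: "w i \<in> space M" for i using w by (rule space_iid_seq_comp)
    have int: "integrable M (\<lambda>z. h (w i) z * h (w j) z)" for i j
      by (rule integral_mult_square_le) (use ws h_sq in auto)
    have "v l w = (\<integral>z. (\<Sum>i=1..<l. \<Sum>j=1..<l. h (w i) z * h (w j) z) / s\<^sup>2 \<partial>M)"
      unfolding v_def \<xi>_upd by (simp add: power_divide power2_eq_square sum_product)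
    also have "\<dots> = (\<Sum>i=1..<l. \<Sum>j=1..<l. \<integral>z. h (w i) z * h (w j) z \<partial>M) / s\<^sup>2"
      using int by (simp add: Bochner_Integration.integral_sum Bochner_Integration.integrable_sum)
    also have "(\<lambda>i j. \<integral>z. h (w i) z * h (w j) z \<partial>M) = (\<lambda>i j. G (w i) (w j))"
      by (simp add: G_def h_sym[of _ "w _"])
    finally show ?thesis by meson
  qed
  \<comment> \<open>Up to 1 / s^2, the conditional variance of row l sums G (w i) (w j) over i, j <
    l. Over all rows its diagonal gives D, once sig2 is subtracted, and the rest gives 2 F; the
    weight is the number n - k of rows beyond the larger index k.\<close>
  define D where "D w = (\<Sum>k=1..n. real (n - k) * (G (w k) (w k) - sig2))" for w :: "nat \<Rightarrow> 'a"
  define F where "F w = (\<Sum>(j, k)\<in>lt_pairs n. real (n - k) * G (w j) (w k))" for w :: "nat \<Rightarrow> 'a"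
  have G_iid [measurable]: "(\<lambda>w. G (w i) (w j)) \<in> borel_measurable ?S" for i j
    by measurable
  have [measurable]: "D \<in> borel_measurable ?S" unfolding D_def by measurable
  have F_meas [measurable]: "F \<in> borel_measurable ?S" unfolding F_def split_def by measurable
  have V_eq: "(\<Sum>l=1..n. v l w) - 1 = D w / s\<^sup>2 + 2 * F w / s\<^sup>2" if w: "w \<in> space ?S" for w
  proof -
    have "(\<Sum>l=1..n. v l w) = (\<Sum>l=1..n. (\<Sum>k=1..<l. G (w k) (w k) + 2 * (\<Sum>j=1..<k. G (w j) (w k)))) / s\<^sup>2"
      using v_eq[OF w] sum_square_split[of "\<lambda>i j. G (w i) (w j)"] G_sym
      by (simp add: sum_divide_distrib[symmetric] sum.distrib sum_distrib_left[symmetric])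
    also have "\<dots> = (\<Sum>k=1..n. real (n - k) * (G (w k) (w k) + 2 * (\<Sum>j=1..<k. G (w j) (w k)))) / s\<^sup>2"
      by (subst sum_triangle_swap) simp
    also have "(\<Sum>k=1..n. real (n - k) * (G (w k) (w k) + 2 * (\<Sum>j=1..<k. G (w j) (w k))))
       = D w + (\<Sum>k=1..n. real (n - k)) * sig2 + 2 * F w"
      unfolding F_def sum_lt_pairs D_def
      by (simp add: algebra_simps sum.distrib sum_distrib_left sum_distrib_right sum_subtractf)
    also have "(\<Sum>k=1..n. real (n - k)) * sig2 = s\<^sup>2" unfolding sum_real_diff nf(2) ..
    finally show ?thesis using s0 by (simp add: field_simps)
  qed
  have sr: "(s\<^sup>2) powr (p / 2) = s powr p"
  proof -
    have "s\<^sup>2 = s powr 2" using s0 by simp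
    thus ?thesis by (simp only: powr_powr) simp
  qed
  have e2r: "1 / (e\<^sup>2 / 2) powr (p / 2) \<le> 3 * E"
  proof -
    have "e\<^sup>2 = e powr 2" using e by simp
    hence "(e\<^sup>2) powr (p / 2) = e powr p" by (simp only: powr_powr) simp
    hence q: "(e\<^sup>2 / 2) powr (p / 2) = e powr p / 2 powr (p / 2)"
      using e by (simp add: powr_divide)
    have "1 / (e\<^sup>2 / 2) powr (p / 2) = 2 powr (p / 2) * (1 / e powr p)" by (subst q) simp
    also have "1 / e powr p = E" by (simp add: E_def powr_minus_divide)
    finally have "1 / (e\<^sup>2 / 2) powr (p / 2) = 2 powr (p / 2) * E" .
    also have "\<dots> \<le> 3 * E" using powr_r_bounds(1) E0 by (rule mult_right_mono)
    finally show ?thesis .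
  qed
  \<comment> \<open>Markov with exponent p/2 at level e^2 / 2: the price e powr - p is the same as
    in the exchange.\<close>
  have mk: "measure ?S {w \<in> space ?S. e\<^sup>2 / 2 \<le> \<bar>X w\<bar>} \<le> 3 * c * E"
    if [measurable]: "X \<in> borel_measurable ?S" and "integrable ?S (\<lambda>w. \<bar>X w\<bar> powr (p / 2))" "(\<integral>w. \<bar>X w\<bar> powr (p / 2) \<partial>?S) \<le> c" for X c
  proof -
    have "0 \<le> (\<integral>w. \<bar>X w\<bar> powr (p / 2) \<partial>?S)" by simp
    hence c: "0 \<le> c" using that by linarith
    have "measure ?S {w \<in> space ?S. e\<^sup>2 / 2 \<le> \<bar>X w\<bar>} \<le> (\<integral>w. \<bar>X w\<bar> powr (p / 2) \<partial>?S) / (e\<^sup>2 / 2) powr (p / 2)"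
      using that e p by (intro S.markov_powr) auto
    also have "\<dots> \<le> c / (e\<^sup>2 / 2) powr (p / 2)" using that by (intro divide_right_mono) auto
    also have "\<dots> = c * (1 / (e\<^sup>2 / 2) powr (p / 2))" by simp
    also have "\<dots> \<le> c * (3 * E)" using e2r c by (rule mult_left_mono)
    finally show ?thesis by simp
  qed
  have PD: "measure ?S {w \<in> space ?S. e\<^sup>2 / 2 \<le> \<bar>D w / s\<^sup>2\<bar>} \<le> 3 * (96 * (N powr (1 - p / 2) * R)) * E"
  proof (rule mk)
    have eq: "\<bar>D w / s\<^sup>2\<bar> powr (p / 2) = \<bar>D w\<bar> powr (p / 2) / s powr p" for w
      by (simp add: powr_divide sr)
    show "integrable ?S (\<lambda>w. \<bar>D w / s\<^sup>2\<bar> powr (p / 2))"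
      unfolding eq using diag_sum_moment(1)[of n] by (simp add: D_def)
    have "(\<integral>w. \<bar>D w / s\<^sup>2\<bar> powr (p / 2) \<partial>?S) = (\<integral>w. \<bar>D w\<bar> powr (p / 2) \<partial>?S) / s powr p"
      unfolding eq by simp
    also have "\<dots> \<le> 4 * (N * N powr (p / 2) * (2 powr (p / 2) * rho)) / s powr p"
      using diag_sum_moment(2)[of n] by (intro divide_right_mono) (auto simp: D_def N_def)
    also have "\<dots> = (4 * 2 powr (p / 2)) * (N * N powr (p / 2) * rho) / s powr p" by simp
    also have "\<dots> \<le> 8 * (4 * 2 powr (p / 2)) * (N powr (1 - p / 2) * R)" by (rule scale) simp
    also have "\<dots> \<le> 8 * (4 * 3) * (N powr (1 - p / 2) * R)"
      using powr_r_bounds(1) R0 by (intro mult_right_mono mult_left_mono) auto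
    finally show "(\<integral>w. \<bar>D w / s\<^sup>2\<bar> powr (p / 2) \<partial>?S) \<le> 96 * (N powr (1 - p / 2) * R)" by simp
  qed measurable
  \<comment> \<open>Chebyshev on the off-diagonal part would cost e^(-4). Lowering its second moment
    to the p/2-th by Jensen costs e powr - p and produces the exponent p/4 of gam / sig2^2.\<close>
  have PF: "measure ?S {w \<in> space ?S. e\<^sup>2 / 2 \<le> \<bar>2 * F w / s\<^sup>2\<bar>} \<le> 3 * (23 * \<Gamma>) * E"
  proof (rule mk)
    have mom: "integrable ?S (\<lambda>w. (F w)\<^sup>2)" "(\<integral>w. (F w)\<^sup>2 \<partial>?S) = (\<Sum>a\<in>lt_pairs n. (real (n - snd a))\<^sup>2) * gam"
      using degenerate_sum_second_moment[OF G_meas G_sym G_mean G_sq2 finite_lt_pairs, of n "\<lambda>a. real (n - snd a)"]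
      by (auto simp: F_def gam_def lt_pairs_def)
    have int2: "integrable ?S (\<lambda>w. (2 * F w / s\<^sup>2)\<^sup>2)" using mom by (simp add: power_divide power_mult_distrib)
    have "(\<Sum>a\<in>lt_pairs n. (real (n - snd a))\<^sup>2) \<le> (\<Sum>a\<in>lt_pairs n. N\<^sup>2)"
      by (intro sum_mono power_mono) (auto simp: N_def)
    also have "\<dots> = N * (N - 1) / 2 * N\<^sup>2" by (simp add: card_lt_pairs N_def)
    also have "\<dots> \<le> N\<^sup>2 * N\<^sup>2" using N2 by (intro mult_right_mono) (auto simp: power2_eq_square algebra_simps)
    finally have c: "(\<Sum>a\<in>lt_pairs n. (real (n - snd a))\<^sup>2) \<le> N\<^sup>2 * N\<^sup>2" .
    have "(\<integral>w. (2 * F w / s\<^sup>2)\<^sup>2 \<partial>?S) = 4 * ((\<Sum>a\<in>lt_pairs n. (real (n - snd a))\<^sup>2) * gam) / (s\<^sup>2)\<^sup>2"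
      using mom by (simp add: power_divide power_mult_distrib)
    also have "\<dots> \<le> 4 * (N\<^sup>2 * N\<^sup>2 * gam) / (s\<^sup>2)\<^sup>2"
      using c gam_nonneg by (intro divide_right_mono mult_left_mono mult_right_mono) auto
    also have "\<dots> = 64 * (N\<^sup>2 * N\<^sup>2 * gam) / (4 * s\<^sup>2)\<^sup>2" by (simp add: power_mult_distrib)
    also have "\<dots> \<le> 64 * (N\<^sup>2 * N\<^sup>2 * gam) / (N\<^sup>2 * sig2)\<^sup>2"
      using nf(3) N2 sig s0 gam_nonneg by (intro divide_left_mono power_mono mult_pos_pos zero_less_power) (auto simp: N_def)
    also have "\<dots> = 64 * (gam / sig2\<^sup>2)" using N2 by (simp add: power_mult_distrib power2_eq_square)
    finally have m2: "(\<integral>w. (2 * F w / s\<^sup>2)\<^sup>2 \<partial>?S) \<le> 64 * (gam / sig2\<^sup>2)" .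
    have eq: "\<bar>2 * F w / s\<^sup>2\<bar> powr (p / 2) = ((2 * F w / s\<^sup>2)\<^sup>2) powr (p / 4)" for w
    proof -
      have sq: "x\<^sup>2 = \<bar>x\<bar> powr 2" for x :: real by simp
      have "(2 * F w / s\<^sup>2)\<^sup>2 = \<bar>2 * F w / s\<^sup>2\<bar> powr 2" by (rule sq)
      thus ?thesis by (simp only: powr_powr) simp
    qed
    have p4: "0 < p / 4" "p / 4 \<le> 1" using p by auto
    note jen = S.integral_powr_le_powr_integral[OF int2 _ p4]
    show "integrable ?S (\<lambda>w. \<bar>2 * F w / s\<^sup>2\<bar> powr (p / 2))" unfolding eq using jen by simp
    have "(\<integral>w. \<bar>2 * F w / s\<^sup>2\<bar> powr (p / 2) \<partial>?S) \<le> (\<integral>w. (2 * F w / s\<^sup>2)\<^sup>2 \<partial>?S) powr (p / 4)"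
      unfolding eq using jen by simp
    also have "\<dots> \<le> (64 * (gam / sig2\<^sup>2)) powr (p / 4)" using m2 p4 by (intro powr_mono2) auto
    also have "\<dots> = 64 powr (p / 4) * \<Gamma>" unfolding \<Gamma>_def by (rule powr_mult; simp add: gam_nonneg)
    also have "64 powr (p / 4) = (8 powr 2) powr (p / 4)" by simp
    also have "\<dots> = (8::real) powr (p / 2)" by (simp only: powr_powr) simp
    also have "\<dots> * \<Gamma> \<le> 23 * \<Gamma>" using powr_r_bounds(2) by (intro mult_right_mono) (auto simp: \<Gamma>_def)
    finally show "(\<integral>w. \<bar>2 * F w / s\<^sup>2\<bar> powr (p / 2) \<partial>?S) \<le> 23 * \<Gamma>" .
  qed measurable
  have PV: "measure ?S {w \<in> space ?S. e\<^sup>2 < \<bar>(\<Sum>l=1..n. v l w) - 1\<bar>}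
     \<le> 3 * (96 * (N powr (1 - p / 2) * R)) * E + 3 * (23 * \<Gamma>) * E"
  proof -
    have "measure ?S {w \<in> space ?S. e\<^sup>2 < \<bar>(\<Sum>l=1..n. v l w) - 1\<bar>}
      \<le> measure ?S ({w \<in> space ?S. e\<^sup>2 / 2 \<le> \<bar>D w / s\<^sup>2\<bar>} \<union> {w \<in> space ?S. e\<^sup>2 / 2 \<le> \<bar>2 * F w / s\<^sup>2\<bar>})"
    proof (rule S.finite_measure_mono)
      show "{w \<in> space ?S. e\<^sup>2 < \<bar>(\<Sum>l=1..n. v l w) - 1\<bar>} \<subseteq> {w \<in> space ?S. e\<^sup>2 / 2 \<le> \<bar>D w / s\<^sup>2\<bar>} \<union> {w \<in> space ?S. e\<^sup>2 / 2 \<le> \<bar>2 * F w / s\<^sup>2\<bar>}"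
      proof
        fix w assume "w \<in> {w \<in> space ?S. e\<^sup>2 < \<bar>(\<Sum>l=1..n. v l w) - 1\<bar>}"
        hence w: "w \<in> space ?S" and "e\<^sup>2 < \<bar>D w / s\<^sup>2 + 2 * F w / s\<^sup>2\<bar>" using V_eq by auto
        hence "e\<^sup>2 / 2 \<le> \<bar>D w / s\<^sup>2\<bar> \<or> e\<^sup>2 / 2 \<le> \<bar>2 * F w / s\<^sup>2\<bar>"
          using abs_triangle_ineq[of "D w / s\<^sup>2" "2 * F w / s\<^sup>2"] by argo
        thus "w \<in> {w \<in> space ?S. e\<^sup>2 / 2 \<le> \<bar>D w / s\<^sup>2\<bar>} \<union> {w \<in> space ?S. e\<^sup>2 / 2 \<le> \<bar>2 * F w / s\<^sup>2\<bar>}" using w by auto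
      qed
    qed measurable
    also have "\<dots> \<le> measure ?S {w \<in> space ?S. e\<^sup>2 / 2 \<le> \<bar>D w / s\<^sup>2\<bar>} + measure ?S {w \<in> space ?S. e\<^sup>2 / 2 \<le> \<bar>2 * F w / s\<^sup>2\<bar>}"
      by (rule measure_Un_le) measurable
    finally show ?thesis using PD PF by linarith
  qed
  have "\<bar>measure ?S {w \<in> space ?S. (\<Sum>l=1..n. \<xi> l w) \<le> a} - Phi a\<bar>
    \<le> 2 * (4 * e powr (-p) * (\<Sum>l=1..n. \<integral>w. \<bar>\<xi> l w\<bar> powr p \<partial>?S) + 8 * e
         + measure ?S {w \<in> space ?S. e\<^sup>2 < \<bar>(\<Sum>l=1..n. v l w) - 1\<bar>})"
  proof (rule martingale_Berry_Esseen)
    show "\<xi> l (w(k := z)) = \<xi> l w" if "l < k" for k l w z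
      unfolding \<xi>_def using that by (intro arg_cong2[where f = "(/)"] sum.cong) auto
  next
    fix l w assume w: "w \<in> space ?S"
    have ws: "w i \<in> space M" for i using w by (rule space_iid_seq_comp)
    show "integrable M (\<lambda>z. \<bar>\<xi> l (w(l := z))\<bar> powr p)"
    proof -
      have bd: "\<bar>\<xi> l (w(l := z))\<bar> powr p \<le> real (card {1..<l}) powr (p - 1) * (\<Sum>k=1..<l. \<bar>h (w k) z\<bar> powr p) / s powr p" for z
        unfolding \<xi>_upd using s0 p sum_abs_powr_le[of "{1..<l}" p "\<lambda>k. h (w k) z"]
        by (simp add: powr_divide divide_right_mono)
      show ?thesis
      proof (rule Bochner_Integration.integrable_bound)
        show "integrable M (\<lambda>z. real (card {1..<l}) powr (p - 1) * (\<Sum>k=1..<l. \<bar>h (w k) z\<bar> powr p) / s powr p)"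
          using h_int1 ws by (intro integrable_divide integrable_mult_right Bochner_Integration.integrable_sum) auto
        have [measurable]: "(\<lambda>z. \<xi> l (w(l := z))) \<in> borel_measurable M"
          by (rule measurable_compose[OF _ \<xi>_meas]) (use w in measurable)
        show "(\<lambda>z. \<bar>\<xi> l (w(l := z))\<bar> powr p) \<in> borel_measurable M" by measurable
        show "AE z in M. norm (\<bar>\<xi> l (w(l := z))\<bar> powr p) \<le> norm (real (card {1..<l}) powr (p - 1) * (\<Sum>k=1..<l. \<bar>h (w k) z\<bar> powr p) / s powr p)"
          unfolding real_norm_def abs_of_nonneg[OF powr_ge_zero] by (rule AE_I2, rule order.trans[OF bd abs_ge_self])
      qed
    qed
    have "integrable M (h (w k))" for k
      using abs_integral_powr_le(1)[OF h_meas_fst[OF ws] h_int1[OF ws]] p by simp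
    thus "(\<integral>z. \<xi> l (w(l := z)) \<partial>M) = 0"
      unfolding \<xi>_upd using h_mean ws by (simp add: Bochner_Integration.integral_sum)
  qed (use \<xi>_int p e in \<open>auto simp: v_def\<close>)
  also have "\<dots> \<le> 2 * (4 * E * (96 * (N powr (1 - p / 2) * R)) + 8 * e + (3 * (96 * (N powr (1 - p / 2) * R)) * E + 3 * (23 * \<Gamma>) * E))"
    unfolding E_def[symmetric] using L PV E0 by (intro mult_left_mono add_mono) auto
  also have "\<dots> = 16 * e + E * (1344 * (N powr (1 - p / 2) * R) + 138 * \<Gamma>)" by (simp add: algebra_simps)
  also have "\<dots> \<le> 2000 * e + E * (2000 * (N powr (1 - p / 2) * R) + 2000 * \<Gamma>)"
    using e E0 R0 by (intro add_mono mult_left_mono mult_right_mono) (auto simp: \<Gamma>_def)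
  also have "\<dots> = 2000 * (e + E * (N powr (1 - p / 2) * R + \<Gamma>))" by (simp add: algebra_simps)
  finally show ?thesis
    by (simp add: \<xi>_def sum_divide_distrib s_def N_def R_def \<Gamma>_def E_def)
qed

end

section \<open>U-centering\<close>

text \<open>A centered kernel need not vanish at equal arguments, whereas a distance array does, and
  U-centering sums over whole rows; zeroing the diagonal makes the two comparable.\<close>

definition hollow :: "('a \<Rightarrow> 'a \<Rightarrow> real) \<Rightarrow> (nat \<Rightarrow> 'a) \<Rightarrow> nat \<Rightarrow> nat \<Rightarrow> real" where
  "hollow h w k l = (if k = l then 0 else h (w k) (w l))"

text \<open>The sample distance covariance without its factor 1 / (n (n - 3)), which cancels in the
  correlation.\<close>

definition u_inner :: "nat \<Rightarrow> (nat \<Rightarrow> nat \<Rightarrow> real) \<Rightarrow> (nat \<Rightarrow> nat \<Rightarrow> real) \<Rightarrow> real" where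
  "u_inner n a b = (\<Sum>k=1..n. \<Sum>l\<in>{1..n} - {k}. u_center n a k l * u_center n b k l)"

lemma sum_off_diag:
  fixes f :: "nat \<Rightarrow> real"
  assumes "k \<in> {1..n}"
  shows "(\<Sum>l\<in>{1..n} - {k}. f l) = (\<Sum>l=1..n. f l) - f k"
  using assms by (simp add: sum_diff1)

text \<open>The diagonal takes no part in the shift, so row i gains (n - 2) \<phi> i plus the total
  of \<phi>; this is why U-centering divides by n - 2. The totals cancel against the grand
  sum.\<close>

lemma u_center_shift:
  assumes n: "3 \<le> n" and kl: "k \<in> {1..n}" "l \<in> {1..n}" "k \<noteq> l"
    and a: "\<And>k l. k \<noteq> l \<Longrightarrow> a k l = \<alpha> k l + \<phi> k + \<phi> l" "\<And>k. a k k = 0" "\<And>k. \<alpha> k k = 0"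
  shows "u_center n a k l = u_center n \<alpha> k l"
proof -
  define F where "F = (\<Sum>i=1..n. \<phi> i)"
  have a': "a i j = \<alpha> i j + (if i = j then 0 else \<phi> i + \<phi> j)" for i j using a by auto
  have row: "(\<Sum>j=1..n. a i j) = (\<Sum>j=1..n. \<alpha> i j) + F + (real n - 2) * \<phi> i" if i: "i \<in> {1..n}" for i
  proof -
    have "(\<Sum>j=1..n. a i j) = (\<Sum>j=1..n. \<alpha> i j) + (\<Sum>j=1..n. if i = j then 0 else \<phi> i + \<phi> j)"
      unfolding a' by (simp add: sum.distrib)
    also have "(\<Sum>j=1..n. if i = j then 0 else \<phi> i + \<phi> j) = (\<Sum>j\<in>{1..n} - {i}. \<phi> i + \<phi> j)"
      using i by (subst sum.remove[of _ i]) (auto intro!: sum.cong)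
    also have "\<dots> = F + (real n - 2) * \<phi> i"
      unfolding sum_off_diag[OF i] by (simp add: sum.distrib F_def algebra_simps)
    finally show ?thesis by simp
  qed
  have col: "(\<Sum>i=1..n. a i j) = (\<Sum>i=1..n. \<alpha> i j) + F + (real n - 2) * \<phi> j" if j: "j \<in> {1..n}" for j
  proof -
    have "(\<Sum>i=1..n. a i j) = (\<Sum>i=1..n. \<alpha> i j) + (\<Sum>i=1..n. if i = j then 0 else \<phi> i + \<phi> j)"
      unfolding a' by (simp add: sum.distrib)
    also have "(\<Sum>i=1..n. if i = j then 0 else \<phi> i + \<phi> j) = (\<Sum>i\<in>{1..n} - {j}. \<phi> i + \<phi> j)"
      using j by (subst sum.remove[of _ j]) (auto intro!: sum.cong)
    also have "\<dots> = F + (real n - 2) * \<phi> j"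
      unfolding sum_off_diag[OF j] by (simp add: sum.distrib F_def algebra_simps)
    finally show ?thesis by simp
  qed
  have tot: "(\<Sum>i=1..n. \<Sum>j=1..n. a i j) = (\<Sum>i=1..n. \<Sum>j=1..n. \<alpha> i j) + (real n - 1) * (2 * F)"
  proof -
    have "(\<Sum>i=1..n. \<Sum>j=1..n. a i j) = (\<Sum>i=1..n. (\<Sum>j=1..n. \<alpha> i j) + F + (real n - 2) * \<phi> i)"
      by (intro sum.cong refl row)
    also have "\<dots> = (\<Sum>i=1..n. \<Sum>j=1..n. \<alpha> i j) + (real n - 1) * (2 * F)"
      by (simp add: sum.distrib sum_distrib_left[symmetric] F_def) (simp add: algebra_simps)
    finally show ?thesis .
  qed
  have nz: "real n - 2 \<noteq> 0" "real n - 1 \<noteq> 0" using n by auto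
  have e1: "(x + F + (real n - 2) * \<phi> i) / (real n - 2) = x / (real n - 2) + F / (real n - 2) + \<phi> i" for x i
    using nz by (simp add: add_divide_distrib)
  have e2: "(x + (real n - 1) * (2 * F)) / ((real n - 1) * (real n - 2)) = x / ((real n - 1) * (real n - 2)) + 2 * F / (real n - 2)" for x
    unfolding add_divide_distrib nonzero_mult_divide_mult_cancel_left[OF nz(2)] ..
  show ?thesis
    unfolding u_center_def row[OF kl(1)] col[OF kl(2)] tot e1 e2 using kl a(1) by simp
qed

text \<open>Off the diagonal a U-centered array has vanishing row sums, so the corrections of the
  other array drop out and its raw entries remain. The last two terms on the right are the
  remainders that are later bounded through row sums.\<close>

lemma u_inner_eq:
  assumes n: "3 \<le> n"
    and a: "\<And>k l. a k l = a l k" "\<And>k. a k k = 0" and b: "\<And>k l. b k l = b l k" "\<And>k. b k k = 0"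
  shows "u_inner n a b = (\<Sum>k=1..n. \<Sum>l=1..n. a k l * b k l)
     - 2 * (\<Sum>k=1..n. (\<Sum>l=1..n. a k l) * (\<Sum>l=1..n. b k l)) / (real n - 2)
     + (\<Sum>k=1..n. \<Sum>l=1..n. a k l) * (\<Sum>k=1..n. \<Sum>l=1..n. b k l) / ((real n - 1) * (real n - 2))"
proof -
  have nz: "real n - 2 \<noteq> 0" "real n - 1 \<noteq> 0" using n by auto
  define r where "r c k = (\<Sum>l=1..n. c k l)" for c :: "nat \<Rightarrow> nat \<Rightarrow> real" and k
  define t where "t c = (\<Sum>k=1..n. r c k)" for c
  have u: "u_center n c k l = c k l - (r c k + r c l) / (real n - 2) + t c / ((real n - 1) * (real n - 2))"
    if "\<And>k l. c k l = c l k" for c :: "nat \<Rightarrow> nat \<Rightarrow> real" and k l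
  proof -
    have "(\<Sum>i=1..n. c i l) = r c l" unfolding r_def using that by simp
    thus ?thesis by (simp add: u_center_def r_def t_def add_divide_distrib)
  qed
  define m where "m = real n - 2"
  define q where "q = t a / ((real n - 1) * (real n - 2))"
  have m0: "m \<noteq> 0" using nz by (simp add: m_def)
  have row0: "(\<Sum>l\<in>{1..n} - {k}. u_center n a k l) = 0" if k: "k \<in> {1..n}" for k
  proof -
    have "(\<Sum>l\<in>{1..n} - {k}. u_center n a k l) = (\<Sum>l=1..n. a k l - (r a k + r a l) / m + q) - (a k k - (r a k + r a k) / m + q)"
      unfolding sum_off_diag[OF k] by (simp add: u[OF a(1)] m_def q_def)
    also have "(\<Sum>l=1..n. a k l - (r a k + r a l) / m + q) = r a k - (real n * r a k + t a) / m + real n * q"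
      by (simp add: sum.distrib sum_subtractf sum_divide_distrib[symmetric] r_def t_def)
    finally have "(\<Sum>l\<in>{1..n} - {k}. u_center n a k l) = r a k - (m * r a k + t a) / m + (real n - 1) * q"
      by (simp add: a(2) m_def field_simps diff_divide_distrib add_divide_distrib)
    also have "(real n - 1) * q = t a / m" using nz by (simp add: q_def m_def)
    finally show ?thesis using m0 by (simp add: add_divide_distrib)
  qed
  have u_sym: "u_center n a k l = u_center n a l k" for k l
    unfolding u[OF a(1)] using a(1) by (simp add: add.commute)
  have "u_inner n a b = (\<Sum>k=1..n. \<Sum>l\<in>{1..n} - {k}. u_center n a k l * b k l
      - u_center n a k l * r b k / m - u_center n a k l * r b l / m + u_center n a k l * (t b / ((real n - 1) * m)))"
    unfolding u_inner_def u[OF b(1)] by (intro sum.cong refl) (simp add: m_def algebra_simps add_divide_distrib)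
  also have "\<dots> = (\<Sum>k=1..n. \<Sum>l\<in>{1..n} - {k}. u_center n a k l * b k l)
      - (\<Sum>k=1..n. (\<Sum>l\<in>{1..n} - {k}. u_center n a k l) * r b k / m)
      - (\<Sum>k=1..n. \<Sum>l\<in>{1..n} - {k}. u_center n a k l * r b l / m)
      + (\<Sum>k=1..n. (\<Sum>l\<in>{1..n} - {k}. u_center n a k l) * (t b / ((real n - 1) * m)))"
    by (simp add: sum.distrib sum_subtractf sum_distrib_right sum_divide_distrib)
  also have "(\<Sum>k=1..n. \<Sum>l\<in>{1..n} - {k}. u_center n a k l * r b l / m)
      = (\<Sum>l=1..n. \<Sum>k\<in>{1..n} - {l}. u_center n a k l * r b l / m)"
  proof -
    let ?g = "\<lambda>k l. u_center n a k l * r b l / m"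
    have "(\<Sum>k=1..n. \<Sum>l\<in>{1..n} - {k}. ?g k l) = (\<Sum>k\<in>{1..n}. \<Sum>l | l \<in> {1..n} \<and> k \<noteq> l. ?g k l)"
      by (intro sum.cong refl) auto
    also have "\<dots> = (\<Sum>l\<in>{1..n}. \<Sum>k | k \<in> {1..n} \<and> k \<noteq> l. ?g k l)"
      by (rule sum.swap_restrict) auto
    also have "\<dots> = (\<Sum>l=1..n. \<Sum>k\<in>{1..n} - {l}. ?g k l)"
      by (intro sum.cong refl) auto
    finally show ?thesis .
  qed
  also have "\<dots> = (\<Sum>l=1..n. (\<Sum>k\<in>{1..n} - {l}. u_center n a l k) * r b l / m)"
    by (simp add: sum_distrib_right sum_divide_distrib u_sym)
  also have "(\<Sum>k=1..n. \<Sum>l\<in>{1..n} - {k}. u_center n a k l * b k l)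
      - (\<Sum>k=1..n. (\<Sum>l\<in>{1..n} - {k}. u_center n a k l) * r b k / m)
      - (\<Sum>l=1..n. (\<Sum>k\<in>{1..n} - {l}. u_center n a l k) * r b l / m)
      + (\<Sum>k=1..n. (\<Sum>l\<in>{1..n} - {k}. u_center n a k l) * (t b / ((real n - 1) * m)))
      = (\<Sum>k=1..n. \<Sum>l\<in>{1..n} - {k}. u_center n a k l * b k l)"
    using row0 by simp
  \<comment> \<open>The diagonal may be put back because b vanishes there, although the U-centered
    array need not.\<close>
  also have "\<dots> = (\<Sum>k=1..n. \<Sum>l=1..n. u_center n a k l * b k l)"
    by (rule sum.cong[OF refl], subst sum_off_diag) (auto simp: b(2))
  also have "\<dots> = (\<Sum>k=1..n. \<Sum>l=1..n. a k l * b k l - r a k * b k l / m - r a l * b k l / m + q * b k l)"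
    unfolding u[OF a(1)] by (intro sum.cong refl) (simp add: m_def q_def algebra_simps add_divide_distrib)
  also have "\<dots> = (\<Sum>k=1..n. \<Sum>l=1..n. a k l * b k l) - (\<Sum>k=1..n. r a k * r b k) / m
     - (\<Sum>k=1..n. \<Sum>l=1..n. r a l * b k l) / m + q * t b"
    by (simp add: sum.distrib sum_subtractf sum_distrib_left sum_divide_distrib r_def t_def)
  also have "(\<Sum>k=1..n. \<Sum>l=1..n. r a l * b k l) = (\<Sum>k=1..n. r a k * r b k)"
    by (subst sum.swap) (simp add: r_def b(1)[of _ "_ :: nat"] sum_distrib_left[symmetric] b(1))
  finally show ?thesis
    by (simp add: r_def t_def m_def q_def)
qed

section \<open>Concentration of the studentizing terms\<close>

lemma hollow_sym: "(\<And>x y. h x y = h y x) \<Longrightarrow> hollow h w k l = hollow h w l k"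
  by (simp add: hollow_def)

lemma hollow_diag [simp]: "hollow h w k k = 0"
  by (simp add: hollow_def)

lemma hollow_mult: "hollow f w k l * hollow g w k l = hollow (\<lambda>x y. f x y * g x y) w k l"
  by (simp add: hollow_def)

lemma sum_hollow_eq:
  assumes "\<And>x y. h x y = h y x"
  shows "(\<Sum>k=1..n. \<Sum>l=1..n. hollow h w k l) = 2 * (\<Sum>l=1..n. \<Sum>k=1..<l. h (w k) (w l))"
proof -
  have "{1..n} = {1..<Suc n}" by auto
  hence "(\<Sum>k=1..n. \<Sum>l=1..n. hollow h w k l) = (\<Sum>k=1..<Suc n. \<Sum>l=1..<Suc n. hollow h w k l)" by simp
  also have "\<dots> = 2 * (\<Sum>l=1..<Suc n. \<Sum>k=1..<l. hollow h w k l)"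
    unfolding sum_square_split[of "hollow h w" "Suc n", OF hollow_sym[of h w, OF assms]] by (simp del: sum.op_ivl_Suc)
  also have "(\<Sum>l=1..<Suc n. \<Sum>k=1..<l. hollow h w k l) = (\<Sum>l=1..n. \<Sum>k=1..<l. h (w k) (w l))"
    by (intro sum.cong) (auto simp: hollow_def)
  finally show ?thesis .
qed

definition rowsum :: "('a \<Rightarrow> 'a \<Rightarrow> real) \<Rightarrow> nat \<Rightarrow> (nat \<Rightarrow> 'a) \<Rightarrow> nat \<Rightarrow> real" where
  "rowsum h n w k = (\<Sum>l=1..n. hollow h w k l)"

context degenerate_kernel
begin

lemma hollow_meas [measurable]: "(\<lambda>w. hollow h w k l) \<in> borel_measurable (iid_seq M)"
  unfolding hollow_def by (cases "k = l") auto

lemma rowsum_meas [measurable]: "(\<lambda>w. rowsum h n w k) \<in> borel_measurable (iid_seq M)"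
  unfolding rowsum_def by measurable

lemma hollow_cov:
  "integrable (iid_seq M) (\<lambda>w. hollow h w i j * hollow h w k l)"
  "(\<integral>w. hollow h w i j * hollow h w k l \<partial>iid_seq M) = (if i \<noteq> j \<and> k \<noteq> l \<and> {i, j} = {k, l} then sig2 else 0)"
proof -
  have "integrable (iid_seq M) (\<lambda>w. hollow h w i j * hollow h w k l) \<and>
    (\<integral>w. hollow h w i j * hollow h w k l \<partial>iid_seq M) = (if i \<noteq> j \<and> k \<noteq> l \<and> {i, j} = {k, l} then sig2 else 0)"
  proof (cases "i \<noteq> j \<and> k \<noteq> l")
    case True
    thus ?thesis using degenerate_orthogonal[OF h_meas h_sym h_mean h_sq2, of i j k l]
      by (simp add: hollow_def sig2_def)
  next
    case False
    hence "(\<lambda>w. hollow h w i j * hollow h w k l) = (\<lambda>_. 0)" by (auto simp: hollow_def)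
    thus ?thesis using False by auto
  qed
  thus "integrable (iid_seq M) (\<lambda>w. hollow h w i j * hollow h w k l)"
    "(\<integral>w. hollow h w i j * hollow h w k l \<partial>iid_seq M) = (if i \<noteq> j \<and> k \<noteq> l \<and> {i, j} = {k, l} then sig2 else 0)"
    by blast+
qed

text \<open>Different rows k and l share just the unordered pair {k, l}, while a row shares n - 1
  pairs with itself.\<close>

lemma rowsum_cov:
  assumes k: "k \<in> {1..n}" "l \<in> {1..n}"
  shows "integrable (iid_seq M) (\<lambda>w. rowsum h n w k * rowsum h n w l)"
    "(\<integral>w. rowsum h n w k * rowsum h n w l \<partial>iid_seq M) = (if k = l then real n - 1 else 1) * sig2"
proof -
  have eq: "rowsum h n w k * rowsum h n w l = (\<Sum>i=1..n. \<Sum>j=1..n. hollow h w k i * hollow h w l j)" for w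
    by (simp add: rowsum_def sum_product)
  show "integrable (iid_seq M) (\<lambda>w. rowsum h n w k * rowsum h n w l)"
    unfolding eq by (intro Bochner_Integration.integrable_sum hollow_cov)
  have "(\<integral>w. rowsum h n w k * rowsum h n w l \<partial>iid_seq M)
      = (\<Sum>i=1..n. \<Sum>j=1..n. if k \<noteq> i \<and> l \<noteq> j \<and> {k, i} = {l, j} then sig2 else 0)"
    unfolding eq using hollow_cov
    by (simp add: Bochner_Integration.integral_sum Bochner_Integration.integrable_sum)
  also have "\<dots> = (if k = l then real n - 1 else 1) * sig2"
  proof (cases "k = l")
    case True
    have "(\<Sum>i=1..n. \<Sum>j=1..n. if k \<noteq> i \<and> l \<noteq> j \<and> {k, i} = {l, j} then sig2 else 0)
       = (\<Sum>i=1..n. \<Sum>j=1..n. if j = i then (if k = i then 0 else sig2) else 0)"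
      using True by (intro sum.cong refl) (auto simp: doubleton_eq_iff)
    also have "\<dots> = (\<Sum>i=1..n. if k = i then 0 else sig2)" by simp
    also have "\<dots> = (\<Sum>i\<in>{1..n} - {k}. sig2)" using k by (subst sum.remove[of _ k]) auto
    also have "\<dots> = (real n - 1) * sig2" using k by (subst sum_off_diag) (auto simp: algebra_simps)
    finally show ?thesis using True by simp
  next
    case False
    have "(\<Sum>i=1..n. \<Sum>j=1..n. if k \<noteq> i \<and> l \<noteq> j \<and> {k, i} = {l, j} then sig2 else 0)
       = (\<Sum>i=1..n. \<Sum>j=1..n. if j = k then (if i = l then sig2 else 0) else 0)"
      using False by (intro sum.cong refl) (auto simp: doubleton_eq_iff)
    also have "\<dots> = sig2" using k by simp
    finally show ?thesis using False by simp
  qed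
  finally show "(\<integral>w. rowsum h n w k * rowsum h n w l \<partial>iid_seq M) = (if k = l then real n - 1 else 1) * sig2" .
qed

lemma sum_row_sq:
  "integrable (iid_seq M) (\<lambda>w. \<Sum>k=1..n. (rowsum h n w k)\<^sup>2)"
  "(\<integral>w. (\<Sum>k=1..n. (rowsum h n w k)\<^sup>2) \<partial>iid_seq M) = real n * (real n - 1) * sig2"
proof -
  have i: "integrable (iid_seq M) (\<lambda>w. (rowsum h n w k)\<^sup>2)"
    "(\<integral>w. (rowsum h n w k)\<^sup>2 \<partial>iid_seq M) = (real n - 1) * sig2" if "k \<in> {1..n}" for k
    using rowsum_cov[OF that that] by (simp_all add: power2_eq_square)
  show "integrable (iid_seq M) (\<lambda>w. \<Sum>k=1..n. (rowsum h n w k)\<^sup>2)"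
    by (intro Bochner_Integration.integrable_sum i)
  have "(\<integral>w. (\<Sum>k=1..n. (rowsum h n w k)\<^sup>2) \<partial>iid_seq M) = (\<Sum>k=1..n. (real n - 1) * sig2)"
    using i by (subst Bochner_Integration.integral_sum) (auto intro!: sum.cong)
  thus "(\<integral>w. (\<Sum>k=1..n. (rowsum h n w k)\<^sup>2) \<partial>iid_seq M) = real n * (real n - 1) * sig2" by simp
qed

lemma total_sq:
  "integrable (iid_seq M) (\<lambda>w. (\<Sum>k=1..n. rowsum h n w k)\<^sup>2)"
  "(\<integral>w. (\<Sum>k=1..n. rowsum h n w k)\<^sup>2 \<partial>iid_seq M) = 2 * real n * (real n - 1) * sig2"
proof -
  have eq: "(\<Sum>k=1..n. rowsum h n w k)\<^sup>2 = (\<Sum>k=1..n. \<Sum>l=1..n. rowsum h n w k * rowsum h n w l)" for w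
    by (simp add: power2_eq_square sum_product)
  show "integrable (iid_seq M) (\<lambda>w. (\<Sum>k=1..n. rowsum h n w k)\<^sup>2)"
    unfolding eq by (intro Bochner_Integration.integrable_sum rowsum_cov)
  have "(\<integral>w. (\<Sum>k=1..n. rowsum h n w k)\<^sup>2 \<partial>iid_seq M) = (\<Sum>k=1..n. \<Sum>l=1..n. (if k = l then real n - 1 else 1) * sig2)"
  proof -
    have "(\<integral>w. (\<Sum>k=1..n. \<Sum>l=1..n. rowsum h n w k * rowsum h n w l) \<partial>iid_seq M)
        = (\<Sum>k=1..n. \<integral>w. (\<Sum>l=1..n. rowsum h n w k * rowsum h n w l) \<partial>iid_seq M)"
      by (rule Bochner_Integration.integral_sum) (intro Bochner_Integration.integrable_sum rowsum_cov)
    also have "\<dots> = (\<Sum>k=1..n. \<Sum>l=1..n. \<integral>w. rowsum h n w k * rowsum h n w l \<partial>iid_seq M)"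
      by (intro sum.cong refl Bochner_Integration.integral_sum rowsum_cov)
    also have "\<dots> = (\<Sum>k=1..n. \<Sum>l=1..n. (if k = l then real n - 1 else 1) * sig2)"
      by (intro sum.cong refl rowsum_cov(2))
    finally show ?thesis unfolding eq .
  qed
  also have "\<dots> = (\<Sum>k=1..n. \<Sum>l=1..n. sig2 + (if k = l then (real n - 2) * sig2 else 0))"
    by (intro sum.cong refl) (auto simp: algebra_simps)
  also have "\<dots> = 2 * real n * (real n - 1) * sig2"
    by (simp add: sum.distrib) (simp add: algebra_simps)
  finally show "(\<integral>w. (\<Sum>k=1..n. rowsum h n w k)\<^sup>2 \<partial>iid_seq M) = 2 * real n * (real n - 1) * sig2" .
qed

lemma h_sq_powr: "((h x y)\<^sup>2) powr (p / 2) = \<bar>h x y\<bar> powr p"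
proof -
  have "(h x y)\<^sup>2 = \<bar>h x y\<bar> powr 2" by simp
  thus ?thesis by (simp only: powr_powr) simp
qed

text \<open>h^2 - sig2 is split as (h^2 - G (w k) (w k)) + (G (w k) (w k) - sig2). Summed over k <
  l, the first part is a martingale difference in l and the second is the weighted diagonal sum;
  both have p/2 moments and use von Bahr--Esseen.\<close>

lemma square_sum_moment:
  "integrable (iid_seq M) (\<lambda>w. \<bar>\<Sum>l=1..n. \<Sum>k=1..<l. (h (w k) (w l))\<^sup>2 - sig2\<bar> powr (p / 2))"
  "(\<integral>w. \<bar>\<Sum>l=1..n. \<Sum>k=1..<l. (h (w k) (w l))\<^sup>2 - sig2\<bar> powr (p / 2) \<partial>iid_seq M)
     \<le> 48 * (real n * real n powr (p / 2) * rho)"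
proof -
  define N where "N = real n"
  define r where "r = p / 2"
  have r: "1 < r" "r \<le> 3/2" using p by (auto simp: r_def)
  define c where "c = 2 powr r * rho"
  have c0: "0 \<le> c" using rho_nonneg by (simp add: c_def)
  have G_iid [measurable]: "(\<lambda>w. G (w i) (w j)) \<in> borel_measurable (iid_seq M)" for i j
    by measurable
  define \<xi> where "\<xi> l w = (\<Sum>k=1..<l. (h (w k) (w l))\<^sup>2 - G (w k) (w k))" for l and w :: "nat \<Rightarrow> 'a"
  have [measurable]: "\<xi> l \<in> borel_measurable (iid_seq M)" for l unfolding \<xi>_def by measurable
  have tm: "integrable (iid_seq M) (\<lambda>w. \<bar>(h (w k) (w l))\<^sup>2 - G (w k) (w k)\<bar> powr r)"
    "(\<integral>w. \<bar>(h (w k) (w l))\<^sup>2 - G (w k) (w k)\<bar> powr r \<partial>iid_seq M) \<le> c" if "k < l" for k l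
  proof -
    have X: "integrable (iid_seq M) (\<lambda>w. \<bar>(h (w k) (w l))\<^sup>2\<bar> powr r)"
      "(\<integral>w. \<bar>(h (w k) (w l))\<^sup>2\<bar> powr r \<partial>iid_seq M) \<le> rho"
      using integrable_iid_seq_comp2_iff[of "\<lambda>(x, y). \<bar>h x y\<bar> powr p" k l] h_int2 that
        integral_iid_seq_comp2[of "\<lambda>(x, y). \<bar>h x y\<bar> powr p" k l]
      by (auto simp: r_def h_sq_powr rho_def)
    have Y: "integrable (iid_seq M) (\<lambda>w. \<bar>G (w k) (w k)\<bar> powr r)"
      "(\<integral>w. \<bar>G (w k) (w k)\<bar> powr r \<partial>iid_seq M) \<le> rho"
      using integrable_iid_seq_comp_iff[of "\<lambda>x. \<bar>G x x\<bar> powr (p / 2)" k] G_diag_powr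
        integral_iid_seq_comp[of "\<lambda>x. \<bar>G x x\<bar> powr (p / 2)" k]
      by (auto simp: r_def)
    show "integrable (iid_seq M) (\<lambda>w. \<bar>(h (w k) (w l))\<^sup>2 - G (w k) (w k)\<bar> powr r)"
      "(\<integral>w. \<bar>(h (w k) (w l))\<^sup>2 - G (w k) (w k)\<bar> powr r \<partial>iid_seq M) \<le> c"
      using S.centered_powr_moment[OF _ _ X Y] r by (auto simp: c_def)
  qed
  \<comment> \<open>Inside a row only convexity is used and no cancellation; N rows of size N^r c
    are still of the order of the diagonal sum.\<close>
  have \<xi>_bd: "\<bar>\<xi> l w\<bar> powr r \<le> N powr (r - 1) * (\<Sum>k=1..<l. \<bar>(h (w k) (w l))\<^sup>2 - G (w k) (w k)\<bar> powr r)"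
    if "l \<in> {1..n}" for l w
  proof -
    have "\<bar>\<xi> l w\<bar> powr r \<le> real (card {1..<l}) powr (r - 1) * (\<Sum>k=1..<l. \<bar>(h (w k) (w l))\<^sup>2 - G (w k) (w k)\<bar> powr r)"
      unfolding \<xi>_def using r by (intro sum_abs_powr_le) auto
    also have "\<dots> \<le> N powr (r - 1) * (\<Sum>k=1..<l. \<bar>(h (w k) (w l))\<^sup>2 - G (w k) (w k)\<bar> powr r)"
      using that r by (intro mult_right_mono powr_mono2) (auto simp: N_def intro: sum_nonneg)
    finally show ?thesis .
  qed
  have i_bd: "integrable (iid_seq M) (\<lambda>w. N powr (r - 1) * (\<Sum>k=1..<l. \<bar>(h (w k) (w l))\<^sup>2 - G (w k) (w k)\<bar> powr r))" for l
    using tm by (intro integrable_mult_right Bochner_Integration.integrable_sum) auto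
  have \<xi>_int: "integrable (iid_seq M) (\<lambda>w. \<bar>\<xi> l w\<bar> powr r)" if "l \<in> {1..n}" for l
    by (rule Bochner_Integration.integrable_bound[OF i_bd[of l]])
       (simp, rule AE_I2, unfold real_norm_def abs_of_nonneg[OF powr_ge_zero], rule order.trans[OF \<xi>_bd[OF that] abs_ge_self])
  have NN: "N powr (r - 1) * (N * c) = N powr r * c"
    using powr_mult_base[of N "r - 1"] by (simp add: N_def algebra_simps)
  have \<xi>_mom: "(\<integral>w. \<bar>\<xi> l w\<bar> powr r \<partial>iid_seq M) \<le> N powr r * c" if l: "l \<in> {1..n}" for l
  proof -
    have "(\<integral>w. \<bar>\<xi> l w\<bar> powr r \<partial>iid_seq M)
      \<le> (\<integral>w. N powr (r - 1) * (\<Sum>k=1..<l. \<bar>(h (w k) (w l))\<^sup>2 - G (w k) (w k)\<bar> powr r) \<partial>iid_seq M)"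
      using \<xi>_int[OF l] i_bd \<xi>_bd[OF l] by (intro integral_mono) auto
    also have "\<dots> = N powr (r - 1) * (\<Sum>k=1..<l. (\<integral>w. \<bar>(h (w k) (w l))\<^sup>2 - G (w k) (w k)\<bar> powr r \<partial>iid_seq M))"
      using tm by (simp add: Bochner_Integration.integral_sum)
    also have "\<dots> \<le> N powr (r - 1) * (\<Sum>k=1..<l. c)"
      using tm by (intro mult_left_mono sum_mono) auto
    also have "\<dots> \<le> N powr (r - 1) * (N * c)"
      using l c0 by (intro mult_left_mono) (auto simp: N_def intro: mult_right_mono)
    finally show ?thesis using NN by simp
  qed
  have vbe: "integrable (iid_seq M) (\<lambda>w. \<bar>\<Sum>l=1..n. \<xi> l w\<bar> powr r) \<and>
    (\<integral>w. \<bar>\<Sum>l=1..n. \<xi> l w\<bar> powr r \<partial>iid_seq M) \<le> 4 * (\<Sum>l=1..n. \<integral>w. \<bar>\<xi> l w\<bar> powr r \<partial>iid_seq M)"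
  proof (rule von_bahr_esseen)
    show "\<xi> l (w(k := z)) = \<xi> l w" if "l < k" for k l w z
      unfolding \<xi>_def using that by (intro sum.cong) auto
    fix l w assume w: "w \<in> space (iid_seq M)"
    have ws: "w i \<in> space M" for i using w by (rule space_iid_seq_comp)
    have "\<xi> l (w(l := z)) = (\<Sum>k=1..<l. (h (w k) z)\<^sup>2 - G (w k) (w k))" for z
      unfolding \<xi>_def by (intro sum.cong) auto
    thus "(\<integral>z. \<xi> l (w(l := z)) \<partial>M) = 0"
      using h_sq[OF ws] G_diag by (simp add: Bochner_Integration.integral_sum prob_space)
  qed (use \<xi>_int r in auto)
  have A: "(\<integral>w. \<bar>\<Sum>l=1..n. \<xi> l w\<bar> powr r \<partial>iid_seq M) \<le> 4 * (N * (N powr r * c))"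
  proof -
    have "(\<Sum>l=1..n. \<integral>w. \<bar>\<xi> l w\<bar> powr r \<partial>iid_seq M) \<le> real (card {1..n}) * (N powr r * c)"
      by (rule sum_bounded_above) (rule \<xi>_mom)
    thus ?thesis using vbe by (simp add: N_def)
  qed
  define D where "D w = (\<Sum>k=1..n. real (n - k) * (G (w k) (w k) - sig2))" for w :: "nat \<Rightarrow> 'a"
  have B: "integrable (iid_seq M) (\<lambda>w. \<bar>D w\<bar> powr r)" "(\<integral>w. \<bar>D w\<bar> powr r \<partial>iid_seq M) \<le> 4 * (N * N powr r * c)"
    using diag_sum_moment[of n] by (auto simp: D_def r_def N_def c_def)
  have [measurable]: "D \<in> borel_measurable (iid_seq M)" unfolding D_def by measurable
  have eq: "(\<Sum>l=1..n. \<Sum>k=1..<l. (h (w k) (w l))\<^sup>2 - sig2) = (\<Sum>l=1..n. \<xi> l w) - (- D w)" for w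
  proof -
    have "D w = (\<Sum>l=1..n. \<Sum>k=1..<l. G (w k) (w k) - sig2)"
      unfolding D_def by (rule sum_triangle_swap[symmetric])
    thus ?thesis by (simp add: \<xi>_def sum.distrib[symmetric])
  qed
  have fin: "integrable (iid_seq M) (\<lambda>w. \<bar>(\<Sum>l=1..n. \<xi> l w) - (- D w)\<bar> powr r)"
    "(\<integral>w. \<bar>(\<Sum>l=1..n. \<xi> l w) - (- D w)\<bar> powr r \<partial>iid_seq M) \<le> 2 powr r * (4 * (N * N powr r * c))"
    using S.centered_powr_moment[of "\<lambda>w. \<Sum>l=1..n. \<xi> l w" "\<lambda>w. - D w" r "4 * (N * N powr r * c)"] vbe A B r
    by (auto simp: mult.assoc)
  show "integrable (iid_seq M) (\<lambda>w. \<bar>\<Sum>l=1..n. \<Sum>k=1..<l. (h (w k) (w l))\<^sup>2 - sig2\<bar> powr (p / 2))"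
    unfolding eq using fin by (simp add: r_def)
  have "2 powr r * (4 * (N * N powr r * c)) = (2 powr r * 2 powr r) * (4 * (N * N powr r * rho))" by (simp add: c_def)
  also have "2 powr r * 2 powr r = (4::real) powr r" by (simp flip: powr_mult)
  also have "(4::real) powr r * (4 * (N * N powr r * rho)) \<le> 8 * (4 * (N * N powr r * rho))"
    using powr_r_bounds(3) rho_nonneg by (intro mult_right_mono) (auto simp: r_def N_def)
  also have "\<dots> \<le> 48 * (N * N powr r * rho)" using rho_nonneg by (simp add: N_def)
  finally have X: "2 powr r * (4 * (N * N powr r * c)) \<le> 48 * (N * N powr r * rho)" .
  show "(\<integral>w. \<bar>\<Sum>l=1..n. \<Sum>k=1..<l. (h (w k) (w l))\<^sup>2 - sig2\<bar> powr (p / 2) \<partial>iid_seq M)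
     \<le> 48 * (real n * real n powr (p / 2) * rho)"
    unfolding eq using order.trans[OF fin(2) X] by (simp only: r_def N_def)
qed

text \<open>The fluctuation U of the squares is treated by its p/2-th moment. For the row-sum
  corrections X a first moment is enough, as they are a difference of nonnegative terms with
  expectation O(1/n).\<close>

lemma u_inner_concentration:
  assumes n: "4 \<le> n" and sig: "0 < sig2" and e: "0 < e" "e \<le> 1"
  shows "measure (iid_seq M) {w \<in> space (iid_seq M). e \<le> \<bar>u_inner n (hollow h w) (hollow h w) / (2 * (normalizer n)\<^sup>2) - 1\<bar>}
    \<le> 1152 * (e powr (- p / 2) * (real n powr (1 - p / 2) * (rho / sig2 powr (p / 2)))) + 16 / (real n * e)"
proof -
  let ?S = "iid_seq M"
  define s where "s = normalizer n"
  define N where "N = real n"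
  have n2: "2 \<le> n" using n by simp
  note nf = normalizer_facts[OF n2 sig, folded s_def]
  note scale = normalizer_scale[OF n2 sig, folded s_def]
  have N4: "4 \<le> N" using n by (simp add: N_def)
  define U where "U w = (\<Sum>l=1..n. \<Sum>k=1..<l. (h (w k) (w l))\<^sup>2 - sig2)" for w :: "nat \<Rightarrow> 'a"
  define A where "A w = (\<Sum>k=1..n. (rowsum h n w k)\<^sup>2)" for w
  define B where "B w = (\<Sum>k=1..n. rowsum h n w k)\<^sup>2" for w
  define X where "X w = (- 2 * A w / (N - 2) + B w / ((N - 1) * (N - 2))) / (2 * s\<^sup>2)" for w
  have [measurable]: "U \<in> borel_measurable ?S" "A \<in> borel_measurable ?S" "B \<in> borel_measurable ?S"
    unfolding U_def A_def B_def by measurable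
  have [measurable]: "X \<in> borel_measurable ?S" unfolding X_def by measurable
  have eq: "u_inner n (hollow h w) (hollow h w) / (2 * s\<^sup>2) - 1 = U w / s\<^sup>2 + X w" for w
  proof -
    have sq: "(\<Sum>k=1..n. \<Sum>l=1..n. hollow h w k l * hollow h w k l) = 2 * (U w + s\<^sup>2)"
    proof -
      have "(\<Sum>k=1..n. \<Sum>l=1..n. hollow h w k l * hollow h w k l) = 2 * (\<Sum>l=1..n. \<Sum>k=1..<l. h (w k) (w l) * h (w k) (w l))"
        unfolding hollow_mult by (rule sum_hollow_eq) (simp add: h_sym)
      also have "(\<Sum>l=1..n. \<Sum>k=1..<l. h (w k) (w l) * h (w k) (w l)) = U w + (\<Sum>l=1..n. \<Sum>k=1..<l. sig2)"
        by (simp only: U_def sum.distrib[symmetric]) (simp add: power2_eq_square)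
      also have "(\<Sum>l=1..n. \<Sum>k=1..<l. sig2) = s\<^sup>2"
        unfolding sum_triangle_swap nf(2) sum_real_diff[symmetric] by (simp add: sum_distrib_right)
      finally show ?thesis .
    qed
    have "u_inner n (hollow h w) (hollow h w) = 2 * (U w + s\<^sup>2) - 2 * A w / (N - 2) + B w / ((N - 1) * (N - 2))"
      using u_inner_eq[of n "hollow h w" "hollow h w"] n hollow_sym[of h w, OF h_sym] sq
      by (simp add: rowsum_def A_def B_def power2_eq_square N_def)
    thus ?thesis using nf(1) by (simp add: X_def field_simps)
  qed
  have PU: "measure ?S {w \<in> space ?S. e / 2 \<le> \<bar>U w / s\<^sup>2\<bar>} \<le> 1152 * (e powr (- p / 2) * (N powr (1 - p / 2) * (rho / sig2 powr (p / 2))))"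
  proof -
    have sr: "(s\<^sup>2) powr (p / 2) = s powr p"
    proof -
      have "s\<^sup>2 = s powr 2" using nf(1) by simp
      thus ?thesis by (simp only: powr_powr) simp
    qed
    have pw: "\<bar>U w / s\<^sup>2\<bar> powr (p / 2) = \<bar>U w\<bar> powr (p / 2) / s powr p" for w
      by (simp add: powr_divide sr)
    have i: "integrable ?S (\<lambda>w. \<bar>U w / s\<^sup>2\<bar> powr (p / 2))"
      unfolding pw using square_sum_moment(1)[of n] by (simp add: U_def)
    have "measure ?S {w \<in> space ?S. e / 2 \<le> \<bar>U w / s\<^sup>2\<bar>} \<le> (\<integral>w. \<bar>U w / s\<^sup>2\<bar> powr (p / 2) \<partial>?S) / (e / 2) powr (p / 2)"
      using e p i by (intro S.markov_powr) auto
    also have "(\<integral>w. \<bar>U w / s\<^sup>2\<bar> powr (p / 2) \<partial>?S) = (\<integral>w. \<bar>U w\<bar> powr (p / 2) \<partial>?S) / s powr p"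
      unfolding pw by simp
    also have "\<dots> / (e / 2) powr (p / 2) \<le> (48 * (N * N powr (p / 2) * rho)) / s powr p / (e / 2) powr (p / 2)"
      using square_sum_moment(2)[of n] by (intro divide_right_mono) (auto simp: U_def N_def)
    also have "\<dots> \<le> (8 * 48 * (N powr (1 - p / 2) * (rho / sig2 powr (p / 2)))) / (e / 2) powr (p / 2)"
      using scale[of 48] by (intro divide_right_mono) (auto simp: N_def)
    also have "\<dots> = 384 * (N powr (1 - p / 2) * (rho / sig2 powr (p / 2))) * (1 / (e / 2) powr (p / 2))" by simp
    also have "1 / (e / 2) powr (p / 2) = 2 powr (p / 2) * e powr (- p / 2)"
    proof -
      have "(e / 2) powr (p / 2) = e powr (p / 2) / 2 powr (p / 2)" using e by (simp add: powr_divide)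
      hence "1 / (e / 2) powr (p / 2) = 2 powr (p / 2) * (1 / e powr (p / 2))" by simp
      also have "1 / e powr (p / 2) = e powr (- (p / 2))" by (rule powr_minus_divide[symmetric])
      finally show ?thesis by simp
    qed
    also have "384 * (N powr (1 - p / 2) * (rho / sig2 powr (p / 2))) * (2 powr (p / 2) * e powr (- p / 2))
       \<le> 384 * (N powr (1 - p / 2) * (rho / sig2 powr (p / 2))) * (3 * e powr (- p / 2))"
      using powr_r_bounds(1) rho_nonneg by (intro mult_left_mono mult_right_mono) auto
    also have "\<dots> = 1152 * (e powr (- p / 2) * (N powr (1 - p / 2) * (rho / sig2 powr (p / 2))))" by simp
    finally show ?thesis .
  qed
  have PX: "measure ?S {w \<in> space ?S. e / 2 \<le> \<bar>X w\<bar>} \<le> 16 / (N * e)"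
  proof -
    have A0: "0 \<le> A w" for w by (simp add: A_def sum_nonneg)
    have B0: "0 \<le> B w" for w by (simp add: B_def)
    have Xbd: "\<bar>X w\<bar> \<le> (2 * A w / (N - 2) + B w / ((N - 1) * (N - 2))) / (2 * s\<^sup>2)" for w
    proof -
      have "0 \<le> 2 * A w / (N - 2)" "0 \<le> B w / ((N - 1) * (N - 2))" using A0[of w] B0[of w] N4 by auto
      hence "\<bar>- 2 * A w / (N - 2) + B w / ((N - 1) * (N - 2))\<bar> \<le> 2 * A w / (N - 2) + B w / ((N - 1) * (N - 2))"
        by (simp add: abs_le_iff)
      hence "\<bar>- 2 * A w / (N - 2) + B w / ((N - 1) * (N - 2))\<bar> / (2 * s\<^sup>2) \<le> (2 * A w / (N - 2) + B w / ((N - 1) * (N - 2))) / (2 * s\<^sup>2)"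
        by (rule divide_right_mono) simp
      thus ?thesis unfolding X_def by (simp add: abs_divide)
    qed
    have iA: "integrable ?S A" "(\<integral>w. A w \<partial>?S) = N * (N - 1) * sig2" using sum_row_sq[of n] by (auto simp: A_def[abs_def] N_def)
    have iB: "integrable ?S B" "(\<integral>w. B w \<partial>?S) = 2 * N * (N - 1) * sig2" using total_sq[of n] by (auto simp: B_def[abs_def] N_def)
    define Y where "Y w = (2 * A w / (N - 2) + B w / ((N - 1) * (N - 2))) / (2 * s\<^sup>2)" for w
    have iY: "integrable ?S Y" unfolding Y_def using iA iB by simp
    have XY: "\<bar>X w\<bar> \<le> Y w" for w unfolding Y_def by (rule Xbd)
    have [measurable]: "Y \<in> borel_measurable ?S" using iY by simp
    have "measure ?S {w \<in> space ?S. e / 2 \<le> \<bar>X w\<bar>} \<le> measure ?S {w \<in> space ?S. e / 2 \<le> Y w}"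
    proof (rule S.finite_measure_mono, safe)
      fix w assume "e / 2 \<le> \<bar>X w\<bar>"
      with XY[of w] show "e / 2 \<le> Y w" by linarith
    qed measurable
    also have "\<dots> \<le> (\<integral>w. Y w \<partial>?S) / (e / 2)"
      using e order.trans[OF abs_ge_zero XY]
      by (intro integral_Markov_inequality_measure[OF iY, of "{}"]) auto
    also have "(\<integral>w. Y w \<partial>?S) = (2 * (N * (N - 1) * sig2) / (N - 2) + 2 * N * (N - 1) * sig2 / ((N - 1) * (N - 2))) / (2 * s\<^sup>2)"
      unfolding Y_def using iA iB by simp
    also have "\<dots> = 2 / (N - 2) + 2 / ((N - 1) * (N - 2))"
    proof -
      define K where "K = N * (N - 1) * sig2"
      have K: "0 < K" using N4 sig by (simp add: K_def)
      have e1: "2 * s\<^sup>2 = K" unfolding nf(2) K_def N_def by simp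
      have e2: "2 * N * (N - 1) * sig2 = 2 * K" by (simp add: K_def)
      show ?thesis unfolding K_def[symmetric] e1 e2 using K by (simp add: add_divide_distrib)
    qed
    also have "\<dots> \<le> 8 / N"
    proof -
      have "1 * (N - 2) \<le> (N - 1) * (N - 2)" using N4 by (intro mult_right_mono) auto
      hence "2 / ((N - 1) * (N - 2)) \<le> 2 / (N - 2)" using N4 by (intro divide_left_mono mult_pos_pos) auto
      hence "2 / (N - 2) + 2 / ((N - 1) * (N - 2)) \<le> 4 / (N - 2)" by simp
      also have "\<dots> \<le> 8 / N" using N4 by (simp add: field_simps)
      finally show ?thesis .
    qed
    finally have "measure ?S {w \<in> space ?S. e / 2 \<le> \<bar>X w\<bar>} \<le> (8 / N) / (e / 2)"
      using e by (simp add: divide_right_mono)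
    also have "\<dots> = 16 / (N * e)" by simp
    finally show ?thesis .
  qed
  have "measure ?S {w \<in> space ?S. e \<le> \<bar>U w / s\<^sup>2 + X w\<bar>}
    \<le> measure ?S ({w \<in> space ?S. e / 2 \<le> \<bar>U w / s\<^sup>2\<bar>} \<union> {w \<in> space ?S. e / 2 \<le> \<bar>X w\<bar>})"
  proof (rule S.finite_measure_mono)
    show "{w \<in> space ?S. e \<le> \<bar>U w / s\<^sup>2 + X w\<bar>} \<subseteq> {w \<in> space ?S. e / 2 \<le> \<bar>U w / s\<^sup>2\<bar>} \<union> {w \<in> space ?S. e / 2 \<le> \<bar>X w\<bar>}"
    proof
      fix w assume w: "w \<in> {w \<in> space ?S. e \<le> \<bar>U w / s\<^sup>2 + X w\<bar>}"
      hence "e / 2 \<le> \<bar>U w / s\<^sup>2\<bar> \<or> e / 2 \<le> \<bar>X w\<bar>"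
        using abs_triangle_ineq[of "U w / s\<^sup>2" "X w"] by (simp, argo)
      thus "w \<in> {w \<in> space ?S. e / 2 \<le> \<bar>U w / s\<^sup>2\<bar>} \<union> {w \<in> space ?S. e / 2 \<le> \<bar>X w\<bar>}" using w by auto
    qed
  qed measurable
  also have "\<dots> \<le> measure ?S {w \<in> space ?S. e / 2 \<le> \<bar>U w / s\<^sup>2\<bar>} + measure ?S {w \<in> space ?S. e / 2 \<le> \<bar>X w\<bar>}"
    by (rule measure_Un_le) measurable
  finally show ?thesis
    using PU PX unfolding s_def[symmetric] eq N_def[symmetric] by linarith
qed

end

section \<open>Independent pairs\<close>

text \<open>At the level t, T is sandwiched between events for X at levels shifted by e (1 + |t|), a
  relative perturbation that Phi absorbs at cost 2 e. On A nothing is known, hence its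
  probability.\<close>

lemma (in prob_space) Phi_ratio_perturbation:
  fixes X T :: "'a \<Rightarrow> real"
  assumes [measurable]: "X \<in> borel_measurable M" "T \<in> borel_measurable M" "A \<in> sets M"
    and up: "\<And>w. w \<in> space M - A \<Longrightarrow> T w \<le> t \<Longrightarrow> X w \<le> t + e * (1 + \<bar>t\<bar>)"
    and low: "\<And>w. w \<in> space M - A \<Longrightarrow> X w \<le> t - e * (1 + \<bar>t\<bar>) \<Longrightarrow> T w \<le> t"
    and D: "\<And>a. \<bar>prob {w \<in> space M. X w \<le> a} - Phi a\<bar> \<le> D"
    and e: "0 \<le> e" "e \<le> 1/2"
  shows "\<bar>prob {w \<in> space M. T w \<le> t} - Phi t\<bar> \<le> D + 2 * e + prob A"
proof -
  define d where "d = e * (1 + \<bar>t\<bar>)"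
  have d0: "0 \<le> d" using e by (simp add: d_def)
  have 1: "\<bar>Phi (t + d) - Phi t\<bar> \<le> 2 * e" "\<bar>Phi (t - d) - Phi t\<bar> \<le> 2 * e"
    using d0 e by (auto intro!: Phi_relative_perturbation simp: d_def)
  have "prob {w \<in> space M. T w \<le> t} \<le> prob ({w \<in> space M. X w \<le> t + d} \<union> A)"
    using up by (intro finite_measure_mono) (auto simp: d_def)
  also have "\<dots> \<le> prob {w \<in> space M. X w \<le> t + d} + prob A" by (rule measure_Un_le) measurable
  finally have u: "prob {w \<in> space M. T w \<le> t} \<le> prob {w \<in> space M. X w \<le> t + d} + prob A" .
  have "prob {w \<in> space M. X w \<le> t - d} \<le> prob ({w \<in> space M. T w \<le> t} \<union> A)"
    using low by (intro finite_measure_mono) (auto simp: d_def)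
  also have "\<dots> \<le> prob {w \<in> space M. T w \<le> t} + prob A" by (rule measure_Un_le) measurable
  finally have l: "prob {w \<in> space M. X w \<le> t - d} \<le> prob {w \<in> space M. T w \<le> t} + prob A" .
  show ?thesis using u l D[of "t + d"] D[of "t - d"] 1 by linarith
qed

lemma measurable_pair_seq:
  "(\<lambda>(a, b) i. (a i, b i)) \<in> measurable (iid_seq \<mu> \<Otimes>\<^sub>M iid_seq \<nu>) (iid_seq (\<mu> \<Otimes>\<^sub>M \<nu>))"
proof (rule measurable_PiM_single')
  show "(\<lambda>q. (case q of (a, b) \<Rightarrow> \<lambda>i. (a i, b i)) i) \<in> measurable (iid_seq \<mu> \<Otimes>\<^sub>M iid_seq \<nu>) (\<mu> \<Otimes>\<^sub>M \<nu>)" for i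
    by (simp add: split_def)
qed (auto simp: space_PiM space_pair_measure PiE_iff)

lemma measurable_fst_seq: "(\<lambda>w i. fst (w i)) \<in> measurable (iid_seq (\<mu> \<Otimes>\<^sub>M \<nu>)) (iid_seq \<mu>)"
  by (rule measurable_PiM_single') (auto simp: space_PiM space_pair_measure PiE_iff mem_Times_iff)

lemma measurable_snd_seq: "(\<lambda>w i. snd (w i)) \<in> measurable (iid_seq (\<mu> \<Otimes>\<^sub>M \<nu>)) (iid_seq \<nu>)"
  by (rule measurable_PiM_single') (auto simp: space_PiM space_pair_measure PiE_iff mem_Times_iff)

text \<open>Checked on finite-dimensional cylinders by induction on the set of constrained
  coordinates, resampling one coordinate of both sequences at a time. It makes the two component
  sequences independent, which factorizes all mixed moments.\<close>

lemma distr_iid_seq_pair: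
  fixes \<mu> :: "'a measure" and \<nu> :: "'b measure"
  assumes "prob_space \<mu>" "prob_space \<nu>"
  shows "distr (iid_seq \<mu> \<Otimes>\<^sub>M iid_seq \<nu>) (iid_seq (\<mu> \<Otimes>\<^sub>M \<nu>)) (\<lambda>(a, b) i. (a i, b i)) = iid_seq (\<mu> \<Otimes>\<^sub>M \<nu>)"
proof -
  interpret X: prob_space \<mu> by fact
  interpret Y: prob_space \<nu> by fact
  interpret SX: prob_space "iid_seq \<mu>" by (rule X.prob_space_iid_seq)
  interpret SY: prob_space "iid_seq \<nu>" by (rule Y.prob_space_iid_seq)
  interpret XY: pair_prob_space \<mu> \<nu> ..
  interpret SXY: pair_prob_space "iid_seq \<mu>" "iid_seq \<nu>" ..
  interpret S: product_prob_space "\<lambda>_. \<mu> \<Otimes>\<^sub>M \<nu>" "UNIV :: nat set" ..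
  let ?\<Psi> = "\<lambda>(a, b) i. (a i, b i)"
  have \<Psi> [measurable]: "?\<Psi> \<in> measurable (iid_seq \<mu> \<Otimes>\<^sub>M iid_seq \<nu>) (iid_seq (\<mu> \<Otimes>\<^sub>M \<nu>))"
    by (rule measurable_pair_seq)
  have prod: "(\<integral>\<^sup>+a. (\<integral>\<^sup>+b. (\<Prod>j\<in>J. indicator (F j) (a j, b j)) \<partial>iid_seq \<nu>) \<partial>iid_seq \<mu>) = (\<Prod>j\<in>J. emeasure (\<mu> \<Otimes>\<^sub>M \<nu>) (F j))"
    if "finite J" "\<And>j. j \<in> J \<Longrightarrow> F j \<in> sets (\<mu> \<Otimes>\<^sub>M \<nu>)" for J and F :: "nat \<Rightarrow> ('a \<times> 'b) set"
    using that
  proof (induction J rule: finite_induct)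
    case empty
    show ?case by (simp add: SX.emeasure_space_1 SY.emeasure_space_1)
  next
    case (insert k J)
    have [measurable]: "F k \<in> sets (\<mu> \<Otimes>\<^sub>M \<nu>)" using insert.prems by simp
    have FJ [measurable]: "F j \<in> sets (\<mu> \<Otimes>\<^sub>M \<nu>)" if "j \<in> J" for j using insert.prems that by simp
    define P where "P a b = (\<Prod>j\<in>J. indicator (F j) (a j, b j) :: ennreal)" for a b
    have P_meas [measurable]: "(\<lambda>(a, b). P a b) \<in> borel_measurable (iid_seq \<mu> \<Otimes>\<^sub>M iid_seq \<nu>)"
      unfolding P_def split_def by measurable
    have P_meas2: "(\<lambda>b. P a b) \<in> borel_measurable (iid_seq \<nu>)" if "a \<in> space (iid_seq \<mu>)" for a
      using measurable_Pair2[OF P_meas that] by simp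
    have inner: "(\<integral>\<^sup>+b. (\<Prod>j\<in>insert k J. indicator (F j) ((a(k := x)) j, b j)) \<partial>iid_seq \<nu>)
        = (\<integral>\<^sup>+y. indicator (F k) (x, y) \<partial>\<nu>) * (\<integral>\<^sup>+b. P a b \<partial>iid_seq \<nu>)"
      if a: "a \<in> space (iid_seq \<mu>)" and x: "x \<in> space \<mu>" for a x
    proof -
      have [measurable]: "(\<lambda>b. P a b) \<in> borel_measurable (iid_seq \<nu>)" by (rule P_meas2[OF a])
      have [measurable]: "(\<lambda>y. indicator (F k) (x, y) :: ennreal) \<in> borel_measurable \<nu>"
        using x by measurable
      have ins: "(\<Prod>j\<in>insert k J. indicator (F j) ((a(k := x)) j, b j)) = indicator (F k) (x, b k) * P a b" for b
      proof -
        have "(\<Prod>j\<in>J. indicator (F j) ((a(k := x)) j, b j)) = P a b"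
          unfolding P_def using insert.hyps by (intro prod.cong) auto
        thus ?thesis using insert.hyps by simp
      qed
      have Pb: "P a (b(k := y)) = P a b" for b y
        unfolding P_def using insert.hyps by (intro prod.cong) auto
      have "(\<integral>\<^sup>+b. indicator (F k) (x, b k) * P a b \<partial>iid_seq \<nu>)
        = (\<integral>\<^sup>+b. (\<integral>\<^sup>+y. indicator (F k) (x, y) * P a b \<partial>\<nu>) \<partial>iid_seq \<nu>)"
        by (subst Y.nn_integral_resample[of _ k]) (auto simp: Pb)
      also have "\<dots> = (\<integral>\<^sup>+b. (\<integral>\<^sup>+y. indicator (F k) (x, y) \<partial>\<nu>) * P a b \<partial>iid_seq \<nu>)"
        by (subst nn_integral_multc) auto
      also have "\<dots> = (\<integral>\<^sup>+y. indicator (F k) (x, y) \<partial>\<nu>) * (\<integral>\<^sup>+b. P a b \<partial>iid_seq \<nu>)"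
        by (subst nn_integral_cmult) auto
      finally show ?thesis by (simp only: ins)
    qed
    have "(\<integral>\<^sup>+a. (\<integral>\<^sup>+b. (\<Prod>j\<in>insert k J. indicator (F j) (a j, b j)) \<partial>iid_seq \<nu>) \<partial>iid_seq \<mu>)
      = (\<integral>\<^sup>+a. (\<integral>\<^sup>+x. (\<integral>\<^sup>+b. (\<Prod>j\<in>insert k J. indicator (F j) ((a(k := x)) j, b j)) \<partial>iid_seq \<nu>) \<partial>\<mu>) \<partial>iid_seq \<mu>)"
    proof (rule X.nn_integral_resample)
      have [measurable]: "F j \<in> sets (\<mu> \<Otimes>\<^sub>M \<nu>)" if "j \<in> insert k J" for j using insert.prems that by simp
      show "(\<lambda>a. \<integral>\<^sup>+b. (\<Prod>j\<in>insert k J. indicator (F j) (a j, b j)) \<partial>iid_seq \<nu>) \<in> borel_measurable (iid_seq \<mu>)"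
        by measurable
    qed
    also have "\<dots> = (\<integral>\<^sup>+a. (\<integral>\<^sup>+x. (\<integral>\<^sup>+y. indicator (F k) (x, y) \<partial>\<nu>) * (\<integral>\<^sup>+b. P a b \<partial>iid_seq \<nu>) \<partial>\<mu>) \<partial>iid_seq \<mu>)"
      by (intro nn_integral_cong inner)
    also have "\<dots> = (\<integral>\<^sup>+a. (\<integral>\<^sup>+x. (\<integral>\<^sup>+y. indicator (F k) (x, y) \<partial>\<nu>) \<partial>\<mu>) * (\<integral>\<^sup>+b. P a b \<partial>iid_seq \<nu>) \<partial>iid_seq \<mu>)"
      by (subst nn_integral_multc) auto
    also have "\<dots> = (\<integral>\<^sup>+x. (\<integral>\<^sup>+y. indicator (F k) (x, y) \<partial>\<nu>) \<partial>\<mu>) * (\<integral>\<^sup>+a. (\<integral>\<^sup>+b. P a b \<partial>iid_seq \<nu>) \<partial>iid_seq \<mu>)"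
      by (subst nn_integral_cmult) auto
    also have "(\<integral>\<^sup>+x. (\<integral>\<^sup>+y. indicator (F k) (x, y) \<partial>\<nu>) \<partial>\<mu>) = emeasure (\<mu> \<Otimes>\<^sub>M \<nu>) (F k)"
      by (subst Y.nn_integral_fst) auto
    also have "(\<integral>\<^sup>+a. (\<integral>\<^sup>+b. P a b \<partial>iid_seq \<nu>) \<partial>iid_seq \<mu>) = (\<Prod>j\<in>J. emeasure (\<mu> \<Otimes>\<^sub>M \<nu>) (F j))"
      unfolding P_def using insert by simp
    finally show ?case using insert.hyps by simp
  qed
  show ?thesis
  proof (rule S.PiM_eq)
    fix J :: "nat set" and F assume J: "finite J" "J \<subseteq> UNIV" and F: "\<And>j. j \<in> J \<Longrightarrow> F j \<in> sets (\<mu> \<Otimes>\<^sub>M \<nu>)"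
    note [measurable] = F
    let ?E = "S.emb UNIV J (Pi\<^sub>E J F)"
    have E [measurable]: "?E \<in> sets (iid_seq (\<mu> \<Otimes>\<^sub>M \<nu>))" using J F by (intro sets_PiM_I) auto
    have ind: "indicator ?E (?\<Psi> (a, b)) = (\<Prod>j\<in>J. indicator (F j) (a j, b j) :: ennreal)"
      if "a \<in> space (iid_seq \<mu>)" "b \<in> space (iid_seq \<nu>)" for a b
    proof -
      have "?\<Psi> (a, b) \<in> ?E \<longleftrightarrow> (\<forall>j\<in>J. (a j, b j) \<in> F j)"
        using that by (auto simp: prod_emb_def space_PiM PiE_iff space_pair_measure restrict_def extensional_def)
      thus ?thesis using J(1) by (auto simp: indicator_def prod_zero_iff)
    qed
    have "emeasure (distr (iid_seq \<mu> \<Otimes>\<^sub>M iid_seq \<nu>) (iid_seq (\<mu> \<Otimes>\<^sub>M \<nu>)) ?\<Psi>) ?E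
        = (\<integral>\<^sup>+w. indicator ?E w \<partial>distr (iid_seq \<mu> \<Otimes>\<^sub>M iid_seq \<nu>) (iid_seq (\<mu> \<Otimes>\<^sub>M \<nu>)) ?\<Psi>)"
      by simp
    also have "\<dots> = (\<integral>\<^sup>+q. indicator ?E (?\<Psi> q) \<partial>(iid_seq \<mu> \<Otimes>\<^sub>M iid_seq \<nu>))"
      by (rule nn_integral_distr) measurable
    also have "\<dots> = (\<integral>\<^sup>+a. (\<integral>\<^sup>+b. indicator ?E (?\<Psi> (a, b)) \<partial>iid_seq \<nu>) \<partial>iid_seq \<mu>)"
      by (rule SY.nn_integral_fst[symmetric]) measurable
    also have "\<dots> = (\<integral>\<^sup>+a. (\<integral>\<^sup>+b. (\<Prod>j\<in>J. indicator (F j) (a j, b j)) \<partial>iid_seq \<nu>) \<partial>iid_seq \<mu>)"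
      by (intro nn_integral_cong ind)
    also have "\<dots> = (\<Prod>j\<in>J. emeasure (\<mu> \<Otimes>\<^sub>M \<nu>) (F j))" by (rule prod[OF J(1) F])
    finally show "emeasure (distr (iid_seq \<mu> \<Otimes>\<^sub>M iid_seq \<nu>) (iid_seq (\<mu> \<Otimes>\<^sub>M \<nu>)) ?\<Psi>) ?E = (\<Prod>j\<in>J. emeasure (\<mu> \<Otimes>\<^sub>M \<nu>) (F j))" .
  qed simp
qed

lemma integral_iid_seq_pair_product:
  fixes \<mu> :: "'a measure" and \<nu> :: "'b measure" and A :: "(nat \<Rightarrow> 'a) \<Rightarrow> real" and B :: "(nat \<Rightarrow> 'b) \<Rightarrow> real"
  assumes "prob_space \<mu>" "prob_space \<nu>" and A: "integrable (iid_seq \<mu>) A" and B: "integrable (iid_seq \<nu>) B"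
  shows "integrable (iid_seq (\<mu> \<Otimes>\<^sub>M \<nu>)) (\<lambda>w. A (\<lambda>i. fst (w i)) * B (\<lambda>i. snd (w i)))"
    "(\<integral>w. A (\<lambda>i. fst (w i)) * B (\<lambda>i. snd (w i)) \<partial>iid_seq (\<mu> \<Otimes>\<^sub>M \<nu>)) = (\<integral>a. A a \<partial>iid_seq \<mu>) * (\<integral>b. B b \<partial>iid_seq \<nu>)"
proof -
  interpret X: prob_space \<mu> by fact
  interpret Y: prob_space \<nu> by fact
  interpret SX: prob_space "iid_seq \<mu>" by (rule X.prob_space_iid_seq)
  interpret SY: prob_space "iid_seq \<nu>" by (rule Y.prob_space_iid_seq)
  interpret SXY: pair_prob_space "iid_seq \<mu>" "iid_seq \<nu>" ..
  have [measurable]: "A \<in> borel_measurable (iid_seq \<mu>)" "B \<in> borel_measurable (iid_seq \<nu>)" using A B by auto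
  let ?\<Psi> = "\<lambda>(a, b) i. (a i, b i)"
  have \<Psi> [measurable]: "?\<Psi> \<in> measurable (iid_seq \<mu> \<Otimes>\<^sub>M iid_seq \<nu>) (iid_seq (\<mu> \<Otimes>\<^sub>M \<nu>))"
    by (rule measurable_pair_seq)
  have [measurable]: "(\<lambda>w i. fst (w i)) \<in> measurable (iid_seq (\<mu> \<Otimes>\<^sub>M \<nu>)) (iid_seq \<mu>)"
    "(\<lambda>w i. snd (w i)) \<in> measurable (iid_seq (\<mu> \<Otimes>\<^sub>M \<nu>)) (iid_seq \<nu>)" by (rule measurable_fst_seq measurable_snd_seq)+
  let ?f = "\<lambda>w. A (\<lambda>i. fst (w i)) * B (\<lambda>i. snd (w i))"
  have f [measurable]: "?f \<in> borel_measurable (iid_seq (\<mu> \<Otimes>\<^sub>M \<nu>))" by measurable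
  have i: "integrable (iid_seq \<mu> \<Otimes>\<^sub>M iid_seq \<nu>) (\<lambda>(a, b). A a * B b)"
    by (rule SXY.integrable_pair_product[OF A B])
  have "integrable (distr (iid_seq \<mu> \<Otimes>\<^sub>M iid_seq \<nu>) (iid_seq (\<mu> \<Otimes>\<^sub>M \<nu>)) ?\<Psi>) ?f"
    using i by (subst integrable_distr_eq[OF \<Psi> f]) (simp add: split_def)
  thus "integrable (iid_seq (\<mu> \<Otimes>\<^sub>M \<nu>)) ?f" by (simp only: distr_iid_seq_pair[OF assms(1,2)])
  have "(\<integral>w. ?f w \<partial>iid_seq (\<mu> \<Otimes>\<^sub>M \<nu>)) = (\<integral>w. ?f w \<partial>distr (iid_seq \<mu> \<Otimes>\<^sub>M iid_seq \<nu>) (iid_seq (\<mu> \<Otimes>\<^sub>M \<nu>)) ?\<Psi>)"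
    by (simp only: distr_iid_seq_pair[OF assms(1,2)])
  also have "\<dots> = (\<integral>q. ?f (?\<Psi> q) \<partial>(iid_seq \<mu> \<Otimes>\<^sub>M iid_seq \<nu>))" by (rule integral_distr[OF \<Psi> f])
  also have "\<dots> = (\<integral>(a, b). A a * B b \<partial>(iid_seq \<mu> \<Otimes>\<^sub>M iid_seq \<nu>))" by (simp add: split_def)
  also have "\<dots> = (\<integral>a. (\<integral>b. A a * B b \<partial>iid_seq \<nu>) \<partial>iid_seq \<mu>)" using SXY.integral_fst[OF i] by simp
  also have "\<dots> = (\<integral>a. A a \<partial>iid_seq \<mu>) * (\<integral>b. B b \<partial>iid_seq \<nu>)" by simp
  finally show "(\<integral>w. ?f w \<partial>iid_seq (\<mu> \<Otimes>\<^sub>M \<nu>)) = (\<integral>a. A a \<partial>iid_seq \<mu>) * (\<integral>b. B b \<partial>iid_seq \<nu>)" .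
qed

text \<open>Two independent copies are read off as coordinates 0 and 1 of the sequence, so the
  factorization for sequences yields the one for pairs.\<close>

lemma integral_pair_pair_product:
  fixes \<mu> :: "'a measure" and \<nu> :: "'b measure" and a :: "'a \<times> 'a \<Rightarrow> real" and b :: "'b \<times> 'b \<Rightarrow> real"
  assumes prob: "prob_space \<mu>" "prob_space \<nu>" and a: "integrable (\<mu> \<Otimes>\<^sub>M \<mu>) a" and b: "integrable (\<nu> \<Otimes>\<^sub>M \<nu>) b"
  shows "integrable ((\<mu> \<Otimes>\<^sub>M \<nu>) \<Otimes>\<^sub>M (\<mu> \<Otimes>\<^sub>M \<nu>)) (\<lambda>(z, z'). a (fst z, fst z') * b (snd z, snd z'))"
    "(\<integral>(z, z'). a (fst z, fst z') * b (snd z, snd z') \<partial>((\<mu> \<Otimes>\<^sub>M \<nu>) \<Otimes>\<^sub>M (\<mu> \<Otimes>\<^sub>M \<nu>)))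
      = (\<integral>x. a x \<partial>(\<mu> \<Otimes>\<^sub>M \<mu>)) * (\<integral>y. b y \<partial>(\<nu> \<Otimes>\<^sub>M \<nu>))"
proof -
  interpret X: prob_space \<mu> by fact
  interpret Y: prob_space \<nu> by fact
  interpret XY: pair_prob_space \<mu> \<nu> ..
  have [measurable]: "a \<in> borel_measurable (\<mu> \<Otimes>\<^sub>M \<mu>)" "b \<in> borel_measurable (\<nu> \<Otimes>\<^sub>M \<nu>)" using a b by auto
  have A: "integrable (iid_seq \<mu>) (\<lambda>w. a (w 0, w 1))" "(\<integral>w. a (w 0, w 1) \<partial>iid_seq \<mu>) = (\<integral>x. a x \<partial>(\<mu> \<Otimes>\<^sub>M \<mu>))"
    using X.integrable_iid_seq_comp2_iff[of a 0 1] X.integral_iid_seq_comp2[of a 0 1] a by auto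
  have B: "integrable (iid_seq \<nu>) (\<lambda>w. b (w 0, w 1))" "(\<integral>w. b (w 0, w 1) \<partial>iid_seq \<nu>) = (\<integral>x. b x \<partial>(\<nu> \<Otimes>\<^sub>M \<nu>))"
    using Y.integrable_iid_seq_comp2_iff[of b 0 1] Y.integral_iid_seq_comp2[of b 0 1] b by auto
  define f where "f = (\<lambda>(z, z'). a (fst z, fst z') * b (snd z, snd z'))"
  have [measurable]: "f \<in> borel_measurable ((\<mu> \<Otimes>\<^sub>M \<nu>) \<Otimes>\<^sub>M (\<mu> \<Otimes>\<^sub>M \<nu>))" unfolding f_def by measurable
  have "integrable (iid_seq (\<mu> \<Otimes>\<^sub>M \<nu>)) (\<lambda>w. f (w 0, w 1))"
    using integral_iid_seq_pair_product(1)[OF prob A(1) B(1)] by (simp add: f_def)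
  thus "integrable ((\<mu> \<Otimes>\<^sub>M \<nu>) \<Otimes>\<^sub>M (\<mu> \<Otimes>\<^sub>M \<nu>)) (\<lambda>(z, z'). a (fst z, fst z') * b (snd z, snd z'))"
    using XY.P.integrable_iid_seq_comp2_iff[of f 0 1] by (simp add: f_def)
  have "(\<integral>w. f (w 0, w 1) \<partial>iid_seq (\<mu> \<Otimes>\<^sub>M \<nu>)) = (\<integral>x. a x \<partial>(\<mu> \<Otimes>\<^sub>M \<mu>)) * (\<integral>y. b y \<partial>(\<nu> \<Otimes>\<^sub>M \<nu>))"
    using integral_iid_seq_pair_product(2)[OF prob A(1) B(1)] A(2) B(2) by (simp add: f_def)
  thus "(\<integral>(z, z'). a (fst z, fst z') * b (snd z, snd z') \<partial>((\<mu> \<Otimes>\<^sub>M \<nu>) \<Otimes>\<^sub>M (\<mu> \<Otimes>\<^sub>M \<nu>)))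
      = (\<integral>x. a x \<partial>(\<mu> \<Otimes>\<^sub>M \<mu>)) * (\<integral>y. b y \<partial>(\<nu> \<Otimes>\<^sub>M \<nu>))"
    using XY.P.integral_iid_seq_comp2[of f 0 1] by (simp add: f_def)
qed

section \<open>The product of two degenerate kernels under independence\<close>

locale two_kernels = X: degenerate_kernel \<mu> f p + Y: degenerate_kernel \<nu> g p
  for \<mu> :: "'a measure" and f :: "'a \<Rightarrow> 'a \<Rightarrow> real" and \<nu> :: "'b measure" and g :: "'b \<Rightarrow> 'b \<Rightarrow> real" and p :: real
begin

sublocale XY: pair_prob_space \<mu> \<nu> ..

abbreviation P :: "('a \<times> 'b) measure" where "P \<equiv> \<mu> \<Otimes>\<^sub>M \<nu>"

text \<open>Both kernels are lifted to pairs so that numerator and self-normalizers are statistics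
  of one sequence.\<close>

definition F where "F z z' = f (fst z) (fst z')" for z z' :: "'a \<times> 'b"
definition K where "K z z' = g (snd z) (snd z')" for z z' :: "'a \<times> 'b"
definition H where "H z z' = F z z' * K z z'" for z z' :: "'a \<times> 'b"

lemma integral_P_product:
  fixes a :: "'a \<Rightarrow> real" and b :: "'b \<Rightarrow> real"
  assumes a: "integrable \<mu> a" and b: "integrable \<nu> b"
  shows "integrable P (\<lambda>z. a (fst z) * b (snd z))"
    "(\<integral>z. a (fst z) * b (snd z) \<partial>P) = (\<integral>x. a x \<partial>\<mu>) * (\<integral>y. b y \<partial>\<nu>)"
proof -
  have i: "integrable P (\<lambda>(x, y). a x * b y)" by (rule XY.integrable_pair_product[OF a b])
  thus "integrable P (\<lambda>z. a (fst z) * b (snd z))" by (simp add: split_def)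
  have "(\<integral>z. a (fst z) * b (snd z) \<partial>P) = (\<integral>(x, y). a x * b y \<partial>P)" by (simp add: split_def)
  also have "\<dots> = (\<integral>x. (\<integral>y. a x * b y \<partial>\<nu>) \<partial>\<mu>)" using XY.integral_fst[OF i] by simp
  finally show "(\<integral>z. a (fst z) * b (snd z) \<partial>P) = (\<integral>x. a x \<partial>\<mu>) * (\<integral>y. b y \<partial>\<nu>)" by simp
qed

lemma integral_P_fst:
  fixes a :: "'a \<Rightarrow> real"
  assumes "integrable \<mu> a"
  shows "integrable P (\<lambda>z. a (fst z))" "(\<integral>z. a (fst z) \<partial>P) = (\<integral>x. a x \<partial>\<mu>)"
  using integral_P_product[OF assms, of "\<lambda>_. 1"] Y.prob_space by simp_all

lemma integral_P_snd:
  fixes b :: "'b \<Rightarrow> real"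
  assumes "integrable \<nu> b"
  shows "integrable P (\<lambda>z. b (snd z))" "(\<integral>z. b (snd z) \<partial>P) = (\<integral>y. b y \<partial>\<nu>)"
  using integral_P_product[OF _ assms, of "\<lambda>_. 1"] X.prob_space by simp_all

lemmas integral_PP_product = integral_pair_pair_product[OF X.prob_space_axioms Y.prob_space_axioms]

lemma integral_PP_fst:
  fixes a :: "'a \<times> 'a \<Rightarrow> real"
  assumes "integrable (\<mu> \<Otimes>\<^sub>M \<mu>) a"
  shows "integrable (P \<Otimes>\<^sub>M P) (\<lambda>(z, z'). a (fst z, fst z'))"
    "(\<integral>(z, z'). a (fst z, fst z') \<partial>(P \<Otimes>\<^sub>M P)) = (\<integral>x. a x \<partial>(\<mu> \<Otimes>\<^sub>M \<mu>))"
  using integral_PP_product[OF assms, of "\<lambda>_. 1"] Y.MM.P.prob_space by simp_all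

lemma integral_PP_snd:
  fixes b :: "'b \<times> 'b \<Rightarrow> real"
  assumes "integrable (\<nu> \<Otimes>\<^sub>M \<nu>) b"
  shows "integrable (P \<Otimes>\<^sub>M P) (\<lambda>(z, z'). b (snd z, snd z'))"
    "(\<integral>(z, z'). b (snd z, snd z') \<partial>(P \<Otimes>\<^sub>M P)) = (\<integral>x. b x \<partial>(\<nu> \<Otimes>\<^sub>M \<nu>))"
  using integral_PP_product[OF _ assms, of "\<lambda>_. 1"] X.MM.P.prob_space by simp_all

lemma f_meas_PP [measurable]: "(\<lambda>q. f (fst (fst q)) (fst (snd q))) \<in> borel_measurable (P \<Otimes>\<^sub>M P)"
proof -
  have "(\<lambda>q. case (fst (fst q), fst (snd q)) of (x, y) \<Rightarrow> f x y) \<in> borel_measurable (P \<Otimes>\<^sub>M P)"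
    by (rule measurable_compose[OF _ X.h_meas]) measurable
  thus ?thesis by simp
qed

lemma g_meas_PP [measurable]: "(\<lambda>q. g (snd (fst q)) (snd (snd q))) \<in> borel_measurable (P \<Otimes>\<^sub>M P)"
proof -
  have "(\<lambda>q. case (snd (fst q), snd (snd q)) of (x, y) \<Rightarrow> g x y) \<in> borel_measurable (P \<Otimes>\<^sub>M P)"
    by (rule measurable_compose[OF _ Y.h_meas]) measurable
  thus ?thesis by simp
qed

lemma h_int_f: "x \<in> space \<mu> \<Longrightarrow> integrable \<mu> (f x)"
  using X.abs_integral_powr_le(1)[OF X.h_meas_fst X.h_int1] X.p by simp

lemma h_int_g: "y \<in> space \<nu> \<Longrightarrow> integrable \<nu> (g y)"
  using Y.abs_integral_powr_le(1)[OF Y.h_meas_fst Y.h_int1] Y.p by simp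

sublocale FK: degenerate_kernel P F p
proof (unfold_locales)
  show "(\<lambda>(x, y). F x y) \<in> borel_measurable (P \<Otimes>\<^sub>M P)" by (simp add: F_def split_def)
  show "F x y = F y x" for x y by (simp add: F_def X.h_sym)
  show "integrable P (\<lambda>y. \<bar>F x y\<bar> powr p)" if "x \<in> space P" for x
    using integral_P_fst(1)[OF X.h_int1, of "fst x"] that by (simp add: F_def space_pair_measure mem_Times_iff)
  show "(\<integral>y. F x y \<partial>P) = 0" if "x \<in> space P" for x
    using integral_P_fst(2)[OF h_int_f, of "fst x"] X.h_mean[of "fst x"] that
    by (simp add: F_def space_pair_measure mem_Times_iff)
  show "integrable (P \<Otimes>\<^sub>M P) (\<lambda>(x, y). \<bar>F x y\<bar> powr p)"
    using integral_PP_fst(1)[OF X.h_int2] by (simp add: F_def)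
qed (use X.p in auto)

sublocale KK: degenerate_kernel P K p
proof (unfold_locales)
  show "(\<lambda>(x, y). K x y) \<in> borel_measurable (P \<Otimes>\<^sub>M P)" by (simp add: K_def split_def)
  show "K x y = K y x" for x y by (simp add: K_def Y.h_sym)
  show "integrable P (\<lambda>y. \<bar>K x y\<bar> powr p)" if "x \<in> space P" for x
    using integral_P_snd(1)[OF Y.h_int1, of "snd x"] that by (simp add: K_def space_pair_measure mem_Times_iff)
  show "(\<integral>y. K x y \<partial>P) = 0" if "x \<in> space P" for x
    using integral_P_snd(2)[OF h_int_g, of "snd x"] Y.h_mean[of "snd x"] that
    by (simp add: K_def space_pair_measure mem_Times_iff)
  show "integrable (P \<Otimes>\<^sub>M P) (\<lambda>(x, y). \<bar>K x y\<bar> powr p)"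
    using integral_PP_snd(1)[OF Y.h_int2] by (simp add: K_def)
qed (use X.p in auto)

sublocale HK: degenerate_kernel P H p
proof (unfold_locales)
  show "(\<lambda>(x, y). H x y) \<in> borel_measurable (P \<Otimes>\<^sub>M P)" by (simp add: H_def F_def K_def split_def)
  show "H x y = H y x" for x y by (simp add: H_def FK.h_sym[of x y] KK.h_sym[of x y])
  show "integrable P (\<lambda>y. \<bar>H x y\<bar> powr p)" if "x \<in> space P" for x
    using integral_P_product(1)[OF X.h_int1 Y.h_int1, of "fst x" "snd x"] that
    by (simp add: H_def F_def K_def space_pair_measure mem_Times_iff abs_mult powr_mult)
  show "(\<integral>y. H x y \<partial>P) = 0" if "x \<in> space P" for x
    using integral_P_product(2)[OF h_int_f h_int_g, of "fst x" "snd x"] X.h_mean[of "fst x"] that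
    by (simp add: H_def F_def K_def space_pair_measure mem_Times_iff)
  show "integrable (P \<Otimes>\<^sub>M P) (\<lambda>(x, y). \<bar>H x y\<bar> powr p)"
    using integral_PP_product(1)[OF X.h_int2 Y.h_int2] by (simp add: H_def F_def K_def abs_mult powr_mult)
qed (use X.p in auto)

lemma kernel_params:
  "FK.sig2 = X.sig2" "FK.rho = X.rho" "KK.sig2 = Y.sig2" "KK.rho = Y.rho"
  "HK.sig2 = X.sig2 * Y.sig2" "HK.rho = X.rho * Y.rho"
  using integral_PP_fst(2)[OF X.h_sq2] integral_PP_fst(2)[OF X.h_int2]
    integral_PP_snd(2)[OF Y.h_sq2] integral_PP_snd(2)[OF Y.h_int2]
    integral_PP_product(2)[OF X.h_sq2 Y.h_sq2] integral_PP_product(2)[OF X.h_int2 Y.h_int2]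
  by (simp_all add: FK.sig2_def KK.sig2_def HK.sig2_def X.sig2_def Y.sig2_def FK.rho_def KK.rho_def HK.rho_def
      X.rho_def Y.rho_def H_def F_def K_def power_mult_distrib abs_mult powr_mult)

text \<open>Independence splits the integral over w into one over each component, once square
  integrability has made both factors integrable; this is where points of the space are
  required.\<close>

lemma HK_G: "z \<in> space P \<Longrightarrow> z' \<in> space P \<Longrightarrow> HK.G z z' = X.G (fst z) (fst z') * Y.G (snd z) (snd z')"
proof -
  assume z: "z \<in> space P" "z' \<in> space P"
  have "integrable \<mu> (\<lambda>w. f w (fst z) * f w (fst z'))"
    using integral_mult_square_le(1)[of "f (fst z)" \<mu> "f (fst z')"] X.h_sq z
    by (simp add: X.h_sym[of _ "fst _"] space_pair_measure mem_Times_iff)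
  note 1 = this
  have 2: "integrable \<nu> (\<lambda>w. g w (snd z) * g w (snd z'))"
    using integral_mult_square_le(1)[of "g (snd z)" \<nu> "g (snd z')"] Y.h_sq z
    by (simp add: Y.h_sym[of _ "snd _"] space_pair_measure mem_Times_iff)
  have eq: "H w z * H w z' = (f (fst w) (fst z) * f (fst w) (fst z')) * (g (snd w) (snd z) * g (snd w) (snd z'))" for w
    by (simp add: H_def F_def K_def)
  show ?thesis
    unfolding HK.G_def X.G_def Y.G_def eq by (rule integral_P_product(2)[OF 1 2])
qed

lemma HK_gam: "HK.gam = X.gam * Y.gam"
proof -
  have "HK.gam = (\<integral>(z, z'). (X.G (fst z) (fst z'))\<^sup>2 * (Y.G (snd z) (snd z'))\<^sup>2 \<partial>(P \<Otimes>\<^sub>M P))"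
    unfolding HK.gam_def by (rule Bochner_Integration.integral_cong) (auto simp: HK_G space_pair_measure power_mult_distrib)
  also have "\<dots> = X.gam * Y.gam"
    using integral_PP_product(2)[OF X.G_sq2 Y.G_sq2] by (simp add: X.gam_def Y.gam_def)
  finally show ?thesis .
qed

lemma rowsum_F: "rowsum F n w k = rowsum f n (\<lambda>i. fst (w i)) k"
  unfolding rowsum_def hollow_def F_def ..

lemma rowsum_K: "rowsum K n w k = rowsum g n (\<lambda>i. snd (w i)) k"
  unfolding rowsum_def hollow_def K_def ..

text \<open>By independence each mixed moment is a product of two row covariances, (n - 1)^2 on the
  diagonal and 1 off it, times both variances. The total makes this remainder of relative variance
  O(1/n).\<close>

lemma rowsum_product_moment:
  "integrable (iid_seq P) (\<lambda>w. (\<Sum>k=1..n. rowsum F n w k * rowsum K n w k)\<^sup>2)"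
  "(\<integral>w. (\<Sum>k=1..n. rowsum F n w k * rowsum K n w k)\<^sup>2 \<partial>iid_seq P) = (real n)\<^sup>2 * (real n - 1) * (X.sig2 * Y.sig2)"
proof -
  let ?A = "\<lambda>k l a. rowsum f n a k * rowsum f n a l" and ?B = "\<lambda>k l b. rowsum g n b k * rowsum g n b l"
  have eq: "(\<Sum>k=1..n. rowsum F n w k * rowsum K n w k)\<^sup>2
      = (\<Sum>k=1..n. \<Sum>l=1..n. ?A k l (\<lambda>i. fst (w i)) * ?B k l (\<lambda>i. snd (w i)))" for w
    unfolding rowsum_F rowsum_K power2_eq_square sum_product by (intro sum.cong refl) (simp add: ac_simps)
  have m: "integrable (iid_seq P) (\<lambda>w. ?A k l (\<lambda>i. fst (w i)) * ?B k l (\<lambda>i. snd (w i)))"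
    "(\<integral>w. ?A k l (\<lambda>i. fst (w i)) * ?B k l (\<lambda>i. snd (w i)) \<partial>iid_seq P)
      = (1 + (if l = k then (real n - 1)\<^sup>2 - 1 else 0)) * (X.sig2 * Y.sig2)"
    if "k \<in> {1..n}" "l \<in> {1..n}" for k l
    using integral_iid_seq_pair_product[OF X.prob_space_axioms Y.prob_space_axioms X.rowsum_cov(1)[OF that] Y.rowsum_cov(1)[OF that]]
      X.rowsum_cov(2)[OF that] Y.rowsum_cov(2)[OF that]
    by (auto simp: power2_eq_square)
  show "integrable (iid_seq P) (\<lambda>w. (\<Sum>k=1..n. rowsum F n w k * rowsum K n w k)\<^sup>2)"
    unfolding eq by (intro Bochner_Integration.integrable_sum m)
  have "(\<integral>w. (\<Sum>k=1..n. rowsum F n w k * rowsum K n w k)\<^sup>2 \<partial>iid_seq P)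
     = (\<Sum>k=1..n. \<integral>w. (\<Sum>l=1..n. ?A k l (\<lambda>i. fst (w i)) * ?B k l (\<lambda>i. snd (w i))) \<partial>iid_seq P)"
    unfolding eq by (rule Bochner_Integration.integral_sum) (intro Bochner_Integration.integrable_sum m)
  also have "\<dots> = (\<Sum>k=1..n. \<Sum>l=1..n. \<integral>w. ?A k l (\<lambda>i. fst (w i)) * ?B k l (\<lambda>i. snd (w i)) \<partial>iid_seq P)"
    by (intro sum.cong refl Bochner_Integration.integral_sum m)
  also have "\<dots> = (\<Sum>k=1..n. \<Sum>l=1..n. (1 + (if l = k then (real n - 1)\<^sup>2 - 1 else 0)) * (X.sig2 * Y.sig2))"
    by (intro sum.cong refl m(2))
  also have "\<dots> = (real n * real n + real n * ((real n - 1)\<^sup>2 - 1)) * (X.sig2 * Y.sig2)"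
    by (simp add: sum_distrib_right[symmetric] sum.distrib) (simp add: distrib_left)
  also have "real n * real n + real n * ((real n - 1)\<^sup>2 - 1) = (real n)\<^sup>2 * (real n - 1)"
    by (simp add: power2_eq_square algebra_simps)
  finally show "(\<integral>w. (\<Sum>k=1..n. rowsum F n w k * rowsum K n w k)\<^sup>2 \<partial>iid_seq P) = (real n)\<^sup>2 * (real n - 1) * (X.sig2 * Y.sig2)" .
qed

lemma total_product_moment:
  "integrable (iid_seq P) (\<lambda>w. ((\<Sum>k=1..n. rowsum F n w k) * (\<Sum>k=1..n. rowsum K n w k))\<^sup>2)"
  "(\<integral>w. ((\<Sum>k=1..n. rowsum F n w k) * (\<Sum>k=1..n. rowsum K n w k))\<^sup>2 \<partial>iid_seq P) = (2 * real n * (real n - 1))\<^sup>2 * (X.sig2 * Y.sig2)"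
  using integral_iid_seq_pair_product[OF X.prob_space_axioms Y.prob_space_axioms X.total_sq(1)[of n] Y.total_sq(1)[of n]]
    X.total_sq(2)[of n] Y.total_sq(2)[of n]
  unfolding rowsum_F rowsum_K power_mult_distrib by (simp_all add: power2_eq_square)

end

text \<open>Both q lie within e of 1, hence so does their geometric mean s; multiplying by s leaves
  linear inequalities in s t.\<close>

lemma ratio_deviation:
  fixes x r q1 q2 e t :: real
  assumes q: "\<bar>q1 - 1\<bar> < e" "\<bar>q2 - 1\<bar> < e" and r: "\<bar>r\<bar> < e" and e: "e \<le> 1/2"
  shows "0 < q1" "0 < q2"
    "(x + r) / sqrt (q1 * q2) \<le> t \<Longrightarrow> x \<le> t + e * (1 + \<bar>t\<bar>)"
    "x \<le> t - e * (1 + \<bar>t\<bar>) \<Longrightarrow> (x + r) / sqrt (q1 * q2) \<le> t"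
proof -
  have b: "1 - e < q1" "q1 < 1 + e" "1 - e < q2" "q2 < 1 + e" "1/2 \<le> 1 - e" using q e by (auto simp: abs_less_iff)
  show pos: "0 < q1" "0 < q2" using b by auto
  define s where "s = sqrt (q1 * q2)"
  have "(1 - e)\<^sup>2 \<le> q1 * q2" unfolding power2_eq_square using b by (intro mult_mono) auto
  hence s1: "1 - e \<le> s" unfolding s_def by (rule real_le_rsqrt)
  have "q1 * q2 \<le> (1 + e)\<^sup>2" unfolding power2_eq_square using b by (intro mult_mono) auto
  hence s2: "s \<le> 1 + e" unfolding s_def using b by (intro real_le_lsqrt) auto
  have s0: "0 < s" using s1 b by simp
  have "\<bar>s - 1\<bar> \<le> e" using s1 s2 by simp
  hence "\<bar>(s - 1) * t\<bar> \<le> e * \<bar>t\<bar>" unfolding abs_mult by (rule mult_right_mono) simp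
  hence st: "s * t \<le> t + e * \<bar>t\<bar>" "t - e * \<bar>t\<bar> \<le> s * t" by (auto simp: abs_le_iff algebra_simps)
  have ee: "e * (1 + \<bar>t\<bar>) = e + e * \<bar>t\<bar>" by (simp add: algebra_simps)
  have iff: "(x + r) / s \<le> t \<longleftrightarrow> x + r \<le> s * t" using s0 by (simp add: pos_divide_le_eq mult.commute)
  show "(x + r) / sqrt (q1 * q2) \<le> t \<Longrightarrow> x \<le> t + e * (1 + \<bar>t\<bar>)"
    unfolding s_def[symmetric] iff ee using st r by linarith
  show "x \<le> t - e * (1 + \<bar>t\<bar>) \<Longrightarrow> (x + r) / sqrt (q1 * q2) \<le> t"
    unfolding s_def[symmetric] iff ee using st r by linarith
qed

text \<open>The test statistic for arbitrary arrays, with the common factor of the covariances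
  cancelled.\<close>

definition corr_stat :: "nat \<Rightarrow> (nat \<Rightarrow> nat \<Rightarrow> real) \<Rightarrow> (nat \<Rightarrow> nat \<Rightarrow> real) \<Rightarrow> real" where
  "corr_stat n a b = sqrt (real n * (real n - 1) / 2) *
     (if u_inner n a a * u_inner n b b > 0 then u_inner n a b / sqrt (u_inner n a a * u_inner n b b) else 0)"

section \<open>Normal approximation of the studentized statistic\<close>

context two_kernels
begin

lemma corr_stat_measurable [measurable]:
  "(\<lambda>w. corr_stat n (hollow F w) (hollow K w)) \<in> borel_measurable (iid_seq P)"
  unfolding corr_stat_def u_inner_def u_center_def by measurable

lemma corr_stat_Berry_Esseen:
  assumes n: "4 \<le> n" and sx: "0 < X.sig2" and sy: "0 < Y.sig2" and e: "0 < e" "e \<le> 1/2"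
  defines "RX \<equiv> X.rho / X.sig2 powr (p / 2)" and "RY \<equiv> Y.rho / Y.sig2 powr (p / 2)"
    and "\<Gamma> \<equiv> (X.gam * Y.gam / (X.sig2 * Y.sig2)\<^sup>2) powr (p / 4)"
  shows "\<bar>measure (iid_seq P) {w \<in> space (iid_seq P). corr_stat n (hollow F w) (hollow K w) \<le> t} - Phi t\<bar>
    \<le> 5000 * (e + e powr (-p) * (real n powr (1 - p / 2) * (RX * RY) + \<Gamma>) + 1 / (real n * e\<^sup>2))"
proof -
  let ?S = "iid_seq P"
  have Sp: "prob_space ?S"
    by (intro prob_space.prob_space_iid_seq prob_space_pair X.prob_space_axioms Y.prob_space_axioms)
  define N where "N = real n"
  have N4: "4 \<le> N" using n by (simp add: N_def)
  have n2: "2 \<le> n" using n by simp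
  have sig: "0 < HK.sig2" "0 < FK.sig2" "0 < KK.sig2" using sx sy by (auto simp: kernel_params)
  define sf where "sf = FK.normalizer n"
  define sg where "sg = KK.normalizer n"
  define sh where "sh = HK.normalizer n"
  note nff = FK.normalizer_facts[OF n2 sig(2), folded sf_def]
  note nfg = KK.normalizer_facts[OF n2 sig(3), folded sg_def]
  note nfh = HK.normalizer_facts[OF n2 sig(1), folded sh_def]
  define W where "W w = (\<Sum>l=1..n. \<Sum>k=1..<l. H (w k) (w l)) / sh" for w
  define rr where "rr w = (\<Sum>k=1..n. rowsum F n w k * rowsum K n w k)" for w
  define tt where "tt w = (\<Sum>k=1..n. rowsum F n w k) * (\<Sum>k=1..n. rowsum K n w k)" for w
  define A1 where "A1 w = rr w / ((N - 2) * sh)" for w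
  define A2 where "A2 w = tt w / ((N - 1) * (N - 2) * (2 * sh))" for w
  define R where "R w = A2 w - A1 w" for w
  define QX where "QX w = u_inner n (hollow F w) (hollow F w) / (2 * sf\<^sup>2)" for w
  define QY where "QY w = u_inner n (hollow K w) (hollow K w) / (2 * sg\<^sup>2)" for w
  have W_meas [measurable]: "W \<in> borel_measurable ?S" unfolding W_def by measurable
  have [measurable]: "rr \<in> borel_measurable ?S" unfolding rr_def by measurable
  have [measurable]: "tt \<in> borel_measurable ?S" unfolding tt_def by measurable
  have [measurable]: "A1 \<in> borel_measurable ?S" unfolding A1_def by measurable
  have [measurable]: "A2 \<in> borel_measurable ?S" unfolding A2_def by measurable
  have [measurable]: "R \<in> borel_measurable ?S" unfolding R_def by measurable
  have [measurable]: "QX \<in> borel_measurable ?S" unfolding QX_def u_inner_def u_center_def by measurable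
  have [measurable]: "QY \<in> borel_measurable ?S" unfolding QY_def u_inner_def u_center_def by measurable
  have num: "u_inner n (hollow F w) (hollow K w) = 2 * sh * (W w + R w)" for w
  proof -
    have "(\<Sum>k=1..n. \<Sum>l=1..n. hollow F w k l * hollow K w k l) = (\<Sum>k=1..n. \<Sum>l=1..n. hollow H w k l)"
      by (simp add: hollow_mult H_def[abs_def])
    also have "\<dots> = 2 * (\<Sum>l=1..n. \<Sum>k=1..<l. H (w k) (w l))" by (rule sum_hollow_eq) (rule HK.h_sym)
    also have "\<dots> = 2 * sh * W w" using nfh(1) by (simp add: W_def)
    finally have "u_inner n (hollow F w) (hollow K w) = 2 * sh * W w - 2 * rr w / (N - 2) + tt w / ((N - 1) * (N - 2))"
      using u_inner_eq[of n "hollow F w" "hollow K w"] n hollow_sym[of F w, OF FK.h_sym] hollow_sym[of K w, OF KK.h_sym]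
      by (simp add: rowsum_def rr_def tt_def N_def)
    moreover have "2 * rr w / (N - 2) = 2 * sh * A1 w" using nfh(1) by (simp add: A1_def)
    moreover have "tt w / ((N - 1) * (N - 2)) = 2 * sh * A2 w" using nfh(1) by (simp add: A2_def)
    ultimately show ?thesis by (simp add: R_def algebra_simps)
  qed
  \<comment> \<open>This identity is the reason for the factor sqrt (n (n - 1) / 2): with it the
    statistic becomes (W + R) / sqrt (QX QY), where W has variance 1.\<close>
  have sfg: "sf * sg = sqrt (N * (N - 1) / 2) * sh"
  proof -
    have "sf * sg = sqrt (N * (N - 1) / 2) * (sqrt (N * (N - 1) / 2) * (sqrt X.sig2 * sqrt Y.sig2))"
      unfolding sf_def sg_def FK.normalizer_def KK.normalizer_def kernel_params N_def
        real_sqrt_mult[of _ X.sig2] real_sqrt_mult[of _ Y.sig2] by (simp only: ac_simps)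
    also have "sqrt (N * (N - 1) / 2) * (sqrt X.sig2 * sqrt Y.sig2) = sh"
      unfolding sh_def HK.normalizer_def kernel_params N_def real_sqrt_mult[of _ "X.sig2 * Y.sig2"]
        real_sqrt_mult[of X.sig2] ..
    finally show ?thesis .
  qed
  have stat: "corr_stat n (hollow F w) (hollow K w) = (W w + R w) / sqrt (QX w * QY w)" if "0 < QX w" "0 < QY w" for w
  proof -
    have uF: "u_inner n (hollow F w) (hollow F w) = 2 * sf\<^sup>2 * QX w" using nff(1) by (simp add: QX_def)
    have uK: "u_inner n (hollow K w) (hollow K w) = 2 * sg\<^sup>2 * QY w" using nfg(1) by (simp add: QY_def)
    have pos: "0 < u_inner n (hollow F w) (hollow F w) * u_inner n (hollow K w) (hollow K w)"
      unfolding uF uK using that nff(1) nfg(1) by (intro mult_pos_pos) auto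
    have "u_inner n (hollow F w) (hollow F w) * u_inner n (hollow K w) (hollow K w) = (2 * (sf * sg))\<^sup>2 * (QX w * QY w)"
      unfolding uF uK by (simp add: power_mult_distrib)
    hence "sqrt (u_inner n (hollow F w) (hollow F w) * u_inner n (hollow K w) (hollow K w)) = 2 * (sf * sg) * sqrt (QX w * QY w)"
      using nff(1) nfg(1) by (simp add: real_sqrt_mult)
    hence eq: "corr_stat n (hollow F w) (hollow K w)
       = sqrt (N * (N - 1) / 2) * (2 * sh * (W w + R w) / (2 * (sqrt (N * (N - 1) / 2) * sh) * sqrt (QX w * QY w)))"
      using pos by (simp add: corr_stat_def num sfg N_def)
    have sN: "sqrt (N * (N - 1) / 2) \<noteq> 0" using N4 by simp
    have cancel: "c * (2 * s * x / (2 * (c * s) * q)) = x / q" if "c \<noteq> 0" "s \<noteq> 0" for c s x q :: real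
      using that by (simp add: field_simps)
    show ?thesis unfolding eq by (rule cancel) (use sN nfh(1) in auto)
  qed
  define R1 where "R1 = N powr (1 - p / 2) * (RX * RY)"
  define E where "E = e powr (-p)"
  define Z where "Z = 1 / (N * e\<^sup>2)"
  have E0: "0 \<le> E" by (simp add: E_def)
  have Z0: "0 \<le> Z" using N4 by (simp add: Z_def)
  \<comment> \<open>By Jensen both ratios are at least 1, so the concentration error of one
    self-normalizer, which involves RX or RY alone, is dominated by their product.\<close>
  have R1ge: "1 \<le> RX" "1 \<le> RY"
    using X.sig2_powr_le Y.sig2_powr_le sx sy by (auto simp: RX_def RY_def)
  have R10: "0 \<le> R1" using R1ge by (simp add: R1_def)
  have g0: "0 \<le> \<Gamma>" by (simp add: \<Gamma>_def)
  have BE: "\<bar>measure ?S {w \<in> space ?S. W w \<le> a} - Phi a\<bar> \<le> 2000 * (e + E * (R1 + \<Gamma>))" for a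
    using HK.kernel_Berry_Esseen[OF n2 sig(1) e, of a] X.sig2_nonneg Y.sig2_nonneg
    by (simp add: W_def sh_def kernel_params HK_gam R1_def N_def RX_def RY_def \<Gamma>_def E_def powr_mult)
  have Ele: "e powr (- p / 2) \<le> E" unfolding E_def
  proof (rule powr_mono')
    show "- p \<le> - p / 2" using X.p by simp
  qed (use e in auto)
  have Zle: "16 / (N * e) \<le> 16 * Z"
  proof -
    have "e\<^sup>2 \<le> e" using e by (simp add: power2_eq_square mult_left_le)
    hence "N * e\<^sup>2 \<le> N * e" using N4 by (intro mult_left_mono) auto
    hence "1 / (N * e) \<le> 1 / (N * e\<^sup>2)" using N4 e by (intro divide_left_mono mult_pos_pos) auto
    thus ?thesis by (simp add: Z_def)
  qed
  have bound: "1152 * (e powr (- p / 2) * (N powr (1 - p / 2) * c)) \<le> 1152 * (E * R1)" if "0 \<le> c" "c \<le> RX * RY" for c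
    unfolding R1_def using Ele E0 that by (intro mult_left_mono mult_mono) auto
  have PX: "measure ?S {w \<in> space ?S. e \<le> \<bar>QX w - 1\<bar>} \<le> 1152 * (E * R1) + 16 * Z"
  proof -
    have "measure ?S {w \<in> space ?S. e \<le> \<bar>QX w - 1\<bar>} \<le> 1152 * (e powr (- p / 2) * (N powr (1 - p / 2) * RX)) + 16 / (N * e)"
      using FK.u_inner_concentration[OF n sig(2) e(1)] e by (simp add: QX_def sf_def N_def RX_def kernel_params)
    moreover have "RX \<le> RX * RY" using R1ge mult_left_mono[of 1 RY RX] by simp
    ultimately show ?thesis using bound[of RX] Zle R1ge by linarith
  qed
  have PY: "measure ?S {w \<in> space ?S. e \<le> \<bar>QY w - 1\<bar>} \<le> 1152 * (E * R1) + 16 * Z"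
  proof -
    have "measure ?S {w \<in> space ?S. e \<le> \<bar>QY w - 1\<bar>} \<le> 1152 * (e powr (- p / 2) * (N powr (1 - p / 2) * RY)) + 16 / (N * e)"
      using KK.u_inner_concentration[OF n sig(3) e(1)] e by (simp add: QY_def sg_def N_def RY_def kernel_params)
    moreover have "RY \<le> RX * RY" using R1ge mult_right_mono[of 1 RX RY] by simp
    ultimately show ?thesis using bound[of RY] Zle R1ge by linarith
  qed
  \<comment> \<open>Chebyshev at level e / 2 for the two remainders of the numerator; for small e
    this is the dominant source of the extra term 1 / (n e^2).\<close>
  have mk: "measure ?S {w \<in> space ?S. e / 2 \<le> \<bar>A w\<bar>} \<le> 32 * Z"
    if [measurable]: "A \<in> borel_measurable ?S" and i: "integrable ?S (\<lambda>w. (A w)\<^sup>2)" and m: "(\<integral>w. (A w)\<^sup>2 \<partial>?S) \<le> 8 / N" for A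
  proof -
    have pw: "\<bar>A w\<bar> powr 2 = (A w)\<^sup>2" for w by simp
    have "measure ?S {w \<in> space ?S. e / 2 \<le> \<bar>A w\<bar>} \<le> (\<integral>w. \<bar>A w\<bar> powr 2 \<partial>?S) / (e / 2) powr 2"
      using i e by (intro prob_space.markov_powr[OF Sp]) (simp_all only: pw, auto)
    also have "\<dots> = (\<integral>w. (A w)\<^sup>2 \<partial>?S) / (e / 2)\<^sup>2" using e by (simp only: pw) simp
    also have "\<dots> \<le> (8 / N) / (e / 2)\<^sup>2" using m by (intro divide_right_mono) auto
    also have "\<dots> = 32 * Z" by (simp add: Z_def power_divide)
    finally show ?thesis .
  qed
  have shsq: "sh\<^sup>2 = N * (N - 1) / 2 * (X.sig2 * Y.sig2)" using nfh(2) by (simp add: kernel_params N_def)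
  define \<sigma> where "\<sigma> = X.sig2 * Y.sig2"
  have \<sigma>: "0 < \<sigma>" using sx sy by (simp add: \<sigma>_def)
  have N8: "2 * N / (N - 2)\<^sup>2 \<le> 8 / N"
  proof -
    have "N / 2 \<le> N - 2" using N4 by simp
    hence "(N / 2)\<^sup>2 \<le> (N - 2)\<^sup>2" using N4 by (intro power_mono) auto
    hence "2 * N / (N - 2)\<^sup>2 \<le> 2 * N / (N / 2)\<^sup>2" using N4 by (intro divide_left_mono mult_pos_pos zero_less_power) auto
    also have "\<dots> = 8 / N" using N4 by (simp add: power2_eq_square)
    finally show ?thesis .
  qed
  have PA1: "measure ?S {w \<in> space ?S. e / 2 \<le> \<bar>A1 w\<bar>} \<le> 32 * Z"
  proof (rule mk)
    have eq: "(A1 w)\<^sup>2 = (rr w)\<^sup>2 / ((N - 2) * sh)\<^sup>2" for w by (simp add: A1_def power_divide)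
    have m: "integrable ?S (\<lambda>w. (rr w)\<^sup>2)" "(\<integral>w. (rr w)\<^sup>2 \<partial>?S) = N\<^sup>2 * (N - 1) * \<sigma>"
      using rowsum_product_moment[of n] by (simp_all add: rr_def N_def \<sigma>_def)
    show "integrable ?S (\<lambda>w. (A1 w)\<^sup>2)" unfolding eq using m by simp
    have "(\<integral>w. (A1 w)\<^sup>2 \<partial>?S) = N\<^sup>2 * (N - 1) * \<sigma> / ((N - 2) * sh)\<^sup>2" unfolding eq using m by simp
    also have "\<dots> = (2 * N) * (N * (N - 1) / 2 * \<sigma>) / ((N - 2)\<^sup>2 * (N * (N - 1) / 2 * \<sigma>))"
      unfolding power_mult_distrib shsq \<sigma>_def[symmetric] by (simp add: power2_eq_square)
    also have "\<dots> = 2 * N / (N - 2)\<^sup>2"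
      by (rule nonzero_mult_divide_mult_cancel_right) (use N4 \<sigma> in auto)
    finally show "(\<integral>w. (A1 w)\<^sup>2 \<partial>?S) \<le> 8 / N" using N8 by simp
  qed measurable
  have PA2: "measure ?S {w \<in> space ?S. e / 2 \<le> \<bar>A2 w\<bar>} \<le> 32 * Z"
  proof (rule mk)
    have eq: "(A2 w)\<^sup>2 = (tt w)\<^sup>2 / ((N - 1) * (N - 2) * (2 * sh))\<^sup>2" for w by (simp add: A2_def power_divide)
    have m: "integrable ?S (\<lambda>w. (tt w)\<^sup>2)" "(\<integral>w. (tt w)\<^sup>2 \<partial>?S) = (2 * N * (N - 1))\<^sup>2 * \<sigma>"
      using total_product_moment[of n] by (simp_all add: tt_def N_def \<sigma>_def)
    show "integrable ?S (\<lambda>w. (A2 w)\<^sup>2)" unfolding eq using m by simp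
    have "(\<integral>w. (A2 w)\<^sup>2 \<partial>?S) = (2 * N * (N - 1))\<^sup>2 * \<sigma> / ((N - 1) * (N - 2) * (2 * sh))\<^sup>2" unfolding eq using m by simp
    also have "\<dots> = N\<^sup>2 * \<sigma> * (2 * (N - 1))\<^sup>2 / ((N - 2)\<^sup>2 * sh\<^sup>2 * (2 * (N - 1))\<^sup>2)"
      by (simp only: power_mult_distrib ac_simps)
    also have "\<dots> = N\<^sup>2 * \<sigma> / ((N - 2)\<^sup>2 * sh\<^sup>2)"
      by (rule nonzero_mult_divide_mult_cancel_right) (use N4 in auto)
    also have "\<dots> = (2 * N) * (N / 2 * \<sigma>) / ((N - 2)\<^sup>2 * (N - 1) * (N / 2 * \<sigma>))"
      unfolding shsq \<sigma>_def[symmetric] by (simp add: power2_eq_square ac_simps)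
    also have "\<dots> = 2 * N / ((N - 2)\<^sup>2 * (N - 1))"
      by (rule nonzero_mult_divide_mult_cancel_right) (use N4 \<sigma> in auto)
    also have "\<dots> \<le> 2 * N / ((N - 2)\<^sup>2 * 1)"
      using N4 by (intro divide_left_mono mult_left_mono mult_pos_pos) auto
    finally show "(\<integral>w. (A2 w)\<^sup>2 \<partial>?S) \<le> 8 / N" using N8 by simp
  qed measurable
  define B1 where "B1 = {w \<in> space ?S. e \<le> \<bar>QX w - 1\<bar>}"
  define B2 where "B2 = {w \<in> space ?S. e \<le> \<bar>QY w - 1\<bar>}"
  define B3 where "B3 = {w \<in> space ?S. e / 2 \<le> \<bar>A1 w\<bar>}"
  define B4 where "B4 = {w \<in> space ?S. e / 2 \<le> \<bar>A2 w\<bar>}"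
  have B_sets [measurable]: "B1 \<in> sets ?S" "B2 \<in> sets ?S" "B3 \<in> sets ?S" "B4 \<in> sets ?S"
    unfolding B1_def B2_def B3_def B4_def by measurable
  define Bad where "Bad = (B1 \<union> B2) \<union> (B3 \<union> B4)"
  have "measure ?S Bad \<le> measure ?S (B1 \<union> B2) + measure ?S (B3 \<union> B4)" unfolding Bad_def by (rule measure_Un_le) measurable
  also have "\<dots> \<le> (measure ?S B1 + measure ?S B2) + (measure ?S B3 + measure ?S B4)" by (intro add_mono measure_Un_le) measurable
  \<comment> \<open>2304 is 2 * 1152 from the two self-normalizers; 96 is 2 * 16 from them plus 2 *
    32 from the two remainders.\<close>
  finally have PB: "measure ?S Bad \<le> 2304 * (E * R1) + 96 * Z"
    using PX PY PA1 PA2 by (simp add: B1_def B2_def B3_def B4_def)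
  have good: "\<bar>QX w - 1\<bar> < e" "\<bar>QY w - 1\<bar> < e" "\<bar>R w\<bar> < e" if "w \<in> space ?S - Bad" for w
  proof -
    have w: "w \<in> space ?S" "w \<notin> B1" "w \<notin> B2" "w \<notin> B3" "w \<notin> B4" using that by (auto simp: Bad_def)
    show "\<bar>QX w - 1\<bar> < e" "\<bar>QY w - 1\<bar> < e" using w by (auto simp: B1_def B2_def)
    have "\<bar>A1 w\<bar> < e / 2" "\<bar>A2 w\<bar> < e / 2" using w by (auto simp: B3_def B4_def)
    thus "\<bar>R w\<bar> < e" unfolding R_def using abs_triangle_ineq4[of "A2 w" "A1 w"] by argo
  qed
  have "\<bar>measure ?S {w \<in> space ?S. corr_stat n (hollow F w) (hollow K w) \<le> t} - Phi t\<bar>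
    \<le> 2000 * (e + E * (R1 + \<Gamma>)) + 2 * e + measure ?S Bad"
  proof (rule prob_space.Phi_ratio_perturbation[OF Sp W_meas corr_stat_measurable _ _ _ BE])
    show "Bad \<in> sets ?S" unfolding Bad_def by measurable
    fix w assume w: "w \<in> space ?S - Bad"
    note gd = good[OF w] 
    note rd = ratio_deviation[OF gd e(2)]
    note st = stat[OF rd(1,2)]
    show "W w \<le> t + e * (1 + \<bar>t\<bar>)" if "corr_stat n (hollow F w) (hollow K w) \<le> t"
      using that rd(3) unfolding st by blast
    show "corr_stat n (hollow F w) (hollow K w) \<le> t" if "W w \<le> t - e * (1 + \<bar>t\<bar>)"
      using that rd(4) unfolding st by blast
  qed (use e in auto)
  also have "\<dots> \<le> 2000 * (e + E * (R1 + \<Gamma>)) + 2 * e + (2304 * (E * R1) + 96 * Z)" using PB by simp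
  also have "\<dots> \<le> 5000 * (e + E * (R1 + \<Gamma>) + Z)"
  proof -
    have "0 \<le> E * R1" "0 \<le> E * \<Gamma>" using E0 R10 g0 by auto
    thus ?thesis using e Z0 by (simp add: algebra_simps)
  qed
  finally show ?thesis by (simp add: R1_def N_def E_def Z_def)
qed

end

section \<open>Euclidean distances and double centering\<close>

lemma vec_norm_nonneg: "0 \<le> vec_norm d x" by (simp add: vec_norm_def)

lemma vec_dist_nonneg: "0 \<le> vec_dist d x y" by (simp add: vec_dist_def vec_norm_nonneg)

lemma vec_norm_sq: "(vec_norm d x)\<^sup>2 = (\<Sum>i<d. (x i)\<^sup>2)"
  by (simp add: vec_norm_def L2_set_def sum_nonneg)

lemma vec_dist_sq: "(vec_dist d x y)\<^sup>2 = (vec_norm d x)\<^sup>2 + (vec_norm d y)\<^sup>2 - 2 * vec_inner d x y"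
  by (simp add: vec_dist_def vec_norm_sq vec_inner_def power2_diff sum.distrib sum_subtractf sum_distrib_left mult.assoc)

lemma vec_inner_sym: "vec_inner d x y = vec_inner d y x"
  by (simp add: vec_inner_def mult.commute)

lemma vec_dist_sym: "vec_dist d x y = vec_dist d y x"
  using vec_dist_sq[of d x y] vec_dist_sq[of d y x] vec_dist_nonneg
  by (metis add.commute power2_eq_iff_nonneg vec_inner_sym)

lemma vec_dist_self: "vec_dist d x x = 0"
  by (simp add: vec_dist_def vec_norm_def L2_set_def)

lemma abs_vec_inner_le: "\<bar>vec_inner d x y\<bar> \<le> vec_norm d x * vec_norm d y"
proof -
  have "\<bar>vec_inner d x y\<bar> \<le> (\<Sum>i<d. \<bar>x i\<bar> * \<bar>y i\<bar>)"
    unfolding vec_inner_def by (rule order.trans[OF sum_abs]) (simp add: abs_mult)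
  also have "\<dots> \<le> vec_norm d x * vec_norm d y" unfolding vec_norm_def by (rule L2_set_mult_ineq)
  finally show ?thesis .
qed

lemma vec_dist_le: "vec_dist d x y \<le> vec_norm d x + vec_norm d y"
proof (rule power2_le_imp_le)
  have "- vec_inner d x y \<le> vec_norm d x * vec_norm d y" using abs_vec_inner_le[of d x y] by linarith
  thus "(vec_dist d x y)\<^sup>2 \<le> (vec_norm d x + vec_norm d y)\<^sup>2"
    unfolding vec_dist_sq power2_sum by linarith
qed (simp add: vec_norm_nonneg)

lemma abs_coord_le_vec_norm: "i < d \<Longrightarrow> \<bar>x i\<bar> \<le> vec_norm d x"
  unfolding vec_norm_def L2_set_def
  by (rule real_le_rsqrt) (auto intro: member_le_sum[of i "{..<d}" "\<lambda>i. (x i)\<^sup>2", simplified])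

lemma vec_norm_measurable [measurable]: "vec_norm d \<in> borel_measurable (vec_space d)"
  unfolding vec_norm_def L2_set_def by measurable

lemma vec_inner_measurable [measurable (raw)]:
  assumes [measurable]: "f \<in> measurable N (vec_space d)" "g \<in> measurable N (vec_space d)"
  shows "(\<lambda>w. vec_inner d (f w) (g w)) \<in> borel_measurable N"
proof -
  have "(\<lambda>w. f w i) \<in> borel_measurable N" "(\<lambda>w. g w i) \<in> borel_measurable N" if "i < d" for i
    using that by (auto intro!: measurable_compose[OF assms(1)] measurable_compose[OF assms(2)] measurable_component_singleton)
  thus ?thesis unfolding vec_inner_def by (intro borel_measurable_sum borel_measurable_times) auto
qed

text \<open>The coordinatewise difference of two points need not be extensional outside
  \<open>{..<d}\<close>, so measurability goes through norms and inner product instead of the norm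
  of the difference.\<close>

lemma vec_dist_measurable [measurable (raw)]:
  assumes [measurable]: "f \<in> measurable N (vec_space d)" "g \<in> measurable N (vec_space d)"
  shows "(\<lambda>w. vec_dist d (f w) (g w)) \<in> borel_measurable N"
proof -
  have eq: "vec_dist d x y = sqrt ((vec_norm d x)\<^sup>2 + (vec_norm d y)\<^sup>2 - 2 * vec_inner d x y)" for x y
    unfolding vec_dist_sq[symmetric] using vec_dist_nonneg by simp
  have [measurable]: "(\<lambda>w. vec_norm d (f w)) \<in> borel_measurable N" "(\<lambda>w. vec_norm d (g w)) \<in> borel_measurable N"
    by (rule measurable_compose[OF assms(1) vec_norm_measurable], rule measurable_compose[OF assms(2) vec_norm_measurable])
  show ?thesis unfolding eq by measurable
qed

section \<open>Double centering of square integrable kernels\<close>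

lemma (in prob_space) integral_centered_square_le:
  fixes f :: "'a \<Rightarrow> real"
  assumes [measurable]: "f \<in> borel_measurable M" and f2: "integrable M (\<lambda>x. (f x)\<^sup>2)"
  shows "integrable M (\<lambda>x. (f x - (\<integral>z. f z \<partial>M))\<^sup>2)" "(\<integral>x. (f x - (\<integral>z. f z \<partial>M))\<^sup>2 \<partial>M) \<le> (\<integral>x. (f x)\<^sup>2 \<partial>M)"
proof -
  define m where "m = (\<integral>z. f z \<partial>M)"
  have i: "integrable M f" using integral_mult_square_le(1)[of f M "\<lambda>_. 1"] f2 by simp
  have eq: "(f x - m)\<^sup>2 = (f x)\<^sup>2 - (2 * m) * f x + m\<^sup>2" for x by (simp add: power2_diff)
  show "integrable M (\<lambda>x. (f x - (\<integral>z. f z \<partial>M))\<^sup>2)" unfolding m_def[symmetric] eq using i f2 by simp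
  have "(\<integral>x. (f x - m)\<^sup>2 \<partial>M) = (\<integral>x. (f x)\<^sup>2 \<partial>M) - m\<^sup>2"
    unfolding eq using i f2 by (simp add: prob_space m_def power2_eq_square)
  thus "(\<integral>x. (f x - (\<integral>z. f z \<partial>M))\<^sup>2 \<partial>M) \<le> (\<integral>x. (f x)\<^sup>2 \<partial>M)" by (simp add: m_def)
qed

definition double_center :: "'a measure \<Rightarrow> ('a \<Rightarrow> 'a \<Rightarrow> real) \<Rightarrow> 'a \<Rightarrow> 'a \<Rightarrow> real" where
  "double_center M k x y = k x y - (\<integral>z. k x z \<partial>M) - (\<integral>z. k y z \<partial>M) + (\<integral>w. (\<integral>z. k w z \<partial>M) \<partial>M)"

locale sq_kernel = prob_space M for M :: "'a measure" +
  fixes k :: "'a \<Rightarrow> 'a \<Rightarrow> real"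
  assumes k_meas: "(\<lambda>(x, y). k x y) \<in> borel_measurable (M \<Otimes>\<^sub>M M)"
    and k_sym: "k x y = k y x"
    and k_sq1: "x \<in> space M \<Longrightarrow> integrable M (\<lambda>y. (k x y)\<^sup>2)"
    and k_sq2: "integrable (M \<Otimes>\<^sub>M M) (\<lambda>(x, y). (k x y)\<^sup>2)"
begin

sublocale QQ: pair_prob_space M M ..

lemmas k_meas' [measurable] = k_meas

lemma k_meas1 [measurable]: "x \<in> space M \<Longrightarrow> k x \<in> borel_measurable M"
  using measurable_Pair2[OF k_meas, of x] by simp

lemma k_int1: "x \<in> space M \<Longrightarrow> integrable M (k x)"
  using integral_mult_square_le(1)[of "k x" M "\<lambda>_. 1"] k_sq1 by simp

lemma k_int2: "integrable (M \<Otimes>\<^sub>M M) (\<lambda>(x, y). k x y)"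
  using integral_mult_square_le(1)[of "\<lambda>(x, y). k x y" "M \<Otimes>\<^sub>M M" "\<lambda>_. 1"] k_sq2 by (simp add: split_def)

lemma marg_int: "integrable M (\<lambda>x. \<integral>z. k x z \<partial>M)"
  using QQ.integrable_fst[OF k_int2] .

lemma dc_meas: "(\<lambda>(x, y). double_center M k x y) \<in> borel_measurable (M \<Otimes>\<^sub>M M)"
  unfolding double_center_def by measurable

lemma dc_sym: "double_center M k x y = double_center M k y x"
  by (simp add: double_center_def k_sym[of x y])

lemma dc_mean: "x \<in> space M \<Longrightarrow> (\<integral>y. double_center M k x y \<partial>M) = 0"
  unfolding double_center_def using k_int1 marg_int by (simp add: prob_space)

text \<open>Double centering is two successive conditional centerings, hence an \<open>L\<^sup>2\<close> contraction.\<close>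

lemma dc_square:
  "x \<in> space M \<Longrightarrow> integrable M (\<lambda>y. (double_center M k x y)\<^sup>2)"
  "integrable (M \<Otimes>\<^sub>M M) (\<lambda>(x, y). (double_center M k x y)\<^sup>2)"
  "(\<integral>(x, y). (double_center M k x y)\<^sup>2 \<partial>(M \<Otimes>\<^sub>M M)) \<le> (\<integral>(x, y). (k x y)\<^sup>2 \<partial>(M \<Otimes>\<^sub>M M))"
proof -
  define k1 where "k1 x = (\<integral>z. k x z \<partial>M)" for x
  have k1_meas [measurable]: "k1 \<in> borel_measurable M" unfolding k1_def by measurable
  define c where "c x y = k x y - k1 x" for x y
  have c_meas [measurable]: "(\<lambda>(x, y). c x y) \<in> borel_measurable (M \<Otimes>\<^sub>M M)" unfolding c_def split_def
    using k_meas by (simp add: split_def)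
  have c1: "integrable M (\<lambda>y. (c x y)\<^sup>2)" "(\<integral>y. (c x y)\<^sup>2 \<partial>M) \<le> (\<integral>y. (k x y)\<^sup>2 \<partial>M)" if "x \<in> space M" for x
    using integral_centered_square_le[OF k_meas1[OF that] k_sq1[OF that]] by (auto simp: c_def k1_def)
  have ik: "integrable M (\<lambda>x. \<integral>y. (k x y)\<^sup>2 \<partial>M)" "(\<integral>x. (\<integral>y. (k x y)\<^sup>2 \<partial>M) \<partial>M) = (\<integral>(x, y). (k x y)\<^sup>2 \<partial>(M \<Otimes>\<^sub>M M))"
    using QQ.integrable_fst[OF k_sq2] QQ.integral_fst[OF k_sq2] by simp_all
  have ic: "integrable M (\<lambda>x. \<integral>y. (c x y)\<^sup>2 \<partial>M)"
    by (rule Bochner_Integration.integrable_bound[OF ik(1)]) (use c1 in auto)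
  have c2: "integrable (M \<Otimes>\<^sub>M M) (\<lambda>(x, y). (c x y)\<^sup>2)"
    by (rule QQ.Fubini_integrable) (use ic c1 in \<open>auto intro!: AE_I2\<close>)
  have c2le: "(\<integral>(x, y). (c x y)\<^sup>2 \<partial>(M \<Otimes>\<^sub>M M)) \<le> (\<integral>(x, y). (k x y)\<^sup>2 \<partial>(M \<Otimes>\<^sub>M M))"
  proof -
    have "(\<integral>(x, y). (c x y)\<^sup>2 \<partial>(M \<Otimes>\<^sub>M M)) = (\<integral>x. (\<integral>y. (c x y)\<^sup>2 \<partial>M) \<partial>M)"
      using QQ.integral_fst[OF c2] by simp
    also have "\<dots> \<le> (\<integral>x. (\<integral>y. (k x y)\<^sup>2 \<partial>M) \<partial>M)" by (rule integral_mono) (use c1 ic ik in auto)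
    finally show ?thesis using ik(2) by simp
  qed
  have k1sq: "integrable M (\<lambda>x. (k1 x)\<^sup>2)"
  proof (rule Bochner_Integration.integrable_bound[OF ik(1)])
    show "AE x in M. norm ((k1 x)\<^sup>2) \<le> norm (\<integral>y. (k x y)\<^sup>2 \<partial>M)"
    proof (rule AE_I2)
      fix x assume x: "x \<in> space M"
      show "norm ((k1 x)\<^sup>2) \<le> norm (\<integral>y. (k x y)\<^sup>2 \<partial>M)"
        using integral_mult_square_le(2)[of "k x" M "\<lambda>_. 1"] k_sq1[OF x] x prob_space by (simp add: k1_def)
    qed
  qed simp
  \<comment> \<open>c came from centering in the second argument; centering c in the first gives the
    rest, the grand mean arising as the average of k1.\<close>
  have dc_eq: "double_center M k x y = c x y - (\<integral>z. c z y \<partial>M)" if "y \<in> space M" for x y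
  proof -
    have "(\<integral>z. c z y \<partial>M) = (\<integral>z. k y z - k1 z \<partial>M)" unfolding c_def by (subst k_sym) simp
    also have "\<dots> = k1 y - (\<integral>z. k1 z \<partial>M)" using k_int1[OF that] marg_int by (simp add: k1_def)
    finally show ?thesis by (simp add: double_center_def c_def k1_def)
  qed
  have c_col: "integrable M (\<lambda>x. (c x y)\<^sup>2)" if y: "y \<in> space M" for y
  proof (rule Bochner_Integration.integrable_bound)
    show "integrable M (\<lambda>x. 2 * ((k y x)\<^sup>2 + (k1 x)\<^sup>2))" using k_sq1[OF y] k1sq by simp
    show "(\<lambda>x. (c x y)\<^sup>2) \<in> borel_measurable M" unfolding c_def using y by (subst k_sym) simp
    have "(c x y)\<^sup>2 \<le> 2 * ((k y x)\<^sup>2 + (k1 x)\<^sup>2)" for x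
      unfolding c_def using k_sym[of x y] sum_squares_bound[of "k y x" "- k1 x"] by (simp add: power2_diff)
    thus "AE x in M. norm ((c x y)\<^sup>2) \<le> norm (2 * ((k y x)\<^sup>2 + (k1 x)\<^sup>2))" by (intro AE_I2) simp
  qed
  have c_col_meas: "(\<lambda>x. c x y) \<in> borel_measurable M" if y: "y \<in> space M" for y
    unfolding c_def using y by (subst k_sym) simp
  have d1: "integrable M (\<lambda>x. (double_center M k x y)\<^sup>2)"
    "(\<integral>x. (double_center M k x y)\<^sup>2 \<partial>M) \<le> (\<integral>x. (c x y)\<^sup>2 \<partial>M)" if y: "y \<in> space M" for y
    unfolding dc_eq[OF y] by (rule integral_centered_square_le[OF c_col_meas[OF y] c_col[OF y]])+
  show "integrable M (\<lambda>y. (double_center M k x y)\<^sup>2)" if "x \<in> space M"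
    using d1(1)[OF that] by (simp add: dc_sym[of x])
  have icc: "integrable M (\<lambda>y. \<integral>x. (c x y)\<^sup>2 \<partial>M)" "(\<integral>y. (\<integral>x. (c x y)\<^sup>2 \<partial>M) \<partial>M) = (\<integral>(x, y). (c x y)\<^sup>2 \<partial>(M \<Otimes>\<^sub>M M))"
    using QQ.integrable_snd[OF c2] QQ.integral_snd[OF c2] by simp_all
  have dcm [measurable]: "(\<lambda>(x, y). double_center M k x y) \<in> borel_measurable (M \<Otimes>\<^sub>M M)" by (rule dc_meas)
  have id: "integrable M (\<lambda>y. \<integral>x. (double_center M k x y)\<^sup>2 \<partial>M)"
    by (rule Bochner_Integration.integrable_bound[OF icc(1)]) (use d1 in auto)
  have id': "integrable M (\<lambda>x. \<integral>y. (double_center M k x y)\<^sup>2 \<partial>M)" using id by (subst dc_sym)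
  show d2: "integrable (M \<Otimes>\<^sub>M M) (\<lambda>(x, y). (double_center M k x y)\<^sup>2)"
    by (rule QQ.Fubini_integrable) (use id' d1 in \<open>auto intro!: AE_I2 simp: dc_sym\<close>)
  have "(\<integral>(x, y). (double_center M k x y)\<^sup>2 \<partial>(M \<Otimes>\<^sub>M M)) = (\<integral>y. (\<integral>x. (double_center M k x y)\<^sup>2 \<partial>M) \<partial>M)"
    using QQ.integral_snd[OF d2] by simp
  also have "\<dots> \<le> (\<integral>y. (\<integral>x. (c x y)\<^sup>2 \<partial>M) \<partial>M)" by (rule integral_mono) (use id icc d1 in auto)
  finally show "(\<integral>(x, y). (double_center M k x y)\<^sup>2 \<partial>(M \<Otimes>\<^sub>M M)) \<le> (\<integral>(x, y). (k x y)\<^sup>2 \<partial>(M \<Otimes>\<^sub>M M))"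
    using icc(2) c2le by simp
qed

text \<open>Four summands, each with p-th moment at most that of k by Jensen; convexity gives 4 powr
  (p - 1) times four of them.\<close>

lemma dc_powr:
  assumes p: "2 \<le> p"
    and i1: "\<And>x. x \<in> space M \<Longrightarrow> integrable M (\<lambda>y. \<bar>k x y\<bar> powr p)"
    and i2: "integrable (M \<Otimes>\<^sub>M M) (\<lambda>(x, y). \<bar>k x y\<bar> powr p)"
  shows "x \<in> space M \<Longrightarrow> integrable M (\<lambda>y. \<bar>double_center M k x y\<bar> powr p)"
    "integrable (M \<Otimes>\<^sub>M M) (\<lambda>(x, y). \<bar>double_center M k x y\<bar> powr p)"
    "(\<integral>(x, y). \<bar>double_center M k x y\<bar> powr p \<partial>(M \<Otimes>\<^sub>M M)) \<le> 4 powr p * (\<integral>(x, y). \<bar>k x y\<bar> powr p \<partial>(M \<Otimes>\<^sub>M M))"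
proof -
  define k1 where "k1 x = (\<integral>z. k x z \<partial>M)" for x
  define k0 where "k0 = (\<integral>x. k1 x \<partial>M)"
  define C where "C = (\<integral>(x, y). \<bar>k x y\<bar> powr p \<partial>(M \<Otimes>\<^sub>M M))"
  have k1_meas [measurable]: "k1 \<in> borel_measurable M" unfolding k1_def by measurable
  have ik: "integrable M (\<lambda>x. \<integral>y. \<bar>k x y\<bar> powr p \<partial>M)" "(\<integral>x. (\<integral>y. \<bar>k x y\<bar> powr p \<partial>M) \<partial>M) = C"
    using QQ.integrable_fst[OF i2] QQ.integral_fst[OF i2] by (simp_all add: C_def)
  have k1p: "\<bar>k1 x\<bar> powr p \<le> (\<integral>y. \<bar>k x y\<bar> powr p \<partial>M)" if "x \<in> space M" for x
    using abs_integral_powr_le(2)[OF k_meas1[OF that] i1[OF that]] p by (simp add: k1_def)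
  have ik1: "integrable M (\<lambda>x. \<bar>k1 x\<bar> powr p)"
    by (rule Bochner_Integration.integrable_bound[OF ik(1)]) (use k1p in auto)
  have k1C: "(\<integral>x. \<bar>k1 x\<bar> powr p \<partial>M) \<le> C"
    unfolding ik(2)[symmetric] using ik1 ik k1p by (intro integral_mono) auto
  have k0C: "\<bar>k0\<bar> powr p \<le> C"
    using abs_integral_powr_le(2)[OF k1_meas ik1] p k1C by (simp add: k0_def)
  have dc: "double_center M k x y = k x y - k1 x - k1 y + k0" for x y
    by (simp add: double_center_def k1_def k0_def)
  have bd: "\<bar>double_center M k x y\<bar> powr p
     \<le> 4 powr (p - 1) * (\<bar>k x y\<bar> powr p + \<bar>k1 x\<bar> powr p + \<bar>k1 y\<bar> powr p + \<bar>k0\<bar> powr p)" for x y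
  proof -
    define a where "a i = (if i = (0::nat) then k x y else if i = 1 then - k1 x else if i = 2 then - k1 y else k0)" for i
    have "{0..<4::nat} = {0, 1, 2, 3}" by auto
    hence s: "(\<Sum>i\<in>{0..<4}. a i) = double_center M k x y"
      "(\<Sum>i\<in>{0..<4}. \<bar>a i\<bar> powr p) = \<bar>k x y\<bar> powr p + \<bar>k1 x\<bar> powr p + \<bar>k1 y\<bar> powr p + \<bar>k0\<bar> powr p"
      by (simp_all add: a_def dc)
    show ?thesis using sum_abs_powr_le[of "{0..<4}" p a] p unfolding s by simp
  qed
  have dcm: "(\<lambda>(x, y). double_center M k x y) \<in> borel_measurable (M \<Otimes>\<^sub>M M)" by (rule dc_meas)
  show "integrable M (\<lambda>y. \<bar>double_center M k x y\<bar> powr p)" if x: "x \<in> space M"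
  proof (rule Bochner_Integration.integrable_bound)
    show "integrable M (\<lambda>y. 4 powr (p - 1) * (\<bar>k x y\<bar> powr p + \<bar>k1 x\<bar> powr p + \<bar>k1 y\<bar> powr p + \<bar>k0\<bar> powr p))"
      using i1[OF x] ik1 by simp
    have [measurable]: "double_center M k x \<in> borel_measurable M" using measurable_Pair2[OF dcm x] by simp
    show "(\<lambda>y. \<bar>double_center M k x y\<bar> powr p) \<in> borel_measurable M" by measurable
  qed (rule AE_I2, unfold real_norm_def abs_of_nonneg[OF powr_ge_zero], rule order.trans[OF bd abs_ge_self])
  have one: "integrable M (\<lambda>_. 1 :: real)" by simp
  have f1: "integrable (M \<Otimes>\<^sub>M M) (\<lambda>q. \<bar>k1 (fst q)\<bar> powr p)" "(\<integral>q. \<bar>k1 (fst q)\<bar> powr p \<partial>(M \<Otimes>\<^sub>M M)) = (\<integral>x. \<bar>k1 x\<bar> powr p \<partial>M)"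
    using QQ.integrable_pair_product[OF ik1 one] QQ.integral_fst[OF QQ.integrable_pair_product[OF ik1 one]] prob_space
    by (simp_all add: split_def)
  have f2: "integrable (M \<Otimes>\<^sub>M M) (\<lambda>q. \<bar>k1 (snd q)\<bar> powr p)" "(\<integral>q. \<bar>k1 (snd q)\<bar> powr p \<partial>(M \<Otimes>\<^sub>M M)) = (\<integral>x. \<bar>k1 x\<bar> powr p \<partial>M)"
    using QQ.integrable_pair_product[OF one ik1] QQ.integral_snd[OF QQ.integrable_pair_product[OF one ik1]] prob_space
    by (simp_all add: split_def)
  have i2': "integrable (M \<Otimes>\<^sub>M M) (\<lambda>q. \<bar>k (fst q) (snd q)\<bar> powr p)" using i2 by (simp add: split_def)
  let ?R = "\<lambda>q. 4 powr (p - 1) * (\<bar>k (fst q) (snd q)\<bar> powr p + \<bar>k1 (fst q)\<bar> powr p + \<bar>k1 (snd q)\<bar> powr p + \<bar>k0\<bar> powr p)"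
  have iR: "integrable (M \<Otimes>\<^sub>M M) ?R" using i2' f1 f2 by simp
  have dcm' [measurable]: "(\<lambda>q. double_center M k (fst q) (snd q)) \<in> borel_measurable (M \<Otimes>\<^sub>M M)"
    using dcm by (simp add: split_def)
  have iL: "integrable (M \<Otimes>\<^sub>M M) (\<lambda>q. \<bar>double_center M k (fst q) (snd q)\<bar> powr p)"
    by (rule Bochner_Integration.integrable_bound[OF iR], measurable)
       (rule AE_I2, unfold real_norm_def abs_of_nonneg[OF powr_ge_zero], rule order.trans[OF bd abs_ge_self])
  thus "integrable (M \<Otimes>\<^sub>M M) (\<lambda>(x, y). \<bar>double_center M k x y\<bar> powr p)" by (simp add: split_def)
  have "(\<integral>q. \<bar>double_center M k (fst q) (snd q)\<bar> powr p \<partial>(M \<Otimes>\<^sub>M M)) \<le> (\<integral>q. ?R q \<partial>(M \<Otimes>\<^sub>M M))"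
    using iL iR bd by (intro integral_mono) auto
  also have "\<dots> = 4 powr (p - 1) * (C + (\<integral>x. \<bar>k1 x\<bar> powr p \<partial>M) + (\<integral>x. \<bar>k1 x\<bar> powr p \<partial>M) + \<bar>k0\<bar> powr p)"
    using i2' f1 f2 QQ.P.prob_space by (simp add: C_def split_def)
  also have "\<dots> \<le> 4 powr (p - 1) * (C + C + C + C)"
    using k1C k0C by (intro mult_left_mono add_mono) auto
  also have "\<dots> = (4 * 4 powr (p - 1)) * C" by simp
  also have "4 * 4 powr (p - 1) = (4::real) powr p" using powr_mult_base[of 4 "p - 1"] by simp
  finally show "(\<integral>(x, y). \<bar>double_center M k x y\<bar> powr p \<partial>(M \<Otimes>\<^sub>M M)) \<le> 4 powr p * (\<integral>(x, y). \<bar>k x y\<bar> powr p \<partial>(M \<Otimes>\<^sub>M M))"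
    by (simp add: C_def split_def)
qed

end

text \<open>All from w = (s - 1) (s + 1) with s \<ge> 0. The square of s - 1 is at most w^2 and at
  most |w|, hence at most any power of |w| with exponent between 1 and 2; 1 + \<tau> is chosen
  because its double is the order of the controlled moment.\<close>

lemma sqrt_expansion:
  fixes s w \<tau> :: real
  assumes s: "0 \<le> s" "s\<^sup>2 = 1 + w" and \<tau>: "0 \<le> \<tau>" "\<tau> \<le> 1"
  shows "\<bar>s - 1\<bar> \<le> \<bar>w\<bar>" "s - 1 - w / 2 = - ((s - 1)\<^sup>2 / 2)" "(s - 1)\<^sup>2 \<le> \<bar>w\<bar> powr (1 + \<tau>)"
proof -
  have w: "w = (s - 1) * (s + 1)" using s(2) by (simp add: power2_eq_square algebra_simps)
  have aw: "\<bar>w\<bar> = \<bar>s - 1\<bar> * (s + 1)" unfolding w abs_mult using s(1) by simp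
  have "\<bar>s - 1\<bar> * 1 \<le> \<bar>s - 1\<bar> * (s + 1)" using s(1) by (intro mult_left_mono) auto
  thus 1: "\<bar>s - 1\<bar> \<le> \<bar>w\<bar>" using aw by simp
  show "s - 1 - w / 2 = - ((s - 1)\<^sup>2 / 2)" unfolding w by (simp add: power2_eq_square field_simps)
  have "(s - 1)\<^sup>2 \<le> \<bar>w\<bar>\<^sup>2" using 1 by (simp add: abs_le_square_iff[symmetric])
  moreover have "(s - 1)\<^sup>2 \<le> \<bar>w\<bar>"
  proof -
    have "(s - 1)\<^sup>2 = \<bar>s - 1\<bar> * \<bar>s - 1\<bar>" by (simp add: power2_eq_square)
    also have "\<dots> \<le> \<bar>s - 1\<bar> * (s + 1)" using s(1) by (intro mult_left_mono) auto
    finally show ?thesis using aw by simp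
  qed
  moreover have "\<bar>w\<bar>\<^sup>2 \<le> \<bar>w\<bar> powr (1 + \<tau>) \<or> \<bar>w\<bar> \<le> \<bar>w\<bar> powr (1 + \<tau>)"
  proof (cases "w = 0")
    case False
    show ?thesis
    proof (cases "\<bar>w\<bar> \<le> 1")
      case True
      have "\<bar>w\<bar> powr 2 \<le> \<bar>w\<bar> powr (1 + \<tau>)" using True False \<tau> by (intro powr_mono') auto
      thus ?thesis using False by simp
    next
      case False
      have "\<bar>w\<bar> powr 1 \<le> \<bar>w\<bar> powr (1 + \<tau>)" using False \<tau> by (intro powr_mono) auto
      thus ?thesis using False by simp
    qed
  qed simp
  ultimately show "(s - 1)\<^sup>2 \<le> \<bar>w\<bar> powr (1 + \<tau>)" by linarith
qed

lemma (in pair_prob_space) integral_pair_fst_snd: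
  fixes a :: "'a \<Rightarrow> real" and b :: "'b \<Rightarrow> real"
  shows "integrable M1 a \<Longrightarrow> integrable (M1 \<Otimes>\<^sub>M M2) (\<lambda>q. a (fst q))"
    "integrable M1 a \<Longrightarrow> (\<integral>q. a (fst q) \<partial>(M1 \<Otimes>\<^sub>M M2)) = (\<integral>x. a x \<partial>M1)"
    "integrable M2 b \<Longrightarrow> integrable (M1 \<Otimes>\<^sub>M M2) (\<lambda>q. b (snd q))"
    "integrable M2 b \<Longrightarrow> (\<integral>q. b (snd q) \<partial>(M1 \<Otimes>\<^sub>M M2)) = (\<integral>y. b y \<partial>M2)"
proof -
  have one: "integrable M2 (\<lambda>_. 1 :: real)" "integrable M1 (\<lambda>_. 1 :: real)" by simp_all
  show "integrable (M1 \<Otimes>\<^sub>M M2) (\<lambda>q. a (fst q))" "(\<integral>q. a (fst q) \<partial>(M1 \<Otimes>\<^sub>M M2)) = (\<integral>x. a x \<partial>M1)" if a: "integrable M1 a"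
    using integrable_pair_product[OF a one(1)] integral_fst[OF integrable_pair_product[OF a one(1)]] M2.prob_space
    by (simp_all add: split_def)
  show "integrable (M1 \<Otimes>\<^sub>M M2) (\<lambda>q. b (snd q))" "(\<integral>q. b (snd q) \<partial>(M1 \<Otimes>\<^sub>M M2)) = (\<integral>y. b y \<partial>M2)" if b: "integrable M2 b"
    using integrable_pair_product[OF one(2) b] integral_snd[OF integrable_pair_product[OF one(2) b]] M1.prob_space
    by (simp_all add: split_def)
qed

section \<open>Moments of norms, inner products and distances under a mean-zero law\<close>

locale mean_zero_law = prob_space \<mu> for \<mu> :: "(nat \<Rightarrow> real) measure" +
  fixes d :: nat and \<tau> :: real
  assumes sets_\<mu> [measurable_cong]: "sets \<mu> = sets (vec_space d)"
    and mz: "mean_zero d \<mu>"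
    and moment: "integrable \<mu> (\<lambda>x. vec_norm d x powr (4 + 4 * \<tau>))"
    and \<tau>: "0 < \<tau>" "\<tau> \<le> 1/2"
begin

abbreviation nm where "nm \<equiv> vec_norm d"
abbreviation ip where "ip \<equiv> vec_inner d"
abbreviation ds where "ds \<equiv> vec_dist d"
abbreviation p where "p \<equiv> 2 + 2 * \<tau>"

sublocale QQ: pair_prob_space \<mu> \<mu> ..

lemma nm_meas [measurable]: "nm \<in> borel_measurable \<mu>" by measurable

lemma nm_powr: "0 < r \<Longrightarrow> r \<le> 4 + 4 * \<tau> \<Longrightarrow> integrable \<mu> (\<lambda>x. nm x powr r)"
  using moment_mono(1)[of nm "4 + 4 * \<tau>" r] moment by (simp add: vec_norm_nonneg)

lemma nm_sq: "integrable \<mu> (\<lambda>x. (nm x)\<^sup>2)"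
proof -
  have "nm x powr 2 = (nm x)\<^sup>2" for x using vec_norm_nonneg[of d x] by simp
  thus ?thesis using nm_powr[of 2] \<tau> by simp
qed

lemma ip_meas [measurable]: "(\<lambda>(x, y). ip x y) \<in> borel_measurable (\<mu> \<Otimes>\<^sub>M \<mu>)"
  unfolding split_def by measurable

lemma ip_meas1 [measurable]: "x \<in> space \<mu> \<Longrightarrow> ip x \<in> borel_measurable \<mu>"
  using measurable_Pair2[OF ip_meas, of x] by simp

lemma ds_meas [measurable]: "(\<lambda>(x, y). ds x y) \<in> borel_measurable (\<mu> \<Otimes>\<^sub>M \<mu>)"
  unfolding split_def by measurable

lemma ds_meas1 [measurable]: "x \<in> space \<mu> \<Longrightarrow> ds x \<in> borel_measurable \<mu>"
  using measurable_Pair2[OF ds_meas, of x] by simp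

lemma ip_powr_le: "0 < r \<Longrightarrow> \<bar>ip x y\<bar> powr r \<le> nm x powr r * nm y powr r"
  using powr_mono2[OF _ _ abs_vec_inner_le[of d x y], of r] vec_norm_nonneg by (simp add: powr_mult)

lemma ip_powr:
  assumes r: "0 < r" "r \<le> 4 + 4 * \<tau>"
  shows "x \<in> space \<mu> \<Longrightarrow> integrable \<mu> (\<lambda>y. \<bar>ip x y\<bar> powr r)"
    "integrable (\<mu> \<Otimes>\<^sub>M \<mu>) (\<lambda>(x, y). \<bar>ip x y\<bar> powr r)"
proof -
  show "integrable \<mu> (\<lambda>y. \<bar>ip x y\<bar> powr r)" if x: "x \<in> space \<mu>"
  proof (rule Bochner_Integration.integrable_bound)
    show "integrable \<mu> (\<lambda>y. nm x powr r * nm y powr r)" using nm_powr[OF r] by simp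
    show "(\<lambda>y. \<bar>ip x y\<bar> powr r) \<in> borel_measurable \<mu>" using x by measurable
  qed (use ip_powr_le[OF r(1)] in auto)
  show "integrable (\<mu> \<Otimes>\<^sub>M \<mu>) (\<lambda>(x, y). \<bar>ip x y\<bar> powr r)"
    by (rule Bochner_Integration.integrable_bound[OF QQ.integrable_pair_product[OF nm_powr[OF r] nm_powr[OF r]]])
       (use ip_powr_le[OF r(1)] in auto)
qed

lemma ds_powr_le: "1 \<le> r \<Longrightarrow> \<bar>ds x y\<bar> powr r \<le> 2 powr (r - 1) * (nm x powr r + nm y powr r)"
proof -
  assume r: "1 \<le> r"
  have "\<bar>ds x y\<bar> powr r \<le> \<bar>nm x + nm y\<bar> powr r"
    using vec_dist_le[of d x y] vec_dist_nonneg[of d x y] r by (intro powr_mono2) auto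
  also have "\<dots> \<le> 2 powr (r - 1) * (\<bar>nm x\<bar> powr r + \<bar>nm y\<bar> powr r)" by (rule abs_add_powr_le[OF r])
  finally show ?thesis by (simp add: vec_norm_nonneg)
qed

lemma ds_powr:
  assumes r: "1 \<le> r" "r \<le> 4 + 4 * \<tau>"
  shows "x \<in> space \<mu> \<Longrightarrow> integrable \<mu> (\<lambda>y. \<bar>ds x y\<bar> powr r)"
    "integrable (\<mu> \<Otimes>\<^sub>M \<mu>) (\<lambda>(x, y). \<bar>ds x y\<bar> powr r)"
proof -
  have i: "integrable \<mu> (\<lambda>y. nm y powr r)" using nm_powr[of r] r by simp
  show "integrable \<mu> (\<lambda>y. \<bar>ds x y\<bar> powr r)" if x: "x \<in> space \<mu>"
  proof (rule Bochner_Integration.integrable_bound)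
    show "integrable \<mu> (\<lambda>y. 2 powr (r - 1) * (nm x powr r + nm y powr r))" using i by simp
    show "(\<lambda>y. \<bar>ds x y\<bar> powr r) \<in> borel_measurable \<mu>" using x by measurable
  qed (use ds_powr_le[OF r(1)] in auto)
  show "integrable (\<mu> \<Otimes>\<^sub>M \<mu>) (\<lambda>(x, y). \<bar>ds x y\<bar> powr r)"
  proof (rule Bochner_Integration.integrable_bound)
    show "integrable (\<mu> \<Otimes>\<^sub>M \<mu>) (\<lambda>q. 2 powr (r - 1) * (nm (fst q) powr r + nm (snd q) powr r))"
      using QQ.integral_pair_fst_snd[of "\<lambda>y. nm y powr r"] i by simp
  qed (use ds_powr_le[OF r(1)] in auto)
qed

lemma sq_eq_powr: "\<bar>x :: real\<bar> powr 2 = x\<^sup>2" by simp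

lemma ip_sq:
  "x \<in> space \<mu> \<Longrightarrow> integrable \<mu> (\<lambda>y. (ip x y)\<^sup>2)" "integrable (\<mu> \<Otimes>\<^sub>M \<mu>) (\<lambda>(x, y). (ip x y)\<^sup>2)"
  using ip_powr[of 2] \<tau> by (simp_all only: sq_eq_powr)

lemma ds_sq:
  "x \<in> space \<mu> \<Longrightarrow> integrable \<mu> (\<lambda>y. (ds x y)\<^sup>2)" "integrable (\<mu> \<Otimes>\<^sub>M \<mu>) (\<lambda>(x, y). (ds x y)\<^sup>2)"
  using ds_powr[of 2] \<tau> by (simp_all only: sq_eq_powr)

lemma ip_mean: "(\<integral>y. ip x y \<partial>\<mu>) = 0"
  using mz by (simp add: vec_inner_def mean_zero_def Bochner_Integration.integral_sum)

definition kern where "kern = double_center \<mu> ds"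

sublocale DS: sq_kernel \<mu> ds
  by unfold_locales (auto simp: vec_dist_sym[of d] intro: ds_sq ds_meas)

sublocale DK: degenerate_kernel \<mu> kern p
proof unfold_locales
  have i: "x \<in> space \<mu> \<Longrightarrow> integrable \<mu> (\<lambda>y. \<bar>ds x y\<bar> powr p)" "integrable (\<mu> \<Otimes>\<^sub>M \<mu>) (\<lambda>(x, y). \<bar>ds x y\<bar> powr p)" for x
    using ds_powr[of p] \<tau> by auto
  show "(\<lambda>(x, y). kern x y) \<in> borel_measurable (\<mu> \<Otimes>\<^sub>M \<mu>)" unfolding kern_def by (rule DS.dc_meas)
  show "kern x y = kern y x" for x y unfolding kern_def by (rule DS.dc_sym)
  show "x \<in> space \<mu> \<Longrightarrow> integrable \<mu> (\<lambda>y. \<bar>kern x y\<bar> powr p)" for x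
    unfolding kern_def by (rule DS.dc_powr(1)) (use i \<tau> in auto)
  show "x \<in> space \<mu> \<Longrightarrow> (\<integral>y. kern x y \<partial>\<mu>) = 0" for x unfolding kern_def by (rule DS.dc_mean)
  show "integrable (\<mu> \<Otimes>\<^sub>M \<mu>) (\<lambda>(x, y). \<bar>kern x y\<bar> powr p)"
    unfolding kern_def by (rule DS.dc_powr(2)) (use i \<tau> in auto)
qed (use \<tau> in auto)

definition B where "B = mean_sq_dist d \<mu>"
definition L where "L = L_moment d \<mu> \<tau>"
definition I2 where "I2 = inner_moment2 d \<mu>"
definition C2 where "C2 = cov_form_moment2 d \<mu>"
definition \<alpha> where "\<alpha> x = (nm x)\<^sup>2 - (\<integral>z. (nm z)\<^sup>2 \<partial>\<mu>)" for x

lemma \<alpha>_meas [measurable]: "\<alpha> \<in> borel_measurable \<mu>" unfolding \<alpha>_def by measurable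

lemma ip_int2: "integrable (\<mu> \<Otimes>\<^sub>M \<mu>) (\<lambda>(x, y). ip x y)"
  using integral_mult_square_le(1)[of "\<lambda>(x, y). ip x y" "\<mu> \<Otimes>\<^sub>M \<mu>" "\<lambda>_. 1"] ip_sq by (simp add: split_def)

lemma B_eq: "B = 2 * (\<integral>x. (nm x)\<^sup>2 \<partial>\<mu>)"
proof -
  have i0: "(\<integral>(x, y). ip x y \<partial>(\<mu> \<Otimes>\<^sub>M \<mu>)) = 0"
    using QQ.integral_fst[OF ip_int2] by (simp add: ip_mean)
  have "B = (\<integral>q. (nm (fst q))\<^sup>2 + (nm (snd q))\<^sup>2 - 2 * ip (fst q) (snd q) \<partial>(\<mu> \<Otimes>\<^sub>M \<mu>))"
    by (simp add: B_def mean_sq_dist_def vec_dist_sq split_def)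
  also have "\<dots> = 2 * (\<integral>x. (nm x)\<^sup>2 \<partial>\<mu>)"
    using QQ.integral_pair_fst_snd[of "\<lambda>x. (nm x)\<^sup>2"] nm_sq ip_int2 i0 by (simp add: split_def)
  finally show ?thesis .
qed

lemma B_nonneg: "0 \<le> B" by (simp add: B_eq)

text \<open>Cauchy--Schwarz on the inner product. It forces B > 0 as soon as the denominator I2 is
  positive.\<close>

lemma I2_le: "I2 \<le> (B / 2)\<^sup>2"
proof -
  have "I2 \<le> (\<integral>(x, y). (nm x)\<^sup>2 * (nm y)\<^sup>2 \<partial>(\<mu> \<Otimes>\<^sub>M \<mu>))"
    unfolding I2_def inner_moment2_def
  proof (rule integral_mono[OF ip_sq(2) QQ.integrable_pair_product[OF nm_sq nm_sq]])
    fix q :: "(nat \<Rightarrow> real) \<times> (nat \<Rightarrow> real)"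
    have "(ip (fst q) (snd q))\<^sup>2 \<le> (nm (fst q) * nm (snd q))\<^sup>2"
      using abs_vec_inner_le[of d "fst q" "snd q"] vec_norm_nonneg
      by (subst abs_le_square_iff[symmetric]) (simp add: abs_mult)
    thus "(case q of (x, y) \<Rightarrow> (ip x y)\<^sup>2) \<le> (case q of (x, y) \<Rightarrow> (nm x)\<^sup>2 * (nm y)\<^sup>2)"
      by (simp add: split_def power_mult_distrib)
  qed
  also have "\<dots> = (\<integral>x. (nm x)\<^sup>2 \<partial>\<mu>) * (\<integral>y. (nm y)\<^sup>2 \<partial>\<mu>)"
    using QQ.integral_fst[OF QQ.integrable_pair_product[OF nm_sq nm_sq]] by simp
  finally show ?thesis by (simp add: B_eq power2_eq_square)
qed

lemma \<alpha>_powr: "integrable \<mu> (\<lambda>x. \<bar>\<alpha> x\<bar> powr p)"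
proof (rule Bochner_Integration.integrable_bound)
  define m where "m = (\<integral>z. (nm z)\<^sup>2 \<partial>\<mu>)"
  have e: "((nm x)\<^sup>2) powr p = nm x powr (4 + 4 * \<tau>)" for x
  proof -
    have "((nm x)\<^sup>2) powr p = (nm x powr 2) powr p" using vec_norm_nonneg[of d x] by simp
    also have "\<dots> = nm x powr (2 * p)" by (rule powr_powr)
    finally show ?thesis by simp
  qed
  show "integrable \<mu> (\<lambda>x. 2 powr (p - 1) * (nm x powr (4 + 4 * \<tau>) + \<bar>m\<bar> powr p))" using moment by simp
  have "\<bar>\<alpha> x\<bar> powr p \<le> 2 powr (p - 1) * (nm x powr (4 + 4 * \<tau>) + \<bar>m\<bar> powr p)" for x
    using abs_add_powr_le[of p "(nm x)\<^sup>2" "- m"] \<tau> by (simp add: \<alpha>_def m_def[symmetric] e)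
  thus "AE x in \<mu>. norm (\<bar>\<alpha> x\<bar> powr p) \<le> norm (2 powr (p - 1) * (nm x powr (4 + 4 * \<tau>) + \<bar>m\<bar> powr p))"
    by (intro AE_I2) (auto intro: order.trans)
qed measurable

lemma L_eq: "L = (\<integral>x. \<bar>\<alpha> x\<bar> powr p \<partial>\<mu>) + (\<integral>(x, y). \<bar>ip x y\<bar> powr p \<partial>(\<mu> \<Otimes>\<^sub>M \<mu>))"
  by (simp add: L_def L_moment_def \<alpha>_def)

lemma L_nonneg: "0 \<le> L"
  unfolding L_eq by (intro add_nonneg_nonneg integral_nonneg_AE) auto

lemma I2_powr_le: "I2 powr (1 + \<tau>) \<le> L"
proof -
  have "I2 powr (p / 2) \<le> (\<integral>(x, y). \<bar>ip x y\<bar> powr p \<partial>(\<mu> \<Otimes>\<^sub>M \<mu>))"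
    using QQ.P.integrable_square_of_powr(2)[of "\<lambda>(x, y). ip x y" p] ip_powr(2)[of p] \<tau>
    by (simp add: I2_def inner_moment2_def split_def)
  also have "\<dots> \<le> L" unfolding L_eq by simp
  finally show ?thesis by (simp add: add_divide_distrib)
qed

lemma C2_nonneg: "0 \<le> C2" unfolding C2_def cov_form_moment2_def by (intro integral_nonneg_AE) auto

definition W where "W x y = (\<alpha> x + \<alpha> y - 2 * ip x y) / B"

lemma W_meas [measurable]: "(\<lambda>(x, y). W x y) \<in> borel_measurable (\<mu> \<Otimes>\<^sub>M \<mu>)"
  unfolding W_def split_def by measurable

lemma W_powr_le:
  assumes "0 < B"
  shows "\<bar>W x y\<bar> powr p \<le> 4 powr (p - 1) * B powr (-p) * (\<bar>\<alpha> x\<bar> powr p + \<bar>\<alpha> y\<bar> powr p + 2 * \<bar>ip x y\<bar> powr p)"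
proof -
  \<comment> \<open>The inner product enters twice, so W is treated as a sum of four terms.\<close>
  define a where "a i = (if i = (0::nat) then \<alpha> x else if i = 1 then \<alpha> y else - ip x y)" for i
  have "{0..<4::nat} = {0, 1, 2, 3}" by auto
  hence s: "(\<Sum>i\<in>{0..<4}. a i) = \<alpha> x + \<alpha> y - 2 * ip x y"
    "(\<Sum>i\<in>{0..<4}. \<bar>a i\<bar> powr p) = \<bar>\<alpha> x\<bar> powr p + \<bar>\<alpha> y\<bar> powr p + 2 * \<bar>ip x y\<bar> powr p"
    by (simp_all add: a_def)
  have "\<bar>W x y\<bar> powr p = B powr (-p) * \<bar>\<alpha> x + \<alpha> y - 2 * ip x y\<bar> powr p"
    using assms unfolding powr_minus_divide[of B p] W_def abs_divide by (simp add: powr_divide)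
  also have "\<dots> \<le> B powr (-p) * (4 powr (p - 1) * (\<bar>\<alpha> x\<bar> powr p + \<bar>\<alpha> y\<bar> powr p + 2 * \<bar>ip x y\<bar> powr p))"
    using sum_abs_powr_le[of "{0..<4}" p a] \<tau> unfolding s by (intro mult_left_mono) auto
  finally show ?thesis by (simp add: ac_simps)
qed

lemma W_powr:
  assumes B: "0 < B"
  shows "x \<in> space \<mu> \<Longrightarrow> integrable \<mu> (\<lambda>y. \<bar>W x y\<bar> powr p)"
    "integrable (\<mu> \<Otimes>\<^sub>M \<mu>) (\<lambda>(x, y). \<bar>W x y\<bar> powr p)"
    "(\<integral>(x, y). \<bar>W x y\<bar> powr p \<partial>(\<mu> \<Otimes>\<^sub>M \<mu>)) \<le> 32 * B powr (-p) * L"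
proof -
  note bd = W_powr_le[OF B]
  have p4: "0 < p" "p \<le> 4 + 4 * \<tau>" using \<tau> by auto
  show "integrable \<mu> (\<lambda>y. \<bar>W x y\<bar> powr p)" if x: "x \<in> space \<mu>"
  proof (rule Bochner_Integration.integrable_bound)
    show "integrable \<mu> (\<lambda>y. 4 powr (p - 1) * B powr (-p) * (\<bar>\<alpha> x\<bar> powr p + \<bar>\<alpha> y\<bar> powr p + 2 * \<bar>ip x y\<bar> powr p))"
      using \<alpha>_powr ip_powr(1)[OF p4 x] by simp
    have [measurable]: "W x \<in> borel_measurable \<mu>" using measurable_Pair2[OF W_meas x] by simp
    show "(\<lambda>y. \<bar>W x y\<bar> powr p) \<in> borel_measurable \<mu>" by measurable
  qed (rule AE_I2, unfold real_norm_def abs_of_nonneg[OF powr_ge_zero], rule order.trans[OF bd abs_ge_self])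
  let ?R = "\<lambda>q. 4 powr (p - 1) * B powr (-p) * (\<bar>\<alpha> (fst q)\<bar> powr p + \<bar>\<alpha> (snd q)\<bar> powr p + 2 * \<bar>ip (fst q) (snd q)\<bar> powr p)"
  have ii: "integrable (\<mu> \<Otimes>\<^sub>M \<mu>) (\<lambda>q. \<bar>ip (fst q) (snd q)\<bar> powr p)" using ip_powr(2)[OF p4] by (simp add: split_def)
  note fs = QQ.integral_pair_fst_snd[of "\<lambda>x. \<bar>\<alpha> x\<bar> powr p"]
  have iR: "integrable (\<mu> \<Otimes>\<^sub>M \<mu>) ?R" using fs \<alpha>_powr ii by simp
  have [measurable]: "(\<lambda>q. W (fst q) (snd q)) \<in> borel_measurable (\<mu> \<Otimes>\<^sub>M \<mu>)" using W_meas by (simp add: split_def)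
  have iL: "integrable (\<mu> \<Otimes>\<^sub>M \<mu>) (\<lambda>q. \<bar>W (fst q) (snd q)\<bar> powr p)"
    by (rule Bochner_Integration.integrable_bound[OF iR], measurable)
       (rule AE_I2, unfold real_norm_def abs_of_nonneg[OF powr_ge_zero], rule order.trans[OF bd abs_ge_self])
  thus "integrable (\<mu> \<Otimes>\<^sub>M \<mu>) (\<lambda>(x, y). \<bar>W x y\<bar> powr p)" by (simp add: split_def)
  have "(\<integral>q. \<bar>W (fst q) (snd q)\<bar> powr p \<partial>(\<mu> \<Otimes>\<^sub>M \<mu>)) \<le> (\<integral>q. ?R q \<partial>(\<mu> \<Otimes>\<^sub>M \<mu>))"
    using iL iR bd by (intro integral_mono) auto
  also have "\<dots> = 4 powr (p - 1) * B powr (-p) * (2 * L)"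
    using fs \<alpha>_powr ii by (simp add: L_eq split_def)
  also have "\<dots> \<le> 16 * B powr (-p) * (2 * L)"
  proof -
    have "4 powr (p - 1) \<le> (4::real) powr 2" using \<tau> by (intro powr_mono) auto
    thus ?thesis using L_nonneg by (intro mult_right_mono) auto
  qed
  finally show "(\<integral>(x, y). \<bar>W x y\<bar> powr p \<partial>(\<mu> \<Otimes>\<^sub>M \<mu>)) \<le> 32 * B powr (-p) * L" by (simp add: split_def)
qed

end

text \<open>Cauchy--Schwarz in w bounds the composition pointwise by row norms: Hilbert--Schmidt
  norms are submultiplicative.\<close>

lemma composition_square:
  assumes "sq_kernel M k" "sq_kernel M l"
  shows "integrable (M \<Otimes>\<^sub>M M) (\<lambda>(x, y). (\<integral>w. k w x * l w y \<partial>M)\<^sup>2)"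
    "(\<integral>(x, y). (\<integral>w. k w x * l w y \<partial>M)\<^sup>2 \<partial>(M \<Otimes>\<^sub>M M))
      \<le> (\<integral>(x, y). (k x y)\<^sup>2 \<partial>(M \<Otimes>\<^sub>M M)) * (\<integral>(x, y). (l x y)\<^sup>2 \<partial>(M \<Otimes>\<^sub>M M))"
proof -
  interpret A: sq_kernel M k by fact
  interpret B: sq_kernel M l by fact
  define a where "a x = (\<integral>w. (k x w)\<^sup>2 \<partial>M)" for x
  define b where "b x = (\<integral>w. (l x w)\<^sup>2 \<partial>M)" for x
  have ia: "integrable M a" "(\<integral>x. a x \<partial>M) = (\<integral>(x, y). (k x y)\<^sup>2 \<partial>(M \<Otimes>\<^sub>M M))"
    using A.QQ.integrable_fst[OF A.k_sq2] A.QQ.integral_fst[OF A.k_sq2] by (simp_all add: a_def[abs_def])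
  have ib: "integrable M b" "(\<integral>x. b x \<partial>M) = (\<integral>(x, y). (l x y)\<^sup>2 \<partial>(M \<Otimes>\<^sub>M M))"
    using A.QQ.integrable_fst[OF B.k_sq2] A.QQ.integral_fst[OF B.k_sq2] by (simp_all add: b_def[abs_def])
  have bd: "(\<integral>w. k w x * l w y \<partial>M)\<^sup>2 \<le> a x * b y" if "x \<in> space M" "y \<in> space M" for x y
    using integral_mult_square_le(2)[of "k x" M "l y"] A.k_sq1[OF that(1)] B.k_sq1[OF that(2)] that
    by (simp add: a_def b_def A.k_sym[of _ x] B.k_sym[of _ y])
  have [measurable]: "(\<lambda>q. k (fst q) (snd q)) \<in> borel_measurable (M \<Otimes>\<^sub>M M)"
    "(\<lambda>q. l (fst q) (snd q)) \<in> borel_measurable (M \<Otimes>\<^sub>M M)"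
    using A.k_meas B.k_meas by (simp_all add: split_def)
  have meas: "(\<lambda>(x, y). (\<integral>w. k w x * l w y \<partial>M)\<^sup>2) \<in> borel_measurable (M \<Otimes>\<^sub>M M)"
    unfolding split_def by measurable
  note ab = A.QQ.integrable_pair_product[OF ia(1) ib(1)]
  have a0: "0 \<le> a x" and b0: "0 \<le> b x" for x by (simp_all add: a_def b_def)
  show int: "integrable (M \<Otimes>\<^sub>M M) (\<lambda>(x, y). (\<integral>w. k w x * l w y \<partial>M)\<^sup>2)"
    by (rule Bochner_Integration.integrable_bound[OF ab meas])
       (use bd a0 b0 in \<open>auto intro!: AE_I2 simp: space_pair_measure\<close>)
  have "(\<integral>(x, y). (\<integral>w. k w x * l w y \<partial>M)\<^sup>2 \<partial>(M \<Otimes>\<^sub>M M)) \<le> (\<integral>(x, y). a x * b y \<partial>(M \<Otimes>\<^sub>M M))"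
    by (rule integral_mono[OF int ab]) (use bd in \<open>auto simp: space_pair_measure\<close>)
  also have "\<dots> = (\<integral>x. a x \<partial>M) * (\<integral>y. b y \<partial>M)" using A.QQ.integral_fst[OF ab] by simp
  finally show "(\<integral>(x, y). (\<integral>w. k w x * l w y \<partial>M)\<^sup>2 \<partial>(M \<Otimes>\<^sub>M M))
      \<le> (\<integral>(x, y). (k x y)\<^sup>2 \<partial>(M \<Otimes>\<^sub>M M)) * (\<integral>(x, y). (l x y)\<^sup>2 \<partial>(M \<Otimes>\<^sub>M M))"
    by (simp add: ia ib)
qed

section \<open>Linearization of the centered distance\<close>

locale regular_law = mean_zero_law +
  assumes I2_pos: "0 < I2" and small: "B powr (- 2 * \<tau>) * L / I2 \<le> 1 / 18"
begin

definition b where "b = sqrt B"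

lemma B_pos: "0 < B"
  using I2_le I2_pos B_nonneg by (cases "B = 0") auto

lemma b_pos: "0 < b" and b_sq: "b\<^sup>2 = B"
  using B_pos by (auto simp: b_def)

lemma scaled_dist_sq: "(ds x y / b)\<^sup>2 = 1 + W x y"
  using B_pos by (simp add: power_divide b_sq vec_dist_sq W_def \<alpha>_def B_eq field_simps)

text \<open>Up to terms killed by double centering, \<open>ds = lin + remd\<close>, hence \<open>kern = lin + err\<close>.\<close>

definition remd where "remd x y = b * (ds x y / b - 1 - W x y / 2)"
definition dev where "dev x y = ds x y - b"
definition lin where "lin x y = - ip x y / b"
definition err where "err = double_center \<mu> remd"

lemma remd_meas: "(\<lambda>(x, y). remd x y) \<in> borel_measurable (\<mu> \<Otimes>\<^sub>M \<mu>)"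
  using ds_meas W_meas unfolding remd_def split_def by measurable

lemma dev_meas: "(\<lambda>(x, y). dev x y) \<in> borel_measurable (\<mu> \<Otimes>\<^sub>M \<mu>)"
  using ds_meas unfolding dev_def split_def by measurable

lemma dev_powr_le: "\<bar>dev x y\<bar> powr p \<le> b powr p * \<bar>W x y\<bar> powr p"
proof -
  have "\<bar>ds x y / b - 1\<bar> \<le> \<bar>W x y\<bar>"
    using sqrt_expansion(1)[OF _ scaled_dist_sq, of x y \<tau>] vec_dist_nonneg b_pos \<tau> by simp
  hence "b * \<bar>ds x y / b - 1\<bar> \<le> b * \<bar>W x y\<bar>" using b_pos by (intro mult_left_mono) auto
  moreover have "b * \<bar>ds x y / b - 1\<bar> = \<bar>dev x y\<bar>"
  proof -
    have "dev x y = b * (ds x y / b - 1)" using b_pos by (simp add: dev_def field_simps)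
    thus ?thesis using b_pos by (simp add: abs_mult)
  qed
  ultimately have "\<bar>dev x y\<bar> powr p \<le> (b * \<bar>W x y\<bar>) powr p" using \<tau> by (intro powr_mono2) auto
  thus ?thesis using b_pos by (simp add: powr_mult)
qed

text \<open>With u = ds / b - 1 the remainder is - b u^2 / 2, so its square is B u^4 / 4; the bound
  u^2 \<le> |W| powr (1 + \<tau>) makes this exactly the moment order that L controls.\<close>

lemma remd_sq_le: "(remd x y)\<^sup>2 \<le> B / 4 * \<bar>W x y\<bar> powr p"
proof -
  let ?u = "ds x y / b - 1"
  have s: "?u - W x y / 2 = - (?u\<^sup>2 / 2)" "?u\<^sup>2 \<le> \<bar>W x y\<bar> powr (1 + \<tau>)"
    using sqrt_expansion(2,3)[OF _ scaled_dist_sq, of x y \<tau>] vec_dist_nonneg b_pos \<tau> by auto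
  have "(remd x y)\<^sup>2 = B / 4 * (?u\<^sup>2)\<^sup>2"
    unfolding remd_def s(1) power_mult_distrib b_sq by (simp add: power_divide)
  also have "\<dots> \<le> B / 4 * (\<bar>W x y\<bar> powr (1 + \<tau>))\<^sup>2"
    using s(2) B_pos by (intro mult_left_mono power_mono) auto
  also have "(\<bar>W x y\<bar> powr (1 + \<tau>))\<^sup>2 = \<bar>W x y\<bar> powr p"
  proof -
    have "(\<bar>W x y\<bar> powr (1 + \<tau>))\<^sup>2 = (\<bar>W x y\<bar> powr (1 + \<tau>)) powr 2" by simp
    also have "\<dots> = \<bar>W x y\<bar> powr ((1 + \<tau>) * 2)" by (rule powr_powr)
    finally show ?thesis by (simp add: algebra_simps)
  qed
  finally show ?thesis .
qed

lemma W_sym: "W x y = W y x" by (simp add: W_def vec_inner_sym[of d x y])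

sublocale RM: sq_kernel \<mu> remd
proof unfold_locales
  show "(\<lambda>(x, y). remd x y) \<in> borel_measurable (\<mu> \<Otimes>\<^sub>M \<mu>)" by (rule remd_meas)
  show "remd x y = remd y x" for x y by (simp add: remd_def W_sym[of x y] vec_dist_sym[of d x y])
  show "integrable \<mu> (\<lambda>y. (remd x y)\<^sup>2)" if x: "x \<in> space \<mu>" for x
  proof (rule Bochner_Integration.integrable_bound)
    show "integrable \<mu> (\<lambda>y. B / 4 * \<bar>W x y\<bar> powr p)" using W_powr(1)[OF B_pos x] by simp
    have [measurable]: "remd x \<in> borel_measurable \<mu>" using measurable_Pair2[OF remd_meas x] by simp
    show "(\<lambda>y. (remd x y)\<^sup>2) \<in> borel_measurable \<mu>" by measurable
  qed (use remd_sq_le B_pos in auto)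
  have [measurable]: "(\<lambda>q. remd (fst q) (snd q)) \<in> borel_measurable (\<mu> \<Otimes>\<^sub>M \<mu>)" using remd_meas by (simp add: split_def)
  have "integrable (\<mu> \<Otimes>\<^sub>M \<mu>) (\<lambda>q. (remd (fst q) (snd q))\<^sup>2)"
  proof (rule Bochner_Integration.integrable_bound)
    show "integrable (\<mu> \<Otimes>\<^sub>M \<mu>) (\<lambda>q. B / 4 * \<bar>W (fst q) (snd q)\<bar> powr p)"
      using W_powr(2)[OF B_pos] by (simp add: split_def)
  qed (use remd_sq_le B_pos in auto)
  thus "integrable (\<mu> \<Otimes>\<^sub>M \<mu>) (\<lambda>(x, y). (remd x y)\<^sup>2)" by (simp add: split_def)
qed

lemma dev_powr:
  "x \<in> space \<mu> \<Longrightarrow> integrable \<mu> (\<lambda>y. \<bar>dev x y\<bar> powr p)"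
  "integrable (\<mu> \<Otimes>\<^sub>M \<mu>) (\<lambda>(x, y). \<bar>dev x y\<bar> powr p)"
  "(\<integral>(x, y). \<bar>dev x y\<bar> powr p \<partial>(\<mu> \<Otimes>\<^sub>M \<mu>)) \<le> 32 * B powr (- (1 + \<tau>)) * L"
proof -
  show "integrable \<mu> (\<lambda>y. \<bar>dev x y\<bar> powr p)" if x: "x \<in> space \<mu>"
  proof (rule Bochner_Integration.integrable_bound)
    show "integrable \<mu> (\<lambda>y. b powr p * \<bar>W x y\<bar> powr p)" using W_powr(1)[OF B_pos x] by simp
    have [measurable]: "dev x \<in> borel_measurable \<mu>" using measurable_Pair2[OF dev_meas x] by simp
    show "(\<lambda>y. \<bar>dev x y\<bar> powr p) \<in> borel_measurable \<mu>" by measurable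
  qed (use dev_powr_le in auto)
  have [measurable]: "(\<lambda>q. dev (fst q) (snd q)) \<in> borel_measurable (\<mu> \<Otimes>\<^sub>M \<mu>)" using dev_meas by (simp add: split_def)
  have iW: "integrable (\<mu> \<Otimes>\<^sub>M \<mu>) (\<lambda>q. \<bar>W (fst q) (snd q)\<bar> powr p)"
    using W_powr(2)[OF B_pos] by (simp add: split_def)
  have i: "integrable (\<mu> \<Otimes>\<^sub>M \<mu>) (\<lambda>q. \<bar>dev (fst q) (snd q)\<bar> powr p)"
  proof (rule Bochner_Integration.integrable_bound)
    show "integrable (\<mu> \<Otimes>\<^sub>M \<mu>) (\<lambda>q. b powr p * \<bar>W (fst q) (snd q)\<bar> powr p)" using iW by simp
  qed (use dev_powr_le in auto)
  thus "integrable (\<mu> \<Otimes>\<^sub>M \<mu>) (\<lambda>(x, y). \<bar>dev x y\<bar> powr p)" by (simp add: split_def)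
  have "(\<integral>q. \<bar>dev (fst q) (snd q)\<bar> powr p \<partial>(\<mu> \<Otimes>\<^sub>M \<mu>)) \<le> (\<integral>q. b powr p * \<bar>W (fst q) (snd q)\<bar> powr p \<partial>(\<mu> \<Otimes>\<^sub>M \<mu>))"
    using i iW dev_powr_le by (intro integral_mono) auto
  also have "\<dots> \<le> b powr p * (32 * B powr (-p) * L)"
    using W_powr(3)[OF B_pos] by (simp add: split_def mult_left_mono)
  also have "b powr p = B powr (1 + \<tau>)"
  proof -
    have "b powr p = (B powr (1/2)) powr p" using B_pos by (simp add: b_def powr_half_sqrt)
    also have "\<dots> = B powr (1/2 * p)" by (rule powr_powr)
    also have "1/2 * p = 1 + \<tau>" by simp
    finally show ?thesis .
  qed
  also have "B powr (1 + \<tau>) * (32 * B powr (-p) * L) = 32 * (B powr (1 + \<tau>) * B powr (-p)) * L" by simp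
  also have "B powr (1 + \<tau>) * B powr (-p) = B powr (- (1 + \<tau>))" by (simp flip: powr_add)
  finally show "(\<integral>(x, y). \<bar>dev x y\<bar> powr p \<partial>(\<mu> \<Otimes>\<^sub>M \<mu>)) \<le> 32 * B powr (- (1 + \<tau>)) * L" by (simp add: split_def)
qed

sublocale DV: sq_kernel \<mu> dev
proof unfold_locales
  show "(\<lambda>(x, y). dev x y) \<in> borel_measurable (\<mu> \<Otimes>\<^sub>M \<mu>)" by (rule dev_meas)
  show "dev x y = dev y x" for x y by (simp add: dev_def vec_dist_sym[of d x y])
  show "integrable \<mu> (\<lambda>y. (dev x y)\<^sup>2)" if x: "x \<in> space \<mu>" for x
  proof (rule integrable_square_of_powr(1)[OF _ dev_powr(1)[OF x]])
    show "dev x \<in> borel_measurable \<mu>" using measurable_Pair2[OF dev_meas x] by simp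
  qed (use \<tau> in simp)
  show "integrable (\<mu> \<Otimes>\<^sub>M \<mu>) (\<lambda>(x, y). (dev x y)\<^sup>2)"
    using QQ.P.integrable_square_of_powr(1)[of "\<lambda>(x, y). dev x y" p] dev_meas dev_powr(2) \<tau> by (simp add: split_def)
qed

sublocale LN: sq_kernel \<mu> lin
proof unfold_locales
  show "(\<lambda>(x, y). lin x y) \<in> borel_measurable (\<mu> \<Otimes>\<^sub>M \<mu>)" using ip_meas unfolding lin_def split_def by measurable
  show "lin x y = lin y x" for x y by (simp add: lin_def vec_inner_sym[of d x y])
  show "integrable \<mu> (\<lambda>y. (lin x y)\<^sup>2)" if "x \<in> space \<mu>" for x
    using ip_sq(1)[OF that] by (simp add: lin_def power_divide)
  show "integrable (\<mu> \<Otimes>\<^sub>M \<mu>) (\<lambda>(x, y). (lin x y)\<^sup>2)"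
    using ip_sq(2) by (simp add: lin_def power_divide split_def)
qed

sublocale ER: sq_kernel \<mu> err
  unfolding err_def by unfold_locales (auto intro: RM.dc_meas RM.dc_sym RM.dc_square)

lemma lin_sq: "(\<integral>(x, y). (lin x y)\<^sup>2 \<partial>(\<mu> \<Otimes>\<^sub>M \<mu>)) = I2 / B"
  by (simp add: lin_def power_divide b_sq split_def I2_def inner_moment2_def)

text \<open>Double centering contracts L^2 and the remainder is bounded by the p-th moment of W; 8
  is 32 / 4.\<close>

lemma err_sq: "(\<integral>(x, y). (err x y)\<^sup>2 \<partial>(\<mu> \<Otimes>\<^sub>M \<mu>)) \<le> 8 / B * (B powr (- 2 * \<tau>) * L)"
proof -
  have iW: "integrable (\<mu> \<Otimes>\<^sub>M \<mu>) (\<lambda>(x, y). B / 4 * \<bar>W x y\<bar> powr p)"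
    using W_powr(2)[OF B_pos] by (simp add: split_def)
  have "(\<integral>(x, y). (err x y)\<^sup>2 \<partial>(\<mu> \<Otimes>\<^sub>M \<mu>)) \<le> (\<integral>(x, y). (remd x y)\<^sup>2 \<partial>(\<mu> \<Otimes>\<^sub>M \<mu>))"
    unfolding err_def by (rule RM.dc_square(3))
  also have "\<dots> \<le> (\<integral>(x, y). B / 4 * \<bar>W x y\<bar> powr p \<partial>(\<mu> \<Otimes>\<^sub>M \<mu>))"
    by (rule integral_mono[OF RM.k_sq2 iW]) (use remd_sq_le in auto)
  also have "\<dots> = B / 4 * (\<integral>(x, y). \<bar>W x y\<bar> powr p \<partial>(\<mu> \<Otimes>\<^sub>M \<mu>))" by (simp add: split_def)
  also have "\<dots> \<le> B / 4 * (32 * B powr (-p) * L)"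
    using W_powr(3)[OF B_pos] B_pos by (intro mult_left_mono) auto
  also have "\<dots> = 8 * (B powr 1 * B powr (-p)) * L" using B_pos by simp
  also have "B powr 1 * B powr (-p) = B powr (-1) * B powr (- 2 * \<tau>)"
    unfolding powr_add[symmetric] by (rule arg_cong2[where f = "(powr)"]) auto
  also have "B powr (-1) = 1 / B" using B_pos by (simp add: powr_minus_divide)
  finally show ?thesis by simp
qed

lemma err_sq_small: "(\<integral>(x, y). (err x y)\<^sup>2 \<partial>(\<mu> \<Otimes>\<^sub>M \<mu>)) \<le> 4/9 * (I2 / B)"
proof -
  have "B powr (- 2 * \<tau>) * L \<le> I2 / 18" using small I2_pos by (simp add: pos_divide_le_eq)
  hence "8 / B * (B powr (- 2 * \<tau>) * L) \<le> 8 / B * (I2 / 18)" using B_pos by (intro mult_left_mono) auto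
  with err_sq show ?thesis by simp
qed

lemma \<alpha>_int: "integrable \<mu> \<alpha>" "(\<integral>x. \<alpha> x \<partial>\<mu>) = 0"
  using nm_sq by (simp_all add: \<alpha>_def[abs_def] prob_space)

lemma kern_eq:
  assumes x: "x \<in> space \<mu>" and y: "y \<in> space \<mu>"
  shows "kern x y = lin x y + err x y"
proof -
  \<comment> \<open>Half of b W contributes \<alpha> / (2 b) for each argument. Functions of one
    argument are removed by double centering, whereas lin is centered already.\<close>
  define c where "c = 1 / (2 * b)"
  have ds_eq: "ds x y = b + c * \<alpha> x + c * \<alpha> y + lin x y + remd x y" for x y
  proof -
    have "ds x y = b * (ds x y / b)" using b_pos by simp
    also have "\<dots> = b + b * W x y / 2 + remd x y" by (simp add: remd_def algebra_simps)
    also have "b * W x y / 2 = c * \<alpha> x + c * \<alpha> y + lin x y"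
      unfolding W_def b_sq[symmetric] c_def lin_def using b_pos by (simp add: power2_eq_square field_simps)
    finally show ?thesis by simp
  qed
  have marg: "(\<integral>z. ds x z \<partial>\<mu>) = b + c * \<alpha> x + (\<integral>z. remd x z \<partial>\<mu>)" if "x \<in> space \<mu>" for x
  proof -
    have l: "integrable \<mu> (lin x)" "(\<integral>z. lin x z \<partial>\<mu>) = 0"
      using LN.k_int1[OF that] by (simp_all add: lin_def ip_mean)
    have r: "integrable \<mu> (remd x)" by (rule RM.k_int1[OF that])
    show ?thesis unfolding ds_eq[of x] using l r \<alpha>_int by (simp add: prob_space)
  qed
  have tot: "(\<integral>w. (\<integral>z. ds w z \<partial>\<mu>) \<partial>\<mu>) = b + (\<integral>w. (\<integral>z. remd w z \<partial>\<mu>) \<partial>\<mu>)"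
  proof -
    have "(\<integral>w. (\<integral>z. ds w z \<partial>\<mu>) \<partial>\<mu>) = (\<integral>w. b + c * \<alpha> w + (\<integral>z. remd w z \<partial>\<mu>) \<partial>\<mu>)"
      by (intro Bochner_Integration.integral_cong refl marg)
    also have "\<dots> = b + (\<integral>w. (\<integral>z. remd w z \<partial>\<mu>) \<partial>\<mu>)"
      using \<alpha>_int RM.marg_int by (simp add: prob_space)
    finally show ?thesis .
  qed
  show ?thesis
    unfolding kern_def err_def double_center_def marg[OF x] marg[OF y] tot ds_eq[of x y] by simp
qed

text \<open>Double centering does not see the constant b. This second form serves for p-th moments,
  where dev is bounded by b |W|; for err only the L^2 norm is estimated.\<close>

lemma kern_eq_dev:
  assumes x: "x \<in> space \<mu>" and y: "y \<in> space \<mu>"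
  shows "kern x y = double_center \<mu> dev x y"
proof -
  have marg: "(\<integral>z. dev x z \<partial>\<mu>) = (\<integral>z. ds x z \<partial>\<mu>) - b" if "x \<in> space \<mu>" for x
    unfolding dev_def using DS.k_int1[OF that] by (simp add: prob_space)
  have tot: "(\<integral>w. (\<integral>z. dev w z \<partial>\<mu>) \<partial>\<mu>) = (\<integral>w. (\<integral>z. ds w z \<partial>\<mu>) \<partial>\<mu>) - b"
  proof -
    have "(\<integral>w. (\<integral>z. dev w z \<partial>\<mu>) \<partial>\<mu>) = (\<integral>w. (\<integral>z. ds w z \<partial>\<mu>) - b \<partial>\<mu>)"
      by (intro Bochner_Integration.integral_cong refl marg)
    thus ?thesis using DS.marg_int by (simp add: prob_space)
  qed
  show ?thesis
    unfolding kern_def double_center_def marg[OF x] marg[OF y] tot by (simp add: dev_def)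
qed

text \<open>From lin = kern - err, I2 / B \<le> 2 sig2 + 2 * (4/9) I2 / B. The bound 1/18 gave 4/9 =
  8/18, just below 1/2, so that 1/9 of the left side survives.\<close>

lemma sig2_lower: "I2 / (18 * B) \<le> DK.sig2"
proof -
  have iK: "integrable (\<mu> \<Otimes>\<^sub>M \<mu>) (\<lambda>(x, y). (kern x y)\<^sup>2)" by (rule DK.h_sq2)
  have iE: "integrable (\<mu> \<Otimes>\<^sub>M \<mu>) (\<lambda>(x, y). (err x y)\<^sup>2)" by (rule ER.k_sq2)
  let ?R = "\<lambda>q. 2 * (kern (fst q) (snd q))\<^sup>2 + 2 * (err (fst q) (snd q))\<^sup>2"
  have iR: "integrable (\<mu> \<Otimes>\<^sub>M \<mu>) ?R" using iK iE by (simp add: split_def)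
  have "I2 / B = (\<integral>(x, y). (lin x y)\<^sup>2 \<partial>(\<mu> \<Otimes>\<^sub>M \<mu>))" by (simp add: lin_sq)
  also have "\<dots> \<le> (\<integral>q. ?R q \<partial>(\<mu> \<Otimes>\<^sub>M \<mu>))"
  proof (rule integral_mono[OF LN.k_sq2 iR])
    fix q assume q: "q \<in> space (\<mu> \<Otimes>\<^sub>M \<mu>)"
    hence "lin (fst q) (snd q) = kern (fst q) (snd q) - err (fst q) (snd q)"
      by (subst kern_eq) (auto simp: space_pair_measure)
    thus "(case q of (x, y) \<Rightarrow> (lin x y)\<^sup>2) \<le> ?R q"
      using sum_squares_bound[of "kern (fst q) (snd q)" "- err (fst q) (snd q)"] by (simp add: split_def power2_diff)
  qed
  also have "\<dots> = 2 * DK.sig2 + 2 * (\<integral>(x, y). (err x y)\<^sup>2 \<partial>(\<mu> \<Otimes>\<^sub>M \<mu>))"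
    using iK iE by (simp add: split_def DK.sig2_def)
  also have "\<dots> \<le> 2 * DK.sig2 + 2 * (4/9 * (I2 / B))" using err_sq_small by (intro add_left_mono mult_left_mono) auto
  finally have "1/9 * (I2 / B) \<le> 2 * DK.sig2" by argo
  thus ?thesis by simp
qed

lemma sig2_pos: "0 < DK.sig2"
proof -
  have "0 < I2 / (18 * B)" using I2_pos B_pos by simp
  thus ?thesis using sig2_lower by linarith
qed

text \<open>Numerator and denominator carry the same power of B, which cancels. The constant is 64 *
  32 * 18^2: from 4 powr p, from the moment of W, and from \<open>sig2_lower\<close>.\<close>

lemma rho_ratio: "DK.rho / DK.sig2 powr (p / 2) \<le> 663552 * (L / I2 powr (1 + \<tau>))"
proof -
  have "DK.rho = (\<integral>(x, y). \<bar>double_center \<mu> dev x y\<bar> powr p \<partial>(\<mu> \<Otimes>\<^sub>M \<mu>))"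
    unfolding DK.rho_def by (rule Bochner_Integration.integral_cong) (auto simp: kern_eq_dev space_pair_measure)
  also have "\<dots> \<le> 4 powr p * (\<integral>(x, y). \<bar>dev x y\<bar> powr p \<partial>(\<mu> \<Otimes>\<^sub>M \<mu>))"
    by (rule DV.dc_powr(3)) (use dev_powr \<tau> in auto)
  also have "\<dots> \<le> 64 * (32 * B powr (- (1 + \<tau>)) * L)"
  proof (rule mult_mono)
    have "4 powr p \<le> (4::real) powr 3" using \<tau> by (intro powr_mono) auto
    thus "4 powr p \<le> (64::real)" by simp
    show "0 \<le> (\<integral>(x, y). \<bar>dev x y\<bar> powr p \<partial>(\<mu> \<Otimes>\<^sub>M \<mu>))" by (rule integral_nonneg_AE) auto
  qed (use dev_powr(3) in auto)
  finally have rho: "DK.rho \<le> 2048 * (B powr (- (1 + \<tau>)) * L)" by simp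
  have p2: "p / 2 = 1 + \<tau>" by simp
  have "(I2 / (18 * B)) powr (1 + \<tau>) \<le> DK.sig2 powr (1 + \<tau>)"
    using sig2_lower I2_pos B_pos \<tau> by (intro powr_mono2) auto
  moreover have "(I2 / (18 * B)) powr (1 + \<tau>) = I2 powr (1 + \<tau>) / (18 powr (1 + \<tau>) * B powr (1 + \<tau>))"
    using I2_pos B_pos by (simp add: powr_divide powr_mult)
  ultimately have s: "I2 powr (1 + \<tau>) / (18 powr (1 + \<tau>) * B powr (1 + \<tau>)) \<le> DK.sig2 powr (1 + \<tau>)" by simp
  have pos: "0 < I2 powr (1 + \<tau>) / (18 powr (1 + \<tau>) * B powr (1 + \<tau>))" using I2_pos B_pos by simp
  have "DK.rho / DK.sig2 powr (1 + \<tau>) \<le> 2048 * (B powr (- (1 + \<tau>)) * L) / DK.sig2 powr (1 + \<tau>)"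
    using rho by (intro divide_right_mono) auto
  also have "\<dots> \<le> 2048 * (B powr (- (1 + \<tau>)) * L) / (I2 powr (1 + \<tau>) / (18 powr (1 + \<tau>) * B powr (1 + \<tau>)))"
    using s pos L_nonneg by (intro divide_left_mono mult_pos_pos) (auto intro: order.strict_trans2)
  also have "\<dots> = 2048 * ((B powr (- (1 + \<tau>)) * B powr (1 + \<tau>)) * 18 powr (1 + \<tau>)) * (L / I2 powr (1 + \<tau>))" by simp
  also have "B powr (- (1 + \<tau>)) * B powr (1 + \<tau>) = 1" using B_pos by (simp flip: powr_add)
  also have "2048 * (1 * 18 powr (1 + \<tau>)) * (L / I2 powr (1 + \<tau>)) \<le> 2048 * (1 * 324) * (L / I2 powr (1 + \<tau>))"
  proof -
    have "18 powr (1 + \<tau>) \<le> (18::real) powr 2" using \<tau> by (intro powr_mono) auto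
    thus ?thesis using L_nonneg by (intro mult_right_mono mult_left_mono) auto
  qed
  finally show ?thesis unfolding p2 by simp
qed

text \<open>Integrating the product of two inner products with w produces the covariance form, so
  the linear part composed with itself is exactly x^T Sigma y / B. This is how the covariance matrix
  enters the rate.\<close>

lemma lin_composition: "(\<integral>(x, y). (\<integral>w. lin w x * lin w y \<partial>\<mu>)\<^sup>2 \<partial>(\<mu> \<Otimes>\<^sub>M \<mu>)) = C2 / B\<^sup>2"
proof -
  have coord: "integrable \<mu> (\<lambda>w. w i * w j)" if "i < d" "j < d" for i j
  proof (rule Bochner_Integration.integrable_bound[OF nm_sq])
    have "(\<lambda>w. w i) \<in> borel_measurable \<mu>" if "i < d" for i
      using mz that by (simp add: mean_zero_def)
    thus "(\<lambda>w. w i * w j) \<in> borel_measurable \<mu>" using that by simp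
    have "\<bar>w i\<bar> * \<bar>w j\<bar> \<le> nm w * nm w" for w
      using that by (intro mult_mono abs_coord_le_vec_norm) (auto simp: vec_norm_nonneg)
    thus "AE w in \<mu>. norm (w i * w j) \<le> norm ((nm w)\<^sup>2)" by (intro AE_I2) (simp add: abs_mult power2_eq_square)
  qed
  have "(\<integral>w. lin w x * lin w y \<partial>\<mu>) = (\<Sum>i<d. \<Sum>j<d. x i * cov_entry \<mu> i j * y j) / B" for x y
  proof -
    have e: "lin w x * lin w y = (\<Sum>i<d. \<Sum>j<d. (x i * y j) * (w i * w j)) / B" for w
      by (simp add: lin_def vec_inner_def sum_product b_sq[symmetric] power2_eq_square ac_simps)
    have "(\<integral>w. (\<Sum>i<d. \<Sum>j<d. (x i * y j) * (w i * w j)) \<partial>\<mu>) = (\<Sum>i<d. \<integral>w. (\<Sum>j<d. (x i * y j) * (w i * w j)) \<partial>\<mu>)"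
      by (rule Bochner_Integration.integral_sum)
         (intro Bochner_Integration.integrable_sum integrable_mult_right coord, auto)
    also have "\<dots> = (\<Sum>i<d. \<Sum>j<d. \<integral>w. (x i * y j) * (w i * w j) \<partial>\<mu>)"
      by (intro sum.cong refl Bochner_Integration.integral_sum integrable_mult_right coord) auto
    also have "\<dots> = (\<Sum>i<d. \<Sum>j<d. x i * cov_entry \<mu> i j * y j)"
      by (intro sum.cong refl) (simp add: cov_entry_def)
    finally show ?thesis unfolding e by simp
  qed
  thus ?thesis by (simp add: C2_def cov_form_moment2_def power_divide split_def)
qed

text \<open>G expands into four compositions of lin and err. Only lin with lin is computed exactly;
  the other three are bounded by products of squared norms, err being no larger than lin. With the 8
  of \<open>err_sq\<close>, 96 = 4 * 3 * 8.\<close>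

lemma gam_bound: "DK.gam \<le> 4 * C2 / B\<^sup>2 + 96 * (I2 * (B powr (- 2 * \<tau>) * L)) / B\<^sup>2"
proof -
  define T where "T k l x y = (\<integral>w. k w x * l w y \<partial>\<mu>)" for k l :: "(nat \<Rightarrow> real) \<Rightarrow> (nat \<Rightarrow> real) \<Rightarrow> real" and x y
  define m2 where "m2 = I2 / B"
  define e2 where "e2 = (\<integral>(x, y). (err x y)\<^sup>2 \<partial>(\<mu> \<Otimes>\<^sub>M \<mu>))"
  have e20: "0 \<le> e2" unfolding e2_def by (rule integral_nonneg_AE) auto
  have m20: "0 \<le> m2" using I2_pos B_pos by (simp add: m2_def)
  note ll = composition_square[OF LN.sq_kernel_axioms LN.sq_kernel_axioms, folded T_def]
  note le = composition_square[OF LN.sq_kernel_axioms ER.sq_kernel_axioms, folded T_def]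
  note el = composition_square[OF ER.sq_kernel_axioms LN.sq_kernel_axioms, folded T_def]
  note ee = composition_square[OF ER.sq_kernel_axioms ER.sq_kernel_axioms, folded T_def]
  have G_eq: "DK.G x y = T lin lin x y + T lin err x y + T err lin x y + T err err x y"
    if x: "x \<in> space \<mu>" and y: "y \<in> space \<mu>" for x y
  proof -
    have i: "integrable \<mu> (\<lambda>w. k w x * l w y)" if "sq_kernel \<mu> k" "sq_kernel \<mu> l" for k l
    proof -
      interpret A: sq_kernel \<mu> k by fact
      interpret B: sq_kernel \<mu> l by fact
      show ?thesis
        using integral_mult_square_le(1)[of "k x" \<mu> "l y"] A.k_sq1[OF x] B.k_sq1[OF y] x y
        by (simp add: A.k_sym[of _ x] B.k_sym[of _ y])
    qed
    note ints = i[OF LN.sq_kernel_axioms LN.sq_kernel_axioms] i[OF LN.sq_kernel_axioms ER.sq_kernel_axioms]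
      i[OF ER.sq_kernel_axioms LN.sq_kernel_axioms] i[OF ER.sq_kernel_axioms ER.sq_kernel_axioms]
    have "DK.G x y = (\<integral>w. lin w x * lin w y + lin w x * err w y + err w x * lin w y + err w x * err w y \<partial>\<mu>)"
      unfolding DK.G_def by (intro Bochner_Integration.integral_cong refl) (simp add: kern_eq x y algebra_simps)
    thus ?thesis using ints by (simp add: T_def)
  qed
  let ?R = "\<lambda>q. 4 * ((T lin lin (fst q) (snd q))\<^sup>2 + (T lin err (fst q) (snd q))\<^sup>2 + (T err lin (fst q) (snd q))\<^sup>2 + (T err err (fst q) (snd q))\<^sup>2)"
  have iR: "integrable (\<mu> \<Otimes>\<^sub>M \<mu>) ?R" using ll(1) le(1) el(1) ee(1) by (simp add: split_def)
  have four: "(a + b + c + d)\<^sup>2 \<le> 4 * (a\<^sup>2 + b\<^sup>2 + c\<^sup>2 + d\<^sup>2)" for a b c d :: real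
  proof -
    have "4 * (a\<^sup>2 + b\<^sup>2 + c\<^sup>2 + d\<^sup>2) - (a + b + c + d)\<^sup>2
       = (a - b)\<^sup>2 + (a - c)\<^sup>2 + (a - d)\<^sup>2 + (b - c)\<^sup>2 + (b - d)\<^sup>2 + (c - d)\<^sup>2"
      by (simp add: power2_eq_square algebra_simps)
    moreover have "0 \<le> (a - b)\<^sup>2 + (a - c)\<^sup>2 + (a - d)\<^sup>2 + (b - c)\<^sup>2 + (b - d)\<^sup>2 + (c - d)\<^sup>2"
      by (intro add_nonneg_nonneg) auto
    ultimately show ?thesis by linarith
  qed
  have "DK.gam \<le> (\<integral>q. ?R q \<partial>(\<mu> \<Otimes>\<^sub>M \<mu>))"
    unfolding DK.gam_def
  proof (rule integral_mono[OF DK.G_sq2 iR])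
    fix q assume "q \<in> space (\<mu> \<Otimes>\<^sub>M \<mu>)"
    thus "(case q of (x, y) \<Rightarrow> (DK.G x y)\<^sup>2) \<le> ?R q"
      using four by (auto simp: space_pair_measure G_eq)
  qed
  also have "\<dots> = 4 * ((\<integral>(x, y). (T lin lin x y)\<^sup>2 \<partial>(\<mu> \<Otimes>\<^sub>M \<mu>)) + (\<integral>(x, y). (T lin err x y)\<^sup>2 \<partial>(\<mu> \<Otimes>\<^sub>M \<mu>))
      + (\<integral>(x, y). (T err lin x y)\<^sup>2 \<partial>(\<mu> \<Otimes>\<^sub>M \<mu>)) + (\<integral>(x, y). (T err err x y)\<^sup>2 \<partial>(\<mu> \<Otimes>\<^sub>M \<mu>)))"
    using ll(1) le(1) el(1) ee(1) by (simp add: split_def)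
  also have "\<dots> \<le> 4 * (C2 / B\<^sup>2 + m2 * e2 + e2 * m2 + e2 * e2)"
    using le(2) el(2) ee(2) lin_composition by (intro mult_left_mono add_mono) (auto simp: T_def lin_sq m2_def e2_def)
  also have "e2 * e2 \<le> m2 * e2"
    using err_sq_small e20 m20 by (intro mult_right_mono) (auto simp: e2_def m2_def)
  hence "4 * (C2 / B\<^sup>2 + m2 * e2 + e2 * m2 + e2 * e2) \<le> 4 * C2 / B\<^sup>2 + 12 * (m2 * e2)" by (simp add: mult.commute)
  also have "m2 * e2 \<le> m2 * (8 / B * (B powr (- 2 * \<tau>) * L))"
    using err_sq m20 unfolding e2_def by (rule mult_left_mono)
  hence "4 * C2 / B\<^sup>2 + 12 * (m2 * e2) \<le> 4 * C2 / B\<^sup>2 + 12 * (m2 * (8 / B * (B powr (- 2 * \<tau>) * L)))" by simp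
  also have "\<dots> = 4 * C2 / B\<^sup>2 + 96 * (I2 * (B powr (- 2 * \<tau>) * L)) / B\<^sup>2"
    by (simp add: m2_def power2_eq_square)
  finally show ?thesis .
qed

lemma gam_ratio: "DK.gam / DK.sig2\<^sup>2 \<le> 31104 * E_ratio d \<mu> \<tau>"
proof -
  define Q where "Q = L powr ((2 + \<tau>) / (1 + \<tau>))"
  \<comment> \<open>\<open>I2_powr_le\<close> gives I2 \<le> L powr (1 / (1 + \<tau>)); this is the
    origin of the exponent (2 + \<tau>) / (1 + \<tau>) in \<open>E_ratio\<close>.\<close>
  have IL: "I2 * L \<le> Q"
  proof (cases "L = 0")
    case False
    hence L: "0 < L" using L_nonneg by simp
    have "I2 = (I2 powr (1 + \<tau>)) powr (1 / (1 + \<tau>))" using I2_pos \<tau> by (simp add: powr_powr)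
    also have "\<dots> \<le> L powr (1 / (1 + \<tau>))" using I2_powr_le \<tau> by (intro powr_mono2) auto
    finally have "I2 * L \<le> L powr (1 / (1 + \<tau>)) * L" using L by (intro mult_right_mono) auto
    also have "\<dots> = L powr (1 / (1 + \<tau>) + 1)" using L by (simp add: powr_add)
    also have "1 / (1 + \<tau>) + 1 = (2 + \<tau>) / (1 + \<tau>)" using \<tau> by (simp add: field_simps)
    finally show ?thesis by (simp add: Q_def)
  qed (simp add: Q_def)
  have C0: "0 \<le> C2" by (rule C2_nonneg)
  have "I2 * (B powr (- 2 * \<tau>) * L) = B powr (- 2 * \<tau>) * (I2 * L)" by simp
  also have "\<dots> \<le> B powr (- 2 * \<tau>) * Q" using IL by (intro mult_left_mono) auto
  finally have 1: "I2 * (B powr (- 2 * \<tau>) * L) \<le> B powr (- 2 * \<tau>) * Q" .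
  define E where "E = C2 + B powr (- 2 * \<tau>) * Q"
  have E0: "0 \<le> E" using C0 by (simp add: E_def Q_def)
  have "DK.gam \<le> (4 * C2 + 96 * (I2 * (B powr (- 2 * \<tau>) * L))) / B\<^sup>2"
    using gam_bound by (simp add: add_divide_distrib)
  also have "\<dots> \<le> (96 * E) / B\<^sup>2"
    using 1 C0 by (intro divide_right_mono) (auto simp: E_def)
  finally have g: "DK.gam \<le> 96 * E / B\<^sup>2" .
  have s: "(I2 / (18 * B))\<^sup>2 \<le> DK.sig2\<^sup>2"
    using sig2_lower I2_pos B_pos by (intro power_mono) auto
  have s0: "0 < (I2 / (18 * B))\<^sup>2" using I2_pos B_pos by simp
  have "DK.gam / DK.sig2\<^sup>2 \<le> (96 * E / B\<^sup>2) / DK.sig2\<^sup>2" using g by (intro divide_right_mono) auto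
  also have "\<dots> \<le> (96 * E / B\<^sup>2) / (I2 / (18 * B))\<^sup>2"
    using s s0 E0 sig2_pos by (intro divide_left_mono mult_pos_pos) auto
  \<comment> \<open>This is 96 * 18^2; the powers of B cancel.\<close>
  also have "\<dots> = 31104 * (E / I2\<^sup>2)" using B_pos I2_pos by (simp add: power_divide power_mult_distrib)
  also have "E / I2\<^sup>2 = E_ratio d \<mu> \<tau>"
    by (simp add: E_ratio_def E_def Q_def C2_def B_def L_def I2_def)
  finally show ?thesis .
qed

end

section \<open>From the sample statistic to the kernel\<close>

lemma u_center_distance:
  assumes n: "3 \<le> n" and kl: "k \<in> {1..n}" "l \<in> {1..n}" "k \<noteq> l"
    and F: "\<And>z z'. F z z' = double_center \<mu> (vec_dist d) (f z) (f z')"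
  shows "u_center n (\<lambda>k l. vec_dist d (f (w k)) (f (w l))) k l = u_center n (hollow F w) k l"
proof (rule u_center_shift[OF n kl])
  \<comment> \<open>Each point takes its own marginal and half of the grand mean, so that two points
    together account for the whole difference between distance and kernel.\<close>
  let ?\<phi> = "\<lambda>k. (\<integral>z. vec_dist d (f (w k)) z \<partial>\<mu>) - (\<integral>x. (\<integral>z. vec_dist d x z \<partial>\<mu>) \<partial>\<mu>) / 2"
  show "vec_dist d (f (w k)) (f (w l)) = hollow F w k l + ?\<phi> k + ?\<phi> l" if "k \<noteq> l" for k l
    using that by (simp add: hollow_def F double_center_def)
qed (auto simp: vec_dist_self)

lemma u_inner_distance:
  assumes n: "3 \<le> n" and F: "\<And>z z'. F z z' = double_center \<mu> (vec_dist d) (f z) (f z')"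
    and G: "\<And>z z'. G z z' = double_center \<nu> (vec_dist e) (g z) (g z')"
  shows "u_inner n (\<lambda>k l. vec_dist d (f (w k)) (f (w l))) (\<lambda>k l. vec_dist e (g (w k)) (g (w l)))
    = u_inner n (hollow F w) (hollow G w)"
  unfolding u_inner_def
proof (intro sum.cong refl)
  fix k l assume "k \<in> {1..n}" "l \<in> {1..n} - {k}"
  hence kl: "k \<in> {1..n}" "l \<in> {1..n}" "k \<noteq> l" by auto
  show "u_center n (\<lambda>k l. vec_dist d (f (w k)) (f (w l))) k l * u_center n (\<lambda>k l. vec_dist e (g (w k)) (g (w l))) k l
    = u_center n (hollow F w) k l * u_center n (hollow G w) k l"
    by (rule arg_cong2[where f = "(*)"]; rule u_center_distance[OF n kl]; fact)
qed

text \<open>n \<ge> 4 makes n (n - 3) positive, so this factor cancels and the sign test on the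
  product is unaffected.\<close>

lemma dist_cor_eq_corr_stat:
  assumes n: "4 \<le> n"
  shows "sqrt (real n * (real n - 1) / 2) * dist_cor n a b = corr_stat n a b"
proof -
  define c where "c = real n * (real n - 3)"
  have c: "0 < c" using n by (simp add: c_def)
  have dc: "dist_cov n a b = u_inner n a b / c" for a b
    by (simp add: dist_cov_def u_inner_def c_def)
  have prod: "dist_cov n a a * dist_cov n b b = (u_inner n a a * u_inner n b b) / c\<^sup>2"
    by (simp add: dc power2_eq_square)
  have iff: "0 < dist_cov n a a * dist_cov n b b \<longleftrightarrow> 0 < u_inner n a a * u_inner n b b"
    unfolding prod using c by (simp add: zero_less_divide_iff)
  have "dist_cov n a b / sqrt (dist_cov n a a * dist_cov n b b) = u_inner n a b / sqrt (u_inner n a a * u_inner n b b)"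
    unfolding prod dc using c by (simp add: real_sqrt_divide)
  thus ?thesis unfolding dist_cor_def corr_stat_def iff by simp
qed

text \<open>At this e, \<Delta> = e powr (3 + 2 \<tau>), so e powr - p times \<Delta> is e. For the
  extra term, \<tau> \<le> 1/2 gives 1/n \<le> n powr (- 2 \<tau>) \<le> (K \<Delta>)^2, and
  \<Delta>^2 = e powr (6 + 4 \<tau>) \<le> e^3.\<close>

lemma rate_algebra:
  fixes \<tau> \<Delta> N K :: real
  assumes \<tau>: "0 < \<tau>" "\<tau> \<le> 1/2" and N: "1 \<le> N" and K: "1 \<le> K" and le: "N powr (- \<tau>) \<le> K * \<Delta>"
    and e: "e = \<Delta> powr (1 / (3 + 2 * \<tau>))" "e \<le> 1/2"
  shows "0 < e" "e powr (- (2 + 2 * \<tau>)) * (K * \<Delta>) = K * e" "1 / (N * e\<^sup>2) \<le> K\<^sup>2 * e"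
proof -
  have "0 < N powr (- \<tau>)" using N by simp
  hence "0 < K * \<Delta>" using le by linarith
  hence \<Delta>: "0 < \<Delta>" using K by (simp add: zero_less_mult_iff)
  thus e0: "0 < e" by (simp add: e)
  have \<Delta>e: "\<Delta> = e powr (3 + 2 * \<tau>)" using \<Delta> \<tau> by (simp add: e powr_powr)
  have "e powr (- (2 + 2 * \<tau>)) * (K * \<Delta>) = K * (e powr (- (2 + 2 * \<tau>)) * e powr (3 + 2 * \<tau>))"
    by (simp add: \<Delta>e)
  also have "e powr (- (2 + 2 * \<tau>)) * e powr (3 + 2 * \<tau>) = e powr 1"
    unfolding powr_add[symmetric] by (rule arg_cong2[where f = "(powr)"]) auto
  finally show "e powr (- (2 + 2 * \<tau>)) * (K * \<Delta>) = K * e" using e0 by simp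
  have "1 / N = N powr (- 1)" using N by (simp add: powr_minus_divide)
  also have "\<dots> \<le> N powr (- \<tau> + - \<tau>)" using N \<tau> by (intro powr_mono) auto
  also have "\<dots> = N powr (- \<tau>) * N powr (- \<tau>)" by (rule powr_add)
  also have "\<dots> \<le> (K * \<Delta>) * (K * \<Delta>)" using le by (intro mult_mono) (auto intro: order.trans[OF powr_ge_zero le])
  finally have "1 / N \<le> K\<^sup>2 * (\<Delta> * \<Delta>)" by (simp add: power2_eq_square ac_simps)
  also have "\<Delta> * \<Delta> \<le> e powr 3"
  proof -
    have "\<Delta> * \<Delta> = e powr ((3 + 2 * \<tau>) + (3 + 2 * \<tau>))" unfolding \<Delta>e powr_add[symmetric] ..
    also have "\<dots> \<le> e powr 3" using e0 e \<tau> by (intro powr_mono') auto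
    finally show ?thesis .
  qed
  also have "e powr 3 = e\<^sup>2 * e" using e0 by (simp add: power3_eq_cube power2_eq_square)
  finally have "1 / N \<le> K\<^sup>2 * (e\<^sup>2 * e)" by (simp add: mult_left_mono)
  hence "1 / N / e\<^sup>2 \<le> K\<^sup>2 * (e\<^sup>2 * e) / e\<^sup>2" by (rule divide_right_mono) simp
  thus "1 / (N * e\<^sup>2) \<le> K\<^sup>2 * e" using e0 by simp
qed

theorem theorem4:
  fixes \<tau> :: real
  assumes "0 < \<tau>" "\<tau> \<le> 1/2"
  shows "\<exists>C>0. \<forall>(p::nat) (q::nat) (n::nat) (P :: ((nat \<Rightarrow> real) \<times> (nat \<Rightarrow> real)) measure) \<mu> \<nu>.
     n \<ge> 4 \<longrightarrow>
     prob_space P \<longrightarrow>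
     sets P = sets (vec_space p \<Otimes>\<^sub>M vec_space q) \<longrightarrow>
     \<mu> = distr P (vec_space p) fst \<longrightarrow>
     \<nu> = distr P (vec_space q) snd \<longrightarrow>
     mean_zero p \<mu> \<longrightarrow>
     mean_zero q \<nu> \<longrightarrow>
     integrable \<mu> (\<lambda>x. vec_norm p x powr (4 + 4 * \<tau>)) \<longrightarrow>
     integrable \<nu> (\<lambda>y. vec_norm q y powr (4 + 4 * \<tau>)) \<longrightarrow>
     inner_moment2 p \<mu> > 0 \<longrightarrow>
     inner_moment2 q \<nu> > 0 \<longrightarrow>
     mean_sq_dist p \<mu> powr (- 2 * \<tau>) * L_moment p \<mu> \<tau> / inner_moment2 p \<mu> \<le> 1/18 \<longrightarrow>
     mean_sq_dist q \<nu> powr (- 2 * \<tau>) * L_moment q \<nu> \<tau> / inner_moment2 q \<nu> \<le> 1/18 \<longrightarrow>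
     prob_space.indep_var P (vec_space p) fst (vec_space q) snd \<longrightarrow>
     (SUP t::real. \<bar>\<P>(\<omega> in PiM (UNIV :: nat set) (\<lambda>_. P). T_stat p q n \<omega> \<le> t)
                    - cdf std_normal_distribution t\<bar>)
       \<le> C * ((E_ratio p \<mu> \<tau> * E_ratio q \<nu> \<tau>) powr ((1 + \<tau>) / 2)
               + real n powr (- \<tau>) * L_moment p \<mu> \<tau> * L_moment q \<nu> \<tau>
                 / (inner_moment2 p \<mu> * inner_moment2 q \<nu>) powr (1 + \<tau>)) powr (1 / (3 + 2 * \<tau>))"
proof -
  \<comment> \<open>The product of the two constants of \<open>rho_ratio\<close>; it also exceeds
    31104^2, which the gam ratios require. C adds up the error terms of
    \<open>corr_stat_Berry_Esseen\<close> after balancing: e, K e and K^2 e.\<close>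
  define K :: real where "K = 663552\<^sup>2"
  define C :: real where "C = 5000 * (1 + K + K\<^sup>2)"
  have K1: "1 \<le> K" by (simp add: K_def)
  have "0 \<le> K\<^sup>2" by simp
  hence "2 \<le> C" using K1 unfolding C_def by argo
  hence C2: "2 \<le> C" "0 < C" by auto
  show ?thesis
  proof (intro exI[of _ C] conjI allI impI)
    show "0 < C" by fact
  next
    fix p q n :: nat and P :: "((nat \<Rightarrow> real) \<times> (nat \<Rightarrow> real)) measure" and \<mu> \<nu> :: "(nat \<Rightarrow> real) measure"
    assume n: "4 \<le> n" and P: "prob_space P" and setsP: "sets P = sets (vec_space p \<Otimes>\<^sub>M vec_space q)"
      and \<mu>: "\<mu> = distr P (vec_space p) fst" and \<nu>: "\<nu> = distr P (vec_space q) snd"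
      and mz: "mean_zero p \<mu>" "mean_zero q \<nu>"
      and mom: "integrable \<mu> (\<lambda>x. vec_norm p x powr (4 + 4 * \<tau>))" "integrable \<nu> (\<lambda>y. vec_norm q y powr (4 + 4 * \<tau>))"
      and pos: "inner_moment2 p \<mu> > 0" "inner_moment2 q \<nu> > 0"
      and sm: "mean_sq_dist p \<mu> powr (- 2 * \<tau>) * L_moment p \<mu> \<tau> / inner_moment2 p \<mu> \<le> 1/18"
        "mean_sq_dist q \<nu> powr (- 2 * \<tau>) * L_moment q \<nu> \<tau> / inner_moment2 q \<nu> \<le> 1/18"
      and indep: "prob_space.indep_var P (vec_space p) fst (vec_space q) snd"
    interpret P: prob_space P by fact
    have [measurable]: "fst \<in> measurable P (vec_space p)" "snd \<in> measurable P (vec_space q)"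
      unfolding measurable_cong_sets[OF setsP refl] by measurable
    have prob: "prob_space \<mu>" "prob_space \<nu>"
      unfolding \<mu> \<nu> by (auto intro!: P.prob_space_distr)
    \<comment> \<open>Independence makes P the product of its marginals, so that the two-kernel
      setting applies.\<close>
    have P_eq: "P = \<mu> \<Otimes>\<^sub>M \<nu>"
    proof -
      have "\<mu> \<Otimes>\<^sub>M \<nu> = distr P (vec_space p \<Otimes>\<^sub>M vec_space q) (\<lambda>z. (fst z, snd z))"
        using indep unfolding P.indep_var_distribution_eq \<mu> \<nu> by blast
      also have "\<dots> = distr P P (\<lambda>z. z)" by (rule distr_cong) (auto simp: setsP)
      finally show ?thesis by simp
    qed
    interpret X: regular_law \<mu> p \<tau>
    proof -
      interpret m: prob_space \<mu> by fact
      interpret m: mean_zero_law \<mu> p \<tau>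
        by unfold_locales (use mz mom assms in \<open>auto simp: \<mu>\<close>)
      show "regular_law \<mu> p \<tau>"
        by unfold_locales (use pos sm in \<open>simp_all add: m.I2_def m.B_def m.L_def\<close>)
    qed
    interpret Y: regular_law \<nu> q \<tau>
    proof -
      interpret m: prob_space \<nu> by fact
      interpret m: mean_zero_law \<nu> q \<tau>
        by unfold_locales (use mz mom assms in \<open>auto simp: \<nu>\<close>)
      show "regular_law \<nu> q \<tau>"
        by unfold_locales (use pos sm in \<open>simp_all add: m.I2_def m.B_def m.L_def\<close>)
    qed
    interpret XY: two_kernels \<mu> X.kern \<nu> Y.kern "2 + 2 * \<tau>"
      by (intro two_kernels.intro X.DK.degenerate_kernel_axioms Y.DK.degenerate_kernel_axioms)
    let ?S = "PiM (UNIV :: nat set) (\<lambda>_. P)"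
    have S_prob: "prob_space ?S" by (rule P.prob_space_iid_seq)
    have T_eq: "T_stat p q n w = corr_stat n (hollow XY.F w) (hollow XY.K w)" for w
    proof -
      have n3: "3 \<le> n" using n by simp
      have F: "XY.F z z' = double_center \<mu> (vec_dist p) (fst z) (fst z')" for z z'
        by (subst XY.F_def) (simp only: X.kern_def)
      have G: "XY.K z z' = double_center \<nu> (vec_dist q) (snd z) (snd z')" for z z'
        by (subst XY.K_def) (simp only: Y.kern_def)
      let ?a = "\<lambda>k l. vec_dist p (fst (w k)) (fst (w l))" and ?b = "\<lambda>k l. vec_dist q (snd (w k)) (snd (w l))"
      have "u_inner n ?a ?a = u_inner n (hollow XY.F w) (hollow XY.F w)"
        by (rule u_inner_distance[where \<mu> = \<mu> and \<nu> = \<mu>, OF n3 F F])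
      moreover have "u_inner n ?b ?b = u_inner n (hollow XY.K w) (hollow XY.K w)"
        by (rule u_inner_distance[where \<mu> = \<nu> and \<nu> = \<nu>, OF n3 G G])
      moreover have "u_inner n ?a ?b = u_inner n (hollow XY.F w) (hollow XY.K w)"
        by (rule u_inner_distance[where \<mu> = \<mu> and \<nu> = \<nu>, OF n3 F G])
      ultimately show ?thesis
        unfolding T_stat_def dist_cor_eq_corr_stat[OF n] corr_stat_def by (simp only:)
    qed
    define Lr where "Lr = L_moment p \<mu> \<tau> * L_moment q \<nu> \<tau> / (inner_moment2 p \<mu> * inner_moment2 q \<nu>) powr (1 + \<tau>)"
    define Er where "Er = (E_ratio p \<mu> \<tau> * E_ratio q \<nu> \<tau>) powr ((1 + \<tau>) / 2)"
    define \<Delta> where "\<Delta> = Er + real n powr (- \<tau>) * Lr"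
    define e where "e = \<Delta> powr (1 / (3 + 2 * \<tau>))"
    define RX where "RX = X.DK.rho / X.DK.sig2 powr ((2 + 2 * \<tau>) / 2)"
    define RY where "RY = Y.DK.rho / Y.DK.sig2 powr ((2 + 2 * \<tau>) / 2)"
    define \<Gamma> where "\<Gamma> = (X.DK.gam * Y.DK.gam / (X.DK.sig2 * Y.DK.sig2)\<^sup>2) powr ((2 + 2 * \<tau>) / 4)"
    have R1: "1 \<le> RX" "1 \<le> RY"
      using X.DK.sig2_powr_le Y.DK.sig2_powr_le X.sig2_pos Y.sig2_pos by (auto simp: RX_def RY_def)
    have RR: "RX * RY \<le> K * Lr"
    proof -
      have "RX * RY \<le> (663552 * (L_moment p \<mu> \<tau> / inner_moment2 p \<mu> powr (1 + \<tau>))) * (663552 * (L_moment q \<nu> \<tau> / inner_moment2 q \<nu> powr (1 + \<tau>)))"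
      proof (rule mult_mono)
        show x: "RX \<le> 663552 * (L_moment p \<mu> \<tau> / inner_moment2 p \<mu> powr (1 + \<tau>))"
          using X.rho_ratio unfolding RX_def X.L_def X.I2_def .
        show "RY \<le> 663552 * (L_moment q \<nu> \<tau> / inner_moment2 q \<nu> powr (1 + \<tau>))"
          using Y.rho_ratio unfolding RY_def Y.L_def Y.I2_def .
        show "0 \<le> 663552 * (L_moment p \<mu> \<tau> / inner_moment2 p \<mu> powr (1 + \<tau>))" using x R1 by linarith
      qed (use R1 in auto)
      also have "\<dots> = K * Lr"
        using pos by (simp add: K_def Lr_def powr_mult)
      finally show ?thesis .
    qed
    have GG: "\<Gamma> \<le> K * Er"
    proof -
      have ER: "0 \<le> E_ratio p \<mu> \<tau>" "0 \<le> E_ratio q \<nu> \<tau>"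
      proof -
        have "0 \<le> X.DK.gam / X.DK.sig2\<^sup>2" "0 \<le> Y.DK.gam / Y.DK.sig2\<^sup>2"
          using X.DK.gam_nonneg Y.DK.gam_nonneg by auto
        thus "0 \<le> E_ratio p \<mu> \<tau>" "0 \<le> E_ratio q \<nu> \<tau>" using X.gam_ratio Y.gam_ratio by linarith+
      qed
      have "X.DK.gam * Y.DK.gam / (X.DK.sig2 * Y.DK.sig2)\<^sup>2 = (X.DK.gam / X.DK.sig2\<^sup>2) * (Y.DK.gam / Y.DK.sig2\<^sup>2)"
        by (simp add: power_mult_distrib)
      also have "\<dots> \<le> (31104 * E_ratio p \<mu> \<tau>) * (31104 * E_ratio q \<nu> \<tau>)"
        using X.gam_ratio Y.gam_ratio X.DK.gam_nonneg Y.DK.gam_nonneg ER by (intro mult_mono) auto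
      also have "\<dots> = 31104\<^sup>2 * (E_ratio p \<mu> \<tau> * E_ratio q \<nu> \<tau>)" by simp
      finally have "\<Gamma> \<le> (31104\<^sup>2 * (E_ratio p \<mu> \<tau> * E_ratio q \<nu> \<tau>)) powr ((2 + 2 * \<tau>) / 4)"
        unfolding \<Gamma>_def using X.DK.gam_nonneg Y.DK.gam_nonneg assms by (intro powr_mono2) auto
      also have "(2 + 2 * \<tau>) / 4 = (1 + \<tau>) / 2" by simp
      also have "(31104\<^sup>2 * (E_ratio p \<mu> \<tau> * E_ratio q \<nu> \<tau>)) powr ((1 + \<tau>) / 2) = (31104\<^sup>2) powr ((1 + \<tau>) / 2) * Er"
        unfolding Er_def by (rule powr_mult; simp add: ER)
      also have "(31104\<^sup>2) powr ((1 + \<tau>) / 2) * Er \<le> (31104\<^sup>2) powr 1 * Er"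
        using assms by (intro mult_right_mono powr_mono) (auto simp: Er_def)
      also have "\<dots> \<le> K * Er" by (intro mult_right_mono) (auto simp: K_def Er_def)
      finally show ?thesis .
    qed
    have sum_le: "real n powr (- \<tau>) * (RX * RY) + \<Gamma> \<le> K * \<Delta>"
    proof -
      have "real n powr (- \<tau>) * (RX * RY) \<le> real n powr (- \<tau>) * (K * Lr)"
        using RR by (intro mult_left_mono) auto
      thus ?thesis using GG by (simp add: \<Delta>_def algebra_simps)
    qed
    \<comment> \<open>The lower bound 1 on the moment ratios forces n powr - \<tau> below K
      \<Delta>; balancing relies on this to absorb 1 / (n e^2).\<close>
    have "1 \<le> RX * RY" using mult_mono[OF R1(1) R1(2)] R1 by simp
    hence "real n powr (- \<tau>) * 1 \<le> real n powr (- \<tau>) * (RX * RY)" by (intro mult_left_mono) auto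
    moreover have "0 \<le> \<Gamma>" by (simp add: \<Gamma>_def)
    ultimately have n_le: "real n powr (- \<tau>) \<le> K * \<Delta>" using sum_le by linarith
    have bound: "\<bar>measure ?S {w \<in> space ?S. T_stat p q n w \<le> t} - Phi t\<bar> \<le> C * e" for t
    proof (cases "e \<le> 1/2")
      \<comment> \<open>For e > 1/2 the claimed bound exceeds 1 because C \<ge> 2, so the difference
        of two probabilities satisfies it trivially.\<close>
      case False
      have "measure ?S {w \<in> space ?S. T_stat p q n w \<le> t} \<le> 1"
        by (rule prob_space.prob_le_1[OF S_prob])
      moreover have "0 \<le> measure ?S {w \<in> space ?S. T_stat p q n w \<le> t}" by simp
      ultimately have "\<bar>measure ?S {w \<in> space ?S. T_stat p q n w \<le> t} - Phi t\<bar> \<le> 1"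
        using Phi_bounds[of t] by linarith
      also have "1 \<le> 2 * e" using False by simp
      also have "2 * e \<le> C * e" using C2 False by (intro mult_right_mono) auto
      finally show ?thesis .
    next
      case True
      have N1: "1 \<le> real n" using n by simp
      note ra = rate_algebra[OF assms N1 K1 n_le e_def True]
      have "1 - (2 + 2 * \<tau>) / 2 = - \<tau>" by (simp add: field_simps)
      hence "\<bar>measure ?S {w \<in> space ?S. T_stat p q n w \<le> t} - Phi t\<bar>
        \<le> 5000 * (e + e powr (- (2 + 2 * \<tau>)) * (real n powr (- \<tau>) * (RX * RY) + \<Gamma>) + 1 / (real n * e\<^sup>2))"
        using XY.corr_stat_Berry_Esseen[OF n X.sig2_pos Y.sig2_pos ra(1) True, of t]
        unfolding T_eq RX_def RY_def \<Gamma>_def P_eq by (simp only:)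
      also have "\<dots> \<le> 5000 * (e + e powr (- (2 + 2 * \<tau>)) * (K * \<Delta>) + K\<^sup>2 * e)"
        using sum_le ra(3) by (intro mult_left_mono add_mono) auto
      also have "\<dots> = C * e" unfolding ra(2) C_def by (simp add: algebra_simps)
      finally show ?thesis .
    qed
    have "(SUP t::real. \<bar>measure ?S {w \<in> space ?S. T_stat p q n w \<le> t} - Phi t\<bar>) \<le> C * e"
      by (rule cSUP_least) (use bound in auto)
    thus "(SUP t::real. \<bar>\<P>(\<omega> in ?S. T_stat p q n \<omega> \<le> t) - Phi t\<bar>)
       \<le> C * ((E_ratio p \<mu> \<tau> * E_ratio q \<nu> \<tau>) powr ((1 + \<tau>) / 2)
               + real n powr (- \<tau>) * L_moment p \<mu> \<tau> * L_moment q \<nu> \<tau>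
                 / (inner_moment2 p \<mu> * inner_moment2 q \<nu>) powr (1 + \<tau>)) powr (1 / (3 + 2 * \<tau>))"
      by (simp add: e_def \<Delta>_def Er_def Lr_def mult.assoc)
  qed
qed

end
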